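(* Let the standing assumptions on the data listed in the context hold. Let $\bar{\mathbf u}^*=(\bar u_1^*,\ldots,\bar u_m^* )\in L^2(\Omega)^m$ and let $\bar{\mathbf e}=(\bar e_Y,\bar e_1,\ldots,\bar e_m)\in\mathbf E$ be such that $$\mathcal U_{ad}(\bar{\mathbf e})=\mathcal U^1_{ad}(\bar e_1)\times\cdots\times\mathcal U^m_{ad}(\bar e_m)\neq\emptyset .$$ Then there exists a variational Nash equilibrium with respect to the parameters $(\bar{\mathbf u}^*,\bar{\mathbf e})$, i.e. there exists $\bar{\mathbf u}=(\bar u_1,\ldots,\bar u_m)\in\mathcal U^1_{ad}(\bar e_1)\times\cdots\times\mathcal U^m_{ad}(\bar e_m)$ such that $$\bar u_k^*\in\nabla_{u_k}\mathcal J_k(\bar u_k,\bar u_{-k},\bar e_Y,\bar e_k)+N(\bar u_k;\mathcal U^k_{ad}(\bar e_k))\qquad\text{for all }k=1,\ldots,m.$$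
   Context: Data. Let $m\ge 1$ be an integer and $N\in\{1,2,3\}$. Let $\Omega\subset\mathbb R^N$ be an open bounded domain with Lipschitz boundary $\Gamma$, and let $\mathcal A y=-\sum_{i,j=1}^N\partial_{x_j}(a_{ij}(x)\partial_{x_i}y)$ with $a_{ij}\in L^\infty(\Omega)$ and, for some $\lambda_{\mathcal A}>0$, $\lambda_{\mathcal A}\|\xi\|^2\le\sum_{i,j}a_{ij}(x)\xi_i\xi_j$ for all $\xi\in\mathbb R^N$ and a.a. $x\in\Omega$. Let $\zeta_k,B_k\in L^\infty(\Omega)$ for $k=1,\ldots,m$, with $\zeta_k(x)\ge\zeta_{0k}>0$ for a.a. $x\in\Omega$ ($\zeta_{0k}$ a constant). Let $f,L_1,\ldots,L_m:\Omega\times\mathbb R\to\mathbb R$ be Carathéodory functions of class $C^2$ with respect to the second variable $y$. Assumptions on $f$: $f(\cdot,0)\in L^2(\Omega)$, $\frac{\partial f}{\partial y}(x,y)\ge0$ for a.a. $x\in\Omega$ (and all $y$), and for every $M>0$ there is $C_{f,M}>0$ with $|\frac{\partial f}{\partial y}(x,y)|+|\frac{\partial^2f}{\partial y^2}(x,y)|\le C_{f,M}$ and $|\frac{\partial^2f}{\partial y^2}(x,y_2)-\frac{\partial^2f}{\partial y^2}(x,y_1)|\le C_{f,M}|y_2-y_1|$ for a.a. $x\in\Omega$ and all $|y|,|y_1|,|y_2|\le M$. Assumptions on $L_k$ (each $k$): $L_k(\cdot,0)\in L^1(\Omega)$, and for every $M>0$ there are $C_{L_k,M}>0$ and $\psi_{k,M}\in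 L^2(\Omega)$ with $|\frac{\partial L_k}{\partial y}(x,y)|\le\psi_{k,M}(x)$, $|\frac{\partial^2L_k}{\partial y^2}(x,y)|\le C_{L_k,M}$ and $|\frac{\partial^2L_k}{\partial y^2}(x,y_2)-\frac{\partial^2L_k}{\partial y^2}(x,y_1)|\le C_{L_k,M}|y_2-y_1|$ for a.a. $x\in\Omega$ and all $|y|,|y_1|,|y_2|\le M$. State and costs. For $w\in L^2(\Omega)$, $y_w\in H^1_0(\Omega)\cap C(\bar\Omega)$ denotes the unique weak solution of $\mathcal A y+f(x,y)=w$ in $\Omega$, $y=0$ on $\Gamma$. For $(u_1,\ldots,u_m)\in L^2(\Omega)^m$ put $u=\sum_{i=1}^mB_iu_i$ and $J_k(u_1,\ldots,u_m)=\int_\Omega L_k(x,y_u)\,dx+\frac12\int_\Omega\zeta_ku_k^2\,dx$. One writes $(u_k,u_{-k})$ for $(u_1,\ldots,u_m)$, where $u_{-k}$ collects the components other than $u_k$. Parameters. $E_Y\subset L^2(\Omega)$, $E_{k,J}\subset L^2(\Omega)$ and $E_{k,\bullet}$ are metric spaces of parameters, $E_k=E_{k,J}\times E_{k,\bullet}$ with elements $e_k=(e_{k,J},e_{k,\bullet})$, and $\mathbf E=E_Y\times E_1\times\cdots\times E_m$. The perturbed cost is $$\mathcal J_k(u_k,u_{-k},e_Y,e_k)=J_k(u_k+e_Y,u_{-k})+(e_{k,J},y_{u+e_Y})_{L^2(\Omega)},\qquad u=\sum_{i=1}^mB_iu_i,$$ and $\nabla_{u_k}\mathcal J_k$ is its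 partial gradient in $u_k$. For each $k$ and $e_k\in E_k$, $\mathcal U^k_{ad}(e_k)\subset L^2(\Omega)$ is a convex, closed and bounded set. $N(u;\Theta)$ is the normal cone of convex analysis to the convex set $\Theta$ at $u$. *)

theory Defs
  imports "HOL-Analysis.Analysis"
begin

definition sq_integrable :: "'a measure \<Rightarrow> ('a \<Rightarrow> real) \<Rightarrow> bool" where
  "sq_integrable M g \<longleftrightarrow> g \<in> borel_measurable M \<and> integrable M (\<lambda>x. (g x)\<^sup>2)"

lemma sq_integrable_zero: "sq_integrable M (\<lambda>x. 0)"
  by (simp add: sq_integrable_def)

lemma sq_integrable_scale: "sq_integrable M g \<Longrightarrow> sq_integrable M (\<lambda>x. c * g x)"
  by (auto simp: sq_integrable_def power_mult_distrib)

lemma sq_integrable_mult: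
  assumes "sq_integrable M g" "sq_integrable M h"
  shows "integrable M (\<lambda>x. g x * h x)"
proof (rule Bochner_Integration.integrable_bound)
  show "integrable M (\<lambda>x. (g x)\<^sup>2 + (h x)\<^sup>2)"
    using assms by (auto simp: sq_integrable_def)
  show "(\<lambda>x. g x * h x) \<in> borel_measurable M"
    using assms by (auto simp: sq_integrable_def)
  have "\<bar>s * t\<bar> \<le> s\<^sup>2 + t\<^sup>2" for s t :: real
  proof -
    have "0 \<le> (\<bar>s\<bar> - \<bar>t\<bar>)\<^sup>2" by simp
    then have "2 * (\<bar>s\<bar> * \<bar>t\<bar>) \<le> s\<^sup>2 + t\<^sup>2"
      by (simp add: power2_diff)
    moreover have "0 \<le> \<bar>s\<bar> * \<bar>t\<bar>" by simp
    ultimately show ?thesis unfolding abs_mult by linarith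
  qed
  then show "AE x in M. norm (g x * h x) \<le> norm ((g x)\<^sup>2 + (h x)\<^sup>2)"
    by simp
qed

lemma sq_integrable_add:
  assumes "sq_integrable M g" "sq_integrable M h"
  shows "sq_integrable M (\<lambda>x. g x + h x)"
proof -
  have "(\<lambda>x. (g x + h x)\<^sup>2) = (\<lambda>x. (g x)\<^sup>2 + (h x)\<^sup>2 + 2 * (g x * h x))"
    by (auto simp: power2_sum)
  then show ?thesis
    using assms sq_integrable_mult[OF assms] by (auto simp: sq_integrable_def)
qed

definition L2_rel :: "(real^'n \<Rightarrow> real) \<Rightarrow> (real^'n \<Rightarrow> real) \<Rightarrow> bool" where
  "L2_rel g h \<longleftrightarrow>
     sq_integrable lebesgue g \<and> sq_integrable lebesgue h \<and> (AE x in lebesgue. g x = h x)"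

text \<open>\<open>'n L2\<close> is the space of classes of square integrable functions on all of \<open>real^'n\<close>; the
  classes that vanish off a set \<open>\<Omega>\<close> (see \<open>L2_on\<close>) form the space \<open>L\<^sup>2(\<Omega>)\<close>, extension by zero
  being an isometric isomorphism.\<close>

quotient_type 'n L2 = "real^'n::finite \<Rightarrow> real" / partial: L2_rel
proof (rule part_equivpI)
  show "\<exists>g::real^'n \<Rightarrow> real. L2_rel g g"
    by (rule exI[of _ "\<lambda>_. 0"]) (simp add: L2_rel_def sq_integrable_zero)
  show "symp (L2_rel :: (real^'n \<Rightarrow> real) \<Rightarrow> _)"
    by (auto simp: symp_def L2_rel_def elim: eventually_mono)
  show "transp (L2_rel :: (real^'n \<Rightarrow> real) \<Rightarrow> _)"
    by (auto simp: transp_def L2_rel_def elim: eventually_elim2)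
qed

lemma L2_rel_rep: "L2_rel (rep_L2 u) (rep_L2 u)"
  by (rule Quotient3_rep_reflp[OF Quotient3_L2])

lemma L2_rel_rep_abs: "L2_rel g g \<Longrightarrow> L2_rel (rep_L2 (abs_L2 g)) g"
  by (rule rep_abs_rsp_left[OF Quotient3_L2])

instantiation L2 :: (finite) real_inner
begin

lift_definition zero_L2 :: "'a L2" is "\<lambda>x. 0"
  by (simp add: L2_rel_def sq_integrable_zero)

lift_definition plus_L2 :: "'a L2 \<Rightarrow> 'a L2 \<Rightarrow> 'a L2" is "\<lambda>g h x. g x + h x"
  unfolding L2_rel_def by (auto intro: sq_integrable_add)

lift_definition uminus_L2 :: "'a L2 \<Rightarrow> 'a L2" is "\<lambda>g x. - g x"
  unfolding L2_rel_def using sq_integrable_scale[of _ _ "-1"] by auto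

definition minus_L2 :: "'a L2 \<Rightarrow> 'a L2 \<Rightarrow> 'a L2" where
  "minus_L2 u v = u + - v"

lift_definition scaleR_L2 :: "real \<Rightarrow> 'a L2 \<Rightarrow> 'a L2" is "\<lambda>c g x. c * g x"
  unfolding L2_rel_def by (auto intro: sq_integrable_scale)

lift_definition inner_L2 :: "'a L2 \<Rightarrow> 'a L2 \<Rightarrow> real" is "\<lambda>g h. LINT x|lebesgue. g x * h x"
  unfolding L2_rel_def
  by (intro integral_cong_AE borel_measurable_times)
     (auto simp: sq_integrable_def elim: eventually_elim2)

definition norm_L2 :: "'a L2 \<Rightarrow> real" where
  "norm_L2 u = sqrt (inner u u)"

definition dist_L2 :: "'a L2 \<Rightarrow> 'a L2 \<Rightarrow> real" where
  "dist_L2 u v = norm (u - v)"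

definition sgn_L2 :: "'a L2 \<Rightarrow> 'a L2" where
  "sgn_L2 u = inverse (norm u) *\<^sub>R u"

definition uniformity_L2 :: "('a L2 \<times> 'a L2) filter" where
  "uniformity_L2 = (INF e\<in>{0<..}. principal {(u, v). dist u v < e})"

definition open_L2 :: "'a L2 set \<Rightarrow> bool" where
  "open_L2 U \<longleftrightarrow> (\<forall>u\<in>U. eventually (\<lambda>(u', v). u' = u \<longrightarrow> v \<in> U) uniformity)"

instance
proof
  fix u v w :: "'a L2" and r s :: real
  show "u + v + w = u + (v + w)"
    by transfer (auto simp: L2_rel_def add.assoc intro!: sq_integrable_add)
  show "u + v = v + u"
    by transfer (auto simp: L2_rel_def add.commute intro!: sq_integrable_add)
  show "0 + u = u"
    by transfer (auto simp: L2_rel_def)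
  show "- u + u = 0"
    by transfer (auto simp: L2_rel_def sq_integrable_zero)
  show "u - v = u + - v"
    by (rule minus_L2_def)
  show "r *\<^sub>R (u + v) = r *\<^sub>R u + r *\<^sub>R v"
    by transfer (auto simp: L2_rel_def distrib_left intro!: sq_integrable_add sq_integrable_scale)
  show "(r + s) *\<^sub>R u = r *\<^sub>R u + s *\<^sub>R u"
    by transfer (auto simp: L2_rel_def distrib_right intro!: sq_integrable_add sq_integrable_scale)
  show "r *\<^sub>R s *\<^sub>R u = (r * s) *\<^sub>R u"
    by transfer (auto simp: L2_rel_def mult.assoc intro!: sq_integrable_scale)
  show "1 *\<^sub>R u = u"
    by transfer (auto simp: L2_rel_def)
  show "dist u v = norm (u - v)"
    by (rule dist_L2_def)
  show "sgn u = inverse (norm u) *\<^sub>R u"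
    by (rule sgn_L2_def)
  show "uniformity = (INF e\<in>{0<..}. principal {(u :: 'a L2, v). dist u v < e})"
    by (rule uniformity_L2_def)
  show "open U \<longleftrightarrow> (\<forall>u\<in>U. eventually (\<lambda>(u', v). u' = u \<longrightarrow> v \<in> U) uniformity)"
    for U :: "'a L2 set"
    by (rule open_L2_def)
  show "inner u v = inner v u"
    by transfer (simp add: mult.commute)
  show "inner (u + v) w = inner u w + inner v w"
    by transfer
       (simp add: L2_rel_def distrib_right sq_integrable_mult)
  show "inner (r *\<^sub>R u) v = r * inner u v"
    by transfer (simp add: mult.assoc)
  show "0 \<le> inner u u"
    by transfer (simp add: integral_nonneg_AE)
  show "inner u u = 0 \<longleftrightarrow> u = 0"
  proof transfer
    fix g :: "real^'a \<Rightarrow> real"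
    assume "L2_rel g g"
    then have g: "sq_integrable lebesgue g" by (simp add: L2_rel_def)
    have "(LINT x|lebesgue. g x * g x) = 0 \<longleftrightarrow> (AE x in lebesgue. g x * g x = 0)"
      by (rule integral_nonneg_eq_0_iff_AE) (auto simp: sq_integrable_mult g)
    then show "(LINT x|lebesgue. g x * g x) = 0 \<longleftrightarrow> L2_rel g (\<lambda>x. 0)"
      using g by (simp add: L2_rel_def sq_integrable_zero)
  qed
  show "norm u = sqrt (inner u u)"
    by (rule norm_L2_def)
qed

end

definition L2_on :: "(real^'n) set \<Rightarrow> 'n::finite L2 set" where
  "L2_on \<Omega> = {u. AE x in lebesgue. x \<notin> \<Omega> \<longrightarrow> rep_L2 u x = 0}"

definition Linf_on :: "(real^'n) set \<Rightarrow> (real^'n \<Rightarrow> real) \<Rightarrow> bool" where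
  "Linf_on \<Omega> g \<longleftrightarrow> g \<in> borel_measurable (lebesgue_on \<Omega>) \<and>
     (\<exists>C. AE x in lebesgue_on \<Omega>. \<bar>g x\<bar> \<le> C)"

text \<open>Locally, after a rotation sending \<open>\<nu>\<close> to the last coordinate vector, \<open>\<Omega>\<close> is the strict
  epigraph of a Lipschitz function \<open>\<phi>\<close> on the hyperplane orthogonal to \<open>\<nu>\<close>.\<close>

definition lipschitz_boundary :: "(real^'n) set \<Rightarrow> bool" where
  "lipschitz_boundary \<Omega> \<longleftrightarrow> (\<forall>p\<in>frontier \<Omega>. \<exists>U \<nu> K \<phi>.
     open U \<and> p \<in> U \<and> norm \<nu> = 1 \<and> K-lipschitz_on {z. z \<bullet> \<nu> = 0} \<phi> \<and>
     \<Omega> \<inter> U = {x \<in> U. \<phi> (x - (x \<bullet> \<nu>) *\<^sub>R \<nu>) < x \<bullet> \<nu>})"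

definition partial_deriv :: "'n::finite \<Rightarrow> (real^'n \<Rightarrow> real) \<Rightarrow> real^'n \<Rightarrow> real" where
  "partial_deriv i \<phi> x = frechet_derivative \<phi> (at x) (axis i 1)"

primrec C_k :: "nat \<Rightarrow> (real^'n::finite \<Rightarrow> real) \<Rightarrow> bool" where
  "C_k 0 \<phi> \<longleftrightarrow> continuous_on UNIV \<phi>"
| "C_k (Suc k) \<phi> \<longleftrightarrow> (\<forall>x. \<phi> differentiable (at x)) \<and> (\<forall>i. C_k k (partial_deriv i \<phi>))"

definition test_functions :: "(real^'n::finite) set \<Rightarrow> (real^'n \<Rightarrow> real) set" where
  "test_functions \<Omega> = {\<phi>. (\<forall>k. C_k k \<phi>) \<and>
     compact (closure {x. \<phi> x \<noteq> 0}) \<and> closure {x. \<phi> x \<noteq> 0} \<subseteq> \<Omega>}"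

definition is_weak_partial ::
  "(real^'n::finite) set \<Rightarrow> 'n \<Rightarrow> (real^'n \<Rightarrow> real) \<Rightarrow> (real^'n \<Rightarrow> real) \<Rightarrow> bool" where
  "is_weak_partial \<Omega> i y g \<longleftrightarrow> sq_integrable (lebesgue_on \<Omega>) g \<and>
     (\<forall>\<phi>\<in>test_functions \<Omega>.
        (LINT x|lebesgue_on \<Omega>. y x * partial_deriv i \<phi> x) = - (LINT x|lebesgue_on \<Omega>. g x * \<phi> x))"

definition H1 :: "(real^'n::finite) set \<Rightarrow> (real^'n \<Rightarrow> real) set" where
  "H1 \<Omega> = {y. sq_integrable (lebesgue_on \<Omega>) y \<and> (\<forall>i. \<exists>g. is_weak_partial \<Omega> i y g)}"

text \<open>The weak derivative is determined only almost everywhere; it is used below only under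
  integrals.\<close>

definition weak_partial ::
  "(real^'n::finite) set \<Rightarrow> 'n \<Rightarrow> (real^'n \<Rightarrow> real) \<Rightarrow> real^'n \<Rightarrow> real" where
  "weak_partial \<Omega> i y = (SOME g. is_weak_partial \<Omega> i y g)"

definition H1_norm :: "(real^'n::finite) set \<Rightarrow> (real^'n \<Rightarrow> real) \<Rightarrow> real" where
  "H1_norm \<Omega> y = sqrt ((LINT x|lebesgue_on \<Omega>. (y x)\<^sup>2) +
     (\<Sum>i\<in>UNIV. LINT x|lebesgue_on \<Omega>. (weak_partial \<Omega> i y x)\<^sup>2))"

definition H10 :: "(real^'n::finite) set \<Rightarrow> (real^'n \<Rightarrow> real) set" where
  "H10 \<Omega> = {y \<in> H1 \<Omega>. \<forall>\<epsilon>>0. \<exists>\<phi>\<in>test_functions \<Omega>. H1_norm \<Omega> (\<lambda>x. y x - \<phi> x) < \<epsilon>}"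

definition uniformly_elliptic ::
  "(real^'n::finite) set \<Rightarrow> ('n \<Rightarrow> 'n \<Rightarrow> real^'n \<Rightarrow> real) \<Rightarrow> bool" where
  "uniformly_elliptic \<Omega> a \<longleftrightarrow> (\<forall>i j. Linf_on \<Omega> (a i j)) \<and>
     (\<exists>\<mu>>0. AE x in lebesgue_on \<Omega>. \<forall>\<xi>.
        \<mu> * (norm \<xi>)\<^sup>2 \<le> (\<Sum>i\<in>UNIV. \<Sum>j\<in>UNIV. a i j x * \<xi> $ i * \<xi> $ j))"

definition C2_real :: "(real \<Rightarrow> real) \<Rightarrow> bool" where
  "C2_real g \<longleftrightarrow> (\<forall>t. g differentiable (at t)) \<and> (\<forall>t. deriv g differentiable (at t)) \<and>
     continuous_on UNIV (deriv (deriv g))"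

text \<open>Functions on \<open>\<Omega> \<times> \<real>\<close> are curried, so that \<open>deriv (F x) t\<close> and \<open>deriv (deriv (F x)) t\<close> are
  the first and second partial derivatives of \<open>F\<close> with respect to the second variable.\<close>

definition caratheodory_C2 :: "(real^'n) set \<Rightarrow> (real^'n \<Rightarrow> real \<Rightarrow> real) \<Rightarrow> bool" where
  "caratheodory_C2 \<Omega> F \<longleftrightarrow> (\<forall>t. (\<lambda>x. F x t) \<in> borel_measurable (lebesgue_on \<Omega>)) \<and>
     (AE x in lebesgue_on \<Omega>. C2_real (F x))"

definition state_nonlinearity :: "(real^'n) set \<Rightarrow> (real^'n \<Rightarrow> real \<Rightarrow> real) \<Rightarrow> bool" where
  "state_nonlinearity \<Omega> f \<longleftrightarrow>
     caratheodory_C2 \<Omega> f \<and>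
     sq_integrable (lebesgue_on \<Omega>) (\<lambda>x. f x 0) \<and>
     (AE x in lebesgue_on \<Omega>. \<forall>t. 0 \<le> deriv (f x) t) \<and>
     (\<forall>M>0. \<exists>C>0. AE x in lebesgue_on \<Omega>.
        (\<forall>t. \<bar>t\<bar> \<le> M \<longrightarrow> \<bar>deriv (f x) t\<bar> + \<bar>deriv (deriv (f x)) t\<bar> \<le> C) \<and>
        (\<forall>t1 t2. \<bar>t1\<bar> \<le> M \<and> \<bar>t2\<bar> \<le> M \<longrightarrow>
           \<bar>deriv (deriv (f x)) t2 - deriv (deriv (f x)) t1\<bar> \<le> C * \<bar>t2 - t1\<bar>))"

definition cost_integrand :: "(real^'n) set \<Rightarrow> (real^'n \<Rightarrow> real \<Rightarrow> real) \<Rightarrow> bool" where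
  "cost_integrand \<Omega> L \<longleftrightarrow>
     caratheodory_C2 \<Omega> L \<and>
     integrable (lebesgue_on \<Omega>) (\<lambda>x. L x 0) \<and>
     (\<forall>M>0. \<exists>C>0. \<exists>\<psi>. sq_integrable (lebesgue_on \<Omega>) \<psi> \<and> (AE x in lebesgue_on \<Omega>.
        (\<forall>t. \<bar>t\<bar> \<le> M \<longrightarrow> \<bar>deriv (L x) t\<bar> \<le> \<psi> x \<and> \<bar>deriv (deriv (L x)) t\<bar> \<le> C) \<and>
        (\<forall>t1 t2. \<bar>t1\<bar> \<le> M \<and> \<bar>t2\<bar> \<le> M \<longrightarrow>
           \<bar>deriv (deriv (L x)) t2 - deriv (deriv (L x)) t1\<bar> \<le> C * \<bar>t2 - t1\<bar>)))"

definition is_weak_solution ::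
  "(real^'n::finite) set \<Rightarrow> ('n \<Rightarrow> 'n \<Rightarrow> real^'n \<Rightarrow> real) \<Rightarrow> (real^'n \<Rightarrow> real \<Rightarrow> real) \<Rightarrow>
   (real^'n \<Rightarrow> real) \<Rightarrow> (real^'n \<Rightarrow> real) \<Rightarrow> bool" where
  "is_weak_solution \<Omega> a f w y \<longleftrightarrow>
     y \<in> H10 \<Omega> \<and> continuous_on (closure \<Omega>) y \<and> (\<forall>x\<in>frontier \<Omega>. y x = 0) \<and>
     (\<forall>v\<in>H10 \<Omega>.
        (\<Sum>i\<in>UNIV. \<Sum>j\<in>UNIV. LINT x|lebesgue_on \<Omega>.
           a i j x * weak_partial \<Omega> i y x * weak_partial \<Omega> j v x)
        + (LINT x|lebesgue_on \<Omega>. f x (y x) * v x)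
        = (LINT x|lebesgue_on \<Omega>. w x * v x))"

text \<open>Functions on \<open>closure \<Omega>\<close> are normalised to be zero outside, so that a unique solution
  is unique as an element of the function type.\<close>

definition state ::
  "(real^'n::finite) set \<Rightarrow> ('n \<Rightarrow> 'n \<Rightarrow> real^'n \<Rightarrow> real) \<Rightarrow> (real^'n \<Rightarrow> real \<Rightarrow> real) \<Rightarrow>
   (real^'n \<Rightarrow> real) \<Rightarrow> real^'n \<Rightarrow> real" where
  "state \<Omega> a f w = (THE y. is_weak_solution \<Omega> a f w y \<and> (\<forall>x. x \<notin> closure \<Omega> \<longrightarrow> y x = 0))"

definition total_control ::
  "('m::finite \<Rightarrow> real^'n \<Rightarrow> real) \<Rightarrow> ('m \<Rightarrow> 'n::finite L2) \<Rightarrow> real^'n \<Rightarrow> real" where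
  "total_control B u x = (\<Sum>i\<in>UNIV. B i x * rep_L2 (u i) x)"

definition cost ::
  "(real^'n::finite) set \<Rightarrow> ('n \<Rightarrow> 'n \<Rightarrow> real^'n \<Rightarrow> real) \<Rightarrow> (real^'n \<Rightarrow> real \<Rightarrow> real) \<Rightarrow>
   ('m::finite \<Rightarrow> real^'n \<Rightarrow> real) \<Rightarrow> ('m \<Rightarrow> real^'n \<Rightarrow> real) \<Rightarrow> ('m \<Rightarrow> real^'n \<Rightarrow> real \<Rightarrow> real) \<Rightarrow>
   'm \<Rightarrow> ('m \<Rightarrow> 'n L2) \<Rightarrow> real" where
  "cost \<Omega> a f B \<zeta> L k u =
     (LINT x|lebesgue_on \<Omega>. L k x (state \<Omega> a f (total_control B u) x))
     + 1/2 * (LINT x|lebesgue_on \<Omega>. \<zeta> k x * (rep_L2 (u k) x)\<^sup>2)"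

text \<open>In the first summand the perturbation enters through the \<open>k\<close>-th control and hence as
  \<open>B k * eY\<close> in the state equation; in the second one it is added to the right-hand side.\<close>

definition perturbed_cost ::
  "(real^'n::finite) set \<Rightarrow> ('n \<Rightarrow> 'n \<Rightarrow> real^'n \<Rightarrow> real) \<Rightarrow> (real^'n \<Rightarrow> real \<Rightarrow> real) \<Rightarrow>
   ('m::finite \<Rightarrow> real^'n \<Rightarrow> real) \<Rightarrow> ('m \<Rightarrow> real^'n \<Rightarrow> real) \<Rightarrow> ('m \<Rightarrow> real^'n \<Rightarrow> real \<Rightarrow> real) \<Rightarrow>
   'm \<Rightarrow> ('m \<Rightarrow> 'n L2) \<Rightarrow> 'n L2 \<Rightarrow> 'n L2 \<times> 'e \<Rightarrow> real" where
  "perturbed_cost \<Omega> a f B \<zeta> L k u eY ek =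
     cost \<Omega> a f B \<zeta> L k (u(k := u k + eY))
     + (LINT x|lebesgue_on \<Omega>.
          rep_L2 (fst ek) x * state \<Omega> a f (\<lambda>z. total_control B u z + rep_L2 eY z) x)"

text \<open>Gradient, in the Hilbert space given by the closed subspace \<open>H\<close>, of \<open>F\<close> at the point \<open>p\<close>.\<close>

definition has_gradient_on ::
  "('a::real_inner \<Rightarrow> real) \<Rightarrow> 'a \<Rightarrow> 'a set \<Rightarrow> 'a \<Rightarrow> bool" where
  "has_gradient_on F g H p \<longleftrightarrow> g \<in> H \<and> (F has_derivative (\<lambda>h. g \<bullet> h)) (at p within H)"

definition normal_cone :: "'a::real_inner set \<Rightarrow> 'a \<Rightarrow> 'a set \<Rightarrow> 'a set" where
  "normal_cone H p \<Theta> = (if p \<in> \<Theta> then {\<nu> \<in> H. \<forall>z\<in>\<Theta>. \<nu> \<bullet> (z - p) \<le> 0} else {})"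

end

theory Submission
 imports Defs
begin

text \<open>The state solves a semilinear equation with bounded measurable coefficients. It is obtained by
 truncating the monotone nonlinearity, from a strongly monotone variational inequality in \<open>H\<^sup>1\<^sub>0\<close>; Stampacchia's
 truncation method bounds it uniformly by the \<open>L\<^sup>2\<close> norm of the data, and De Giorgi's method makes it continuous
 up to the boundary, the complement of a Lipschitz domain having positive density at boundary points. The
 state is then Lipschitz, in the uniform norm, with respect to the control. This makes the remainder of the
 cost quadratic, so that its gradient is given by the adjoint state and the linearised state equation is not needed.
 The adjoint states belonging to bounded controls form a relatively compact subset of \<open>L\<^sup>2\<close>. For a given
 adjoint state, the quadratic part of the cost turns the optimality condition of each player into a strongly monotone
 variational inequality; inserting its solution into the adjoint state is a compact continuous map, and
 Schauder's theorem yields the equilibrium.\<close>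

section \<open>The space of square integrable functions\<close>

text \<open>The cost of a player need not be convex in the player's own control, because the state
  depends on it nonlinearly; so the first-order system is solved directly instead of through best
  responses. The multiplication by \<open>\<zeta>\<close> supplies the strong monotonicity, and the
  players are coupled only through adjoint states, which is why compactness is enough. The unknown
  of the fixed point is the vector of the remaining gradient terms, not the controls: the map then
  lives on a whole normed space and has range in a compact set. One device takes the place of
  Sobolev embeddings: the increments \<open>v (x + h) - v x\<close> are integrated over
  \<open>x\<close> and \<open>h\<close>. It yields inequalities of Poincare and Faber-Krahn type, De
  Giorgi's isoperimetric inequality and the compact embedding. For this, functions are extended by
  zero to the whole space, and \<open>H\<^sup>1\<^sub>0\<close> is the closure of the pairs of a
  test function and its gradient. The hypotheses hold almost everywhere, while the estimates are
  proved for data that satisfy them at every point; the given data are finally exchanged for such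
  versions.\<close>

abbreviation leb_integral :: "('a::euclidean_space => real) => real" (binder "LEB " [60] 60)
 where "leb_integral f == integral\<^sup>L lebesgue f"

abbreviation leb_AE :: "('a::euclidean_space => bool) => bool" (binder "AEL " 10)
 where "leb_AE P == almost_everywhere lebesgue P"

abbreviation LM :: "('a::euclidean_space => 'b::topological_space) set" where "LM == borel_measurable lebesgue"

abbreviation sq :: "('a::euclidean_space => real) => bool" where "sq == sq_integrable lebesgue"

notation LIMSEQ ("(_/ ----> _)" [60, 60] 60)

abbreviation L2lim :: "(nat => real^'n::finite => real) => (real^'n => real) => bool" where
 "L2lim f g == (%n. abs_L2 (f n)) ----> abs_L2 g"

lemma sq_integrable_rep: "sq (rep_L2 u)"
 using L2_rel_rep by (auto simp: L2_rel_def)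

lemma L2_rel_refl: "sq g ==> L2_rel g g"
 by (simp add: L2_rel_def)

lemma rep_abs_AE: "sq g ==> AEL x. rep_L2 (abs_L2 g) x = g x"
 using L2_rel_rep_abs[OF L2_rel_refl] by (auto simp: L2_rel_def)

lemma abs_rep_L2 [simp]: "abs_L2 (rep_L2 u) = u"
 by (rule Quotient3_abs_rep[OF Quotient3_L2])

lemma abs_L2_eqI:
 assumes "sq g" "sq h" "AEL x. g x = h x"
 shows "abs_L2 g = abs_L2 h"
 using Quotient3_rel_abs[OF Quotient3_L2] assms by (auto simp: L2_rel_def)

lemma L2_eqI: "(AEL x. rep_L2 u x = rep_L2 v x) ==> u = v"
 using abs_L2_eqI[OF sq_integrable_rep sq_integrable_rep, of u v] by simp

lemma inner_abs_L2:
 assumes "sq g" "sq h"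
 shows "abs_L2 g \<bullet> abs_L2 h = (LEB x. g x * h x)"
 using inner_L2.abs_eq assms by (auto simp: L2_rel_def)

lemma plus_abs_L2:
 assumes "sq g" "sq h"
 shows "abs_L2 g + abs_L2 h = abs_L2 (%x. g x + h x)"
 using plus_L2.abs_eq assms by (auto simp: L2_rel_def)

lemma scaleR_abs_L2:
 assumes "sq g"
 shows "c *\<^sub>R abs_L2 g = abs_L2 (%x. c * g x)"
 using scaleR_L2.abs_eq assms by (auto simp: L2_rel_def)

lemma sq_integrable_diff:
 "sq_integrable M g ==> sq_integrable M h ==> sq_integrable M (%x. g x - h x)"
 using sq_integrable_add[of M g "%x. -1 * h x"] sq_integrable_scale[of M h "-1"] by simp

lemma minus_abs_L2:
 assumes "sq g" "sq h"
 shows "abs_L2 g - abs_L2 h = abs_L2 (%x. g x - h x)"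
proof -
 have "abs_L2 g - abs_L2 h = abs_L2 g + (-1) *\<^sub>R abs_L2 h" by simp
 then show ?thesis
  using plus_abs_L2[OF assms(1) sq_integrable_scale[OF assms(2), of "-1"]]
   scaleR_abs_L2[OF assms(2), of "-1"] by (simp add: diff_conv_add_uminus del: add_uminus_conv_diff)
qed

lemma norm_abs_L2:
 assumes "sq g"
 shows "(norm (abs_L2 g))^2 = (LEB x. (g x)^2)"
 using inner_abs_L2[OF assms assms] by (simp add: power2_norm_eq_inner) (simp add: power2_eq_square)

lemma norm_diff_abs_L2:
 assumes "sq g" "sq h"
 shows "(norm (abs_L2 g - abs_L2 h))^2 = (LEB x. (g x - h x)^2)"
 using assms by (simp add: minus_abs_L2 norm_abs_L2 sq_integrable_diff)

lemma rep_plus_AE: "AEL x. rep_L2 (u + v) x = rep_L2 u x + rep_L2 v x"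
 using rep_abs_AE[OF sq_integrable_add[OF sq_integrable_rep sq_integrable_rep], of u v]
  plus_abs_L2[OF sq_integrable_rep sq_integrable_rep, of u v] by simp

lemma rep_minus_AE: "AEL x. rep_L2 (u - v) x = rep_L2 u x - rep_L2 v x"
 using rep_abs_AE[OF sq_integrable_diff[OF sq_integrable_rep sq_integrable_rep], of u v]
  minus_abs_L2[OF sq_integrable_rep sq_integrable_rep, of u v] by simp

lemma rep_scaleR_AE: "AEL x. rep_L2 (c *\<^sub>R u) x = c * rep_L2 u x"
 using rep_abs_AE[OF sq_integrable_scale[OF sq_integrable_rep], of c u]
  scaleR_abs_L2[OF sq_integrable_rep, of c u] by simp

lemma norm_L2_nn:
 assumes "sq g"
 shows "(\<integral>\<^sup>+x. ennreal ((g x)^2) \<partial>lebesgue) = ennreal ((norm (abs_L2 g))^2)"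
 using assms by (simp add: norm_abs_L2 nn_integral_eq_integral sq_integrable_def)

lemma norm_diff_L2_nn:
 "(\<integral>\<^sup>+x. ennreal ((rep_L2 u x - rep_L2 v x)^2) \<partial>lebesgue) = ennreal ((norm (u - v))^2)"
 using norm_L2_nn[OF sq_integrable_diff[OF sq_integrable_rep sq_integrable_rep], of u v]
  minus_abs_L2[OF sq_integrable_rep sq_integrable_rep, of u v] by simp

lemma measurable_rep_L2 [measurable]: "rep_L2 u \<in> LM"
 using sq_integrable_rep by (auto simp: sq_integrable_def)

section \<open>Completeness of \<open>L2\<close>\<close>

lemma AE_convergent_of_fast:
 fixes f :: "nat => 'a => real"
 assumes [measurable]: "!!n. f n \<in> borel_measurable M"
  and fast: "!!n. (\<integral>\<^sup>+x. ennreal ((f (Suc n) x - f n x)^2) \<partial>M) <= ennreal ((1/8)^n)"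
 shows "AE x in M. convergent (%n. f n x)"
proof -
 \<comment> \<open>The weight \<open>4^n\<close> leaves integrals of size at most
   \<open>(4/8)^n\<close>, which are summable; where the weighted sum has a finite value
   \<open>S\<close>, the n-th increment is at most \<open>sqrt S * (1/2)^n\<close>.\<close>
 define s where "s x = (\<Sum>n. ennreal (4^n) * ennreal ((f (Suc n) x - f n x)^2))" for x
 have [measurable]: "s \<in> borel_measurable M" unfolding s_def by measurable
 have "(\<integral>\<^sup>+x. s x \<partial>M) = (\<Sum>n. \<integral>\<^sup>+x. ennreal (4^n) * ennreal ((f (Suc n) x - f n x)^2) \<partial>M)"
  unfolding s_def by (rule nn_integral_suminf) measurable
 also have "... = (\<Sum>n. ennreal (4^n) * (\<integral>\<^sup>+x. ennreal ((f (Suc n) x - f n x)^2) \<partial>M))"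
  by (subst nn_integral_cmult) auto
 also have "... <= (\<Sum>n. ennreal ((1/2)^n))"
 proof (rule suminf_le)
  fix n
  have "ennreal (4^n) * (\<integral>\<^sup>+x. ennreal ((f (Suc n) x - f n x)^2) \<partial>M) <= ennreal (4^n) * ennreal ((1/8)^n)"
   by (intro mult_left_mono fast) auto
  also have "... = ennreal ((1/2)^n)"
   by (subst ennreal_mult[symmetric], simp, simp, subst power_mult_distrib[symmetric]) simp
  finally show "ennreal (4^n) * (\<integral>\<^sup>+x. ennreal ((f (Suc n) x - f n x)^2) \<partial>M) <= ennreal ((1/2)^n)" .
 qed auto
 also have "... = ennreal 2"
  by (rule suminf_ennreal_eq) (use geometric_sums[of "1/2::real"] in auto)
 finally have "(\<integral>\<^sup>+x. s x \<partial>M) \<noteq> \<infinity>" by (auto simp: top_unique)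
 then have "AE x in M. s x \<noteq> \<infinity>" by (intro nn_integral_PInf_AE) auto
 then show ?thesis
 proof eventually_elim
  case (elim x)
  then obtain S where S: "s x = ennreal S" "S \<ge> 0" by (cases "s x") auto
  have b: "\<bar>f (Suc n) x - f n x\<bar> <= sqrt S * (1/2)^n" for n
  proof -
   have "ennreal (4^n * (f (Suc n) x - f n x)^2) = (\<Sum>i\<in>{n}. ennreal (4^i) * ennreal ((f (Suc i) x - f i x)^2))"
    by (simp add: ennreal_mult)
   also have "... <= s x" unfolding s_def by (intro sum_le_suminf) auto
   finally have "4^n * (f (Suc n) x - f n x)^2 <= S" using S by simp
   then have "(f (Suc n) x - f n x)^2 <= S * (1/4)^n" by (simp add: field_simps)
   also have "S * (1/4)^n = (sqrt S * (1/2)^n)^2"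
   proof -
    have "((1/2::real)^n)^2 = ((1/2)^2)^n"
     by (simp only: power_mult[symmetric] mult.commute)
    also have "(1/2::real)^2 = 1/4" by (simp add: power2_eq_square)
    finally have "((1/2::real)^n)^2 = (1/4)^n" .
    then show ?thesis using S by (simp add: power_mult_distrib)
   qed
   finally have "\<bar>f (Suc n) x - f n x\<bar>^2 <= (sqrt S * (1/2)^n)^2" by (simp only: power2_abs)
   then show ?thesis by (rule power2_le_imp_le) (intro mult_nonneg_nonneg; use S in simp)
  qed
  have "summable (%n. f (Suc n) x - f n x)"
   by (rule summable_comparison_test'[of "%n. sqrt S * (1/2)^n" 0])
    (use b in \<open>auto intro!: summable_mult summable_geometric\<close>)
  then have "convergent (%n. \<Sum>i<n. f (Suc i) x - f i x)" by (simp add: summable_iff_convergent)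
  then have "convergent (%n. f n x - f 0 x)" by (simp only: sum_lessThan_telescope[of "%i. f i x"])
  then show ?case by (subst (asm) convergent_diff_const_right_iff)
 qed
qed

instance L2 :: (finite) complete_space
proof
 fix X :: "nat => 'a L2"
 assume X: "Cauchy X"
 have "\<exists>r::nat=>nat. strict_mono r \<and> (\<forall>n. \<forall>i\<ge>r n. \<forall>j\<ge>r n. norm (X i - X j) <= (1/8)^n)"
 proof -
  have "\<exists>N. \<forall>i\<ge>N. \<forall>j\<ge>N. norm (X i - X j) <= (1/8)^n" for n :: nat
   using X[unfolded Cauchy_def, rule_format, of "(1/8)^n"] by (force simp: dist_norm intro: less_imp_le)
  then obtain N where N: "!!n i j. N n <= i ==> N n <= j ==> norm (X i - X j) <= (1/8)^n" by metis
  \<comment> \<open>The sum dominates \<open>N n\<close>, and the extra summand \<open>n\<close>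
    makes \<open>r\<close> strictly increasing.\<close>
  define r where "r n = (\<Sum>i\<le>n. N i) + n" for n :: nat
  have "strict_mono r" by (rule strict_monoI_Suc) (simp add: r_def)
  moreover have "N n <= r n" for n
   unfolding r_def by (rule trans_le_add1, rule member_le_sum) auto
  ultimately show ?thesis using N by (intro exI[of _ r]) (meson order_trans)
 qed
 then obtain r :: "nat => nat" where r: "strict_mono r"
  "!!n i j. r n <= i ==> r n <= j ==> norm (X i - X j) <= (1/8)^n" by blast
 define f where "f n = rep_L2 (X (r n))" for n
 have [measurable]: "!!n. f n \<in> LM" by (simp add: f_def)
 have le1: "(t::real)^2 <= (1/8)^n" if "0 <= t" "t <= (1/8)^n" for t n
 proof -
  have "t^2 <= t * 1" unfolding power2_eq_square 
   using that power_le_one[of "1/8::real" n] by (intro mult_left_mono) auto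
  with that show ?thesis by simp
 qed
 have dd: "(\<integral>\<^sup>+x. ennreal ((f m x - f n x)^2) \<partial>lebesgue) <= ennreal ((1/8)^n)" if "n <= m" for m n
  unfolding f_def norm_diff_L2_nn using that r(1)
  by (intro ennreal_leI le1 r(2)) (auto simp: strict_mono_less_eq)
 have conv: "AEL x. convergent (%n. f n x)"
  by (rule AE_convergent_of_fast) (auto intro: dd)
 define g where "g x = lim (%n. f n x)" for x
 have [measurable]: "g \<in> LM" unfolding g_def by (rule borel_measurable_lim_metric) auto
 have lim: "AEL x. (%n. f n x) ----> g x"
  using conv by eventually_elim (simp add: g_def convergent_LIMSEQ_iff)
 \<comment> \<open>Fatou's lemma is used for nonnegative integrals, since \<open>g\<close> is not
   yet known to be square integrable; that follows from the case \<open>n = 0\<close>.\<close>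
 have fat: "(\<integral>\<^sup>+x. ennreal ((g x - f n x)^2) \<partial>lebesgue) <= ennreal ((1/8)^n)" for n
 proof -
  have "(\<integral>\<^sup>+x. ennreal ((g x - f n x)^2) \<partial>lebesgue) = (\<integral>\<^sup>+x. liminf (%m. ennreal ((f m x - f n x)^2)) \<partial>lebesgue)"
   by (rule nn_integral_cong_AE, use lim in eventually_elim)
    (intro lim_imp_Liminf[symmetric] tendsto_intros; simp)
  also have "... <= liminf (%m. \<integral>\<^sup>+x. ennreal ((f m x - f n x)^2) \<partial>lebesgue)"
   by (rule nn_integral_liminf) measurable
  also have "... <= ennreal ((1/8)^n)"
   by (rule Liminf_le) (auto intro!: eventually_sequentiallyI[of n] dd)
  finally show ?thesis .
 qed
 have "sq (%x. g x - f 0 x)"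
  unfolding sq_integrable_def
 proof
  show "integrable lebesgue (%x. (g x - f 0 x)^2)"
   using fat[of 0] by (intro integrableI_bounded) (auto simp: top_unique intro: le_less_trans)
 qed measurable
 then have sg: "sq g"
  using sq_integrable_add[OF _ sq_integrable_rep[of "X (r 0)"]] by (fastforce simp: f_def)
 have "norm (X (r n) - abs_L2 g) <= sqrt ((1/8)^n)" for n
 proof -
  have "(norm (abs_L2 g - abs_L2 (f n)))^2 <= (1/8)^n"
   using fat[of n] norm_L2_nn[OF sq_integrable_diff[OF sg sq_integrable_rep[of "X (r n)"]]]
    minus_abs_L2[OF sg sq_integrable_rep, of "X (r n)"] by (simp add: f_def)
  then show ?thesis by (simp add: f_def norm_minus_commute real_le_rsqrt)
 qed
 moreover have "(%n. sqrt ((1/8::real)^n)) ----> 0"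
  using tendsto_real_sqrt[OF LIMSEQ_realpow_zero[of "1/8::real"]] by simp
 ultimately have "(%n. X (r n) - abs_L2 g) ----> 0"
  by (rule_tac Lim_null_comparison[of _ "%n. sqrt ((1/8)^n)"]) auto
 then have "(X \<circ> r) ----> abs_L2 g" by (simp add: LIM_zero_iff o_def)
 then have "X ----> abs_L2 g"
  by (rule Cauchy_converges_subseq[OF X r(1)])
 then show "convergent X" by (auto simp: convergent_def)
qed


section \<open>Projections and variational inequalities in Hilbert space\<close>

lemma closed_convex_projection:
 fixes K :: "'a::{real_inner,complete_space} set"
 assumes "closed K" "convex K" "K \<noteq> {}"
 shows "\<exists>p\<in>K. \<forall>z\<in>K. (x - p) \<bullet> (z - p) <= 0"
proof -
 define d where "d = (INF z\<in>K. (norm (x - z))^2)"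
 have bdd: "bdd_below ((%z. (norm (x - z))^2) ` K)" by (rule bdd_belowI[of _ 0]) auto
 have dle: "d <= (norm (x - z))^2" if "z \<in> K" for z
  unfolding d_def by (rule cINF_lower[OF bdd that])
 have "\<exists>z\<in>K. (norm (x - z))^2 < d + 1 / real (Suc n)" for n
  using cINF_less_iff[OF assms(3) bdd, of "d + 1 / real (Suc n)"] by (simp add: d_def)
 then obtain p where p: "!!n. p n \<in> K" "!!n. (norm (x - p n))^2 < d + 1 / real (Suc n)" by metis
 \<comment> \<open>Parallelogram identity: the midpoint of \<open>p n\<close> and \<open>p m\<close>
   lies in \<open>K\<close>, so its squared distance from \<open>x\<close> is at least
   \<open>d\<close>.\<close>
 have par: "(norm (p n - p m))^2 <= 2 / real (Suc n) + 2 / real (Suc m)" for n m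
 proof -
  have "(1/2) *\<^sub>R p n + (1/2) *\<^sub>R p m \<in> K"
   using convexD[OF assms(2) p(1)[of n] p(1)[of m], of "1/2" "1/2"] by simp
  then have "4 * d <= 4 * (norm (x - ((1/2) *\<^sub>R p n + (1/2) *\<^sub>R p m)))^2" using dle by simp
  also have "... = 2 * (norm (x - p n))^2 + 2 * (norm (x - p m))^2 - (norm (p n - p m))^2"
   by (simp add: power2_norm_eq_inner algebra_simps inner_commute)
  finally show ?thesis using p(2)[of n] p(2)[of m] by (simp add: algebra_simps)
 qed
 have "Cauchy p"
 proof (rule CauchyI)
  fix e :: real assume "e > 0"
  then obtain N where N: "4 / real (Suc N) < e^2"
   using reals_Archimedean[of "e^2 / 4"] by (auto simp: field_simps)
  have "norm (p m - p n) < e" if "m \<ge> N" "n \<ge> N" for m n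
  proof -
   have "2 / real (Suc m) + 2 / real (Suc n) <= 2 / real (Suc N) + 2 / real (Suc N)"
    using that by (intro add_mono divide_left_mono) auto
   with par[of m n] N have "(norm (p m - p n))^2 < e^2" by simp
   then show ?thesis using \<open>e > 0\<close> by (intro power2_less_imp_less[of _ e]) auto
  qed
  then show "\<exists>M. \<forall>m\<ge>M. \<forall>n\<ge>M. norm (p m - p n) < e" by blast
 qed
 then obtain q where q: "p ----> q" using convergent_def Cauchy_convergent by blast
 then have qK: "q \<in> K" using assms(1) p(1) closed_sequentially by blast
 have qd: "(norm (x - q))^2 <= d"
 proof (rule LIMSEQ_le[of "%n. (norm (x - p n))^2" _ "%n. d + 1 / real (Suc n)"])
  show "(%n. (norm (x - p n))^2) ----> (norm (x - q))^2" by (intro tendsto_intros q)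
  show "(%n. d + 1 / real (Suc n)) ----> d"
   using tendsto_add[OF tendsto_const[of d] LIMSEQ_inverse_real_of_nat] by (simp add: divide_inverse)
 qed (use p(2) less_imp_le in blast)
 show ?thesis
 proof (intro bexI ballI)
  fix z assume z: "z \<in> K"
  \<comment> \<open>Minimality of \<open>q\<close> is compared along the segment towards
    \<open>z\<close>; after division by \<open>t\<close>, letting \<open>t\<close> tend to 0 leaves
    the obtuse angle condition.\<close>
  have b: "2 * ((x - q) \<bullet> (z - q)) <= t * (norm (z - q))^2" if t: "0 < t" "t <= 1" for t
  proof -
   have "q + t *\<^sub>R (z - q) \<in> K"
    using convexD[OF assms(2) qK z, of "1 - t" t] t by (simp add: algebra_simps)
   then have "(norm (x - q))^2 <= (norm (x - (q + t *\<^sub>R (z - q))))^2" using dle qd order_trans by blast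
   also have "... = (norm (x - q))^2 - t * (2 * ((x - q) \<bullet> (z - q))) + t * (t * (norm (z - q))^2)"
    by (simp add: power2_norm_eq_inner algebra_simps inner_commute)
   finally have "t * (2 * ((x - q) \<bullet> (z - q))) <= t * (t * (norm (z - q))^2)" by simp
   then show ?thesis using t by simp
  qed
  have "2 * ((x - q) \<bullet> (z - q)) <= 0"
  proof (rule tendsto_lowerbound[of "%t. t * (norm (z - q))^2" _ "at_right 0"])
   show "((%t. t * (norm (z - q))^2) \<longlongrightarrow> 0) (at_right 0)" by (auto intro!: tendsto_eq_intros)
   show "\<forall>\<^sub>F t in at_right 0. 2 * ((x - q) \<bullet> (z - q)) <= t * (norm (z - q))^2"
    by (rule eventually_mono[OF eventually_at_right_real[of 0 1]]) (auto intro: b)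
  qed auto
  then show "(x - q) \<bullet> (z - q) <= 0" by simp
 qed (rule qK)
qed

text \<open>For a small step \<open>t\<close>, \<open>u \<mapsto> P (u - t T u)\<close> with \<open>P\<close> the projection onto \<open>K\<close> is a contraction.\<close>

theorem variational_inequality_strongly_monotone:
 fixes T :: "'a::{real_inner,complete_space} => 'a"
 assumes K: "closed K" "convex K" "K \<noteq> {}"
  and lam: "\<mu> > 0"
  and lip: "!!u v. u \<in> K ==> v \<in> K ==> norm (T u - T v) <= C * norm (u - v)"
  and mono: "!!u v. u \<in> K ==> v \<in> K ==> \<mu> * (norm (u - v))^2 <= (T u - T v) \<bullet> (u - v)"
 shows "\<exists>u\<in>K. \<forall>z\<in>K. 0 <= T u \<bullet> (z - u)"
proof -
 \<comment> \<open>Enlarging the Lipschitz constant to at least \<open>\<mu>\<close> makes it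
   positive and \<open>1 - \<mu>^2 / D^2\<close> nonnegative.\<close>
 define D where "D = max C \<mu>"
 have D: "D > 0" "\<mu> <= D" "C <= D" using lam by (auto simp: D_def)
 obtain P where P: "!!x. P x \<in> K" "!!x z. z \<in> K ==> (x - P x) \<bullet> (z - P x) <= 0"
  using closed_convex_projection[OF K] by metis
 have nonexp: "norm (P x - P y) <= norm (x - y)" for x y
 proof -
  have "(norm (P x - P y))^2 = (x - y) \<bullet> (P x - P y) + (x - P x) \<bullet> (P y - P x) + (y - P y) \<bullet> (P x - P y)"
   by (simp add: power2_norm_eq_inner algebra_simps inner_commute)
  also have "... <= (x - y) \<bullet> (P x - P y)" using P(2)[OF P(1), of x y] P(2)[OF P(1), of y x] by linarith
  also have "... <= norm (x - y) * norm (P x - P y)" by (rule norm_cauchy_schwarz)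
  finally have "norm (P x - P y) * norm (P x - P y) <= norm (x - y) * norm (P x - P y)"
   by (simp add: power2_eq_square)
  then show ?thesis by (cases "P x = P y") auto
 qed
 \<comment> \<open>This step length minimises \<open>1 - 2 * t * \<mu> + t^2 * D^2\<close>, the
   bound for the squared contraction factor; the minimum is \<open>c^2\<close> below.\<close>
 define t where "t = \<mu> / D^2"
 have t: "t > 0" using lam D by (simp add: t_def)
 define c where "c = sqrt (1 - \<mu>^2 / D^2)"
 have "\<mu>^2 <= D^2" using D lam by (intro power_mono) auto
 then have r1: "0 <= 1 - \<mu>^2 / D^2" "1 - \<mu>^2 / D^2 < 1" using D lam by (auto simp: field_simps)
 then have c: "0 <= c" "c < 1" "c^2 = 1 - \<mu>^2 / D^2" by (auto simp: c_def)
 define G where "G u = P (u - t *\<^sub>R T u)" for u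
 have "\<exists>!u. u \<in> K \<and> G u = u"
 proof (rule Banach_fix)
  show "complete K" using K(1) by (simp add: complete_eq_closed)
  show "G ` K \<subseteq> K" using P(1) by (auto simp: G_def)
  fix u v assume uv: "u \<in> K" "v \<in> K"
  have "(norm ((u - t *\<^sub>R T u) - (v - t *\<^sub>R T v)))^2 =
    (norm (u - v))^2 - 2 * t * ((T u - T v) \<bullet> (u - v)) + (t * t) * (norm (T u - T v))^2"
   by (simp add: power2_norm_eq_inner algebra_simps inner_commute)
  also have "... <= (norm (u - v))^2 - 2 * t * (\<mu> * (norm (u - v))^2) + (t * t) * (D * norm (u - v))^2"
  proof -
   have "norm (T u - T v) <= D * norm (u - v)"
    using lip[OF uv] D(3) by (meson mult_right_mono norm_ge_zero order_trans)
   then have "(norm (T u - T v))^2 <= (D * norm (u - v))^2" by (intro power_mono) auto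
   then show ?thesis using mono[OF uv] t by (intro add_mono diff_mono mult_left_mono) auto
  qed
  also have "... = (1 - 2 * t * \<mu> + t^2 * D^2) * (norm (u - v))^2" by (simp add: algebra_simps power_mult_distrib power2_eq_square)
  also have "1 - 2 * t * \<mu> + t^2 * D^2 = c^2"
   unfolding c(3) using D(1) by (simp add: t_def field_simps power2_eq_square)
  finally have "(norm ((u - t *\<^sub>R T u) - (v - t *\<^sub>R T v)))^2 <= (c * norm (u - v))^2"
   by (simp add: power_mult_distrib)
  then have "norm ((u - t *\<^sub>R T u) - (v - t *\<^sub>R T v)) <= c * norm (u - v)"
   by (rule power2_le_imp_le) (intro mult_nonneg_nonneg c(1) norm_ge_zero)
  then show "dist (G u) (G v) <= c * dist u v"
   unfolding dist_norm G_def by (rule order_trans[OF nonexp])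
 qed (fact K(3) c(1) c(2))+
 then obtain u where u: "u \<in> K" "G u = u" by blast
 \<comment> \<open>At the fixed point \<open>u\<close> is the projection of
   \<open>u - t *\<^sub>R T u\<close>, whose characterisation is the claim multiplied by
   \<open>- t\<close>.\<close>
 have "0 <= T u \<bullet> (z - u)" if "z \<in> K" for z
  using P(2)[OF that, of "u - t *\<^sub>R T u"] u(2) t by (simp add: G_def zero_le_mult_iff)
 with u(1) show ?thesis by blast
qed

section \<open>Smooth functions\<close>

definition grad :: "(real^'n::finite => real) => real^'n => real^'n" where
 "grad \<phi> x = (\<chi> i. partial_deriv i \<phi> x)"

definition smooth :: "(real^'n::finite => real) => bool" where
 "smooth \<phi> \<longleftrightarrow> (\<forall>k. C_k k \<phi>)"

lemma partial_deriv_eqI: "(\<phi> has_derivative D) (at x) ==> partial_deriv i \<phi> x = D (axis i 1)"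
 unfolding partial_deriv_def using frechet_derivative_at by metis

lemma has_derivative_grad:
 assumes "\<phi> differentiable (at x)"
 shows "(\<phi> has_derivative (%h. grad \<phi> x \<bullet> h)) (at x)"
proof -
 have d: "(\<phi> has_derivative frechet_derivative \<phi> (at x)) (at x)"
  using assms by (simp add: frechet_derivative_works)
 then have lin: "linear (frechet_derivative \<phi> (at x))" by (rule has_derivative_linear)
 have "frechet_derivative \<phi> (at x) h = grad \<phi> x \<bullet> h" for h
 proof -
  have "frechet_derivative \<phi> (at x) h = frechet_derivative \<phi> (at x) (\<Sum>i\<in>UNIV. h $ i *\<^sub>R axis i 1)"
   using basis_expansion[of h] by (simp add: scalar_mult_eq_scaleR)
  also have "... = (\<Sum>i\<in>UNIV. h $ i * frechet_derivative \<phi> (at x) (axis i 1))"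
   by (simp add: linear_sum[OF lin] linear_scale[OF lin])
  finally show ?thesis by (simp add: grad_def partial_deriv_def inner_vec_def mult.commute)
 qed
 then have "frechet_derivative \<phi> (at x) = (%h. grad \<phi> x \<bullet> h)" by blast
 with d show ?thesis by simp
qed

lemma grad_eqI: "(\<phi> has_derivative (%h. v \<bullet> h)) (at x) ==> grad \<phi> x = v"
 by (simp add: grad_def vec_eq_iff partial_deriv_eqI inner_axis)

lemma C_k_continuous: "C_k k \<phi> ==> continuous_on UNIV \<phi>"
 by (cases k) (auto intro!: differentiable_imp_continuous_on simp: differentiable_on_def
   intro: differentiable_at_withinI)

lemma C_k_Suc_D: "C_k (Suc k) \<phi> ==> C_k k \<phi>"
proof (induction k arbitrary: \<phi>)
 case 0
 then show ?case using C_k_continuous[of "Suc 0" \<phi>] by simp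
next
 case (Suc k)
 have "\<phi> differentiable at x" for x using Suc.prems by (simp only: C_k.simps)
 moreover have "C_k k (partial_deriv i \<phi>)" for i
  by (rule Suc.IH, use Suc.prems in \<open>unfold C_k.simps(2)[of "Suc k"]\<close>) blast
 ultimately show ?case by simp
qed

lemma partial_deriv_const: "partial_deriv i (%x. c) = (%x. 0)"
 by (rule ext, rule partial_deriv_eqI[THEN trans, OF has_derivative_const]) simp

lemma C_k_const: "C_k k (%x. c)"
 by (induction k arbitrary: c) (auto simp: partial_deriv_const)

lemma partial_deriv_coord: "partial_deriv i (%x. x $ j) = (%x. axis i 1 $ j)"
 by (rule ext, rule partial_deriv_eqI) (intro bounded_linear_imp_has_derivative bounded_linear_vec_nth)

lemma C_k_coord: "C_k k (%x. x $ j)"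
proof (cases k)
 case 0 then show ?thesis by (auto intro: continuous_intros)
next
 case (Suc l)
 have "(%x::real^'a. x $ j) differentiable at x" for x
  using bounded_linear_imp_has_derivative[OF bounded_linear_vec_nth] by (auto simp: differentiable_def)
 then show ?thesis using Suc by (simp add: partial_deriv_coord C_k_const)
qed

lemma partial_deriv_add:
 assumes "\<phi> differentiable (at x)" "\<psi> differentiable (at x)"
 shows "partial_deriv i (%x. \<phi> x + \<psi> x) x = partial_deriv i \<phi> x + partial_deriv i \<psi> x"
 using partial_deriv_eqI[OF has_derivative_add[OF has_derivative_grad[OF assms(1)] has_derivative_grad[OF assms(2)]], of i]
 by (simp add: grad_def inner_axis)

lemma partial_deriv_mult:
 assumes "\<phi> differentiable (at x)" "\<psi> differentiable (at x)"
 shows "partial_deriv i (%x. \<phi> x * \<psi> x) x = \<phi> x * partial_deriv i \<psi> x + partial_deriv i \<phi> x * \<psi> x"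
 using partial_deriv_eqI[OF has_derivative_mult[OF has_derivative_grad[OF assms(1)] has_derivative_grad[OF assms(2)]], of i]
 by (simp add: grad_def inner_axis)

lemma C_k_add: "C_k k \<phi> ==> C_k k \<psi> ==> C_k k (%x. \<phi> x + \<psi> x)"
proof (induction k arbitrary: \<phi> \<psi>)
 case 0 then show ?case by (auto intro: continuous_intros)
next
 case (Suc k)
 then have "partial_deriv i (%x. \<phi> x + \<psi> x) = (%x. partial_deriv i \<phi> x + partial_deriv i \<psi> x)" for i
  by (auto simp: partial_deriv_add)
 then show ?case using Suc by (auto intro: differentiable_add)
qed

lemma C_k_mult: "C_k k \<phi> ==> C_k k \<psi> ==> C_k k (%x. \<phi> x * \<psi> x)"
proof (induction k arbitrary: \<phi> \<psi>)
 case 0 then show ?case by (auto intro: continuous_intros)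
next
 case (Suc k)
 have lo: "C_k k \<phi>" "C_k k \<psi>" using Suc.prems C_k_Suc_D by blast+
 have "partial_deriv i (%x. \<phi> x * \<psi> x) = (%x. \<phi> x * partial_deriv i \<psi> x + partial_deriv i \<phi> x * \<psi> x)" for i
  using Suc.prems by (auto simp: partial_deriv_mult)
 moreover have "C_k k (%x. \<phi> x * partial_deriv i \<psi> x + partial_deriv i \<phi> x * \<psi> x)" for i
  using Suc.prems by (intro C_k_add Suc.IH lo) auto
 ultimately show ?case using Suc.prems by (auto intro: differentiable_mult)
qed

lemma has_derivative_comp1:
 assumes "\<phi> differentiable (at x)" "(G has_real_derivative G') (at (\<phi> x))"
 shows "((%x. G (\<phi> x)) has_derivative (%h. (G' *\<^sub>R grad \<phi> x) \<bullet> h)) (at x)"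
 using has_derivative_compose[OF has_derivative_grad[OF assms(1)], of G "(*) G'"] assms(2)
 by (simp add: has_field_derivative_def)

text \<open>Taking the whole sequence \<open>D\<close> of successive derivatives makes the chain
  rule an induction: a partial derivative of the composite is \<open>D (Suc n)\<close> of
  \<open>\<phi>\<close> times a partial derivative of \<open>\<phi>\<close>, a product of two
  functions one class lower.\<close>

lemma C_k_comp:
 assumes D: "!!n t. (D n has_real_derivative D (Suc n) t) (at t)"
 shows "C_k k \<phi> ==> C_k k (%x. D n (\<phi> x))"
proof (induction k arbitrary: \<phi> n)
 case 0
 have "continuous_on UNIV (D n)" using D DERIV_isCont continuous_at_imp_continuous_on by blast
 from continuous_on_compose2[OF this] 0 show ?case by auto
next
 case (Suc k)
 have hd: "((%x. D n (\<phi> x)) has_derivative (%h. (D (Suc n) (\<phi> x) *\<^sub>R grad \<phi> x) \<bullet> h)) (at x)" for x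
  using Suc.prems by (intro has_derivative_comp1 D) auto
 have "partial_deriv i (%x. D n (\<phi> x)) = (%x. D (Suc n) (\<phi> x) * partial_deriv i \<phi> x)" for i
  by (rule ext, subst partial_deriv_eqI[OF hd]) (simp add: grad_def inner_axis)
 moreover have "C_k k (%x. D (Suc n) (\<phi> x) * partial_deriv i \<phi> x)" for i
  using Suc.prems by (intro C_k_mult Suc.IH C_k_Suc_D[OF Suc.prems]) auto
 ultimately show ?case using hd by (auto simp: differentiable_def)
qed

lemma C_k_inverse:
 assumes nz: "!!x. \<phi> x \<noteq> 0"
 shows "C_k k \<phi> ==> C_k k (%x. inverse (\<phi> x))"
proof (induction k)
 case 0 then show ?case using nz by (auto intro: continuous_intros)
next
 case (Suc k)
 have inv: "C_k k (%x. inverse (\<phi> x))" by (rule Suc.IH[OF C_k_Suc_D[OF Suc.prems]])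
 have hd: "((%x. inverse (\<phi> x)) has_derivative (%h. ((- (inverse (\<phi> x) * inverse (\<phi> x))) *\<^sub>R grad \<phi> x) \<bullet> h)) (at x)" for x
  using Suc.prems nz by (intro has_derivative_comp1) (auto intro!: derivative_eq_intros)
 have "partial_deriv i (%x. inverse (\<phi> x)) = (%x. -1 * ((inverse (\<phi> x) * inverse (\<phi> x)) * partial_deriv i \<phi> x))" for i
  by (rule ext, subst partial_deriv_eqI[OF hd]) (simp add: grad_def inner_axis)
 moreover have "C_k k (%x. -1 * ((inverse (\<phi> x) * inverse (\<phi> x)) * partial_deriv i \<phi> x))" for i
  using Suc.prems by (intro C_k_mult C_k_const inv) auto
 ultimately show ?case using hd by (auto simp: differentiable_def)
qed

lemma smooth_const: "smooth (%x. c)"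
 and smooth_coord: "smooth (%x. x $ j)"
 and smooth_add: "smooth \<phi> ==> smooth \<psi> ==> smooth (%x. \<phi> x + \<psi> x)"
 and smooth_mult: "smooth \<phi> ==> smooth \<psi> ==> smooth (%x. \<phi> x * \<psi> x)"
 and smooth_inverse: "(!!x. \<phi> x \<noteq> 0) ==> smooth \<phi> ==> smooth (%x. inverse (\<phi> x))"
 by (auto simp: smooth_def intro: C_k_const C_k_coord C_k_add C_k_mult C_k_inverse)

lemma smooth_comp:
 "(!!n t. (D n has_real_derivative D (Suc n) t) (at t)) ==> smooth \<phi> ==> smooth (%x. D n (\<phi> x))"
 by (auto simp: smooth_def intro: C_k_comp)

lemma smooth_scale: "smooth \<phi> ==> smooth (%x. c * \<phi> x)"
 by (intro smooth_mult smooth_const)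

lemma smooth_diff: "smooth \<phi> ==> smooth \<psi> ==> smooth (%x. \<phi> x - \<psi> x)"
 using smooth_add[of \<phi> "%x. -1 * \<psi> x"] smooth_scale[of \<psi> "-1"] by simp

lemma smooth_sum: "(!!i. i \<in> I ==> smooth (\<phi> i)) ==> smooth (%x. \<Sum>i\<in>I. \<phi> i x)"
 by (induction I rule: infinite_finite_induct) (auto intro: smooth_const smooth_add)

lemma smooth_differentiable: "smooth \<phi> ==> \<phi> differentiable (at x)"
 unfolding smooth_def by (metis C_k.simps(2))

lemma smooth_partial: "smooth \<phi> ==> smooth (partial_deriv i \<phi>)"
 unfolding smooth_def by (metis C_k.simps(2))

lemma smooth_continuous: "smooth \<phi> ==> continuous_on UNIV \<phi>"
 unfolding smooth_def using C_k_continuous by blast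

lemma smooth_has_derivative: "smooth \<phi> ==> (\<phi> has_derivative (%h. grad \<phi> x \<bullet> h)) (at x)"
 by (intro has_derivative_grad smooth_differentiable)

lemma smooth_sqdist: "smooth (%x. (norm (x - c))^2)"
proof -
 have "smooth (%x. \<Sum>i\<in>UNIV. (x $ i - c $ i) * (x $ i - c $ i))"
  by (intro smooth_sum smooth_mult smooth_diff smooth_coord smooth_const)
 moreover have "(%x. (norm (x - c))^2) = (%x. \<Sum>i\<in>UNIV. (x $ i - c $ i) * (x $ i - c $ i))"
  by (auto simp: power2_norm_eq_inner inner_vec_def)
 ultimately show ?thesis by simp
qed

text \<open>The functions \<open>p (1/t) exp (-1/t)\<close>, extended by zero to \<open>t <= 0\<close>, are closed under
 differentiation.\<close>

definition expfun :: "real poly => real => real" where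
 "expfun p t = (if t > 0 then poly p (1/t) * exp (- (1/t)) else 0)"

lemma poly_exp_tendsto_0: "((%s. poly p s * exp (- s)) \<longlongrightarrow> (0::real)) at_top"
proof -
 have "((%s. \<Sum>i\<le>degree p. coeff p i * (s ^ i / exp s)) \<longlongrightarrow> (\<Sum>i\<le>degree p. coeff p i * 0)) at_top"
  by (intro tendsto_sum tendsto_mult tendsto_const tendsto_power_div_exp_0)
 then show ?thesis
  by (simp add: poly_altdef exp_minus divide_inverse sum_distrib_right mult.assoc)
qed

text \<open>With \<open>s = 1/t\<close> one has ds/dt = - s^2, so differentiating
  \<open>p(s) exp(-s)\<close> produces the polynomial s^2 (p - p'). At \<open>t = 0\<close> the
  right difference quotient is again of the form q(s) exp(-s), now with q = s p, and tends to
  0.\<close>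

lemma expfun_deriv: "(expfun p has_real_derivative expfun ([:0,0,1:] * (p - pderiv p)) t) (at t)"
proof (cases "t = 0")
 case False
 show ?thesis
 proof (cases "t > 0")
  case True
  have 1: "((%t. 1/t) has_real_derivative - (1/t^2)) (at t)"
   using True by (auto intro!: derivative_eq_intros simp: power2_eq_square)
  have "((%t. poly p (1/t) * exp (- (1/t))) has_real_derivative
    expfun ([:0,0,1:] * (p - pderiv p)) t) (at t)"
   by (rule DERIV_cong[OF DERIV_mult[OF DERIV_chain2[OF poly_DERIV 1] DERIV_chain2[OF DERIV_exp DERIV_minus[OF 1]]]])
    (use True in \<open>simp add: expfun_def power2_eq_square algebra_simps\<close>)
  then show ?thesis
  proof (rule DERIV_cong_ev[THEN iffD1, rotated -1, OF _ refl _ refl])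
   show "\<forall>\<^sub>F x in nhds t. poly p (1 / x) * exp (- (1 / x)) = expfun p x"
    using eventually_nhds_in_open[of "{0<..}" t] True by (auto elim!: eventually_mono simp: expfun_def)
  qed
 next
  case neg: False
  have "((%t. 0) has_real_derivative expfun ([:0,0,1:] * (p - pderiv p)) t) (at t)"
   using neg by (simp add: expfun_def)
  then show ?thesis
  proof (rule DERIV_cong_ev[THEN iffD1, rotated -1, OF _ refl _ refl])
   show "\<forall>\<^sub>F x in nhds t. 0 = expfun p x"
    using eventually_nhds_in_open[of "{..<0}" t] neg False by (auto elim!: eventually_mono simp: expfun_def)
  qed
 qed
next
 case True
 have R: "((%t. (expfun p t - expfun p 0) / (t - 0)) \<longlongrightarrow> 0) (at_right 0)"
 proof -
  have "((%t. poly ([:0,1:] * p) (inverse t) * exp (- inverse t)) \<longlongrightarrow> (0::real)) (at_right 0)"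
   by (rule filterlim_compose[OF poly_exp_tendsto_0 filterlim_inverse_at_top_right])
  then show ?thesis
   by (rule Lim_transform_eventually, intro eventually_mono[OF eventually_at_right_real[of 0 1]])
    (auto simp: expfun_def field_simps)
 qed
 have L: "((%t. (expfun p t - expfun p 0) / (t - 0)) \<longlongrightarrow> 0) (at_left 0)"
  by (rule Lim_transform_eventually[OF tendsto_const],
    intro eventually_mono[OF eventually_at_left_real[of "-1" 0]]) (auto simp: expfun_def)
 show ?thesis
  using filterlim_split_at[OF L R] True by (simp add: has_field_derivative_iff expfun_def)
qed

primrec exppoly :: "real poly => nat => real poly" where
 "exppoly p 0 = p"
| "exppoly p (Suc n) = [:0,0,1:] * (exppoly p n - pderiv (exppoly p n))"

definition bump :: "real => real" where "bump = expfun 1"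
definition bump' :: "real => real" where "bump' = expfun [:0,0,1:]"

lemma bump_deriv: "(bump has_real_derivative bump' t) (at t)"
 using expfun_deriv[of 1 t] by (simp add: bump_def bump'_def pderiv_1)

lemma smooth_bump: "smooth \<phi> ==> smooth (%x. bump (\<phi> x))"
 using smooth_comp[of "%n. expfun (exppoly 1 n)" \<phi> 0] expfun_deriv by (simp add: bump_def)

lemma bump_nonneg: "0 <= bump t" and bump_le_1: "bump t <= 1" and bump_pos: "0 < bump t \<longleftrightarrow> 0 < t"
 and bump'_0: "t <= 0 ==> bump' t = 0" and bump_0: "t <= 0 ==> bump t = 0"
 by (auto simp: bump_def bump'_def expfun_def)

lemma bump_mono: "s <= t ==> bump s <= bump t"
 by (auto simp: bump_def expfun_def field_simps)

text \<open>For positive \<open>t\<close> the value is s^2 exp(-s) with s = 1/t, and squaring s/2 <=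
  exp(s/2) bounds it by 4.\<close>

lemma bump'_bounds: "0 <= bump' t" "bump' t <= 4"
proof -
 show "0 <= bump' t" by (auto simp: bump'_def expfun_def)
 have "s^2 * exp (- s) <= 4" if "s > 0" for s :: real
 proof -
  have "s / 2 <= exp (s / 2)" using exp_ge_add_one_self[of "s/2"] by linarith
  then have "(s / 2)^2 <= (exp (s / 2))^2" using that by (intro power_mono) auto
  also have "... = exp s" by (simp add: power2_eq_square mult_exp_exp)
  finally show ?thesis by (simp add: exp_minus field_simps power2_eq_square)
 qed
 from this[of "1/t"] show "bump' t <= 4" by (auto simp: bump'_def expfun_def power2_eq_square)
qed

text \<open>The squared distance from \<open>c\<close>, which is smooth also at \<open>c\<close>, is
  rescaled to be 1 at radius \<open>\<rho>\<close> and 0 at radius \<open>r\<close> and then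
  composed with a smooth step. \<open>K\<close> is fixed before the centre and the radii, as the
  iterations over shrinking balls require.\<close>

lemma cutoff_exists:
 "\<exists>K>0. \<forall>(c::real^'n::finite) \<rho> r. 0 < \<rho> --> \<rho> < r --> (\<exists>\<eta>. smooth \<eta> \<and> (\<forall>x. 0 <= \<eta> x \<and> \<eta> x <= 1) \<and>
  (\<forall>x\<in>cball c \<rho>. \<eta> x = 1) \<and> (\<forall>x. x \<notin> ball c r --> \<eta> x = 0) \<and> (\<forall>x. norm (grad \<eta> x) <= K / (r - \<rho>)))"
proof -
 \<comment> \<open>One of \<open>s\<close> and \<open>1 - s\<close> is at least 1/2, so
   \<open>b\<close> bounds the denominator of the smooth step \<open>\<theta>\<close> from
   below.\<close>
 define b where "b = bump (1/2)"
 have b: "b > 0" by (simp add: b_def bump_pos)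
 have den: "b <= bump s + bump (1 - s)" for s
  using bump_mono[of "1/2" s] bump_mono[of "1/2" "1 - s"] bump_nonneg[of s] bump_nonneg[of "1 - s"]
  by (cases "s \<ge> 1/2") (auto simp: b_def)
 define \<theta> where "\<theta> s = bump s * inverse (bump s + bump (1 - s))" for s
 define \<theta>' where "\<theta>' s = (bump' s * bump (1 - s) + bump s * bump' (1 - s)) / (bump s + bump (1 - s))^2" for s
 have th: "(\<theta> has_real_derivative \<theta>' s) (at s)" for s
 proof -
  have "bump s + bump (1 - s) \<noteq> 0" using den[of s] b by linarith
  then show ?thesis unfolding \<theta>_def \<theta>'_def
   by (auto intro!: derivative_eq_intros bump_deriv DERIV_chain2[OF bump_deriv]
     simp: field_simps power2_eq_square)
 qed
 define K where "K = 16 / b^2"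
 have th': "\<bar>\<theta>' s\<bar> <= K / 2" for s
 proof -
  have "b^2 <= (bump s + bump (1 - s))^2" using den b by (intro power_mono) auto
  moreover have "bump' s * bump (1 - s) + bump s * bump' (1 - s) <= 4 * 1 + 1 * 4"
   using bump'_bounds bump_nonneg bump_le_1 by (intro add_mono mult_mono) auto
  moreover have "0 <= bump' s * bump (1 - s) + bump s * bump' (1 - s)"
   using bump'_bounds bump_nonneg by auto
  ultimately have "(bump' s * bump (1 - s) + bump s * bump' (1 - s)) / (bump s + bump (1 - s))^2 <= 8 / b^2"
   using b by (intro frac_le) auto
  then show ?thesis using \<open>0 <= bump' s * bump (1 - s) + bump s * bump' (1 - s)\<close>
   unfolding \<theta>'_def K_def by simp
 qed
 have "\<exists>\<eta>. smooth \<eta> \<and> (\<forall>x. 0 <= \<eta> x \<and> \<eta> x <= 1) \<and>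
  (\<forall>x\<in>cball c \<rho>. \<eta> x = 1) \<and> (\<forall>x. x \<notin> ball c r --> \<eta> x = 0) \<and> (\<forall>x. norm (grad \<eta> x) <= K / (r - \<rho>))"
  if r: "0 < \<rho>" "\<rho> < r" for c :: "real^'n" and \<rho> r
 proof -
  define d where "d = r^2 - \<rho>^2"
  have "\<rho>^2 < r^2" using r by (intro power_strict_mono) auto
  then have d: "d > 0" "d = (r - \<rho>) * (r + \<rho>)"
   unfolding d_def by (simp, simp add: algebra_simps power2_eq_square)
  define s where "s x = (r^2 - (norm (x - c))^2) * inverse d" for x :: "real^'n"
  have ss: "smooth s" unfolding s_def by (intro smooth_mult smooth_diff smooth_const smooth_sqdist)
  have gs: "grad s x = (- 2 / d) *\<^sub>R (x - c)" for x
   by (rule grad_eqI, unfold s_def power2_norm_eq_inner)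
    (auto intro!: derivative_eq_intros simp: inner_commute algebra_simps divide_inverse)
  define \<eta> where "\<eta> x = \<theta> (s x)" for x
  have sm: "smooth \<eta>" unfolding \<eta>_def \<theta>_def
  proof (intro smooth_mult smooth_inverse smooth_add smooth_bump smooth_diff smooth_const ss)
   show "bump (s x) + bump (1 - s x) \<noteq> 0" for x using den[of "s x"] b by linarith
  qed
  have ge: "grad \<eta> x = \<theta>' (s x) *\<^sub>R grad s x" for x
   unfolding \<eta>_def by (rule grad_eqI, rule has_derivative_comp1[OF smooth_differentiable[OF ss] th])
  have s1: "s x \<ge> 1" if "x \<in> cball c \<rho>" for x
  proof -
   have "(norm (x - c))^2 <= \<rho>^2" using that r by (intro power_mono) (auto simp: dist_norm norm_minus_commute)
   then show ?thesis using d(1) by (simp add: s_def d_def field_simps)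
  qed
  have s0: "s x <= 0" if "x \<notin> ball c r" for x
  proof -
   have "r^2 <= (norm (x - c))^2" using that r by (intro power_mono) (auto simp: dist_norm norm_minus_commute)
   then show ?thesis using d(1) by (simp add: s_def mult_nonpos_nonneg)
  qed
  have "norm (grad \<eta> x) <= K / (r - \<rho>)" for x
  proof (cases "x \<in> ball c r")
   case False
   then have "\<theta>' (s x) = 0" using s0[OF False] by (simp add: \<theta>'_def bump_0 bump'_0)
   then show ?thesis using r b by (simp add: ge K_def)
  next
   case True
   then have "norm (grad \<eta> x) <= K / 2 * (2 / d * r)"
    using d(1) r b unfolding ge gs norm_scaleR
    by (intro mult_mono th') (auto simp: dist_norm norm_minus_commute K_def)
   also have "... = K / (r - \<rho>) * (r / (r + \<rho>))"
    using r unfolding d(2) by simp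
   also have "... <= K / (r - \<rho>) * 1"
    using r b by (intro mult_left_mono) (auto simp: K_def)
   also have "... = K / (r - \<rho>)" by simp
   finally show ?thesis .
  qed
  moreover have "0 <= \<eta> x" "\<eta> x <= 1" for x
   using den[of "s x"] b bump_nonneg[of "s x"] bump_nonneg[of "1 - s x"]
   by (auto simp: \<eta>_def \<theta>_def field_simps)
  moreover have "\<eta> x = 1" if "x \<in> cball c \<rho>" for x
   using s1[OF that] den[of "s x"] b by (simp add: \<eta>_def \<theta>_def bump_0)
  moreover have "\<eta> x = 0" if "x \<notin> ball c r" for x
   using s0[OF that] by (simp add: \<eta>_def \<theta>_def bump_0)
  ultimately show ?thesis using sm by blast
 qed
 moreover have "K > 0" using b by (simp add: K_def)
 ultimately show ?thesis by blast
qed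

section \<open>Test functions\<close>

lemma smooth_measurable [measurable]: "smooth \<phi> ==> \<phi> \<in> borel_measurable borel"
 by (intro borel_measurable_continuous_onI smooth_continuous)

lemma borel_imp_lebesgue: "f \<in> borel_measurable borel ==> f \<in> LM"
 by (rule measurable_completion) simp

lemma test_smooth: "\<phi> \<in> test_functions Om ==> smooth \<phi>"
 by (simp add: test_functions_def smooth_def)

lemma test_functionsI:
 assumes "smooth \<phi>" "compact K" "K \<subseteq> Om" "!!x. \<phi> x \<noteq> 0 ==> x \<in> K"
 shows "\<phi> \<in> test_functions Om"
proof -
 have "closure {x. \<phi> x \<noteq> 0} \<subseteq> K"
  using assms by (intro closure_minimal compact_imp_closed) auto
 with assms show ?thesis
  using compact_Int_closed[of K "closure {x. \<phi> x \<noteq> 0}"]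
  by (auto simp: test_functions_def smooth_def Int_absorb1)
qed

lemma test_functionsE:
 assumes "\<phi> \<in> test_functions Om"
 obtains K where "compact K" "K \<subseteq> Om" "!!x. x \<notin> K ==> \<phi> x = 0"
proof (rule that)
 show "compact (closure {x. \<phi> x \<noteq> 0})" "closure {x. \<phi> x \<noteq> 0} \<subseteq> Om"
  using assms by (auto simp: test_functions_def)
 show "x \<notin> closure {x. \<phi> x \<noteq> 0} ==> \<phi> x = 0" for x
  using closure_subset[of "{x. \<phi> x \<noteq> 0}"] by blast
qed

lemma test_zero: "(%x. 0) \<in> test_functions Om"
 by (rule test_functionsI[of _ "{}"]) (auto intro: smooth_const)

lemma test_add:
 assumes "\<phi> \<in> test_functions Om" "\<psi> \<in> test_functions Om"
 shows "(%x. \<phi> x + \<psi> x) \<in> test_functions Om"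
proof -
 obtain K L where "compact K" "K \<subseteq> Om" "!!x. x \<notin> K ==> \<phi> x = 0" "compact L" "L \<subseteq> Om" "!!x. x \<notin> L ==> \<psi> x = 0"
  using assms test_functionsE by metis
 then show ?thesis
  using assms by (intro test_functionsI[of _ "K \<union> L"] smooth_add) (auto dest: test_smooth intro: ccontr)
qed

lemma test_mult:
 assumes "\<phi> \<in> test_functions Om" "smooth \<psi>"
 shows "(%x. \<psi> x * \<phi> x) \<in> test_functions Om"
proof -
 obtain K where "compact K" "K \<subseteq> Om" "!!x. x \<notin> K ==> \<phi> x = 0"
  using assms test_functionsE by metis
 then show ?thesis
  using assms by (intro test_functionsI[of _ K] smooth_mult) (auto dest: test_smooth intro: ccontr)
qed

lemma test_scale: "\<phi> \<in> test_functions Om ==> (%x. c * \<phi> x) \<in> test_functions Om"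
 by (intro test_mult smooth_const)

lemma test_sum: "(!!i. i \<in> I ==> \<phi> i \<in> test_functions Om) ==> (%x. \<Sum>i\<in>I. \<phi> i x) \<in> test_functions Om"
 by (induction I rule: infinite_finite_induct) (auto intro: test_zero test_add)

lemma test_comp:
 assumes "\<phi> \<in> test_functions Om" "!!n t. (D n has_real_derivative D (Suc n) t) (at t)" "D 0 0 = 0"
 shows "(%x. D 0 (\<phi> x)) \<in> test_functions Om"
proof -
 obtain K where "compact K" "K \<subseteq> Om" "!!x. x \<notin> K ==> \<phi> x = 0"
  using assms test_functionsE by metis
 then show ?thesis
  using assms by (intro test_functionsI[of _ K] smooth_comp[of D _ 0]) (auto dest: test_smooth intro: ccontr)
qed

lemma test_partial:
 assumes "\<phi> \<in> test_functions Om"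
 shows "partial_deriv i \<phi> \<in> test_functions Om"
proof -
 obtain K where K: "compact K" "K \<subseteq> Om" "!!x. x \<notin> K ==> \<phi> x = 0"
  using assms test_functionsE by metis
 have "partial_deriv i \<phi> x = 0" if "x \<notin> K" for x
 proof -
  have "(\<phi> has_derivative (%h. 0)) (at x)"
   by (rule has_derivative_transform_within_open[OF has_derivative_const, of "- K"])
    (use K that compact_imp_closed in auto)
  then show ?thesis by (simp add: partial_deriv_eqI)
 qed
 then show ?thesis
  using K by (intro test_functionsI[of _ K] smooth_partial test_smooth[OF assms]) auto
qed

lemma test_bounded:
 assumes "\<phi> \<in> test_functions Om"
 obtains B where "B > 0" "!!x. \<bar>\<phi> x\<bar> <= B"
proof -
 obtain K where K: "compact K" "!!x. x \<notin> K ==> \<phi> x = 0"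
  using assms test_functionsE by metis
 have "bounded (\<phi> ` K)"
  using K(1) smooth_continuous[OF test_smooth[OF assms]]
  by (intro compact_imp_bounded compact_continuous_image) (auto intro: continuous_on_subset)
 then obtain B where "B > 0" "!!x. x \<in> K ==> \<bar>\<phi> x\<bar> <= B" unfolding bounded_pos by auto
 with K(2) have "\<bar>\<phi> x\<bar> <= B" for x by (cases "x \<in> K") auto
 with \<open>B > 0\<close> that show thesis by blast
qed

lemma test_measurable: "\<phi> \<in> test_functions Om ==> \<phi> \<in> borel_measurable borel"
 by (intro smooth_measurable test_smooth)

lemma test_integrable:
 assumes "\<phi> \<in> test_functions Om"
 shows "integrable lborel \<phi>"
proof -
 obtain K where K: "compact K" "!!x. x \<notin> K ==> \<phi> x = 0"
  using assms test_functionsE by metis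
 obtain B where B: "B > 0" "!!x. \<bar>\<phi> x\<bar> <= B" using test_bounded[OF assms] by metis
 show ?thesis
 proof (rule Bochner_Integration.integrable_bound)
  show "integrable lborel (%x. B * indicator K x)"
   using emeasure_bounded_finite[OF compact_imp_bounded[OF K(1)]] compact_imp_closed[OF K(1)]
   by (intro integrable_mult_right integrable_real_indicator) auto
  show "AE x in lborel. norm (\<phi> x) <= norm (B * indicator K x)"
   using B K(2) by (auto simp: indicator_def)
 qed (use test_measurable[OF assms] in simp)
qed

lemma test_lebesgue_integral: "\<phi> \<in> test_functions Om ==> (LEB x. \<phi> x) = (LINT x|lborel. \<phi> x)"
 by (intro integral_completion) (simp add: test_measurable)

lemma test_sq_integrable:
 assumes "\<phi> \<in> test_functions Om"
 shows "sq \<phi>"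
 unfolding sq_integrable_def
proof
 show "\<phi> \<in> LM" by (rule borel_imp_lebesgue[OF test_measurable[OF assms]])
 have "(%x. \<phi> x * \<phi> x) \<in> test_functions Om" by (rule test_mult[OF assms test_smooth[OF assms]])
 from test_integrable[OF this] show "integrable lebesgue (%x. (\<phi> x)^2)"
  using test_measurable[OF assms] by (simp add: power2_eq_square integrable_completion)
qed

lemma test_sq_integrable_grad:
 assumes "\<phi> \<in> test_functions Om"
 shows "sq (%x. grad \<phi> x $ i)"
 using test_sq_integrable[OF test_partial[OF assms]] by (simp add: grad_def)

section \<open>Integration by parts for test functions and the fundamental lemma\<close>

lemma lborel_integral_translation:
 fixes f :: "'a::euclidean_space => real"
 assumes "f \<in> borel_measurable borel"
 shows "(LINT x|lborel. f (x + h)) = (LINT x|lborel. f x)"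
proof -
 have "(LINT x|lborel. f x) = (LINT x|distr lborel borel ((+) h). f x)" by (simp add: lborel_distr_plus)
 also have "... = (LINT x|lborel. f (h + x))" using assms by (intro integral_distr) auto
 finally show ?thesis by (simp add: add.commute)
qed

lemma lborel_nn_integral_translation:
 fixes f :: "'a::euclidean_space => ennreal"
 assumes "f \<in> borel_measurable borel"
 shows "(\<integral>\<^sup>+x. f (x + h) \<partial>lborel) = (\<integral>\<^sup>+x. f x \<partial>lborel)"
proof -
 have "(\<integral>\<^sup>+x. f x \<partial>lborel) = (\<integral>\<^sup>+x. f x \<partial>distr lborel borel ((+) h))" by (simp add: lborel_distr_plus)
 also have "... = (\<integral>\<^sup>+x. f (h + x) \<partial>lborel)" using assms by (intro nn_integral_distr) auto
 finally show ?thesis by (simp add: add.commute)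
qed

text \<open>Difference quotients have integral 0 by translation invariance and converge to the
  partial derivative. The mean value theorem bounds them by \<open>B\<close>, and shifts of length
  at most 1 keep them supported in the ball of radius \<open>R + 1\<close>.\<close>

lemma test_integral_partial:
 assumes "\<phi> \<in> test_functions Om"
 shows "(LINT x|lborel. partial_deriv i \<phi> x) = 0"
proof -
 note sm = test_smooth[OF assms]
 have [measurable]: "\<phi> \<in> borel_measurable borel" by (rule test_measurable[OF assms])
 obtain K where K: "compact K" "!!x. x \<notin> K ==> \<phi> x = 0"
  using assms test_functionsE by metis
 obtain B where B: "B > 0" "!!x. \<bar>partial_deriv i \<phi> x\<bar> <= B" using test_bounded[OF test_partial[OF assms, of i]] by metis
 obtain R where R: "R > 0" "!!x. x \<in> K ==> norm x <= R" using compact_imp_bounded[OF K(1)] bounded_pos by metis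
 define e :: "real^'a" where "e = axis i 1"
 define q where "q n x = (\<phi> (x + (1 / real (Suc n)) *\<^sub>R e) - \<phi> x) * real (Suc n)" for n x
 have der: "((%t. \<phi> (x + t *\<^sub>R e)) has_real_derivative partial_deriv i \<phi> (x + t *\<^sub>R e)) (at t)" for x t
 proof -
  have "((%t. \<phi> (x + t *\<^sub>R e)) has_derivative (%h. grad \<phi> (x + t *\<^sub>R e) \<bullet> (h *\<^sub>R e))) (at t)"
   by (rule has_derivative_compose[OF _ smooth_has_derivative[OF sm]]) (auto intro!: derivative_eq_intros)
  then show ?thesis
   by (simp add: has_field_derivative_def e_def grad_def inner_axis mult.commute[of _ "partial_deriv i \<phi> _"])
 qed
 have "(%n. LINT x|lborel. q n x) ----> (LINT x|lborel. partial_deriv i \<phi> x)"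
 proof (rule integral_dominated_convergence[where w="%x. B * indicator (cball 0 (R + 1)) x"])
  show "partial_deriv i \<phi> \<in> borel_measurable lborel" using test_measurable[OF test_partial[OF assms]] by simp
  show "q n \<in> borel_measurable lborel" for n unfolding q_def by measurable
  show "integrable lborel (%x. B * indicator (cball (0::real^'a) (R + 1)) x)"
   by (intro integrable_mult_right integrable_real_indicator) (use emeasure_bounded_finite[OF bounded_cball] in auto)
  show "AE x in lborel. (%n. q n x) ----> partial_deriv i \<phi> x"
  proof (rule AE_I2)
   fix x
   have "((%t. (\<phi> (x + t *\<^sub>R e) - \<phi> x) / t) \<longlongrightarrow> partial_deriv i \<phi> x) (at 0)"
    using der[of x 0] by (simp add: has_field_derivative_iff)
   moreover have "filterlim (%n. inverse (real (Suc n))) (at 0) sequentially"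
    unfolding filterlim_at using LIMSEQ_inverse_real_of_nat by auto
   ultimately have "(%n. (\<phi> (x + inverse (real (Suc n)) *\<^sub>R e) - \<phi> x) / inverse (real (Suc n))) ----> partial_deriv i \<phi> x"
    by (rule filterlim_compose)
   then show "(%n. q n x) ----> partial_deriv i \<phi> x" by (simp add: q_def divide_inverse)
  qed
  show "AE x in lborel. norm (q n x) <= B * indicator (cball 0 (R + 1)) x" for n
  proof (rule AE_I2)
   fix x
   obtain t where "\<phi> (x + (1 / real (Suc n)) *\<^sub>R e) - \<phi> (x + 0 *\<^sub>R e) = (1 / real (Suc n) - 0) * partial_deriv i \<phi> (x + t *\<^sub>R e)"
    using MVT2[of 0 "1 / real (Suc n)" "%t. \<phi> (x + t *\<^sub>R e)", OF _ der] by auto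
   then have "q n x = partial_deriv i \<phi> (x + t *\<^sub>R e)" by (simp add: q_def del: of_nat_Suc)
   then have 1: "norm (q n x) <= B" using B(2) by simp
   show "norm (q n x) <= B * indicator (cball 0 (R + 1)) x"
   proof (cases "x \<in> cball 0 (R + 1)")
    case True then show ?thesis using 1 by simp
   next
    case False
    have "norm ((1 / real (Suc n)) *\<^sub>R e) <= 1" by (simp add: e_def)
    moreover have "norm x - norm ((1 / real (Suc n)) *\<^sub>R e) <= norm (x + (1 / real (Suc n)) *\<^sub>R e)"
     by (rule norm_diff_ineq)
    moreover have "norm x > R + 1" using False by simp
    ultimately have "norm (x + (1 / real (Suc n)) *\<^sub>R e) > R" by linarith
    then have "x + (1 / real (Suc n)) *\<^sub>R e \<notin> K" "x \<notin> K" using R False by fastforce+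
    then show ?thesis using K(2) B(1) by (simp add: q_def)
   qed
  qed
 qed
 moreover have "(LINT x|lborel. q n x) = 0" for n
 proof -
  have i: "integrable lborel (%x. \<phi> (x + h))" for h
  proof -
   have "integrable (distr lborel borel ((+) h)) \<phi>" using test_integrable[OF assms] by (simp add: lborel_distr_plus)
   then show ?thesis by (subst (asm) integrable_distr_eq) (auto simp: add.commute)
  qed
  show ?thesis unfolding q_def using lborel_integral_translation[of \<phi>] i test_integrable[OF assms] by simp
 qed
 ultimately show ?thesis by (simp add: LIMSEQ_const_iff)
qed

lemma test_integral_by_parts:
 assumes "\<phi> \<in> test_functions Om" "\<psi> \<in> test_functions Om'"
 shows "(LEB x. \<phi> x * partial_deriv i \<psi> x) = - (LEB x. partial_deriv i \<phi> x * \<psi> x)"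
proof -
 note s = test_smooth[OF assms(1)] test_smooth[OF assms(2)]
 have 1: "(%x. \<phi> x * partial_deriv i \<psi> x) \<in> test_functions Om'" by (intro test_mult test_partial assms s)
 have 2: "(%x. partial_deriv i \<phi> x * \<psi> x) \<in> test_functions Om'" by (intro test_mult smooth_partial assms s)
 have "(LINT x|lborel. partial_deriv i (%x. \<phi> x * \<psi> x) x) = 0"
  by (rule test_integral_partial[OF test_mult[OF assms(2) s(1)]])
 then have "(LINT x|lborel. \<phi> x * partial_deriv i \<psi> x) + (LINT x|lborel. partial_deriv i \<phi> x * \<psi> x) = 0"
  using test_integrable[OF 1] test_integrable[OF 2]
  by (simp add: partial_deriv_mult[OF smooth_differentiable smooth_differentiable] s)
 then show ?thesis using test_lebesgue_integral[OF 1] test_lebesgue_integral[OF 2] by simp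
qed

text \<open>Countably many balls inside \<open>U\<close> cover it, each carrying a bump. Composing
  growing finite sums of the bumps with 1 - exp(-t) gives test functions below 1 that tend to 1
  exactly where the sums tend to infinity.\<close>

lemma indicator_open_test_limit:
 fixes U :: "(real^'n::finite) set"
 assumes "open U"
 obtains \<phi> where "!!n::nat. \<phi> n \<in> test_functions U" "!!n x. 0 <= \<phi> n x \<and> \<phi> n x <= indicator U x"
  "!!x. (%n. \<phi> n x) ----> indicator U x"
proof -
 have "\<exists>r>0. cball x r \<subseteq> U" if "x \<in> U" for x using assms that open_contains_cball by blast
 then obtain r where r: "!!x. x \<in> U ==> r x > 0" "!!x. x \<in> U ==> cball x (r x) \<subseteq> U" by metis
 obtain F where F: "F \<subseteq> (%x. ball x (r x)) ` U" "countable F" "\<Union>F = \<Union>((%x. ball x (r x)) ` U)"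
  using Lindelof[of "(%x. ball x (r x)) ` U"] by auto
 obtain C where C: "C \<subseteq> U" "countable C" "F = (%x. ball x (r x)) ` C"
  using countable_subset_image[of F] F(1,2) by metis
 define b where "b c x = bump ((r c)^2 - (norm (x - c))^2)" for c x
 have bt: "b c \<in> test_functions U" if "c \<in> U" for c
 proof (rule test_functionsI[of _ "cball c (r c)"])
  show "smooth (b c)" unfolding b_def by (intro smooth_bump smooth_diff smooth_const smooth_sqdist)
  fix x assume "b c x \<noteq> 0"
  then have "(norm (x - c))^2 < (r c)^2" using bump_0[of "(r c)^2 - (norm (x - c))^2"] by (force simp: b_def)
  then have "norm (x - c) < r c" by (rule power_less_imp_less_base) (use r(1)[OF that] in simp)
  then show "x \<in> cball c (r c)" by (simp add: dist_norm norm_minus_commute)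
 qed (use r(2)[OF that] in auto)
 have bn: "0 <= b c x" for c x by (simp add: b_def bump_nonneg)
 have bp: "b c x > 0" if "c \<in> U" "x \<in> ball c (r c)" for c x
 proof -
  have "(norm (x - c))^2 < (r c)^2" using that by (intro power_strict_mono) (auto simp: dist_norm norm_minus_commute)
  then show ?thesis by (simp add: b_def bump_pos)
 qed
 \<comment> \<open>The factor \<open>real n\<close> drives the sums to infinity at each point of
   \<open>U\<close>; the case \<open>C = {}\<close>, in which \<open>from_nat_into\<close> has no
   meaning, arises only for empty \<open>U\<close>.\<close>
 define S where "S n x = (\<Sum>m<n. if C = {} then 0 else real n * b (from_nat_into C m) x)" for n x
 have St: "S n \<in> test_functions U" for n
  unfolding S_def using C(1) from_nat_into[of C]
  by (intro test_sum, cases "C = {}") (auto intro!: test_zero test_scale bt)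
 have Sn: "0 <= S n x" for n x unfolding S_def using bn by (intro sum_nonneg) auto
 \<comment> \<open>The function 1 - exp(-t) together with all its derivatives, in the form asked for
   by \<open>test_comp\<close>.\<close>
 define D where "D n t = (if n = 0 then 1 - exp (- t) else (-1)^(Suc n) * exp (- t))" for n :: nat and t :: real
 have D: "(D n has_real_derivative D (Suc n) t) (at t)" for n t
  unfolding D_def by (cases n) (auto intro!: derivative_eq_intros)
 define \<phi> where "\<phi> n x = D 0 (S n x)" for n x
 have ph: "\<phi> n \<in> test_functions U" for n
  unfolding \<phi>_def by (rule test_comp[where D=D, OF St D]) (simp add: D_def)
 have z: "\<phi> n x = 0" if "x \<notin> U" for n x
  by (rule test_functionsE[OF ph[of n]]) (use that in blast)
 show thesis
 proof
  show "\<phi> n \<in> test_functions U" for n by (rule ph)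
  show "0 <= \<phi> n x \<and> \<phi> n x <= indicator U x" for n x
   using z[of x n] Sn[of n x] by (cases "x \<in> U") (auto simp: \<phi>_def D_def)
  show "(%n. \<phi> n x) ----> indicator U x" for x
  proof (cases "x \<in> U")
   case False then show ?thesis using z by simp
  next
   case True
   have "x \<in> \<Union>F" unfolding F(3) using True r(1)[OF True] by force
   then obtain c where c: "c \<in> C" "x \<in> ball c (r c)" unfolding C(3) by blast
   then obtain m where m: "from_nat_into C m = c" using C(2) from_nat_into_surj by metis
   have ge: "real n * b c x <= S n x" if "n > m" for n
   proof -
    have "real n * b c x = (\<Sum>i\<in>{m}. if C = {} then 0 else real n * b (from_nat_into C i) x)" using m c(1) by auto
    also have "... <= S n x" unfolding S_def using that bn by (intro sum_mono2) auto
    finally show ?thesis .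
   qed
   have bc: "b c x > 0" using c C(1) bp by blast
   have "filterlim (%n. real n * b c x) at_top sequentially"
    using bc by (intro filterlim_at_top_mult_tendsto_pos[OF tendsto_const] filterlim_real_sequentially) simp
   then have "filterlim (%n. S n x) at_top sequentially"
    by (rule filterlim_at_top_mono) (use ge in \<open>auto intro!: eventually_sequentiallyI[of "Suc m"]\<close>)
   then have "(%n. exp (- S n x)) ----> 0"
    by (intro filterlim_compose[OF exp_at_bot] filterlim_uminus_at_bot_at_top[THEN filterlim_compose])
   then have "(%n. 1 - exp (- S n x)) ----> 1 - 0" by (intro tendsto_intros)
   then show ?thesis using True by (simp add: \<phi>_def D_def)
  qed
 qed
qed

text \<open>Cauchy-Schwarz from the nonnegative quadratic form in \<open>s\<close> and
  \<open>t\<close>. It is stated for an arbitrary measure because it is also applied on the real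
  line, along segments.\<close>

lemma abs_integral_mult_le:
 assumes "sq_integrable M g" "sq_integrable M h"
 shows "\<bar>LINT x|M. g x * h x\<bar> <= sqrt (LINT x|M. (g x)^2) * sqrt (LINT x|M. (h x)^2)"
proof -
 define a b c where "a = (LINT x|M. (g x)^2)" and "b = (LINT x|M. g x * h x)" and "c = (LINT x|M. (h x)^2)"
 have i: "integrable M (%x. (g x)^2)" "integrable M (%x. g x * h x)" "integrable M (%x. (h x)^2)"
  using sq_integrable_mult[OF assms] assms by (simp_all add: sq_integrable_def)
 have q: "0 <= s^2 * a + 2 * s * t * b + t^2 * c" for s t
 proof -
  have "0 <= (LINT x|M. (s * g x + t * h x)^2)" by simp
  also have "... = (LINT x|M. s^2 * (g x)^2 + 2 * s * t * (g x * h x) + t^2 * (h x)^2)"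
   by (intro Bochner_Integration.integral_cong) (auto simp: power2_sum power_mult_distrib algebra_simps)
  also have "... = s^2 * a + 2 * s * t * b + t^2 * c" using i by (simp add: a_def b_def c_def)
  finally show ?thesis .
 qed
 have ac: "a \<ge> 0" "c \<ge> 0" by (auto simp: a_def c_def)
 have "b^2 <= a * c"
 proof (cases "a = 0")
  case False
  have "0 <= b^2 * a + 2 * b * (- a) * b + a^2 * c" using q[of b "- a"] by simp
  then have "a * b^2 <= a * (a * c)" by (simp add: power2_eq_square algebra_simps)
  then show ?thesis using ac False by simp
 next
  case True
  have "b = 0"
  proof (rule ccontr)
   assume "b \<noteq> 0"
   then show False using q[of "- (c + 1) / (2 * b)" 1] True by (simp add: field_simps)
  qed
  then show ?thesis using ac by simp
 qed
 then have "\<bar>b\<bar> <= sqrt (a * c)" by (simp add: real_le_rsqrt)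
 then show ?thesis by (simp add: a_def b_def c_def real_sqrt_mult)
qed

text \<open>Orthogonality passes from test functions to indicators of open subsets by
  \<open>indicator_open_test_limit\<close>, then to measurable subsets by outer regularity and
  Cauchy-Schwarz, and finally to the sets where \<open>g\<close> is positive or negative.\<close>

lemma fundamental_lemma:
 fixes g :: "real^'n::finite => real"
 assumes dom: "open Om" "bounded Om" and g: "sq g"
  and z: "!!\<phi>. \<phi> \<in> test_functions Om ==> (LEB x. g x * \<phi> x) = 0"
 shows "AEL x. x \<in> Om --> g x = 0"
proof -
 have [measurable]: "g \<in> LM" using g by (simp add: sq_integrable_def)
 have ms [measurable]: "Om \<in> sets lebesgue" using dom by simp
 have sq1: "sq (indicator A :: _ => real)" if "A \<subseteq> Om" "A \<in> sets lebesgue" for A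
 proof -
  have "A \<in> lmeasurable" using that dom bounded_subset bounded_set_imp_lmeasurable by blast
  then have "integrable lebesgue (indicator A :: _ => real)" by (simp add: lmeasurable_iff_integrable)
  moreover have "(%x. (indicator A x :: real)^2) = indicator A" by (auto simp: indicator_def)
  ultimately show ?thesis using that(2) by (simp add: sq_integrable_def)
 qed
 have op: "(LEB x. g x * indicator U x) = 0" if U: "open U" "U \<subseteq> Om" for U
 proof -
  obtain \<phi> where p: "!!n::nat. \<phi> n \<in> test_functions U" "!!n x. 0 <= \<phi> n x \<and> \<phi> n x <= indicator U x"
   "!!x. (%n. \<phi> n x) ----> indicator U x" using indicator_open_test_limit[OF U(1)] by metis
  have [measurable]: "\<phi> n \<in> LM" for n by (rule borel_imp_lebesgue[OF test_measurable[OF p(1)]])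
  have [measurable]: "U \<in> sets lebesgue" using U by simp
  have "(%n. LEB x. g x * \<phi> n x) ----> (LEB x. g x * indicator U x)"
  proof (rule integral_dominated_convergence[where w="%x. norm (g x * indicator U x)"])
   show "integrable lebesgue (%x. norm (g x * indicator U x))"
    using sq_integrable_mult[OF g sq1] U by simp
   show "AEL x. norm (g x * \<phi> n x) <= norm (g x * indicator U x)" for n
    using p(2)[of n] by (auto simp: abs_mult intro!: mult_left_mono)
  qed (use p(3) in \<open>auto intro!: tendsto_intros\<close>)
  moreover have "(LEB x. g x * \<phi> n x) = 0" for n
   using p(1)[of n] U(2) by (intro z) (auto simp: test_functions_def)
  ultimately show ?thesis by (simp add: LIMSEQ_const_iff)
 qed
 have set: "(LEB x. g x * indicator E x) = 0" if E: "E \<subseteq> Om" "E \<in> sets lebesgue" for E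
 proof -
  define G where "G = sqrt (LEB x. (g x)^2)"
  have "\<bar>LEB x. g x * indicator E x\<bar> <= G * sqrt e" if e0: "e > 0" for e
  proof -
   obtain T where T: "open T" "E \<subseteq> T" "T - E \<in> lmeasurable" "emeasure lebesgue (T - E) < ennreal e"
    by (rule sets_lebesgue_outer_open[OF E(2) e0])
   define U where "U = T \<inter> Om"
   have U: "open U" "U \<subseteq> Om" "E \<subseteq> U" using T E dom by (auto simp: U_def)
   have [measurable]: "U \<in> sets lebesgue" using U by simp
   have mm: "U - E \<in> sets lebesgue" using E(2) by auto
   have "measure lebesgue (U - E) <= measure lebesgue (T - E)"
    using T(3) mm by (intro measure_mono_fmeasurable) (auto simp: U_def)
   also have "... <= e"
    using T(4) e0 by (simp add: measure_def enn2real_leI less_imp_le)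
   finally have me: "measure lebesgue (U - E) <= e" .
   have "(LEB x. g x * indicator (U - E) x) = (LEB x. g x * indicator U x - g x * indicator E x)"
    using U(3) by (intro Bochner_Integration.integral_cong) (auto simp: indicator_def)
   also have "... = - (LEB x. g x * indicator E x)"
    using op[OF U(1,2)] sq_integrable_mult[OF g sq1] U E by simp
   finally have "\<bar>LEB x. g x * indicator E x\<bar> = \<bar>LEB x. g x * indicator (U - E) x\<bar>" by simp
   also have "... <= G * sqrt (LEB x. (indicator (U - E) x)^2)"
    unfolding G_def using U mm by (intro abs_integral_mult_le g sq1) auto
   also have "(LEB x. (indicator (U - E) x)^2) = measure lebesgue (U - E)"
   proof -
    have "(%x. (indicator (U - E) x :: real)^2) = indicator (U - E)" by (auto simp: indicator_def)
    then show ?thesis by simp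
   qed
   also have "G * sqrt (measure lebesgue (U - E)) <= G * sqrt e"
    using me by (intro mult_left_mono) (auto simp: G_def)
   finally show ?thesis .
  qed
  then have ev: "\<forall>\<^sub>F e in at_right 0. \<bar>LEB x. g x * indicator E x\<bar> <= G * sqrt e"
   by (intro eventually_mono[OF eventually_at_right_less]) simp
  have "((%e. G * sqrt e) \<longlongrightarrow> 0) (at_right 0)" by (auto intro!: tendsto_eq_intros)
  from tendsto_lowerbound[OF this ev] have "\<bar>LEB x. g x * indicator E x\<bar> <= 0"
   by simp
  then show ?thesis by simp
 qed
 have half: "AEL x. \<not> (x \<in> Om \<and> s * g x > 0)" for s :: real
 proof -
  define E where "E = {x \<in> space lebesgue. x \<in> Om \<and> s * g x > 0}"
  have E [measurable]: "E \<in> sets lebesgue" unfolding E_def by measurable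
  have EO: "E \<subseteq> Om" by (auto simp: E_def)
  have "(LEB x. s * (g x * indicator E x)) = 0" using set[OF EO E] by simp
  moreover have "integrable lebesgue (%x. s * (g x * indicator E x))"
   using sq_integrable_mult[OF g sq1[OF EO E]] by simp
  ultimately have "AEL x. s * (g x * indicator E x) = 0"
   by (subst (asm) integral_nonneg_eq_0_iff_AE) (auto simp: E_def indicator_def)
  then show ?thesis by eventually_elim (auto simp: E_def indicator_def)
 qed
 from half[of 1] half[of "-1"] show ?thesis by eventually_elim auto
qed

section \<open>Sobolev functions with zero boundary values\<close>

lemma sq_integrable_bound:
 assumes "sq_integrable M g" "f \<in> borel_measurable M" "AE x in M. \<bar>f x\<bar> <= \<bar>g x\<bar>"
 shows "sq_integrable M f"
 unfolding sq_integrable_def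
proof
 show "integrable M (%x. (f x)^2)"
 proof (rule Bochner_Integration.integrable_bound)
  show "integrable M (%x. (g x)^2)" using assms(1) by (simp add: sq_integrable_def)
  show "(%x. (f x)^2) \<in> borel_measurable M" using assms(2) by measurable
  show "AE x in M. norm ((f x)^2) <= norm ((g x)^2)"
   using assms(3) by eventually_elim (simp add: abs_le_square_iff)
 qed
qed fact

lemma sq_integrable_measurable: "sq_integrable M f ==> f \<in> borel_measurable M"
 by (simp add: sq_integrable_def)

lemma sq_integrable_bounded_mult:
 assumes "sq_integrable M g" "f \<in> borel_measurable M" "!!x. \<bar>f x\<bar> <= C"
 shows "sq_integrable M (%x. f x * g x)"
proof (rule sq_integrable_bound[OF sq_integrable_scale[OF assms(1), of C]])
 have "\<bar>f x\<bar> * \<bar>g x\<bar> <= \<bar>C\<bar> * \<bar>g x\<bar>" for x using assms(3)[of x] by (intro mult_right_mono) auto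
 then show "AE x in M. \<bar>f x * g x\<bar> <= \<bar>C * g x\<bar>" by (simp add: abs_mult)
qed (use assms sq_integrable_measurable in measurable)

lemma sq_integrable_sum:
 "(!!i. i \<in> I ==> sq_integrable M (f i)) ==> sq_integrable M (%x. \<Sum>i\<in>I. f i x)"
 by (induction I rule: infinite_finite_induct) (auto intro: sq_integrable_zero sq_integrable_add)

lemma tendsto_0_sandwich:
 fixes a b :: "nat => real"
 assumes "b ----> 0" "!!n. 0 <= a n" "!!n. a n <= b n"
 shows "a ----> 0"
 by (rule tendsto_sandwich[OF _ _ tendsto_const assms(1)]) (simp_all add: assms)

lemma abs_L2_tendsto_iff:
 assumes "!!n. sq (f n)" "sq g"
 shows "L2lim f g \<longleftrightarrow> (%n. LEB x. (f n x - g x)^2) ----> 0"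
proof -
 have e: "(%n. LEB x. (f n x - g x)^2) = (%n. (norm (abs_L2 (f n) - abs_L2 g))^2)"
  using assms by (simp add: norm_diff_abs_L2)
 show ?thesis unfolding e
 proof
  assume "L2lim f g"
  then have "(%n. (norm (abs_L2 (f n) - abs_L2 g))^2) ----> (norm (abs_L2 g - abs_L2 g))^2"
   by (intro tendsto_intros)
  then show "(%n. (norm (abs_L2 (f n) - abs_L2 g))^2) ----> 0" by simp
 next
  assume "(%n. (norm (abs_L2 (f n) - abs_L2 g))^2) ----> 0"
  then have "(%n. norm (abs_L2 (f n) - abs_L2 g)) ----> 0"
   using tendsto_real_sqrt[of "%n. (norm (abs_L2 (f n) - abs_L2 g))^2"] by fastforce
  then show "L2lim f g"
   using LIM_zero_iff tendsto_norm_zero_iff by blast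
 qed
qed

lemma abs_L2_dominated:
 assumes s: "!!n. sq (f n)" "sq g" "sq h"
  and b: "!!n. AEL x. \<bar>f n x - g x\<bar> <= \<bar>h x\<bar>"
  and l: "AEL x. (%n. f n x) ----> g x"
 shows "L2lim f g"
proof (subst abs_L2_tendsto_iff[OF s(1,2)])
 have [measurable]: "!!n. f n \<in> LM" "g \<in> LM" "h \<in> LM"
  using s sq_integrable_measurable by auto
 have "(%n. LEB x. (f n x - g x)^2) ----> (LINT x|(lebesgue :: (real^'a) measure). 0)"
 proof (rule integral_dominated_convergence[where w="%x. (h x)^2"])
  show "integrable lebesgue (%x. (h x)^2)" using s(3) by (simp add: sq_integrable_def)
  show "AEL x. (%n. (f n x - g x)^2) ----> 0"
   using l by eventually_elim (auto intro!: tendsto_eq_intros)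
  show "AEL x. norm ((f n x - g x)^2) <= (h x)^2" for n
   using b[of n] by eventually_elim (simp add: abs_le_square_iff)
 qed measurable
 then show "(%n. LEB x. (f n x - g x)^2) ----> 0" by simp
qed

text \<open>The sum of the squared errors over the finite index type converges in the mean, so one
  subsequence serves the whole family.\<close>

lemma abs_L2_AE_subseq:
 fixes f :: "nat => 'i::finite => real^'n::finite => real"
 assumes s: "!!n i. sq (f n i)" "!!i. sq (g i)"
  and l: "!!i. (%n. abs_L2 (f n i)) ----> abs_L2 (g i)"
 obtains r :: "nat => nat" where "strict_mono r" "AEL x. \<forall>i. (%n. f (r n) i x) ----> g i x"
proof -
 define u where "u n x = (\<Sum>i\<in>UNIV. (f n i x - g i x)^2)" for n x
 have i: "integrable lebesgue (%x. (f n i x - g i x)^2)" for n i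
  using sq_integrable_diff[OF s(1) s(2)] by (simp add: sq_integrable_def)
 have iu: "integrable lebesgue (u n)" for n unfolding u_def using i by simp
 have un: "0 <= u n x" for n x by (simp add: u_def sum_nonneg)
 have "(%n. \<Sum>i\<in>UNIV. LEB x. (f n i x - g i x)^2) ----> (\<Sum>i\<in>(UNIV::'i set). 0)"
  using l s by (intro tendsto_sum) (simp add: abs_L2_tendsto_iff)
 moreover have "(LEB x. norm (u n x)) = (\<Sum>i\<in>UNIV. LEB x. (f n i x - g i x)^2)" for n
  using un[of n] i by (simp add: u_def)
 ultimately have "(%n. LEB x. norm (u n x)) ----> 0" by simp
 from tendsto_L1_AE_subseq[OF iu this] obtain r :: "nat => nat"
  where r: "strict_mono r" "AEL x. (%n. u (r n) x) ----> 0" by blast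
 from r(2) have "AEL x. \<forall>i. (%n. f (r n) i x) ----> g i x"
 proof eventually_elim
  case (elim x)
  have "(%n. f (r n) i x) ----> g i x" for i
  proof -
   have "(%n. sqrt (u (r n) x)) ----> sqrt 0" by (intro tendsto_real_sqrt elim)
   then have l0: "(%n. sqrt (u (r n) x)) ----> 0" by simp
   have le: "\<bar>f m i x - g i x\<bar> <= sqrt (u m x)" for m
   proof (rule real_le_rsqrt)
    show "\<bar>f m i x - g i x\<bar>^2 <= u m x"
     unfolding u_def power2_abs by (rule member_le_sum) auto
   qed
   have "(%n. f (r n) i x - g i x) ----> 0"
    by (rule Lim_null_comparison[OF _ l0]) (simp add: le)
   then show ?thesis by (simp add: LIM_zero_iff)
  qed
  then show ?case by blast
 qed
 with r(1) that show thesis by blast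
qed

definition sqv :: "(real^'n::finite => real^'n) => bool" where
 "sqv g \<longleftrightarrow> (\<forall>i. sq (%x. g x $ i))"

definition emb :: "(real^'n::finite => real) => (real^'n => real^'n) => 'n L2 \<times> ('n L2 ^ 'n)" where
 "emb y g = (abs_L2 y, \<chi> i. abs_L2 (%x. g x $ i))"

text \<open>\<open>W Om y g\<close> says that \<open>y\<close>, extended by zero, lies in \<open>H\<^sup>1\<^sub>0(Om)\<close> and has the weak gradient \<open>g\<close>.\<close>

definition H0 :: "(real^'n::finite) set => ('n L2 \<times> ('n L2 ^ 'n)) set" where
 "H0 Om = closure ((%\<phi>. emb \<phi> (grad \<phi>)) ` test_functions Om)"

definition W :: "(real^'n::finite) set => (real^'n => real) => (real^'n => real^'n) => bool" where
 "W Om y g \<longleftrightarrow> sq y \<and> sqv g \<and> emb y g \<in> H0 Om"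

lemma W_sq: "W Om y g ==> sq y" and W_sqv: "W Om y g ==> sqv g"
 and W_sq_nth: "W Om y g ==> sq (%x. g x $ i)"
 by (auto simp: W_def sqv_def)

lemma sqv_test: "\<phi> \<in> test_functions Om ==> sqv (grad \<phi>)"
 by (simp add: sqv_def test_sq_integrable_grad)

lemma W_test: "\<phi> \<in> test_functions Om ==> W Om \<phi> (grad \<phi>)"
 by (auto simp: W_def H0_def sqv_test test_sq_integrable intro!: closure_subset[THEN subsetD])

lemma emb_tendsto_iff:
 "(%n. emb (y n) (g n)) ----> emb y' g' \<longleftrightarrow>
  L2lim y y' \<and> (\<forall>i. L2lim (%n x. g n x $ i) (%x. g' x $ i))"
proof
 assume "(%n. emb (y n) (g n)) ----> emb y' g'"
 from tendsto_fst[OF this] tendsto_vec_nth[OF tendsto_snd[OF this]]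
 show "L2lim y y' \<and> (\<forall>i. L2lim (%n x. g n x $ i) (%x. g' x $ i))"
  by (simp add: emb_def)
qed (auto simp: emb_def intro!: tendsto_Pair tendsto_vec_lambda)

lemma W_limit:
 assumes "!!n. W Om (y n) (g n)" "sq y'" "sqv g'"
  "L2lim y y'" "!!i. L2lim (%n x. g n x $ i) (%x. g' x $ i)"
 shows "W Om y' g'"
 unfolding W_def
proof (intro conjI assms(2,3))
 have "(%n. emb (y n) (g n)) ----> emb y' g'" using assms(4,5) by (simp add: emb_tendsto_iff)
 moreover have "emb (y n) (g n) \<in> H0 Om" for n using assms(1) by (simp add: W_def)
 moreover have "closed (H0 Om)" by (simp add: H0_def)
 ultimately show "emb y' g' \<in> H0 Om"
  using closed_sequentially[of "H0 Om" "%n. emb (y n) (g n)" "emb y' g'"] by blast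
qed

lemma W_seqE:
 assumes "W Om y g"
 obtains \<phi> :: "nat => real^'n::finite => real" where
  "!!n. \<phi> n \<in> test_functions Om" "L2lim \<phi> y"
  "!!i. L2lim (%n x. grad (\<phi> n) x $ i) (%x. g x $ i)"
  "AEL x. (%n. \<phi> n x) ----> y x" "AEL x. (%n. grad (\<phi> n) x) ----> g x"
proof -
 have "emb y g \<in> closure ((%\<phi>. emb \<phi> (grad \<phi>)) ` test_functions Om)" using assms by (simp add: W_def H0_def)
 then obtain q where q: "!!n. q n \<in> (%\<phi>. emb \<phi> (grad \<phi>)) ` test_functions Om" "q ----> emb y g"
  unfolding closure_sequential by blast
 have "\<forall>n. \<exists>\<psi>. \<psi> \<in> test_functions Om \<and> q n = emb \<psi> (grad \<psi>)" using q(1) by blast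
 then obtain \<psi> where p: "!!n. \<psi> n \<in> test_functions Om" "!!n. q n = emb (\<psi> n) (grad (\<psi> n))" by metis
 have l: "L2lim \<psi> y" "!!i. L2lim (%n x. grad (\<psi> n) x $ i) (%x. g x $ i)"
 proof -
  have "q = (%n. emb (\<psi> n) (grad (\<psi> n)))" by (rule ext) (rule p(2))
  then show "L2lim \<psi> y" "!!i. L2lim (%n x. grad (\<psi> n) x $ i) (%x. g x $ i)"
   using q(2) emb_tendsto_iff[of \<psi> "%n. grad (\<psi> n)" y g] by simp_all
 qed
 \<comment> \<open>\<open>None\<close> stands for the function and \<open>Some i\<close> for its
   i-th derivative, so that both converge along a common subsequence.\<close>
 define F where "F n j = (case j of None => \<psi> n | Some i => (%x. grad (\<psi> n) x $ i))" for n and j :: "'n option"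
 define G where "G j = (case j of None => y | Some i => (%x. g x $ i))" for j :: "'n option"
 obtain r :: "nat => nat" where r: "strict_mono r" "AEL x. \<forall>j. (%n. F (r n) j x) ----> G j x"
 proof (rule abs_L2_AE_subseq[of F G])
  show "sq (F n i)" for n i
   by (cases i) (auto simp: F_def intro: test_sq_integrable[OF p(1)] test_sq_integrable_grad[OF p(1)])
  show "sq (G i)" for i
   using W_sq[OF assms] W_sq_nth[OF assms] by (cases i) (auto simp: G_def)
  show "(%n. abs_L2 (F n i)) ----> abs_L2 (G i)" for i
   using l by (cases i) (auto simp: F_def G_def)
 qed
 show thesis
 proof
  show "\<psi> (r n) \<in> test_functions Om" for n by (rule p(1))
  show "(%n. abs_L2 (\<psi> (r n))) ----> abs_L2 y"
   using LIMSEQ_subseq_LIMSEQ[OF l(1) r(1)] by (simp add: o_def)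
  show "L2lim (%n x. grad (\<psi> (r n)) x $ i) (%x. g x $ i)" for i
   using LIMSEQ_subseq_LIMSEQ[OF l(2) r(1)] by (simp add: o_def)
  show "AEL x. (%n. \<psi> (r n) x) ----> y x"
   using r(2) by eventually_elim (auto simp: F_def G_def dest: spec[of _ None])
  show "AEL x. (%n. grad (\<psi> (r n)) x) ----> g x"
   using r(2)
  proof eventually_elim
   case (elim x)
   show ?case by (rule vec_tendstoI) (use elim[rule_format, of "Some _"] in \<open>simp add: F_def G_def\<close>)
  qed
 qed
qed

lemma W_AE_cong:
 assumes "W Om y g" "sq y'" "sqv g'" "AEL x. y x = y' x" "AEL x. g x = g' x"
 shows "W Om y' g'"
proof -
 have "abs_L2 (%x. g x $ i) = abs_L2 (%x. g' x $ i)" for i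
  using assms by (intro abs_L2_eqI) (auto simp: sqv_def W_def elim: eventually_mono)
 moreover have "abs_L2 y = abs_L2 y'" using assms by (intro abs_L2_eqI) (auto simp: W_def)
 ultimately have "emb y g = emb y' g'" by (simp add: emb_def)
 then show ?thesis using assms by (simp add: W_def)
qed

lemma grad_add: "smooth \<phi> ==> smooth \<psi> ==> grad (%x. \<phi> x + \<psi> x) x = grad \<phi> x + grad \<psi> x"
 by (rule grad_eqI) (auto intro!: derivative_eq_intros smooth_has_derivative simp: inner_add_left)

lemma grad_mult: "smooth \<phi> ==> smooth \<psi> ==> grad (%x. \<phi> x * \<psi> x) x = \<phi> x *\<^sub>R grad \<psi> x + \<psi> x *\<^sub>R grad \<phi> x"
 by (rule grad_eqI) (auto intro!: derivative_eq_intros smooth_has_derivative simp: inner_add_left algebra_simps)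

lemma grad_const: "grad (%x. c) x = 0"
 by (rule grad_eqI) simp

lemma W_add:
 assumes "W Om y g" "W Om y' g'"
 shows "W Om (%x. y x + y' x) (%x. g x + g' x)"
proof -
 obtain \<phi> where p: "!!n. \<phi> n \<in> test_functions Om" "L2lim \<phi> y"
  "!!i. L2lim (%n x. grad (\<phi> n) x $ i) (%x. g x $ i)" by (rule W_seqE[OF assms(1)]) blast
 obtain \<psi> where q: "!!n. \<psi> n \<in> test_functions Om" "L2lim \<psi> y'"
  "!!i. L2lim (%n x. grad (\<psi> n) x $ i) (%x. g' x $ i)" by (rule W_seqE[OF assms(2)]) blast
 note s = W_sq[OF assms(1)] W_sq[OF assms(2)] W_sq_nth[OF assms(1)] W_sq_nth[OF assms(2)]
 show ?thesis
 proof (rule W_limit[OF W_test[OF test_add[OF p(1) q(1)]]])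
  show "L2lim (%n x. \<phi> n x + \<psi> n x) (%x. y x + y' x)"
   using tendsto_add[OF p(2) q(2)] by (simp add: plus_abs_L2 s test_sq_integrable[OF p(1)] test_sq_integrable[OF q(1)])
  show "L2lim (%n x. grad (%x. \<phi> n x + \<psi> n x) x $ i) (%x. (g x + g' x) $ i)" for i
   using tendsto_add[OF p(3)[of i] q(3)[of i]]
   by (simp add: grad_add[OF test_smooth[OF p(1)] test_smooth[OF q(1)]] plus_abs_L2 s
     test_sq_integrable_grad[OF p(1)] test_sq_integrable_grad[OF q(1)])
 qed (auto simp: sqv_def intro!: sq_integrable_add s)
qed

lemma W_mult:
 assumes y: "W Om y g" and e: "smooth \<eta>" "!!x. \<bar>\<eta> x\<bar> <= C" "!!x. norm (grad \<eta> x) <= C"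
 shows "W Om (%x. \<eta> x * y x) (%x. \<eta> x *\<^sub>R g x + y x *\<^sub>R grad \<eta> x)"
proof -
 obtain \<phi> where p: "!!n. \<phi> n \<in> test_functions Om" "L2lim \<phi> y"
  "!!i. L2lim (%n x. grad (\<phi> n) x $ i) (%x. g x $ i)" by (rule W_seqE[OF y]) blast
 note s = W_sq[OF y] W_sq_nth[OF y] test_sq_integrable[OF p(1)] test_sq_integrable_grad[OF p(1)]
 have em: "\<eta> \<in> LM" "(%x. grad \<eta> x $ i) \<in> LM" for i
  using smooth_measurable[OF e(1)] smooth_measurable[OF smooth_partial[OF e(1), of i]]
  by (auto simp: grad_def intro: borel_imp_lebesgue)
 have gi: "\<bar>grad \<eta> x $ i\<bar> <= C" for x i using e(3)[of x] component_le_norm_cart[of "grad \<eta> x" i] by linarith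
 have C: "C \<ge> 0" using e(2)[of 0] by linarith
 have mc: "L2lim (%n x. m x * f n x) (%x. m x * f' x)"
  if "m \<in> LM" "!!x. \<bar>m x\<bar> <= C" "!!n. sq (f n)" "sq f'"
   "L2lim f f'" for m f and f' :: "real^'a => real"
 proof (subst abs_L2_tendsto_iff)
  show "sq (%x. m x * f n x)" "sq (%x. m x * f' x)" for n
   using sq_integrable_bounded_mult that by blast+
  have l: "(%n. C^2 * (LEB x. (f n x - f' x)^2)) ----> C^2 * 0"
   using that by (intro tendsto_mult tendsto_const) (simp add: abs_L2_tendsto_iff)
  have "(LEB x. (m x * f n x - m x * f' x)^2) <= C^2 * (LEB x. (f n x - f' x)^2)" for n
  proof -
   have d: "sq (%x. f n x - f' x)" using that sq_integrable_diff by blast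
   have "(LEB x. (m x * f n x - m x * f' x)^2) <= (LEB x. C^2 * (f n x - f' x)^2)"
   proof (rule integral_mono)
    show "integrable lebesgue (%x. (m x * f n x - m x * f' x)^2)"
     using sq_integrable_bounded_mult[OF d that(1,2)] by (simp add: sq_integrable_def algebra_simps)
    show "integrable lebesgue (%x. C^2 * (f n x - f' x)^2)" using d by (simp add: sq_integrable_def)
    show "(m x * f n x - m x * f' x)^2 <= C^2 * (f n x - f' x)^2" for x
    proof -
     have "(m x)^2 <= C^2" using that(2)[of x] C by (simp add: abs_le_square_iff[symmetric])
     then have "(m x)^2 * (f n x - f' x)^2 <= C^2 * (f n x - f' x)^2" by (intro mult_right_mono) auto
     then show ?thesis by (simp add: power_mult_distrib[symmetric] right_diff_distrib)
    qed
   qed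
   then show ?thesis by simp
  qed
  then show "(%n. LEB x. (m x * f n x - m x * f' x)^2) ----> 0"
   by (rule tendsto_0_sandwich[OF l[simplified], rotated]) simp
 qed
 have sm: "sq (%x. \<eta> x * g x $ i)" "sq (%x. grad \<eta> x $ i * y x)"
  "sq (%x. \<eta> x * grad (\<phi> n) x $ i)" "sq (%x. grad \<eta> x $ i * \<phi> n x)" for i n
  using sq_integrable_bounded_mult s em e(2) gi by blast+
 show ?thesis
 proof (rule W_limit[OF W_test[OF test_mult[OF p(1) e(1)]]])
  show "sq (%x. \<eta> x * y x)" by (rule sq_integrable_bounded_mult[OF s(1) em(1) e(2)])
  show "sqv (%x. \<eta> x *\<^sub>R g x + y x *\<^sub>R grad \<eta> x)"
   using sq_integrable_add[OF sm(1) sm(2)] by (simp add: sqv_def mult.commute[of "y _"])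
  show "L2lim (%n x. \<eta> x * \<phi> n x) (%x. \<eta> x * y x)"
   by (rule mc[OF em(1) e(2) s(3) s(1) p(2)])
  show "L2lim (%n x. grad (%x. \<eta> x * \<phi> n x) x $ i) (%x. (\<eta> x *\<^sub>R g x + y x *\<^sub>R grad \<eta> x) $ i)" for i
  proof -
   have "(%n. abs_L2 (%x. \<eta> x * grad (\<phi> n) x $ i) + abs_L2 (%x. grad \<eta> x $ i * \<phi> n x))
    ----> abs_L2 (%x. \<eta> x * g x $ i) + abs_L2 (%x. grad \<eta> x $ i * y x)"
    by (intro tendsto_add mc em e gi s p)
   then show ?thesis
    by (simp add: plus_abs_L2 sm grad_mult[OF e(1) test_smooth[OF p(1)]] mult.commute[of "y _"] mult.commute[of "\<phi> _ _"])
  qed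
 qed
qed

lemma W_scale: "W Om y g ==> W Om (%x. c * y x) (%x. c *\<^sub>R g x)"
 using W_mult[of Om y g "%x. c" "\<bar>c\<bar>"] by (simp add: smooth_const grad_const)

lemma W_diff: "W Om y g ==> W Om y' g' ==> W Om (%x. y x - y' x) (%x. g x - g' x)"
 using W_add[of Om y g "%x. -1 * y' x" "%x. -1 *\<^sub>R g' x"] W_scale[of Om y' g' "-1"] by simp

lemma W_uminus: "W Om y g ==> W Om (%x. - y x) (%x. - g x)"
 using W_scale[of Om y g "-1"] by simp

lemma W_zero: "W Om (%x. 0) (%x. 0)"
proof -
 have "grad (%x. 0) = (%x::real^'a. 0)" by (rule ext) (rule grad_const)
 with W_test[OF test_zero, of Om] show ?thesis by simp
qed

lemma W_mono:
 assumes "W Om y g" "Om \<subseteq> Om'" shows "W Om' y g"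
proof -
 have "test_functions Om \<subseteq> test_functions Om'" using assms(2) by (auto simp: test_functions_def)
 then have "H0 Om \<subseteq> H0 Om'" unfolding H0_def by (intro closure_mono image_mono)
 then show ?thesis using assms(1) by (auto simp: W_def)
qed

lemma W_outside:
 assumes "W Om y g"
 shows "AEL x. x \<notin> Om --> y x = 0" "AEL x. x \<notin> Om --> g x = 0"
proof -
 obtain \<phi> where p: "!!n. \<phi> n \<in> test_functions Om" "AEL x. (%n. \<phi> n x) ----> y x"
  "AEL x. (%n. grad (\<phi> n) x) ----> g x" by (rule W_seqE[OF assms]) blast
 have z: "\<psi> x = 0" if "\<psi> \<in> test_functions Om" "x \<notin> Om" for \<psi> x
  by (rule test_functionsE[OF that(1)]) (use that(2) in blast)
 show "AEL x. x \<notin> Om --> y x = 0"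
  using p(2) by eventually_elim (auto simp: z[OF p(1)] LIMSEQ_const_iff)
 have gz: "grad (\<phi> n) x = 0" if "x \<notin> Om" for n x
  using z[OF test_partial[OF p(1)] that] by (simp add: grad_def vec_eq_iff)
 show "AEL x. x \<notin> Om --> g x = 0"
  using p(3) by eventually_elim (auto simp: gz LIMSEQ_const_iff)
qed

lemma lipschitz_of_deriv_bound:
 fixes G :: "real => real"
 assumes "!!t. (G has_real_derivative G' t) (at t)" "!!t. \<bar>G' t\<bar> <= C"
 shows "\<bar>G s - G t\<bar> <= C * \<bar>s - t\<bar>"
 using field_differentiable_bound[of UNIV G G' C s t] assms by simp

text \<open>The gradients of \<open>D 0 (\<phi> n)\<close> differ from the claimed one by
  \<open>D 1 (\<phi> n)\<close> times \<open>grad (\<phi> n) - g\<close>, which is small because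
  \<open>D 1\<close> is bounded, and by \<open>D 1 (\<phi> n) - D 1 y\<close> times
  \<open>g\<close>, which is small by dominated convergence. The condition \<open>D 0 0 = 0\<close>
  keeps the supports compact.\<close>

lemma W_comp_smooth:
 assumes y: "W Om y g" and D: "!!n t. (D n has_real_derivative D (Suc n) t) (at t)" "D 0 0 = 0"
  and b: "!!t. \<bar>D 1 t\<bar> <= C"
 shows "W Om (%x. D 0 (y x)) (%x. D 1 (y x) *\<^sub>R g x)"
proof -
 obtain \<phi> where p: "!!n. \<phi> n \<in> test_functions Om" "L2lim \<phi> y"
  "!!i. L2lim (%n x. grad (\<phi> n) x $ i) (%x. g x $ i)"
  "AEL x. (%n. \<phi> n x) ----> y x" by (rule W_seqE[OF y]) blast
 note s = W_sq[OF y] W_sq_nth[OF y] test_sq_integrable[OF p(1)] test_sq_integrable_grad[OF p(1)]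
 have C: "C \<ge> 0" using b[of 0] by linarith
 have ct: "isCont (D n) t" for n t using D(1) DERIV_isCont by blast
 then have [measurable]: "D n \<in> borel_measurable borel" for n
  by (intro borel_measurable_continuous_onI continuous_at_imp_continuous_on) auto
 have [measurable]: "y \<in> LM" "\<phi> n \<in> LM"
  "(%x. g x $ i) \<in> LM" "(%x. grad (\<phi> n) x $ i) \<in> LM" for n i
  using s[THEN sq_integrable_measurable] by auto
 have lip: "\<bar>D 0 s - D 0 t\<bar> <= C * \<bar>s - t\<bar>" for s t
  by (rule lipschitz_of_deriv_bound[where G'="D 1"]) (use D(1)[of 0] b in auto)
 have b0: "\<bar>D 0 t\<bar> <= \<bar>C * t\<bar>" for t using lip[of t 0] D(2) C by (simp add: abs_mult)
 have sD0: "sq (%x. D 0 (h x))" if h: "sq h" for h :: "real^'a => real"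
 proof (rule sq_integrable_bound[OF sq_integrable_scale[OF h, of C]])
  have [measurable]: "h \<in> LM" using h sq_integrable_measurable by blast
  show "(%x. D 0 (h x)) \<in> LM" by measurable
  show "AEL x. \<bar>D 0 (h x)\<bar> <= \<bar>C * h x\<bar>" using b0 by simp
 qed
 note sD = sD0[OF s(1)] sD0[OF s(3)]
 have D1m: "(%x. D 1 (h x)) \<in> LM" if [measurable]: "h \<in> LM" for h :: "real^'a => real"
  by measurable
 have sg: "sq (%x. D 1 (y x) * g x $ i)" "sq (%x. D 1 (\<phi> n x) * grad (\<phi> n) x $ i)"
  "sq (%x. D 1 (\<phi> n x) * g x $ i)" for i n
  by (intro sq_integrable_bounded_mult[OF _ D1m b] s sq_integrable_measurable)+
 have W: "W Om (%x. D 0 (\<phi> n x)) (%x. D 1 (\<phi> n x) *\<^sub>R grad (\<phi> n) x)" for n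
 proof -
  have d1: "(D 0 has_real_derivative D 1 t) (at t)" for t using D(1)[of 0 t] by simp
  have "grad (%x. D 0 (\<phi> n x)) = (%x. D 1 (\<phi> n x) *\<^sub>R grad (\<phi> n) x)"
   by (rule ext, rule grad_eqI, rule has_derivative_comp1[OF smooth_differentiable[OF test_smooth[OF p(1)]] d1])
  with W_test[OF test_comp[of "\<phi> n" Om D, OF p(1) D]] show ?thesis by (simp only:)
 qed
 have small: "L2lim f (%x. 0)"
  if "!!n. sq (f n)" "!!n. sq (h n)" "L2lim h h'"
   "sq h'" "!!n x. \<bar>f n x\<bar> <= C * \<bar>h n x - h' x\<bar>" for f h and h' :: "real^'a => real"
 proof (subst abs_L2_tendsto_iff[OF that(1) sq_integrable_zero])
  have l: "(%n. C^2 * (LEB x. (h n x - h' x)^2)) ----> C^2 * 0"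
   using that by (intro tendsto_mult tendsto_const) (simp add: abs_L2_tendsto_iff)
  have "(LEB x. (f n x)^2) <= C^2 * (LEB x. (h n x - h' x)^2)" for n
  proof -
   have "(LEB x. (f n x)^2) <= (LEB x. C^2 * (h n x - h' x)^2)"
   proof (rule integral_mono)
    show "integrable lebesgue (%x. C^2 * (h n x - h' x)^2)"
     using sq_integrable_diff[OF that(2,4)] by (simp add: sq_integrable_def)
    show "integrable lebesgue (%x. (f n x)^2)" using that(1) by (simp add: sq_integrable_def)
    have "(f n x)^2 <= (C * \<bar>h n x - h' x\<bar>)^2" for x
     using that(5)[of n x] C by (simp add: abs_le_square_iff[symmetric])
    then show "(f n x)^2 <= C^2 * (h n x - h' x)^2" for x by (simp add: power_mult_distrib)
   qed
   then show ?thesis by simp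
  qed
  then have "(%n. LEB x. (f n x)^2) ----> 0"
   by (rule tendsto_0_sandwich[OF l[simplified], rotated]) simp
  then show "(%n. LEB x. (f n x - 0)^2) ----> 0" by simp
 qed
 show ?thesis
 proof (rule W_limit[OF W])
  show "sq (%x. D 0 (y x))" by (rule sD)
  show "sqv (%x. D 1 (y x) *\<^sub>R g x)" using sg by (simp add: sqv_def)
  have "L2lim (%n x. D 0 (\<phi> n x) - D 0 (y x)) (%x. 0)"
   by (rule small[OF _ s(3) p(2) s(1) lip]) (intro sq_integrable_diff sD)
  then show "L2lim (%n x. D 0 (\<phi> n x)) (%x. D 0 (y x))"
   using sD by (simp add: minus_abs_L2[symmetric] zero_L2.abs_eq[symmetric] LIM_zero_iff zero_L2_def[symmetric])
  show "L2lim (%n x. (D 1 (\<phi> n x) *\<^sub>R grad (\<phi> n) x) $ i) (%x. (D 1 (y x) *\<^sub>R g x) $ i)" for i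
  proof -
   have 1: "L2lim (%n x. D 1 (\<phi> n x) * grad (\<phi> n) x $ i - D 1 (\<phi> n x) * g x $ i) (%x. 0)"
   proof (rule small[OF sq_integrable_diff[OF sg(2) sg(3)] s(4) p(3) s(2)])
    show "\<bar>D 1 (\<phi> n x) * grad (\<phi> n) x $ i - D 1 (\<phi> n x) * g x $ i\<bar> <= C * \<bar>grad (\<phi> n) x $ i - g x $ i\<bar>" for n x
     using b[of "\<phi> n x"] by (simp add: right_diff_distrib[symmetric] abs_mult mult_right_mono)
   qed
   have 2: "L2lim (%n x. D 1 (\<phi> n x) * g x $ i) (%x. D 1 (y x) * g x $ i)"
   proof (rule abs_L2_dominated[OF sg(3) sg(1) sq_integrable_scale[OF s(2)[of i], of "2 * C"]])
    have "\<bar>D 1 (\<phi> n x) * g x $ i - D 1 (y x) * g x $ i\<bar> <= \<bar>2 * C * g x $ i\<bar>" for n x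
    proof -
     have "\<bar>D 1 (\<phi> n x) - D 1 (y x)\<bar> <= 2 * C" using b[of "\<phi> n x"] b[of "y x"] by linarith
     then have "\<bar>D 1 (\<phi> n x) - D 1 (y x)\<bar> * \<bar>g x $ i\<bar> <= 2 * C * \<bar>g x $ i\<bar>" by (rule mult_right_mono) simp
     then show ?thesis using C by (simp add: left_diff_distrib[symmetric] abs_mult)
    qed
    then show "AEL x. \<bar>D 1 (\<phi> n x) * g x $ i - D 1 (y x) * g x $ i\<bar> <= \<bar>2 * C * g x $ i\<bar>" for n by simp
    show "AEL x. (%n. D 1 (\<phi> n x) * g x $ i) ----> D 1 (y x) * g x $ i"
     using p(4) by eventually_elim (intro tendsto_mult tendsto_const isCont_tendsto_compose[OF ct])
   qed
   from tendsto_add[OF 1 2] show ?thesis using sg by (simp add: plus_abs_L2 sq_integrable_diff sq_integrable_zero)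
  qed
 qed
qed

lemma softplus_bounds: "max 0 s <= ln (1 + exp s)" "ln (1 + exp s) <= max 0 s + ln 2" for s :: real
proof -
 have "ln (exp s) <= ln (1 + exp s)" by (subst ln_le_cancel_iff) (auto intro: add_pos_pos)
 moreover have "0 <= ln (1 + exp s)" by simp
 ultimately show "max 0 s <= ln (1 + exp s)" by simp
 have "ln (1 + exp s) <= ln (2 * exp (max 0 s))"
 proof (subst ln_le_cancel_iff)
  have "1 <= exp (max 0 s)" "exp s <= exp (max 0 s)" by auto
  then show "1 + exp s <= 2 * exp (max 0 s)" by linarith
 qed (auto intro: add_pos_pos)
 also have "... = max 0 s + ln 2" by (simp add: ln_mult)
 finally show "ln (1 + exp s) <= max 0 s + ln 2" .
qed

text \<open>The truncation \<open>t \<mapsto> (t - k)\<^sup>+\<close> is approximated by rescaled softplus functions whose derivatives,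
 logistic functions centred slightly to the right of \<open>k\<close>, converge everywhere to the indicator of
 \<open>t > k\<close>; hence the level set \<open>y = k\<close> needs no separate treatment.\<close>

lemma W_trunc:
 assumes y: "W Om y g"
 shows "W Om (%x. max 0 (y x - k) - max 0 (- k)) (%x. if y x > k then g x else 0)"
proof -
 define \<sigma> where "\<sigma> t = inverse (1 + exp (- t))" for t :: real
 \<comment> \<open>The logistic function has derivative \<sigma>(1 - \<sigma>), so every derivative
   of it is a polynomial in \<sigma>; one more derivative takes p to p' times
   \<open>[:0,1,-1:]\<close>.\<close>
 define P where "P m = ((%p. pderiv p * [:0,1,-1:]) ^^ m) [:0,1::real:]" for m :: nat
 define N where "N n = real (Suc n)" for n
 \<comment> \<open>\<open>c n * t - d n\<close> equals N^2 (t - k) - N: it is at most -N for every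
   \<open>t <= k\<close>, while for \<open>t > k\<close> the slope N^2 eventually beats the shift
   and it exceeds N.\<close>
 define c where "c n = (N n)^2" for n
 define d where "d n = c n * k + N n" for n
 \<comment> \<open>The softplus function is normalised to vanish at 0, which accounts for the
   constant \<open>max 0 (- k)\<close> in the claim: for negative \<open>k\<close> the truncation
   alone does not have zero boundary values.\<close>
 define E where "E n m t = (case m of 0 => (ln (1 + exp (c n * t - d n)) - ln (1 + exp (- d n))) / c n
  | Suc m => c n ^ m * poly (P m) (\<sigma> (c n * t - d n)))" for n m t
 have N: "N n \<ge> 1" for n by (simp add: N_def)
 have c: "c n > 0" for n using N[of n] by (simp add: c_def)
 have \<sigma>: "0 < \<sigma> t" "\<sigma> t < 1" "\<sigma> t <= exp t" "1 - \<sigma> t <= exp (- t)" for t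
 proof -
  have e: "0 < exp (- t)" by simp
  show "0 < \<sigma> t" using e by (simp add: \<sigma>_def add_pos_pos)
  show "\<sigma> t < 1" using e by (simp add: \<sigma>_def inverse_less_1_iff)
  show "\<sigma> t <= exp t" unfolding \<sigma>_def by (rule inverse_le_imp_le) (auto simp: exp_minus[symmetric])
  have "1 - \<sigma> t = exp (- t) * \<sigma> t"
  proof -
   have "1 + exp (- t) \<noteq> 0" using e by linarith
   then show ?thesis unfolding \<sigma>_def by (simp add: inverse_eq_divide eq_divide_eq diff_divide_eq_iff)
  qed
  also have "... <= exp (- t) * 1" using \<open>\<sigma> t < 1\<close> by (intro mult_left_mono) auto
  finally show "1 - \<sigma> t <= exp (- t)" by simp
 qed
 have d\<sigma>: "(\<sigma> has_real_derivative \<sigma> t * (1 - \<sigma> t)) (at t)" for t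
 proof -
  have "1 + exp (- t) \<noteq> 0" by (metis add_pos_pos exp_gt_zero less_irrefl zero_less_one)
  then show ?thesis unfolding \<sigma>_def
   by (auto intro!: derivative_eq_intros simp: field_simps power2_eq_square)
 qed
 have lin: "((%t. c n * t - d n) has_real_derivative c n) (at t)" for n t
  by (auto intro!: derivative_eq_intros)
 have D: "(E n m has_real_derivative E n (Suc m) t) (at t)" for n m t
 proof (cases m)
  case 0
  have p: "1 + exp s > 0" for s :: real by (rule add_pos_pos) auto
  have "((%s. ln (1 + exp s)) has_real_derivative \<sigma> s) (at s)" for s :: real
   using p[of s] by (auto intro!: derivative_eq_intros simp: \<sigma>_def exp_minus field_simps)
  from DERIV_cdivide[OF DERIV_diff[OF DERIV_chain2[OF this lin] DERIV_const]]
  have "((%t. (ln (1 + exp (c n * t - d n)) - ln (1 + exp (- d n))) / c n) has_real_derivative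
   (\<sigma> (c n * t - d n) * c n - 0) / c n) (at t)" .
  moreover have "(%t. (ln (1 + exp (c n * t - d n)) - ln (1 + exp (- d n))) / c n) = E n 0" by (rule ext) (simp add: E_def)
  moreover have "(\<sigma> (c n * t - d n) * c n - 0) / c n = E n (Suc 0) t" using c[of n] by (simp add: E_def P_def)
  ultimately show ?thesis unfolding 0 by (simp only:)
 next
  case (Suc l)
  have "((%t. c n ^ l * poly (P l) (\<sigma> (c n * t - d n))) has_real_derivative
    c n ^ l * (poly (pderiv (P l)) (\<sigma> (c n * t - d n)) * (\<sigma> (c n * t - d n) * (1 - \<sigma> (c n * t - d n)) * c n))) (at t)"
   by (rule DERIV_cmult[OF DERIV_chain2[OF poly_DERIV DERIV_chain2[OF d\<sigma> lin]]])
  moreover have "c n ^ l * (poly (pderiv (P l)) (\<sigma> (c n * t - d n)) * (\<sigma> (c n * t - d n) * (1 - \<sigma> (c n * t - d n)) * c n))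
   = E n (Suc (Suc l)) t"
   by (simp add: E_def P_def algebra_simps)
  moreover have "(%t. c n ^ l * poly (P l) (\<sigma> (c n * t - d n))) = E n (Suc l)" by (rule ext) (simp add: E_def)
  ultimately show ?thesis unfolding Suc by (simp only:)
 qed
 have E1: "E n 1 t = \<sigma> (c n * t - d n)" for n t by (simp add: E_def P_def)
 have b1: "\<bar>E n 1 t\<bar> <= 1" for n t unfolding E1 using \<sigma>(1,2)[of "c n * t - d n"] by simp
 have E00: "E n 0 0 = 0" for n by (simp add: E_def)
 have WE: "W Om (%x. E n 0 (y x)) (%x. E n 1 (y x) *\<^sub>R g x)" for n
  by (rule W_comp_smooth[OF y, of "E n", OF D E00 b1])
 have b0: "\<bar>E n 0 t\<bar> <= \<bar>t\<bar>" for n t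
  using lipschitz_of_deriv_bound[of "E n 0" "E n 1" 1 t 0] D[of n 0] b1 E00[of n] by simp
 have Nlim: "(%n. 1 / N n) ----> 0"
  using LIMSEQ_inverse_real_of_nat by (simp add: N_def divide_inverse)
 have lim0: "(%n. E n 0 t) ----> max 0 (t - k) - max 0 (- k)" for t
 proof -
  have s: "(%n. ln (1 + exp (c n * t - d n)) / c n) ----> max 0 (t - k)" for t
  proof -
   have e: "max 0 (c n * t - d n) / c n = max 0 (t - k - 1 / N n)" for n
   proof -
    have "(c n * t - d n) / c n = t - k - 1 / N n"
     using N[of n] by (simp add: d_def c_def field_simps power2_eq_square)
    then show ?thesis using c[of n] by (simp add: max_divide_distrib_right)
   qed
   have "(%n. max 0 (t - k - 1 / N n)) ----> max 0 (t - k - 0)" by (intro tendsto_intros Nlim)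
   moreover have "(%n. ln (1 + exp (c n * t - d n)) / c n - max 0 (t - k - 1 / N n)) ----> 0"
   proof (rule tendsto_0_sandwich)
    show "(%n. ln 2 * (1 / N n * (1 / N n))) ----> 0" 
     using tendsto_mult[OF tendsto_const[of "ln 2"] tendsto_mult[OF Nlim Nlim]] unfolding mult_zero_left mult_zero_right .
    fix n
    show "0 <= ln (1 + exp (c n * t - d n)) / c n - max 0 (t - k - 1 / N n)"
     using softplus_bounds(1)[of "c n * t - d n"] c[of n] unfolding e[symmetric] by (simp add: divide_right_mono)
    have "ln (1 + exp (c n * t - d n)) / c n <= (max 0 (c n * t - d n) + ln 2) / c n"
     using softplus_bounds(2)[of "c n * t - d n"] c[of n] by (intro divide_right_mono) auto
    then show "ln (1 + exp (c n * t - d n)) / c n - max 0 (t - k - 1 / N n) <= ln 2 * (1 / N n * (1 / N n))"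
     unfolding e[symmetric] by (simp add: add_divide_distrib c_def power2_eq_square)
   qed
   ultimately have "(%n. max 0 (t - k - 1 / N n) + (ln (1 + exp (c n * t - d n)) / c n - max 0 (t - k - 1 / N n))) ----> max 0 (t - k - 0) + 0"
    by (rule tendsto_add)
   then show ?thesis by simp
  qed
  have "(%n. ln (1 + exp (c n * t - d n)) / c n - ln (1 + exp (c n * 0 - d n)) / c n) ----> max 0 (t - k) - max 0 (0 - k)"
   by (intro tendsto_diff s)
  then show ?thesis by (simp add: E_def diff_divide_distrib)
 qed
 have elim: "(%n. exp (- N n)) ----> 0"
 proof (rule tendsto_0_sandwich[OF Nlim])
  fix n
  have "N n <= exp (N n)" using exp_ge_add_one_self[of "N n"] by linarith
  then show "exp (- N n) <= 1 / N n" using N[of n] by (simp add: exp_minus field_simps)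
 qed simp
 have lim1: "(%n. E n 1 t) ----> (if t > k then 1 else 0)" for t
 proof (cases "t > k")
  case False
  have "E n 1 t <= exp (- N n)" for n
  proof -
   have "c n * t - d n <= - N n" using False c[of n] by (simp add: d_def mult_left_mono)
   then show ?thesis unfolding E1 using \<sigma>(3)[of "c n * t - d n"] by (meson exp_le_cancel_iff order_trans)
  qed
  moreover have "0 <= E n 1 t" for n unfolding E1 using \<sigma>(1) by (simp add: less_imp_le)
  ultimately show ?thesis using False tendsto_0_sandwich[OF elim, of "%n. E n 1 t"] by simp
 next
  case True
  obtain n0 where n0: "2 / (t - k) <= real n0" using real_arch_simple by blast
  have "(%n. 1 - E n 1 t) ----> 0"
  proof (rule tendsto_sandwich[OF _ _ tendsto_const elim])
   show "\<forall>\<^sub>F n in sequentially. 0 <= 1 - E n 1 t" unfolding E1 using \<sigma>(2) by (simp add: less_imp_le)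
   show "\<forall>\<^sub>F n in sequentially. 1 - E n 1 t <= exp (- N n)"
   proof (rule eventually_sequentiallyI[of n0])
    fix n assume "n0 <= n"
    then have "2 / (t - k) <= N n" using n0 by (simp add: N_def)
    then have "2 <= N n * (t - k)" using True by (simp add: field_simps)
    then have "N n * 2 <= N n * (N n * (t - k))" using N[of n] by (intro mult_left_mono) auto
    then have "N n <= c n * t - d n" by (simp add: c_def d_def power2_eq_square algebra_simps)
    then show "1 - E n 1 t <= exp (- N n)"
     unfolding E1 using \<sigma>(4)[of "c n * t - d n"] by (meson exp_le_cancel_iff neg_le_iff_le order_trans)
   qed
  qed
  from tendsto_diff[OF tendsto_const[of 1] this] True show ?thesis by simp
 qed
 note sy = W_sq[OF y] W_sq_nth[OF y] and sE = W_sq[OF WE] W_sq_nth[OF WE]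
 have [measurable]: "y \<in> LM" "(%x. g x $ i) \<in> LM" for i
  using sy[THEN sq_integrable_measurable] by auto
 have G0: "\<bar>max 0 (t - k) - max 0 (- k)\<bar> <= \<bar>t\<bar>" for t by (simp add: max_def)
 have sG: "sq (%x. max 0 (y x - k) - max 0 (- k))"
  by (rule sq_integrable_bound[OF sy(1)]) (use G0 in auto)
 have sg: "sq (%x. (if y x > k then g x else 0) $ i)" for i
 proof (rule sq_integrable_bound[OF sy(2)[of i]])
  have "(%x. (if y x > k then g x else 0) $ i) = (%x. if y x > k then g x $ i else 0)" by auto
  also have "... \<in> LM" by measurable
  finally show "(%x. (if y x > k then g x else 0) $ i) \<in> LM" .
 qed auto
 show ?thesis
 proof (rule W_limit[OF WE sG])
  show "sqv (%x. if y x > k then g x else 0)" using sg by (simp add: sqv_def)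
  show "L2lim (%n x. E n 0 (y x)) (%x. max 0 (y x - k) - max 0 (- k))"
  proof (rule abs_L2_dominated[OF sE(1) sG sq_integrable_scale[OF sy(1), of 2]])
   show "AEL x. \<bar>E n 0 (y x) - (max 0 (y x - k) - max 0 (- k))\<bar> <= \<bar>2 * y x\<bar>" for n
   proof (rule AE_I2)
    fix x show "\<bar>E n 0 (y x) - (max 0 (y x - k) - max 0 (- k))\<bar> <= \<bar>2 * y x\<bar>"
     using b0[of n "y x"] G0[of "y x"] by linarith
   qed
  qed (simp add: lim0)
  show "L2lim (%n x. (E n 1 (y x) *\<^sub>R g x) $ i) (%x. (if y x > k then g x else 0) $ i)" for i
  proof (rule abs_L2_dominated[OF sE(2) sg sq_integrable_scale[OF sy(2), of 2]])
   show "AEL x. \<bar>(E n 1 (y x) *\<^sub>R g x) $ i - (if y x > k then g x else 0) $ i\<bar> <= \<bar>2 * g x $ i\<bar>" for n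
   proof (rule AE_I2)
    fix x
    have "\<bar>E n 1 (y x) - (if y x > k then 1 else 0)\<bar> * \<bar>g x $ i\<bar> <= 2 * \<bar>g x $ i\<bar>"
     using b1[of n "y x"] by (intro mult_right_mono) auto
    moreover have "(E n 1 (y x) *\<^sub>R g x) $ i - (if y x > k then g x else 0) $ i = (E n 1 (y x) - (if y x > k then 1 else 0)) * g x $ i"
     by (simp add: algebra_simps)
    ultimately show "\<bar>(E n 1 (y x) *\<^sub>R g x) $ i - (if y x > k then g x else 0) $ i\<bar> <= \<bar>2 * g x $ i\<bar>"
     by (simp add: abs_mult)
   qed
   show "AEL x. (%n. (E n 1 (y x) *\<^sub>R g x) $ i) ----> (if y x > k then g x else 0) $ i"
   proof (rule AE_I2)
    fix x
    have "(%n. E n 1 (y x) * g x $ i) ----> (if y x > k then 1 else 0) * g x $ i"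
     by (intro tendsto_mult lim1 tendsto_const)
    then show "(%n. (E n 1 (y x) *\<^sub>R g x) $ i) ----> (if y x > k then g x else 0) $ i"
     by (cases "y x > k") auto
   qed
  qed
 qed
qed

lemma W_pos:
 assumes "W Om y g" "k \<ge> 0"
 shows "W Om (%x. max 0 (y x - k)) (%x. if y x > k then g x else 0)"
 using W_trunc[OF assms(1), of k] assms(2) by simp

text \<open>For negative \<open>k\<close> the truncation is the function of \<open>W_trunc\<close>
  plus the constant \<open>- k\<close>; multiplied by \<open>\<eta>\<close> the constant becomes a
  multiple of a test function, which explains the alternative in the last hypothesis.\<close>

lemma W_cut_trunc:
 assumes y: "W Om y g" and e: "smooth \<eta>" "!!x. \<bar>\<eta> x\<bar> <= C" "!!x. norm (grad \<eta> x) <= C"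
  and k: "k \<ge> 0 \<or> \<eta> \<in> test_functions Om"
 shows "W Om (%x. \<eta> x * max 0 (y x - k)) (%x. \<eta> x *\<^sub>R (if y x > k then g x else 0) + max 0 (y x - k) *\<^sub>R grad \<eta> x)"
proof -
 note 1 = W_mult[OF W_trunc[OF y, of k] e]
 show ?thesis
 proof (cases "k \<ge> 0")
  case True then show ?thesis using 1 by simp
 next
  case False
  with k have "W Om \<eta> (grad \<eta>)" by (intro W_test) auto
  from W_add[OF 1 W_scale[OF this, of "- k"]] False show ?thesis by (simp add: algebra_simps)
 qed
qed

lemma W_by_parts:
 assumes y: "W Om y g" and p: "\<psi> \<in> test_functions Om'"
 shows "(LEB x. y x * partial_deriv i \<psi> x) = - (LEB x. g x $ i * \<psi> x)"
proof -
 obtain \<phi> where q: "!!n. \<phi> n \<in> test_functions Om" "L2lim \<phi> y"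
  "!!i. L2lim (%n x. grad (\<phi> n) x $ i) (%x. g x $ i)" by (rule W_seqE[OF y]) blast
 note s = W_sq[OF y] W_sq_nth[OF y] test_sq_integrable[OF q(1)] test_sq_integrable_grad[OF q(1)]
  test_sq_integrable[OF test_partial[OF q(1)]] test_sq_integrable[OF p] test_sq_integrable[OF test_partial[OF p]]
 have "(%n. abs_L2 (\<phi> n) \<bullet> abs_L2 (partial_deriv i \<psi>)) ----> abs_L2 y \<bullet> abs_L2 (partial_deriv i \<psi>)"
  by (intro tendsto_inner q tendsto_const)
 moreover have "(%n. - (abs_L2 (%x. grad (\<phi> n) x $ i) \<bullet> abs_L2 \<psi>)) ----> - (abs_L2 (%x. g x $ i) \<bullet> abs_L2 \<psi>)"
  by (intro tendsto_minus tendsto_inner q tendsto_const)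
 moreover have "abs_L2 (\<phi> n) \<bullet> abs_L2 (partial_deriv i \<psi>) = - (abs_L2 (%x. grad (\<phi> n) x $ i) \<bullet> abs_L2 \<psi>)" for n
  using test_integral_by_parts[OF q(1)[of n] p, of i] by (simp add: inner_abs_L2 s grad_def)
 ultimately have "abs_L2 y \<bullet> abs_L2 (partial_deriv i \<psi>) = - (abs_L2 (%x. g x $ i) \<bullet> abs_L2 \<psi>)"
  using LIMSEQ_unique by fastforce
 then show ?thesis by (simp add: inner_abs_L2 s)
qed

lemma borel_measurable_vecI:
 fixes g :: "'a => real^'n::finite"
 assumes "!!i. (%x. g x $ i) \<in> borel_measurable M"
 shows "g \<in> borel_measurable M"
 unfolding borel_measurable_euclidean_space[of g]
proof
 fix b :: "real^'n" assume "b \<in> Basis"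
 then obtain i where "b = axis i 1" by (auto simp: Basis_vec_def)
 then show "(%x. g x \<bullet> b) \<in> borel_measurable M" using assms[of i] by (simp add: inner_axis)
qed

lemma sqv_measurable: "sqv g ==> g \<in> LM"
 by (intro borel_measurable_vecI) (simp add: sqv_def sq_integrable_def)

lemma norm_vec_sq: "(norm (v :: real^'n::finite))^2 = (\<Sum>i\<in>UNIV. (v $ i)^2)"
 unfolding power2_norm_eq_inner inner_vec_def by (simp add: power2_eq_square)

lemma sqv_norm:
 assumes "sqv g" shows "sq (%x. norm (g x))"
 unfolding sq_integrable_def
proof
 show "(%x. norm (g x)) \<in> LM" using sqv_measurable[OF assms] by measurable
 show "integrable lebesgue (%x. (norm (g x))^2)"
  using assms unfolding norm_vec_sq by (intro Bochner_Integration.integrable_sum) (simp add: sqv_def sq_integrable_def)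
qed

text \<open>Tonelli's theorem and translations are applied on \<open>lborel\<close>, where Borel
  representatives are wanted.\<close>

lemma W_borel:
 fixes y :: "real^'n::finite => real"
 assumes "W Om y g"
 obtains y' g' where "y' \<in> borel_measurable borel" "g' \<in> borel_measurable borel"
  "AEL x. y x = y' x" "AEL x. g x = g' x" "W Om y' g'"
proof -
 have ex: "\<exists>h'\<in>borel_measurable lborel. AE x in lborel. h x = h' x" if "sq h" for h :: "real^'n => real"
  using that by (intro completion_ex_borel_measurable_real) (simp add: sq_integrable_def)
 obtain y' where y': "y' \<in> borel_measurable lborel" "AE x in lborel. y x = y' x" using ex[OF W_sq[OF assms]] by blast
 have "\<forall>i. \<exists>h. h \<in> borel_measurable lborel \<and> (AE x in lborel. g x $ i = h x)"
  using ex[OF W_sq_nth[OF assms]] by blast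
 then obtain h where h: "!!i. h i \<in> borel_measurable lborel" "!!i. AE x in lborel. g x $ i = h i x" by metis
 define g' where "g' x = (\<chi> i. h i x)" for x
 have g'm: "g' \<in> borel_measurable borel" by (rule borel_measurable_vecI) (use h in \<open>simp add: g'_def\<close>)
 have "AE x in lborel. \<forall>i. g x $ i = h i x" using h(2) by (simp add: AE_all_countable)
 then have ga: "AEL x. g x = g' x"
  by (intro AE_completion) (auto simp: g'_def vec_eq_iff elim: eventually_mono)
 have ya: "AEL x. y x = y' x" using y'(2) by (rule AE_completion)
 have "sq y'"
  by (rule sq_integrable_bound[OF W_sq[OF assms]]) (use y' ya in \<open>auto intro: borel_imp_lebesgue elim: eventually_mono\<close>)
 moreover have "sqv g'"
  unfolding sqv_def
 proof
  fix i show "sq (%x. g' x $ i)"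
   by (rule sq_integrable_bound[OF W_sq_nth[OF assms, of i]])
    (use h ga in \<open>auto simp: g'_def intro: borel_imp_lebesgue elim: eventually_mono\<close>)
 qed
 ultimately have "W Om y' g'" using W_AE_cong[OF assms _ _ ya ga] by blast
 with y' g'm ya ga that show thesis by simp
qed

section \<open>Comparison with the weak derivatives and the space \<open>H10\<close> of the
  problem\<close>

definition ext :: "'a set => ('a => real) => 'a => real" where
 "ext Om f x = (if x \<in> Om then f x else 0)"

lemma ext_measurable:
 fixes f :: "real^'n::finite => real"
 shows "Om \<in> sets lebesgue ==> ext Om f \<in> LM \<longleftrightarrow> f \<in> borel_measurable (lebesgue_on Om)"
 unfolding ext_def[abs_def] by (rule borel_measurable_if)

lemma ext_integral:
 fixes f :: "real^'n::finite => real"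
 shows "Om \<in> sets lebesgue ==> (LINT x|lebesgue_on Om. f x) = (LEB x. ext Om f x)"
 unfolding ext_def[abs_def] by (rule Lebesgue_Measure.integral_restrict_UNIV[symmetric])

lemma ext_integrable:
 fixes f :: "real^'n::finite => real"
 shows "Om \<in> sets lebesgue ==> integrable (lebesgue_on Om) f \<longleftrightarrow> integrable lebesgue (ext Om f)"
 unfolding ext_def[abs_def] by (rule Lebesgue_Measure.integrable_restrict_UNIV[symmetric])

lemma ext_sq_integrable:
 fixes f :: "real^'n::finite => real"
 assumes "Om \<in> sets lebesgue"
 shows "sq_integrable (lebesgue_on Om) f \<longleftrightarrow> sq (ext Om f)"
proof -
 have "ext Om (%x. (f x)^2) = (%x. (ext Om f x)^2)" by (auto simp: ext_def)
 then show ?thesis using assms by (simp add: sq_integrable_def ext_measurable ext_integrable)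
qed

lemma AE_on: "Om \<in> sets lebesgue ==> (AE x in lebesgue_on Om. P x) \<longleftrightarrow> (AEL x. x \<in> Om --> P x)"
 by (rule AE_restrict_space_iff) simp

lemma is_weak_partial_iff:
 assumes "Om \<in> sets lebesgue"
 shows "is_weak_partial Om i y g \<longleftrightarrow> sq (ext Om g) \<and>
  (\<forall>\<phi>\<in>test_functions Om. (LEB x. ext Om y x * partial_deriv i \<phi> x) = - (LEB x. ext Om g x * \<phi> x))"
proof -
 have "ext Om (%x. f x * h x) = (%x. ext Om f x * h x)" for f h by (auto simp: ext_def)
 then show ?thesis by (simp add: is_weak_partial_def ext_sq_integrable assms ext_integral)
qed

text \<open>Two weak derivatives differ by a function orthogonal to all test functions. This makes
  the choice in \<open>weak_partial\<close> immaterial under integrals.\<close>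

lemma is_weak_partial_unique:
 assumes "open Om" "bounded Om" "is_weak_partial Om i y g" "is_weak_partial Om i y g'"
 shows "AEL x. ext Om g x = ext Om g' x"
proof -
 have m: "Om \<in> sets lebesgue" using assms(1) by simp
 note w = assms(3,4)[unfolded is_weak_partial_iff[OF m]]
 have "AEL x. x \<in> Om --> ext Om g x - ext Om g' x = 0"
 proof (rule fundamental_lemma[OF assms(1,2)])
  show "sq (%x. ext Om g x - ext Om g' x)" using w sq_integrable_diff by blast
  fix \<phi> assume p: "\<phi> \<in> test_functions Om"
  have "(LEB x. ext Om g x * \<phi> x) = (LEB x. ext Om g' x * \<phi> x)" using w p by force
  then show "(LEB x. (ext Om g x - ext Om g' x) * \<phi> x) = 0"
   using sq_integrable_mult[OF _ test_sq_integrable[OF p]] w by (simp add: left_diff_distrib)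
 qed
 then show ?thesis by eventually_elim (auto simp: ext_def)
qed

lemma W_is_weak_partial:
 assumes "Om \<in> sets lebesgue" "W Om (ext Om y) g"
 shows "is_weak_partial Om i y (%x. g x $ i)"
proof -
 have a: "AEL x. ext Om (%x. g x $ i) x = g x $ i"
  using W_outside(2)[OF assms(2)] by eventually_elim (auto simp: ext_def)
 have g: "sq (%x. g x $ i)" by (rule W_sq_nth[OF assms(2)])
 have em: "ext Om (%x. g x $ i) \<in> LM"
  unfolding ext_def using assms(1) sq_integrable_measurable[OF g] by measurable
 have "sq (ext Om (%x. g x $ i))"
  by (rule sq_integrable_bound[OF g em]) (auto simp: ext_def)
 moreover have "(LEB x. ext Om y x * partial_deriv i \<phi> x) = - (LEB x. ext Om (%x. g x $ i) x * \<phi> x)"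
  if p: "\<phi> \<in> test_functions Om" for \<phi>
 proof -
  have "(LEB x. ext Om (%x. g x $ i) x * \<phi> x) = (LEB x. g x $ i * \<phi> x)"
   by (rule integral_cong_AE)
    (use em sq_integrable_measurable[OF g] borel_imp_lebesgue[OF test_measurable[OF p]] a in \<open>auto elim: eventually_mono\<close>)
  then show ?thesis using W_by_parts[OF assms(2) p, of i] by simp
 qed
 ultimately show ?thesis using is_weak_partial_iff[OF assms(1)] by blast
qed

lemma weak_partial_AE:
 assumes "open Om" "bounded Om" "is_weak_partial Om i y g"
 shows "AEL x. ext Om (weak_partial Om i y) x = ext Om g x"
 using is_weak_partial_unique[OF assms(1,2) someI[of "is_weak_partial Om i y", OF assms(3)] assms(3)]
 by (simp add: weak_partial_def)

lemma W_weak_partial_AE: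
 assumes "open Om" "bounded Om" "W Om (ext Om y) g"
 shows "AEL x. x \<in> Om --> weak_partial Om i y x = g x $ i"
proof -
 have "Om \<in> sets lebesgue" using assms(1) by simp
 from weak_partial_AE[OF assms(1,2) W_is_weak_partial[OF this assms(3)], of i]
 show ?thesis by eventually_elim (auto simp: ext_def split: if_splits)
qed

text \<open>Translates smallness in \<open>H1_norm\<close>, which involves chosen weak derivatives
  of a difference, into convergence of functions and gradients in \<open>L2\<close>, the convergence
  behind \<open>H0\<close>.\<close>

lemma H1_norm_sq:
 assumes dom: "open Om" "bounded Om" and y: "!!i. is_weak_partial Om i y (g i)" and p: "\<phi> \<in> test_functions Om"
  and sy: "sq (ext Om y)"
 shows "(H1_norm Om (%x. y x - \<phi> x))^2 = (LEB x. (\<phi> x - ext Om y x)^2) +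
  (\<Sum>i\<in>UNIV. LEB x. (grad \<phi> x $ i - ext Om (g i) x)^2)"
proof -
 have m: "Om \<in> sets lebesgue" using dom by simp
 have z: "\<phi> x = 0" "partial_deriv i \<phi> x = 0" if "x \<notin> Om" for x i
  using test_functionsE[OF p] test_functionsE[OF test_partial[OF p, of i]] that by (metis subsetD)+
 have ep: "ext Om \<phi> = \<phi>" "ext Om (partial_deriv i \<phi>) = partial_deriv i \<phi>" for i
  using z by (auto simp: ext_def)
 have ed: "ext Om (%x. a x - b x) x = ext Om a x - ext Om b x" for a b x by (auto simp: ext_def)
 have s: "sq (ext Om (g i))" for i using y is_weak_partial_iff[OF m] by blast
 have iw: "is_weak_partial Om i (%x. y x - \<phi> x) (%x. g i x - partial_deriv i \<phi> x)" for i
  unfolding is_weak_partial_iff[OF m] ed ep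
 proof (intro conjI ballI)
  show "sq (%x. ext Om (g i) x - partial_deriv i \<phi> x)"
   by (intro sq_integrable_diff s test_sq_integrable[OF test_partial[OF p]])
  fix \<psi> assume q: "\<psi> \<in> test_functions Om"
  note t = test_sq_integrable[OF q] test_sq_integrable[OF test_partial[OF q]] test_sq_integrable[OF p] test_sq_integrable[OF test_partial[OF p]]
  have "(LEB x. ext Om y x * partial_deriv i \<psi> x) = - (LEB x. ext Om (g i) x * \<psi> x)"
   using y[of i] q by (simp add: is_weak_partial_iff[OF m])
  then show "(LEB x. (ext Om y x - \<phi> x) * partial_deriv i \<psi> x) = - (LEB x. (ext Om (g i) x - partial_deriv i \<phi> x) * \<psi> x)"
   using test_integral_by_parts[OF p q, of i] by (simp add: left_diff_distrib sq_integrable_mult sy s t)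
 qed
 from weak_partial_AE[OF dom iw]
 have a: "AEL x. ext Om (weak_partial Om i (%x. y x - \<phi> x)) x = ext Om (g i) x - partial_deriv i \<phi> x" for i
  by (simp add: ed ep)
 have sq: "ext Om (%x. (f x)^2) x = (ext Om f x)^2" for f x by (simp add: ext_def)
 have mm: "(%x. ext Om (g i) x - partial_deriv i \<phi> x) \<in> LM" for i
  using s test_sq_integrable[OF test_partial[OF p]] by (intro borel_measurable_diff sq_integrable_measurable) auto
 have wpm: "ext Om (weak_partial Om i (%x. y x - \<phi> x)) \<in> LM" for i
 proof -
  have "is_weak_partial Om i (%x. y x - \<phi> x) (weak_partial Om i (%x. y x - \<phi> x))"
   unfolding weak_partial_def by (rule someI[of "is_weak_partial Om i (%x. y x - \<phi> x)", OF iw])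
  then show ?thesis using is_weak_partial_iff[OF m] sq_integrable_measurable by blast
 qed
 have "(LEB x. (ext Om (weak_partial Om i (%x. y x - \<phi> x)) x)^2) = (LEB x. (grad \<phi> x $ i - ext Om (g i) x)^2)" for i
  by (rule integral_cong_AE) (use a[of i] mm[of i] wpm[of i] borel_measurable_diff[OF sq_integrable_measurable[OF test_sq_integrable_grad[OF p]] sq_integrable_measurable[OF s]] in \<open>auto simp: grad_def power2_commute elim: eventually_mono\<close>)
 then show ?thesis
  unfolding H1_norm_def ext_integral[OF m] sq
  by (subst real_sqrt_pow2) (auto intro!: add_nonneg_nonneg sum_nonneg simp: ed ep power2_commute)
qed

lemma H10_iff_W:
 fixes Om :: "(real^'n::finite) set"
 assumes dom: "open Om" "bounded Om"
 shows "y \<in> H10 Om \<longleftrightarrow> (\<exists>g. W Om (ext Om y) g)"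
proof
 have m: "Om \<in> sets lebesgue" using dom by simp
 assume y: "y \<in> H10 Om"
 then have "\<forall>i. \<exists>g. is_weak_partial Om i y g" by (simp add: H10_def H1_def)
 then obtain g where g: "!!i. is_weak_partial Om i y (g i)" by metis
 have sy: "sq (ext Om y)" using y m by (simp add: H10_def H1_def ext_sq_integrable)
 have sg: "sq (ext Om (g i))" for i using g is_weak_partial_iff[OF m] by blast
 have "\<forall>n. \<exists>\<phi>\<in>test_functions Om. H1_norm Om (%x. y x - \<phi> x) < 1 / real (Suc n)" using y by (simp add: H10_def)
 then obtain \<phi> where p: "!!n. \<phi> n \<in> test_functions Om" "!!n. H1_norm Om (%x. y x - \<phi> n x) < 1 / real (Suc n)" by metis
 have l: "(%n. (1 / real (Suc n))^2) ----> 0"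
  using tendsto_power[OF LIMSEQ_inverse_real_of_nat, of 2] by (simp add: divide_inverse)
 define A where "A n = (LEB x. (\<phi> n x - ext Om y x)^2)" for n
 define B where "B n i = (LEB x. (grad (\<phi> n) x $ i - ext Om (g i) x)^2)" for n i
 have AB: "A n + (\<Sum>i\<in>UNIV. B n i) <= (1 / real (Suc n))^2" for n
 proof -
  have "0 <= H1_norm Om (%x. y x - \<phi> n x)" by (simp add: H1_norm_def sum_nonneg)
  then have "(H1_norm Om (%x. y x - \<phi> n x))^2 <= (1 / real (Suc n))^2" using p(2)[of n] by (intro power_mono) auto
  then show ?thesis using H1_norm_sq[OF dom g p(1) sy] by (simp add: A_def B_def)
 qed
 have nn: "0 <= A n" "0 <= B n i" for n i by (simp_all add: A_def B_def)
 have Ai: "A n <= (1 / real (Suc n))^2" for n using AB[of n] sum_nonneg[of UNIV "B n"] nn by (smt (verit))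
 have Bi: "B n i <= (1 / real (Suc n))^2" for n i
  using AB[of n] member_le_sum[of i UNIV "B n"] nn by (smt (verit) finite iso_tuple_UNIV_I)
 define G where "G x = (\<chi> i. ext Om (g i) x)" for x
 have "W Om (ext Om y) G"
 proof (rule W_limit[OF W_test[OF p(1)] sy])
  show "sqv G" using sg by (simp add: sqv_def G_def)
  show "L2lim \<phi> (ext Om y)"
   using tendsto_0_sandwich[OF l nn(1) Ai] by (simp add: abs_L2_tendsto_iff[OF test_sq_integrable[OF p(1)] sy] A_def)
  show "L2lim (%n x. grad (\<phi> n) x $ i) (%x. G x $ i)" for i
   using tendsto_0_sandwich[OF l, of "%n. B n i", OF nn(2) Bi] sg
   by (simp add: abs_L2_tendsto_iff[OF test_sq_integrable_grad[OF p(1)]] B_def G_def)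
 qed
 then show "\<exists>g. W Om (ext Om y) g" by blast
next
 have m: "Om \<in> sets lebesgue" using dom by simp
 assume "\<exists>g. W Om (ext Om y) g"
 then obtain g where w: "W Om (ext Om y) g" by blast
 have wp: "is_weak_partial Om i y (%x. g x $ i)" for i by (rule W_is_weak_partial[OF m w])
 have sy: "sq (ext Om y)" by (rule W_sq[OF w])
 then have y1: "y \<in> H1 Om" using wp m by (auto simp: H1_def ext_sq_integrable)
 have "\<exists>\<phi>\<in>test_functions Om. H1_norm Om (%x. y x - \<phi> x) < e" if e: "e > 0" for e
 proof -
  obtain \<phi> where q: "!!n. \<phi> n \<in> test_functions Om" "L2lim \<phi> (ext Om y)"
   "!!i. L2lim (%n x. grad (\<phi> n) x $ i) (%x. g x $ i)" by (rule W_seqE[OF w]) blast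
  have ge: "abs_L2 (%x. g x $ i) = abs_L2 (ext Om (%x. g x $ i))" and se: "sq (ext Om (%x. g x $ i))" for i
  proof -
   show se: "sq (ext Om (%x. g x $ i))" using wp is_weak_partial_iff[OF m] by blast
   show "abs_L2 (%x. g x $ i) = abs_L2 (ext Om (%x. g x $ i))"
    by (rule abs_L2_eqI[OF W_sq_nth[OF w] se]) (use W_outside(2)[OF w] in eventually_elim, auto simp: ext_def)
  qed
  have "(%n. (LEB x. (\<phi> n x - ext Om y x)^2) +
   (\<Sum>i\<in>UNIV. LEB x. (grad (\<phi> n) x $ i - ext Om (%x. g x $ i) x)^2)) ----> 0 + (\<Sum>i\<in>(UNIV::'n set). 0)"
   by (intro tendsto_add tendsto_sum abs_L2_tendsto_iff[THEN iffD1] q test_sq_integrable[OF q(1)] test_sq_integrable_grad[OF q(1)] sy se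
    q(3)[unfolded ge])
  then have "(%n. (H1_norm Om (%x. y x - \<phi> n x))^2) ----> 0"
   using H1_norm_sq[OF dom wp q(1) sy] by simp
  then have "\<forall>\<^sub>F n in sequentially. (H1_norm Om (%x. y x - \<phi> n x))^2 < e^2" 
   by (rule order_tendstoD(2)) (use e in simp)
  then obtain n where "(H1_norm Om (%x. y x - \<phi> n x))^2 < e^2" by (auto simp: eventually_sequentially)
  then have "H1_norm Om (%x. y x - \<phi> n x) < e" by (rule power_less_imp_less_base) (use e in simp)
  then show ?thesis using q(1) by blast
 qed
 with y1 show "y \<in> H10 Om" by (simp add: H10_def)
qed

section \<open>Translations and inequalities of Poincare type\<close>

lemma nn_integral_lebesgue: "(\<integral>\<^sup>+x. f x \<partial>lebesgue) = (\<integral>\<^sup>+x. f x \<partial>lborel)"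
 by (rule nn_integral_completion)

text \<open>The fundamental theorem of calculus on a segment, followed by Cauchy-Schwarz on the unit
  interval for the square. Nonnegative integrals allow the later interchange with the integral over
  \<open>x\<close> without integrability conditions.\<close>

lemma increment_le_integral_grad:
 fixes \<phi> :: "real^'n::finite => real"
 assumes s: "smooth \<phi>"
 shows "ennreal \<bar>\<phi> (x + h) - \<phi> x\<bar> <= (\<integral>\<^sup>+t. indicator {0..1} t * ennreal (norm h * norm (grad \<phi> (x + t *\<^sub>R h))) \<partial>lborel)"
  and "ennreal (\<bar>\<phi> (x + h) - \<phi> x\<bar>^2) <= (\<integral>\<^sup>+t. indicator {0..1} t * ennreal ((norm h * norm (grad \<phi> (x + t *\<^sub>R h)))^2) \<partial>lborel)"
proof -
 define f where "f t = grad \<phi> (x + t *\<^sub>R h) \<bullet> h" for t :: real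
 have cg: "continuous_on UNIV (%z. grad \<phi> z)"
  unfolding grad_def by (intro continuous_on_vec_lambda smooth_continuous smooth_partial s)
 have "continuous_on UNIV (%t. grad \<phi> (x + t *\<^sub>R h))"
  by (rule continuous_on_compose2[OF cg]) (auto intro!: continuous_intros)
 then have cf: "continuous_on UNIV f" unfolding f_def by (intro continuous_intros)
 then have [measurable]: "f \<in> borel_measurable borel" by (rule borel_measurable_continuous_onI)
 have der: "((%t. \<phi> (x + t *\<^sub>R h)) has_real_derivative f t) (at t)" for t
 proof -
  have "((%t. \<phi> (x + t *\<^sub>R h)) has_derivative (%u. grad \<phi> (x + t *\<^sub>R h) \<bullet> (u *\<^sub>R h))) (at t)"
   by (rule has_derivative_compose[OF _ smooth_has_derivative[OF s]]) (auto intro!: derivative_eq_intros)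
  then show ?thesis by (simp add: has_field_derivative_def f_def mult.commute[of _ "_ \<bullet> _"])
 qed
 have ftc: "has_bochner_integral lborel (%t. f t * indicator {0..1} t) (\<phi> (x + h) - \<phi> x)"
  using has_bochner_integral_FTC_Icc_real[of 0 1 "%t. \<phi> (x + t *\<^sub>R h)" f, OF _ der] cf
  by (simp add: continuous_on_eq_continuous_at)
 then have int: "integrable lborel (%t. f t * indicator {0..1} t)"
  and eq: "(LINT t|lborel. f t * indicator {0..1} t) = \<phi> (x + h) - \<phi> x"
  by (auto simp: has_bochner_integral_iff)
 have fb: "\<bar>f t\<bar> <= norm h * norm (grad \<phi> (x + t *\<^sub>R h))" for t
  using Cauchy_Schwarz_ineq2[of "grad \<phi> (x + t *\<^sub>R h)" h] by (simp add: f_def mult.commute)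
 have "ennreal \<bar>\<phi> (x + h) - \<phi> x\<bar> <= ennreal (LINT t|lborel. \<bar>f t * indicator {0..1} t\<bar>)"
  unfolding eq[symmetric] by (intro ennreal_leI integral_abs_bound)
 also have "... = (\<integral>\<^sup>+t. ennreal \<bar>f t * indicator {0..1} t\<bar> \<partial>lborel)"
  using int by (intro nn_integral_eq_integral[symmetric]) auto
 also have "... <= (\<integral>\<^sup>+t. indicator {0..1} t * ennreal (norm h * norm (grad \<phi> (x + t *\<^sub>R h))) \<partial>lborel)"
  by (intro nn_integral_mono) (use fb in \<open>auto simp: indicator_def intro!: ennreal_leI\<close>)
 finally show "ennreal \<bar>\<phi> (x + h) - \<phi> x\<bar> <= (\<integral>\<^sup>+t. indicator {0..1} t * ennreal (norm h * norm (grad \<phi> (x + t *\<^sub>R h))) \<partial>lborel)" .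
 have "continuous_on {0..1} (%t. \<bar>f t\<bar>)" using cf by (intro continuous_intros) (auto intro: continuous_on_subset)
 then have "compact ((%t. \<bar>f t\<bar>) ` {0..1})" by (rule compact_continuous_image) simp
 then obtain B where B0: "\<forall>z\<in>(%t. \<bar>f t\<bar>) ` {0..1}. norm z <= B" using compact_imp_bounded bounded_iff by metis
 have B: "\<bar>f t\<bar> <= B" if "t \<in> {0..1}" for t using B0 that by force
 have i1: "integrable lborel (indicator {0..1::real} :: real => real)" by (rule integrable_real_indicator) auto
 have s1: "sq_integrable lborel (indicator {0..1::real} :: real => real)"
 proof -
  have "(%t. (indicator {0..1::real} t :: real)^2) = indicator {0..1}" by (auto simp: indicator_def)
  then show ?thesis using i1 by (simp add: sq_integrable_def)
 qed
 have sf: "sq_integrable lborel (%t. f t * indicator {0..1} t)"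
 proof (rule sq_integrable_bound[OF sq_integrable_scale[OF s1, of B]])
  show "AE t in lborel. \<bar>f t * indicator {0..1} t\<bar> <= \<bar>B * indicator {0..1} t\<bar>"
   using B by (intro AE_I2) (force simp: indicator_def)
 qed measurable
 have "\<bar>\<phi> (x + h) - \<phi> x\<bar> = \<bar>LINT t|lborel. (f t * indicator {0..1} t) * indicator {0..1} t\<bar>"
  unfolding eq[symmetric] by (intro arg_cong[where f=abs] Bochner_Integration.integral_cong) (auto simp: indicator_def)
 also have "... <= sqrt (LINT t|lborel. (f t * indicator {0..1} t)^2) * sqrt (LINT t|lborel. (indicator {0..1::real} t)^2)"
  by (rule abs_integral_mult_le[OF sf s1])
 also have "(LINT t|lborel. (indicator {0..1::real} t)^2) = (1::real)"
 proof -
  have "(%t. (indicator {0..1::real} t :: real)^2) = indicator {0..1}" by (auto simp: indicator_def)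
  then show ?thesis by simp
 qed
 finally have "\<bar>\<phi> (x + h) - \<phi> x\<bar> <= sqrt (LINT t|lborel. (f t * indicator {0..1} t)^2)" by simp
 then have "\<bar>\<phi> (x + h) - \<phi> x\<bar>^2 <= (sqrt (LINT t|lborel. (f t * indicator {0..1} t)^2))^2" by (intro power_mono) auto
 also have "... = (LINT t|lborel. (f t * indicator {0..1} t)^2)" by simp
 finally have "ennreal (\<bar>\<phi> (x + h) - \<phi> x\<bar>^2) <= ennreal (LINT t|lborel. (f t * indicator {0..1} t)^2)" by (rule ennreal_leI)
 also have "... = (\<integral>\<^sup>+t. ennreal ((f t * indicator {0..1} t)^2) \<partial>lborel)"
  using sf by (intro nn_integral_eq_integral[symmetric]) (auto simp: sq_integrable_def)
 also have "... <= (\<integral>\<^sup>+t. indicator {0..1} t * ennreal ((norm h * norm (grad \<phi> (x + t *\<^sub>R h)))^2) \<partial>lborel)"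
 proof (intro nn_integral_mono)
  fix t :: real
  have "\<bar>f t\<bar>^2 <= (norm h * norm (grad \<phi> (x + t *\<^sub>R h)))^2" by (rule power_mono[OF fb]) simp
  then show "ennreal ((f t * indicator {0..1} t)^2) <= indicator {0..1} t * ennreal ((norm h * norm (grad \<phi> (x + t *\<^sub>R h)))^2)"
   by (auto simp: indicator_def intro!: ennreal_leI)
 qed
 finally show "ennreal (\<bar>\<phi> (x + h) - \<phi> x\<bar>^2) <= (\<integral>\<^sup>+t. indicator {0..1} t * ennreal ((norm h * norm (grad \<phi> (x + t *\<^sub>R h)))^2) \<partial>lborel)" .
qed

text \<open>By convexity \<open>x\<close> and \<open>x + h\<close> in \<open>D\<close> force \<open>x + t h\<close> into \<open>D\<close>; hence Fubini and translation
 invariance suffice, and no change of variables is needed.\<close>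

lemma segment_average_le:
 fixes D :: "(real^'n::finite) set"
 assumes D: "convex D" and [measurable]: "D \<in> sets borel" "F \<in> borel_measurable borel"
 shows "(\<integral>\<^sup>+x. indicator D x * indicator D (x + h) * (\<integral>\<^sup>+t. indicator {0..1} t * F (x + t *\<^sub>R h) \<partial>lborel) \<partial>lborel)
  <= (\<integral>\<^sup>+x. indicator D x * F x \<partial>lborel)"
proof -
 have "(\<integral>\<^sup>+x. indicator D x * indicator D (x + h) * (\<integral>\<^sup>+t. indicator {0..1} t * F (x + t *\<^sub>R h) \<partial>lborel) \<partial>lborel)
  = (\<integral>\<^sup>+x. (\<integral>\<^sup>+t. indicator D x * indicator D (x + h) * (indicator {0..1} t * F (x + t *\<^sub>R h)) \<partial>lborel) \<partial>lborel)"
  by (intro nn_integral_cong nn_integral_cmult[symmetric]) measurable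
 also have "... <= (\<integral>\<^sup>+x. (\<integral>\<^sup>+t. indicator {0..1} t * (indicator D (x + t *\<^sub>R h) * F (x + t *\<^sub>R h)) \<partial>lborel) \<partial>lborel)"
 proof (intro nn_integral_mono)
  fix x :: "real^'n" and t :: real
  have "x + t *\<^sub>R h \<in> D" if "x \<in> D" "x + h \<in> D" "t \<in> {0..1}"
   using convexD[OF D that(1,2), of "1 - t" t] that(3) by (simp add: algebra_simps)
  then show "indicator D x * indicator D (x + h) * (indicator {0..1} t * F (x + t *\<^sub>R h))
   <= indicator {0..1} t * (indicator D (x + t *\<^sub>R h) * F (x + t *\<^sub>R h))"
   by (auto simp: indicator_def)
 qed
 also have "... = (\<integral>\<^sup>+t. (\<integral>\<^sup>+x. indicator {0..1} t * (indicator D (x + t *\<^sub>R h) * F (x + t *\<^sub>R h)) \<partial>lborel) \<partial>lborel)"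
  by (rule lborel_pair.Fubini'[symmetric]) measurable
 also have "... = (\<integral>\<^sup>+t. indicator {0..1::real} t * (\<integral>\<^sup>+x. indicator D x * F x \<partial>lborel) \<partial>lborel)"
 proof (intro nn_integral_cong)
  fix t :: real
  have "(\<integral>\<^sup>+x. indicator {0..1} t * (indicator D (x + t *\<^sub>R h) * F (x + t *\<^sub>R h)) \<partial>lborel)
   = indicator {0..1} t * (\<integral>\<^sup>+x. indicator D (x + t *\<^sub>R h) * F (x + t *\<^sub>R h) \<partial>lborel)"
   by (rule nn_integral_cmult) measurable
  also have "(\<integral>\<^sup>+x. indicator D (x + t *\<^sub>R h) * F (x + t *\<^sub>R h) \<partial>lborel) = (\<integral>\<^sup>+x. indicator D x * F x \<partial>lborel)"
   by (rule lborel_nn_integral_translation[of "%x. indicator D x * F x"]) measurable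
  finally show "(\<integral>\<^sup>+x. indicator {0..1} t * (indicator D (x + t *\<^sub>R h) * F (x + t *\<^sub>R h)) \<partial>lborel)
   = indicator {0..1} t * (\<integral>\<^sup>+x. indicator D x * F x \<partial>lborel)" .
 qed
 also have "... = (\<integral>\<^sup>+x. indicator D x * F x \<partial>lborel)"
  by (subst nn_integral_multc) auto
 finally show ?thesis .
qed

lemma grad_measurable [measurable]: "smooth \<phi> ==> grad \<phi> \<in> borel_measurable borel"
 by (rule borel_measurable_vecI) (simp add: grad_def smooth_measurable smooth_partial)

lemma smooth_translation:
 fixes D :: "(real^'n::finite) set"
 assumes D: "convex D" and [measurable]: "D \<in> sets borel" and s[measurable]: "smooth \<phi>" and p: "p = 1 \<or> p = (2::nat)"
 shows "(\<integral>\<^sup>+x. indicator D x * indicator D (x + h) * ennreal (\<bar>\<phi> (x + h) - \<phi> x\<bar> ^ p) \<partial>lborel)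
  <= ennreal (norm h ^ p) * (\<integral>\<^sup>+x. indicator D x * ennreal (norm (grad \<phi> x) ^ p) \<partial>lborel)"
proof -
 have [measurable]: "\<phi> \<in> borel_measurable borel" "grad \<phi> \<in> borel_measurable borel" using s by measurable
 have "(\<integral>\<^sup>+x. indicator D x * indicator D (x + h) * ennreal (\<bar>\<phi> (x + h) - \<phi> x\<bar> ^ p) \<partial>lborel)
  <= (\<integral>\<^sup>+x. indicator D x * indicator D (x + h) *
    (\<integral>\<^sup>+t. indicator {0..1} t * ennreal ((norm h * norm (grad \<phi> (x + t *\<^sub>R h))) ^ p) \<partial>lborel) \<partial>lborel)"
  using p increment_le_integral_grad[OF s] by (intro nn_integral_mono mult_left_mono) auto
 also have "... <= (\<integral>\<^sup>+x. indicator D x * ennreal ((norm h * norm (grad \<phi> x)) ^ p) \<partial>lborel)"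
  by (rule segment_average_le[OF D]) measurable
 also have "... = (\<integral>\<^sup>+x. ennreal (norm h ^ p) * (indicator D x * ennreal (norm (grad \<phi> x) ^ p)) \<partial>lborel)"
  by (intro nn_integral_cong) (simp add: power_mult_distrib ennreal_mult mult.left_commute)
 also have "... = ennreal (norm h ^ p) * (\<integral>\<^sup>+x. indicator D x * ennreal (norm (grad \<phi> x) ^ p) \<partial>lborel)"
  by (rule nn_integral_cmult) measurable
 finally show ?thesis .
qed

lemma abs_L2_tendsto_bounded_mult:
 assumes m: "m \<in> LM" "!!x. \<bar>m x\<bar> <= C" "!!n. sq (f n)" "sq f'"
   "L2lim f f'"
 shows "L2lim (%n x. m x * f n x) (%x. m x * f' x)"
proof (subst abs_L2_tendsto_iff)
 show "sq (%x. m x * f n x)" "sq (%x. m x * f' x)" for n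
  using sq_integrable_bounded_mult m by blast+
 have l: "(%n. C^2 * (LEB x. (f n x - f' x)^2)) ----> C^2 * 0"
  using m by (intro tendsto_mult tendsto_const) (simp add: abs_L2_tendsto_iff)
 have "(LEB x. (m x * f n x - m x * f' x)^2) <= C^2 * (LEB x. (f n x - f' x)^2)" for n
 proof -
  have d: "sq (%x. f n x - f' x)" using m sq_integrable_diff by blast
  have "(LEB x. (m x * f n x - m x * f' x)^2) <= (LEB x. C^2 * (f n x - f' x)^2)"
  proof (rule integral_mono)
   show "integrable lebesgue (%x. (m x * f n x - m x * f' x)^2)"
    using sq_integrable_bounded_mult[OF d m(1,2)] by (simp add: sq_integrable_def algebra_simps)
   show "integrable lebesgue (%x. C^2 * (f n x - f' x)^2)" using d by (simp add: sq_integrable_def)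
   show "(m x * f n x - m x * f' x)^2 <= C^2 * (f n x - f' x)^2" for x
   proof -
    have "\<bar>m x\<bar>^2 <= C^2" by (rule power_mono[OF m(2)]) simp
    then have "(m x)^2 * (f n x - f' x)^2 <= C^2 * (f n x - f' x)^2" by (intro mult_right_mono) auto
    moreover have "m x * f n x - m x * f' x = m x * (f n x - f' x)" by (simp add: algebra_simps)
    ultimately show ?thesis by (simp add: power_mult_distrib)
   qed
  qed
  then show ?thesis by simp
 qed
 then show "(%n. LEB x. (m x * f n x - m x * f' x)^2) ----> 0"
  by (rule tendsto_0_sandwich[OF l[simplified], rotated]) simp
qed

lemma abs_L2_norm_tendsto:
 assumes s: "!!n. sqv (g n)" "sqv g'" and l: "!!i. L2lim (%n x. g n x $ i) (%x. g' x $ i)"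
 shows "L2lim (%n x. norm (g n x)) (%x. norm (g' x :: real^'n::finite))"
proof (subst abs_L2_tendsto_iff[OF sqv_norm[OF s(1)] sqv_norm[OF s(2)]])
 have sc: "sq (%x. g n x $ i)" "sq (%x. g' x $ i)" for n i
  using s by (auto simp: sqv_def)
 have "(%n. \<Sum>i\<in>UNIV. LEB x. (g n x $ i - g' x $ i)^2) ----> (\<Sum>i\<in>(UNIV::'n set). 0)"
  using l by (intro tendsto_sum) (simp add: abs_L2_tendsto_iff sc)
 then have t: "(%n. \<Sum>i\<in>UNIV. LEB x. (g n x $ i - g' x $ i)^2) ----> 0" by simp
 have i: "integrable lebesgue (%x. (g n x $ i - g' x $ i)^2)" for n i
  using sq_integrable_diff[OF sc] by (simp add: sq_integrable_def)
 have "(LEB x. (norm (g n x) - norm (g' x))^2) <= (\<Sum>i\<in>UNIV. LEB x. (g n x $ i - g' x $ i)^2)" for n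
 proof -
  have "(LEB x. (norm (g n x) - norm (g' x))^2) <= (LEB x. (\<Sum>i\<in>UNIV. (g n x $ i - g' x $ i)^2))"
  proof (rule integral_mono)
   show "integrable lebesgue (%x. (norm (g n x) - norm (g' x))^2)"
    using sq_integrable_diff[OF sqv_norm[OF s(1)] sqv_norm[OF s(2)]] by (simp add: sq_integrable_def)
   show "integrable lebesgue (%x. \<Sum>i\<in>UNIV. (g n x $ i - g' x $ i)^2)" using i by simp
   fix x
   have "\<bar>norm (g n x) - norm (g' x)\<bar>^2 <= (norm (g n x - g' x))^2" by (intro power_mono norm_triangle_ineq3) simp
   then show "(norm (g n x) - norm (g' x))^2 <= (\<Sum>i\<in>UNIV. (g n x $ i - g' x $ i)^2)" by (simp add: norm_vec_sq)
  qed
  also have "... = (\<Sum>i\<in>UNIV. LEB x. (g n x $ i - g' x $ i)^2)" using i by simp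
  finally show ?thesis .
 qed
 then show "(%n. LEB x. (norm (g n x) - norm (g' x))^2) ----> 0"
  by (rule tendsto_0_sandwich[OF t, rotated]) simp
qed

text \<open>Fatou's lemma handles the left-hand side along approximating test functions. On the
  right the integral of the gradient converges: for \<open>p = 2\<close> it is a squared
  \<open>L2\<close> norm, for \<open>p = 1\<close> an inner product with the indicator of the
  bounded set \<open>D\<close>.\<close>

lemma W_translation:
 fixes D :: "(real^'n::finite) set"
 assumes D: "convex D" and Db[measurable]: "D \<in> sets borel" and W: "W Om v g"
  and [measurable]: "v \<in> borel_measurable borel" "g \<in> borel_measurable borel"
  and p: "p = 1 \<and> bounded D \<or> p = (2::nat)"
 shows "(\<integral>\<^sup>+x. indicator D x * indicator D (x + h) * ennreal (\<bar>v (x + h) - v x\<bar> ^ p) \<partial>lborel)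
  <= ennreal (norm h ^ p) * (\<integral>\<^sup>+x. indicator D x * ennreal (norm (g x) ^ p) \<partial>lborel)"
proof -
 obtain \<phi> where q: "!!n. \<phi> n \<in> test_functions Om" "L2lim \<phi> v"
  "!!i. L2lim (%n x. grad (\<phi> n) x $ i) (%x. g x $ i)" "AEL x. (%n. \<phi> n x) ----> v x" by (rule W_seqE[OF W]) blast
 note sm = test_smooth[OF q(1)]
 have [measurable]: "\<phi> n \<in> borel_measurable borel" "grad (\<phi> n) \<in> borel_measurable borel" for n
  using sm[of n] by measurable
 have sv: "sqv (grad (\<phi> n))" for n by (rule sqv_test[OF q(1)])
 note nt = abs_L2_norm_tendsto[OF sv W_sqv[OF W] q(3)]
 define I where "I f = (\<integral>\<^sup>+x. indicator D x * ennreal (norm (f x) ^ p) \<partial>lborel)" for f :: "real^'n => real^'n"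
 have lim: "(%n. I (grad (\<phi> n))) ----> I g \<and> I g < top"
  using p
 proof
  assume p: "p = 1 \<and> bounded D"
  have Dl: "D \<in> lmeasurable" using p by (intro bounded_set_imp_lmeasurable) auto
  have s1: "sq (indicator D :: _ => real)"
  proof -
   have "(%x. (indicator D x :: real)^2) = indicator D" by (auto simp: indicator_def)
   then show ?thesis using Dl by (simp add: sq_integrable_def lmeasurable_iff_integrable)
  qed
  have e: "I f = ennreal (abs_L2 (indicator D) \<bullet> abs_L2 (%x. norm (f x)))" if f: "sqv f" "f \<in> borel_measurable borel" for f
  proof -
   have "I f = (\<integral>\<^sup>+x. ennreal (indicator D x * norm (f x)) \<partial>lebesgue)"
    unfolding nn_integral_lebesgue I_def using p by (intro nn_integral_cong) (auto simp: indicator_def)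
   also have "... = ennreal (LEB x. indicator D x * norm (f x))"
    by (rule nn_integral_eq_integral[OF sq_integrable_mult[OF s1 sqv_norm[OF f(1)]]]) auto
   finally show ?thesis by (simp add: inner_abs_L2[OF s1 sqv_norm[OF f(1)]])
  qed
  have e1: "I (grad (\<phi> n)) = ennreal (abs_L2 (indicator D) \<bullet> abs_L2 (%x. norm (grad (\<phi> n) x)))" for n
   by (rule e[OF sv]) measurable
  have e2: "I g = ennreal (abs_L2 (indicator D) \<bullet> abs_L2 (%x. norm (g x)))"
   by (rule e[OF W_sqv[OF W]]) measurable
  show ?thesis unfolding e1 e2 by (intro conjI tendsto_ennrealI tendsto_inner tendsto_const nt) simp
 next
  assume p: "p = 2"
  have mD: "(indicator D :: _ => real) \<in> LM" by (rule borel_imp_lebesgue) measurable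
  have mb: "\<bar>indicator D x :: real\<bar> <= 1" for x by (simp add: indicator_def)
  have e: "I f = ennreal ((norm (abs_L2 (%x. indicator D x * norm (f x))))^2)" if f: "sqv f" for f
  proof -
   have "I f = (\<integral>\<^sup>+x. ennreal ((indicator D x * norm (f x))^2) \<partial>lebesgue)"
    unfolding nn_integral_lebesgue I_def using p by (intro nn_integral_cong) (auto simp: indicator_def)
   also have "... = ennreal ((norm (abs_L2 (%x. indicator D x * norm (f x))))^2)"
    by (rule norm_L2_nn[OF sq_integrable_bounded_mult[OF sqv_norm[OF f] mD mb]])
   finally show ?thesis .
  qed
  have "L2lim (%n x. indicator D x * norm (grad (\<phi> n) x)) (%x. indicator D x * norm (g x))"
   by (rule abs_L2_tendsto_bounded_mult[OF mD mb sqv_norm[OF sv] sqv_norm[OF W_sqv[OF W]] nt])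
  then show ?thesis unfolding e[OF sv] e[OF W_sqv[OF W]] by (intro conjI tendsto_ennrealI tendsto_intros) simp_all
 qed
 have ae: "AE x in lborel. (%n. \<phi> n x) ----> v x" using q(4) by (simp add: AE_completion_iff)
 \<comment> \<open>Translations preserve null sets, so the approximation also converges at almost
   every shifted point.\<close>
 have aeh: "AE x in lborel. (%n. \<phi> n (x + h)) ----> v (x + h)"
 proof -
  have "AE x in distr lborel borel ((+) h). (%n. \<phi> n x) ----> v x" by (subst lborel_distr_plus) (rule ae)
  from AE_distrD[OF _ this] show ?thesis by (simp add: add.commute)
 qed
 have "(\<integral>\<^sup>+x. indicator D x * indicator D (x + h) * ennreal (\<bar>v (x + h) - v x\<bar> ^ p) \<partial>lborel)
  = (\<integral>\<^sup>+x. liminf (%n. indicator D x * indicator D (x + h) * ennreal (\<bar>\<phi> n (x + h) - \<phi> n x\<bar> ^ p)) \<partial>lborel)"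
 proof (rule nn_integral_cong_AE, use ae aeh in eventually_elim)
  fix x assume a: "(%n. \<phi> n x) ----> v x" "(%n. \<phi> n (x + h)) ----> v (x + h)"
  have "(%n. indicator D x * indicator D (x + h) * ennreal (\<bar>\<phi> n (x + h) - \<phi> n x\<bar> ^ p))
   ----> indicator D x * indicator D (x + h) * ennreal (\<bar>v (x + h) - v x\<bar> ^ p)"
   by (intro tendsto_mult_ennreal tendsto_const tendsto_ennrealI tendsto_power tendsto_rabs tendsto_diff a)
    (auto simp: indicator_def)
  then show "indicator D x * indicator D (x + h) * ennreal (\<bar>v (x + h) - v x\<bar> ^ p)
   = liminf (%n. indicator D x * indicator D (x + h) * ennreal (\<bar>\<phi> n (x + h) - \<phi> n x\<bar> ^ p))"
   by (intro lim_imp_Liminf[symmetric]) auto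
 qed
 also have "... <= liminf (%n. \<integral>\<^sup>+x. indicator D x * indicator D (x + h) * ennreal (\<bar>\<phi> n (x + h) - \<phi> n x\<bar> ^ p) \<partial>lborel)"
  by (rule nn_integral_liminf) measurable
 also have "... <= liminf (%n. ennreal (norm h ^ p) * I (grad (\<phi> n)))"
  unfolding I_def using p by (intro Liminf_mono always_eventually allI smooth_translation[OF D Db sm]) auto
 also have "... = ennreal (norm h ^ p) * I g"
  by (intro lim_imp_Liminf tendsto_mult_ennreal tendsto_const conjunct1[OF lim]) (use lim in auto)
 finally show ?thesis by (simp add: I_def)
qed

text \<open>Substituting \<open>z = x + h\<close> and integrating over \<open>h\<close> last reduces
  the double integral to translation estimates with \<open>norm h <= d\<close>.\<close>

lemma double_integral_le:
 fixes D :: "(real^'n::finite) set" and \<kappa> :: "(real^'n) \<times> (real^'n) => ennreal"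
 assumes [measurable]: "D \<in> sets borel" "\<kappa> \<in> borel_measurable borel"
  and d: "!!x z. x \<in> D ==> z \<in> D ==> norm (z - x) <= d"
  and t: "!!h. (\<integral>\<^sup>+x. indicator D x * indicator D (x + h) * \<kappa> (x, x + h) \<partial>lborel) <= ennreal (norm h ^ p) * G"
 shows "(\<integral>\<^sup>+x. \<integral>\<^sup>+z. indicator D x * indicator D z * \<kappa> (x, z) \<partial>lborel \<partial>lborel) <= emeasure lborel (cball (0::real^'n) d) * (ennreal (d ^ p) * G)"
proof -
 have [measurable]: "cball (0::real^'n) d \<in> sets borel" by simp
 have "(\<integral>\<^sup>+x. \<integral>\<^sup>+z. indicator D x * indicator D z * \<kappa> (x, z) \<partial>lborel \<partial>lborel)
  = (\<integral>\<^sup>+x. \<integral>\<^sup>+h. indicator D x * indicator D (h + x) * \<kappa> (x, h + x) \<partial>lborel \<partial>lborel)"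
  by (intro nn_integral_cong lborel_nn_integral_translation[symmetric]) measurable
 also have "... <= (\<integral>\<^sup>+x. \<integral>\<^sup>+h. indicator (cball 0 d) h * (indicator D x * indicator D (x + h) * \<kappa> (x, x + h)) \<partial>lborel \<partial>lborel)"
 proof (intro nn_integral_mono)
  fix x h :: "real^'n"
  show "indicator D x * indicator D (h + x) * \<kappa> (x, h + x)
   <= indicator (cball 0 d) h * (indicator D x * indicator D (x + h) * \<kappa> (x, x + h))"
   using d[of x "x + h"] by (auto simp: indicator_def add.commute)
 qed
 also have "... = (\<integral>\<^sup>+h. \<integral>\<^sup>+x. indicator (cball 0 d) h * (indicator D x * indicator D (x + h) * \<kappa> (x, x + h)) \<partial>lborel \<partial>lborel)"
  by (rule lborel_pair.Fubini') measurable
 also have "... = (\<integral>\<^sup>+h. indicator (cball 0 d) h * (\<integral>\<^sup>+x. indicator D x * indicator D (x + h) * \<kappa> (x, x + h) \<partial>lborel) \<partial>lborel)"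
  by (intro nn_integral_cong nn_integral_cmult) measurable
 also have "... <= (\<integral>\<^sup>+h. indicator (cball (0::real^'n) d) h * (ennreal (d ^ p) * G) \<partial>lborel)"
 proof (intro nn_integral_mono)
  fix h :: "real^'n"
  have "(\<integral>\<^sup>+x. indicator D x * indicator D (x + h) * \<kappa> (x, x + h) \<partial>lborel) <= ennreal (d ^ p) * G" if "norm h <= d"
  proof -
   have "ennreal (norm h ^ p) * G <= ennreal (d ^ p) * G"
    using that by (intro mult_right_mono ennreal_leI power_mono) auto
   with t[of h] show ?thesis by (rule order_trans)
  qed
  then show "indicator (cball 0 d) h * (\<integral>\<^sup>+x. indicator D x * indicator D (x + h) * \<kappa> (x, x + h) \<partial>lborel)
   <= indicator (cball 0 d) h * (ennreal (d ^ p) * G)" by (auto simp: indicator_def)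
 qed
 also have "... = emeasure lborel (cball (0::real^'n) d) * (ennreal (d ^ p) * G)"
  by (subst nn_integral_multc) auto
 finally show ?thesis .
qed

text \<open>A Poincare inequality without mean values. With \<open>p = 1\<close> it yields the
  isoperimetric inequality, with \<open>p = 2\<close> the variance bound on the cells of a
  grid.\<close>

lemma poincare_double:
 fixes D :: "(real^'n::finite) set"
 assumes D: "convex D" "D \<in> sets borel" and W: "W Om v g"
  and [measurable]: "v \<in> borel_measurable borel" "g \<in> borel_measurable borel"
  and p: "p = 1 \<and> bounded D \<or> p = (2::nat)"
  and d: "!!x z. x \<in> D ==> z \<in> D ==> norm (z - x) <= d"
 shows "(\<integral>\<^sup>+x. \<integral>\<^sup>+z. indicator D x * indicator D z * ennreal (\<bar>v z - v x\<bar> ^ p) \<partial>lborel \<partial>lborel)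
  <= emeasure lborel (cball (0::real^'n) d) * (ennreal (d ^ p) * (\<integral>\<^sup>+x. indicator D x * ennreal (norm (g x) ^ p) \<partial>lborel))"
proof -
 define \<kappa> where "\<kappa> = (%(x, z). ennreal (\<bar>v z - v x\<bar> ^ p))"
 have k: "\<kappa> \<in> borel_measurable borel"
  unfolding \<kappa>_def borel_prod[symmetric] by measurable
 have "(\<integral>\<^sup>+x. \<integral>\<^sup>+z. indicator D x * indicator D z * \<kappa> (x, z) \<partial>lborel \<partial>lborel)
  <= emeasure lborel (cball (0::real^'n) d) * (ennreal (d ^ p) * (\<integral>\<^sup>+x. indicator D x * ennreal (norm (g x) ^ p) \<partial>lborel))"
 proof (rule double_integral_le[OF D(2) k d])
  show "(\<integral>\<^sup>+x. indicator D x * indicator D (x + h) * \<kappa> (x, x + h) \<partial>lborel)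
   <= ennreal (norm h ^ p) * (\<integral>\<^sup>+x. indicator D x * ennreal (norm (g x) ^ p) \<partial>lborel)" for h
   unfolding \<kappa>_def prod.case by (rule W_translation[OF D W _ _ p]) measurable
 qed
 then show ?thesis by (simp add: \<kappa>_def)
qed

lemma cube_emeasure:
 assumes "s \<ge> 0"
 shows "emeasure lborel (cbox (0::real^'n::finite) (\<chi> i. s)) = ennreal (s ^ CARD('n))"
proof -
 have b: "(\<chi> i. s) \<bullet> b = s" if "b \<in> Basis" for b :: "real^'n"
  using that by (auto simp: Basis_vec_def inner_axis)
 have "emeasure lborel (cbox (0::real^'n) (\<chi> i. s)) = ennreal (\<Prod>b\<in>(Basis::(real^'n) set). ((\<chi> i. s) - 0) \<bullet> b)"
  by (rule emeasure_lborel_cbox) (use assms b in auto)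
 also have "(\<Prod>b\<in>(Basis::(real^'n) set). ((\<chi> i. s) - 0) \<bullet> b) = (\<Prod>b\<in>(Basis::(real^'n) set). s)"
  by (intro prod.cong) (use b in auto)
 also have "... = s ^ CARD('n)" by simp
 finally show ?thesis .
qed

lemma cube_norm_le:
 assumes "h \<in> cbox (0::real^'n::finite) (\<chi> i. s)"
 shows "norm h <= real CARD('n) * s"
proof -
 have "norm h <= (\<Sum>i\<in>UNIV. \<bar>h $ i\<bar>)" by (rule norm_le_l1_cart)
 also have "... <= (\<Sum>i\<in>(UNIV::'n set). s)"
  using assms by (intro sum_mono) (auto simp: mem_box_cart)
 finally show ?thesis by simp
qed

text \<open>If \<open>v\<close> vanishes off a set which is small compared with a cube \<open>Q\<close>, then the average over
 \<open>h \<in> Q\<close> of \<open>v (x + h)^2\<close> for \<open>x\<close> in that set is at most a quarter of the mass of \<open>v^2\<close>, so the mass is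
 controlled by the increments \<open>v (x + h) - v x\<close>.\<close>

lemma faber_krahn:
 fixes v :: "real^'n::finite => real"
 assumes W: "W Om v g" and A: "A \<in> lmeasurable" "AEL x. x \<notin> A --> v x = 0"
  and s: "s > 0" "4 * measure lebesgue A <= s ^ CARD('n)"
 shows "(LEB x. (v x)^2) <= 4 * (real CARD('n) * s)^2 * (LEB x. (norm (g x))^2)"
proof -
 obtain v' g' where vb[measurable]: "v' \<in> borel_measurable borel" "g' \<in> borel_measurable borel"
  and eq: "AEL x. v x = v' x" "AEL x. g x = g' x" and W': "W Om v' g'"
  by (rule W_borel[OF W])
 define S where "S = {x. v' x \<noteq> 0}"
 have Sb[measurable]: "S \<in> sets borel" unfolding S_def by measurable
 have Sm: "S \<in> sets lebesgue" using Sb by simp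
 define a where "a = measure lebesgue A"
 have "emeasure lebesgue S <= emeasure lebesgue A"
  using A eq(1) by (intro emeasure_mono_AE) (auto simp: S_def fmeasurableD elim: eventually_elim2)
 also have "emeasure lebesgue A = ennreal a" using A(1) by (simp add: a_def emeasure_eq_measure2)
 finally have Sa: "emeasure lborel S <= ennreal a" using Sb by simp
 define N where "N = real CARD('n)"
 define q where "q = s ^ CARD('n)"
 have q: "q > 0" using s(1) by (simp add: q_def)
 define Q where "Q = cbox (0::real^'n) (\<chi> i. s)"
 have [measurable]: "Q \<in> sets borel" by (simp add: Q_def)
 have Qe: "emeasure lborel Q = ennreal q" using cube_emeasure[of s] s(1) by (simp add: Q_def q_def)
 define i where "i = (LEB x. (v' x)^2)"
 define G where "G = (LEB x. (norm (g' x))^2)"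
 have iG: "i \<ge> 0" "G \<ge> 0" by (simp_all add: i_def G_def)
 have I: "(\<integral>\<^sup>+x. ennreal ((v' x)^2) \<partial>lborel) = ennreal i"
  unfolding nn_integral_lebesgue[symmetric] i_def
  using W_sq[OF W'] by (intro nn_integral_eq_integral) (auto simp: sq_integrable_def)
 have GI: "(\<integral>\<^sup>+x. ennreal ((norm (g' x))^2) \<partial>lborel) = ennreal G"
  unfolding nn_integral_lebesgue[symmetric] G_def
  using sqv_norm[OF W_sqv[OF W']] by (intro nn_integral_eq_integral) (auto simp: sq_integrable_def)
 \<comment> \<open>The part of the mass of \<open>v'^2\<close> at shifted points that is seen from
   \<open>S\<close>; \<open>KI\<close> shows that its integral over all \<open>h\<close> is the
   product of the measure of \<open>S\<close> and the full mass.\<close>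
 define K where "K h = (\<integral>\<^sup>+x. indicator S x * ennreal ((v' (x + h))^2) \<partial>lborel)" for h
 have K[measurable]: "K \<in> borel_measurable borel"
 proof -
  have "(%h. \<integral>\<^sup>+x. indicator S x * ennreal ((v' (x + h))^2) \<partial>lborel) \<in> borel_measurable lborel"
   by (rule lborel.borel_measurable_nn_integral) measurable
  then show ?thesis by (simp add: K_def[abs_def])
 qed
 have step: "ennreal i <= ennreal (2 * (N * s)^2 * G) + 2 * K h" if h: "h \<in> Q" for h
 proof -
  have hN: "norm h <= N * s" using cube_norm_le h by (auto simp: Q_def N_def)
  have "(\<integral>\<^sup>+x. ennreal (\<bar>v' (x + h) - v' x\<bar>^2) \<partial>lborel) <= ennreal ((norm h)^2) * ennreal G"
   using W_translation[of UNIV Om v' g' 2 h, OF _ _ W'] by (simp add: GI)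
  also have "... <= ennreal ((N * s)^2 * G)"
   using hN iG by (simp add: ennreal_mult[symmetric] mult_right_mono power_mono)
  finally have T: "(\<integral>\<^sup>+x. ennreal ((v' (x + h) - v' x)^2) \<partial>lborel) <= ennreal ((N * s)^2 * G)" by simp
  have "ennreal i <= (\<integral>\<^sup>+x. 2 * ennreal ((v' (x + h) - v' x)^2) + 2 * (indicator S x * ennreal ((v' (x + h))^2)) \<partial>lborel)"
   unfolding I[symmetric]
  proof (intro nn_integral_mono)
   fix x
   have "(v' x)^2 <= 2 * (v' (x + h) - v' x)^2 + 2 * (v' (x + h))^2"
    using sum_squares_ge_zero[of "v' x - 2 * v' (x + h)" 0] by (simp add: power2_eq_square algebra_simps)
   then have "ennreal ((v' x)^2) <= ennreal (2 * (v' (x + h) - v' x)^2 + 2 * (v' (x + h))^2)" by (rule ennreal_leI)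
   also have "... = 2 * ennreal ((v' (x + h) - v' x)^2) + 2 * ennreal ((v' (x + h))^2)"
    by (simp add: ennreal_mult)
   finally show "ennreal ((v' x)^2) <= 2 * ennreal ((v' (x + h) - v' x)^2) + 2 * (indicator S x * ennreal ((v' (x + h))^2))"
    by (auto simp: S_def indicator_def)
  qed
  also have "... = 2 * (\<integral>\<^sup>+x. ennreal ((v' (x + h) - v' x)^2) \<partial>lborel) + 2 * K h"
   unfolding K_def by (simp add: nn_integral_add nn_integral_cmult)
  also have "... <= 2 * ennreal ((N * s)^2 * G) + 2 * K h" using T by (intro add_mono mult_left_mono) auto
  also have "2 * ennreal ((N * s)^2 * G) = ennreal (2 * (N * s)^2 * G)"
   using iG by (simp add: ennreal_mult mult.assoc)
  finally show ?thesis .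
 qed
 have KI: "(\<integral>\<^sup>+h. K h \<partial>lborel) = emeasure lborel S * ennreal i"
 proof -
  have "(\<integral>\<^sup>+h. K h \<partial>lborel) = (\<integral>\<^sup>+x. \<integral>\<^sup>+h. indicator S x * ennreal ((v' (x + h))^2) \<partial>lborel \<partial>lborel)"
   unfolding K_def by (rule lborel_pair.Fubini') measurable
  also have "... = (\<integral>\<^sup>+x. indicator S x * ennreal i \<partial>lborel)"
  proof (intro nn_integral_cong)
   fix x
   have "(\<integral>\<^sup>+h. ennreal ((v' (x + h))^2) \<partial>lborel) = ennreal i"
    using lborel_nn_integral_translation[of "%z. ennreal ((v' z)^2)" x] by (simp add: I add.commute)
   then show "(\<integral>\<^sup>+h. indicator S x * ennreal ((v' (x + h))^2) \<partial>lborel) = indicator S x * ennreal i"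
    by (simp add: nn_integral_cmult)
  qed
  also have "... = emeasure lborel S * ennreal i" by (subst nn_integral_multc) auto
  finally show ?thesis .
 qed
 have "ennreal (q * i) = (\<integral>\<^sup>+h. indicator Q h * ennreal i \<partial>lborel)"
  using q iG by (subst nn_integral_multc) (auto simp: Qe ennreal_mult)
 also have "... <= (\<integral>\<^sup>+h. indicator Q h * ennreal (2 * (N * s)^2 * G) + 2 * K h \<partial>lborel)"
  using step by (intro nn_integral_mono) (auto simp: indicator_def)
 also have "... = ennreal q * ennreal (2 * (N * s)^2 * G) + 2 * (emeasure lborel S * ennreal i)"
  by (simp add: nn_integral_add nn_integral_cmult nn_integral_multc Qe KI)
 also have "... <= ennreal q * ennreal (2 * (N * s)^2 * G) + 2 * (ennreal a * ennreal i)"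
  using Sa by (intro add_left_mono mult_left_mono mult_right_mono) auto
 also have "... = ennreal (q * (2 * (N * s)^2 * G) + 2 * (a * i))"
  using q iG by (simp add: ennreal_mult a_def)
 finally have "q * i <= q * (2 * (N * s)^2 * G) + 2 * (a * i)"
  using q iG by (subst (asm) ennreal_le_iff) (auto simp: a_def)
 \<comment> \<open>Since the measure of \<open>S\<close> is at most a quarter of the volume
   \<open>q\<close> of the cube, the last term absorbs no more than half of the left-hand
   side.\<close>
 moreover have "4 * a * i <= q * i" using s(2) iG by (intro mult_right_mono) (auto simp: a_def q_def)
 ultimately have "q * i <= q * (4 * (N * s)^2 * G)" by (simp add: algebra_simps)
 then have fin: "i <= 4 * (N * s)^2 * G" using q by simp
 have "(LEB x. (v x)^2) = i"
  unfolding i_def using W_sq[OF W] W_sq[OF W'] eq(1)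
  by (intro integral_cong_AE) (auto simp: sq_integrable_def elim: eventually_mono)
 moreover have "(LEB x. (norm (g x))^2) = G"
  unfolding G_def using sqv_norm[OF W_sqv[OF W]] sqv_norm[OF W_sqv[OF W']] eq(2)
  by (intro integral_cong_AE) (auto simp: sq_integrable_def elim: eventually_mono)
 ultimately show ?thesis using fin by (simp add: N_def)
qed

section \<open>De Giorgi's isoperimetric inequality on balls\<close>

definition vol1 :: "'n::finite itself => real" where
 "vol1 _ = measure lebesgue (ball (0::real^'n) 1)"

lemma ball_measure:
 assumes "r \<ge> 0"
 shows "measure lebesgue (ball (c::real^'n::finite) r) = vol1 TYPE('n) * r ^ CARD('n)"
 using content_ball[OF assms, of c] content_ball[of 1 "0::real^'n"] by (simp add: vol1_def)

lemma vol1_pos: "vol1 TYPE('n::finite) > 0"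
 unfolding vol1_def by simp

text \<open>Between a point of \<open>A\<close> and a point of \<open>B\<close> the function
  \<open>w\<close> increases by at least \<open>m\<close>; hence the left-hand side is at most the
  double integral of the increments over the ball, to which \<open>poincare_double\<close> with
  \<open>p = 1\<close> applies.\<close>

lemma de_giorgi_isoperimetric:
 fixes w :: "real^'n::finite => real"
 assumes W: "W Om w g" and r: "r > 0" and m: "m \<ge> 0"
  and A: "A \<subseteq> ball c r" "A \<in> sets lebesgue" "AEL x. x \<in> A --> w x <= 0"
  and B: "B \<subseteq> ball c r" "B \<in> sets lebesgue" "AEL x. x \<in> B --> m <= w x"
 shows "m * measure lebesgue A * measure lebesgue B
  <= 2 * r * (vol1 TYPE('n) * (2 * r) ^ CARD('n)) * (LEB x. indicator (ball c r) x * norm (g x))"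
proof -
 obtain v g' where vb[measurable]: "v \<in> borel_measurable borel" "g' \<in> borel_measurable borel"
  and eq: "AEL x. w x = v x" "AEL x. g x = g' x" and W': "W Om v g'"
  by (rule W_borel[OF W])
 define D where "D = ball c r"
 have Db[measurable]: "D \<in> sets borel" and Dc: "convex D" "bounded D" by (auto simp: D_def)
 define A' B' where "A' = {x\<in>D. v x <= 0}" and "B' = {x\<in>D. m <= v x}"
 have ABb[measurable]: "A' \<in> sets borel" "B' \<in> sets borel" unfolding A'_def B'_def by measurable
 have fin: "S \<in> lmeasurable" if "S \<subseteq> D" "S \<in> sets lebesgue" for S
  using that Dc bounded_subset bounded_set_imp_lmeasurable by blast
 have le: "emeasure lebesgue A <= emeasure lborel A'" "emeasure lebesgue B <= emeasure lborel B'"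
 proof -
  have "emeasure lebesgue A <= emeasure lebesgue A'"
  proof (rule emeasure_mono_AE)
   show "AEL x. x \<in> A --> x \<in> A'"
    using A(3) eq(1) by eventually_elim (use A(1) in \<open>auto simp: A'_def D_def\<close>)
  qed (use ABb in auto)
  then show "emeasure lebesgue A <= emeasure lborel A'" using ABb by simp
  have "emeasure lebesgue B <= emeasure lebesgue B'"
  proof (rule emeasure_mono_AE)
   show "AEL x. x \<in> B --> x \<in> B'"
    using B(3) eq(1) by eventually_elim (use B(1) in \<open>auto simp: B'_def D_def\<close>)
  qed (use ABb in auto)
  then show "emeasure lebesgue B <= emeasure lborel B'" using ABb by simp
 qed
 have s1: "sq (indicator D :: _ => real)"
 proof -
  have "(%x. (indicator D x :: real)^2) = indicator D" by (auto simp: indicator_def)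
  moreover have "D \<in> lmeasurable" using Db by (intro fin) auto
  ultimately show ?thesis by (simp add: sq_integrable_def lmeasurable_iff_integrable)
 qed
 define J where "J = (LEB x. indicator D x * norm (g' x))"
 have J0: "J \<ge> 0" unfolding J_def by (intro Bochner_Integration.integral_nonneg) auto
 have J: "(\<integral>\<^sup>+x. indicator D x * ennreal (norm (g' x)) \<partial>lborel) = ennreal J"
 proof -
  have "(\<integral>\<^sup>+x. indicator D x * ennreal (norm (g' x)) \<partial>lborel) = (\<integral>\<^sup>+x. ennreal (indicator D x * norm (g' x)) \<partial>lebesgue)"
   unfolding nn_integral_lebesgue by (intro nn_integral_cong) (auto simp: indicator_def)
  also have "... = ennreal J" unfolding J_def
   by (rule nn_integral_eq_integral[OF sq_integrable_mult[OF s1 sqv_norm[OF W_sqv[OF W']]]]) auto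
  finally show ?thesis .
 qed
 have cb: "emeasure lborel (cball (0::real^'n) (2 * r)) = ennreal (vol1 TYPE('n) * (2 * r) ^ CARD('n))"
 proof -
  have "emeasure lborel (cball (0::real^'n) (2 * r)) = ennreal (measure lborel (cball (0::real^'n) (2 * r)))"
   using emeasure_lborel_cball_finite by (intro emeasure_eq_ennreal_measure) (auto simp: less_top)
  also have "measure lborel (cball (0::real^'n) (2 * r)) = vol1 TYPE('n) * (2 * r) ^ CARD('n)"
   using content_cball_conv_ball[of "0::real^'n" "2 * r"] ball_measure[of "2 * r" "0::real^'n"] r by simp
  finally show ?thesis .
 qed
 have "ennreal m * emeasure lborel A' * emeasure lborel B'
  = (\<integral>\<^sup>+x. indicator A' x * (ennreal m * emeasure lborel B') \<partial>lborel)"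
  by (subst nn_integral_multc) (auto simp: ac_simps)
 also have "... = (\<integral>\<^sup>+x. \<integral>\<^sup>+z. indicator A' x * (ennreal m * indicator B' z) \<partial>lborel \<partial>lborel)"
  by (simp add: nn_integral_cmult)
 also have "... <= (\<integral>\<^sup>+x. \<integral>\<^sup>+z. indicator D x * indicator D z * ennreal (\<bar>v z - v x\<bar> ^ 1) \<partial>lborel \<partial>lborel)"
  by (intro nn_integral_mono) (auto simp: indicator_def A'_def B'_def intro!: ennreal_leI)
 also have "... <= emeasure lborel (cball (0::real^'n) (2 * r)) * (ennreal ((2 * r) ^ 1) * (\<integral>\<^sup>+x. indicator D x * ennreal (norm (g' x) ^ 1) \<partial>lborel))"
 proof (rule poincare_double[OF Dc(1) Db W' vb])
  fix x z assume "x \<in> D" "z \<in> D"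
  then have "dist c x < r" "dist c z < r" by (auto simp: D_def)
  then show "norm (z - x) <= 2 * r" using dist_triangle[of z x c] by (simp add: dist_norm norm_minus_commute)
 qed (use Dc in auto)
 also have "... = ennreal (2 * r * (vol1 TYPE('n) * (2 * r) ^ CARD('n)) * J)"
  unfolding cb power_one_right J
  using r J0 vol1_pos[where 'n='n] by (simp add: ennreal_mult[symmetric] mult_ac)
 finally have "ennreal m * emeasure lborel A' * emeasure lborel B' <= ennreal (2 * r * (vol1 TYPE('n) * (2 * r) ^ CARD('n)) * J)" .
 moreover have "ennreal (m * measure lebesgue A * measure lebesgue B) <= ennreal m * emeasure lborel A' * emeasure lborel B'"
 proof -
  have "ennreal (m * measure lebesgue A * measure lebesgue B) = ennreal m * emeasure lebesgue A * emeasure lebesgue B"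
   using fin[of A] fin[of B] A B m by (simp add: ennreal_mult emeasure_eq_measure2 D_def)
  also have "... <= ennreal m * emeasure lborel A' * emeasure lborel B'" using le by (intro mult_mono) auto
  finally show ?thesis .
 qed
 ultimately have "ennreal (m * measure lebesgue A * measure lebesgue B) <= ennreal (2 * r * (vol1 TYPE('n) * (2 * r) ^ CARD('n)) * J)"
  by (rule order_trans[rotated])
 then have "m * measure lebesgue A * measure lebesgue B <= 2 * r * (vol1 TYPE('n) * (2 * r) ^ CARD('n)) * J"
  using r J0 vol1_pos[where 'n='n] by (subst (asm) ennreal_le_iff) auto
 moreover have "(LEB x. indicator (ball c r) x * norm (g x)) = J"
  unfolding J_def D_def[symmetric]
 proof (rule integral_cong_AE)
  have [measurable]: "D \<in> sets lebesgue" "g \<in> LM" "g' \<in> LM"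
   using Db sqv_measurable[OF W_sqv[OF W]] sqv_measurable[OF W_sqv[OF W']] by auto
  show "(%x. indicator D x * norm (g x)) \<in> LM" by measurable
  show "(%x. indicator D x * norm (g' x)) \<in> LM" by measurable
  show "AEL x. indicator D x * norm (g x) = indicator D x * norm (g' x)"
   using eq(2) by eventually_elim simp
 qed
 ultimately show ?thesis by simp
qed

declare smooth_measurable [measurable del] grad_measurable [measurable del]

section \<open>De Giorgi classes\<close>

text \<open>Fixes one constant from \<open>cutoff_exists\<close> for each dimension, so that it can
  be named in the constants of later estimates.\<close>

definition cutK :: "'n::finite itself => real" where
 "cutK _ = (SOME K. K > 0 \<and> (\<forall>(c::real^'n) \<rho> r. 0 < \<rho> --> \<rho> < r --> (\<exists>\<eta>. smooth \<eta> \<and> (\<forall>x. 0 <= \<eta> x \<and> \<eta> x <= 1) \<and>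
  (\<forall>x\<in>cball c \<rho>. \<eta> x = 1) \<and> (\<forall>x. x \<notin> ball c r --> \<eta> x = 0) \<and> (\<forall>x. norm (grad \<eta> x) <= K / (r - \<rho>)))))"

lemma cutK_spec:
 "cutK TYPE('n::finite) > 0 \<and> (\<forall>(c::real^'n) \<rho> r. 0 < \<rho> --> \<rho> < r --> (\<exists>\<eta>. smooth \<eta> \<and> (\<forall>x. 0 <= \<eta> x \<and> \<eta> x <= 1) \<and>
  (\<forall>x\<in>cball c \<rho>. \<eta> x = 1) \<and> (\<forall>x. x \<notin> ball c r --> \<eta> x = 0) \<and> (\<forall>x. norm (grad \<eta> x) <= cutK TYPE('n) / (r - \<rho>))))"
 unfolding cutK_def using cutoff_exists[where 'n='n] by (rule someI_ex)

lemma cutK_pos: "cutK TYPE('n::finite) > 0" using cutK_spec by blast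

lemma cutoffE:
 fixes c :: "real^'n::finite"
 assumes "0 < \<rho>" "\<rho> < r"
 obtains \<eta> where "smooth \<eta>" "!!x. 0 <= \<eta> x" "!!x. \<eta> x <= 1" "!!x. x \<in> cball c \<rho> ==> \<eta> x = 1"
  "!!x. x \<notin> ball c r ==> \<eta> x = 0" "!!x. norm (grad \<eta> x) <= cutK TYPE('n) / (r - \<rho>)"
 using cutK_spec[where 'n='n] assms by metis

text \<open>Points with value 0 or 1 are extrema. So the gradient of a cut-off function vanishes off
  the outer ball and on the inner one, also at boundary points where the function is not locally
  constant.\<close>

lemma grad_extremum:
 assumes s: "smooth \<eta>" and b: "!!x. 0 <= \<eta> x" "!!x. \<eta> x <= 1" and x: "\<eta> x = 0 \<or> \<eta> x = 1"
 shows "grad \<eta> x = 0"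
proof -
 have "(%h. grad \<eta> x \<bullet> h) = (%h. 0)"
  by (rule differential_zero_maxmin[OF _ open_UNIV smooth_has_derivative[OF s]]) (use b x in auto)
 then have "grad \<eta> x \<bullet> grad \<eta> x = 0" by meson
 then show ?thesis by simp
qed

text \<open>The Caccioppoli inequalities on \<open>ball c R\<close> for the truncations at levels from \<open>k0\<close> on; they are all
 that the following estimates use of an elliptic equation.\<close>

definition DG :: "real => real => real^'n::finite => real => (real^'n => real) => (real^'n => real^'n) => bool" where
 "DG C k0 c R u g \<longleftrightarrow> sq u \<and> sqv g \<and>
 (\<forall>k\<ge>k0. \<forall>\<eta> B. smooth \<eta> --> (\<forall>x. 0 <= \<eta> x \<and> \<eta> x <= 1) --> (\<forall>x. norm (grad \<eta> x) <= B) --> (\<forall>x. x \<notin> ball c R --> \<eta> x = 0) -->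
  W UNIV (%x. \<eta> x * max 0 (u x - k)) (%x. \<eta> x *\<^sub>R (if u x > k then g x else 0) + max 0 (u x - k) *\<^sub>R grad \<eta> x) \<and>
  (LEB x. (\<eta> x)^2 * (norm (if u x > k then g x else 0))^2)
   <= C^2 * (LEB x. (max 0 (u x - k))^2 * (norm (grad \<eta> x))^2))"

lemma sq_integrable_indicator:
 assumes "A \<in> lmeasurable"
 shows "sq (indicator A :: _ => real)"
proof -
 have "(%x. (indicator A x :: real)^2) = indicator A" by (auto simp: indicator_def)
 then show ?thesis using assms by (simp add: sq_integrable_def lmeasurable_iff_integrable)
qed

lemma sq_integrable_trunc_ball:
 assumes "sq (u :: real^'n::finite => real)"
 shows "sq (%x. indicator (ball c r) x * max 0 (u x - k))"
proof (rule sq_integrable_bound)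
 show "sq (%x. \<bar>u x\<bar> + \<bar>k\<bar> * indicator (ball c r) x)"
 proof (intro sq_integrable_add sq_integrable_scale sq_integrable_indicator)
  show "sq (%x. \<bar>u x\<bar>)"
   by (rule sq_integrable_bound[OF assms]) (use sq_integrable_measurable[OF assms] in auto)
 qed simp
 have [measurable]: "u \<in> LM" "ball c r \<in> sets lebesgue"
  using sq_integrable_measurable[OF assms] by auto
 show "(%x. indicator (ball c r) x * max 0 (u x - k)) \<in> LM" by measurable
 show "AEL x. \<bar>indicator (ball c r) x * max 0 (u x - k)\<bar> <= \<bar>\<bar>u x\<bar> + \<bar>k\<bar> * indicator (ball c r) x\<bar>"
  by (intro AE_I2) (auto simp: indicator_def)
qed

lemma sq_integrable_trunc_grad:
 assumes u: "sq (u :: real^'n::finite => real)" and s: "smooth \<eta>" "!!x. 0 <= \<eta> x" "!!x. \<eta> x <= 1"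
  "!!x. norm (grad \<eta> x) <= B" "!!x. x \<notin> ball c R ==> \<eta> x = 0"
 shows "sq (%x. max 0 (u x - k) * norm (grad \<eta> x))"
  and "(LEB x. (max 0 (u x - k))^2 * (norm (grad \<eta> x))^2) <= B^2 * (LEB x. (indicator (ball c R) x * max 0 (u x - k))^2)"
proof -
 have gm: "(%x. norm (grad \<eta> x)) \<in> LM"
 proof (rule borel_imp_lebesgue)
  have [measurable]: "grad \<eta> \<in> borel_measurable borel" by (rule grad_measurable[OF s(1)])
  show "(%x. norm (grad \<eta> x)) \<in> borel_measurable borel" by measurable
 qed
 have e: "max 0 (u x - k) * norm (grad \<eta> x) = norm (grad \<eta> x) * (indicator (ball c R) x * max 0 (u x - k))" for x
  using grad_extremum[OF s(1-3), of x] s(5)[of x] by (auto simp: indicator_def)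
 have b: "\<bar>norm (grad \<eta> x)\<bar> <= B" for x using s(4) by simp
 show 1: "sq (%x. max 0 (u x - k) * norm (grad \<eta> x))"
  unfolding e by (rule sq_integrable_bounded_mult[OF sq_integrable_trunc_ball[OF u] gm b])
 have "(LEB x. (max 0 (u x - k))^2 * (norm (grad \<eta> x))^2) = (LEB x. (max 0 (u x - k) * norm (grad \<eta> x))^2)"
  by (simp add: power_mult_distrib)
 also have "... <= (LEB x. B^2 * (indicator (ball c R) x * max 0 (u x - k))^2)"
 proof (rule integral_mono)
  show "integrable lebesgue (%x. (max 0 (u x - k) * norm (grad \<eta> x))^2)" using 1 by (simp add: sq_integrable_def)
  show "integrable lebesgue (%x. B^2 * (indicator (ball c R) x * max 0 (u x - k))^2)"
   using sq_integrable_trunc_ball[OF u, of c R k] by (simp add: sq_integrable_def)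
  fix x
  have "(norm (grad \<eta> x))^2 <= B^2" by (intro power_mono s) simp
  then show "(max 0 (u x - k) * norm (grad \<eta> x))^2 <= B^2 * (indicator (ball c R) x * max 0 (u x - k))^2"
   unfolding e power_mult_distrib by (intro mult_right_mono) auto
 qed
 finally show "(LEB x. (max 0 (u x - k))^2 * (norm (grad \<eta> x))^2) <= B^2 * (LEB x. (indicator (ball c R) x * max 0 (u x - k))^2)"
  by simp
qed

lemma DG_D:
 assumes "DG C k0 c R u g" "k0 <= k" "smooth \<eta>" "!!x. 0 <= \<eta> x" "!!x. \<eta> x <= 1" "!!x. norm (grad \<eta> x) <= B" "!!x. x \<notin> ball c R ==> \<eta> x = 0"
 shows "W UNIV (%x. \<eta> x * max 0 (u x - k)) (%x. \<eta> x *\<^sub>R (if u x > k then g x else 0) + max 0 (u x - k) *\<^sub>R grad \<eta> x)"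
  and "(LEB x. (\<eta> x)^2 * (norm (if u x > k then g x else 0))^2)
   <= C^2 * (LEB x. (max 0 (u x - k))^2 * (norm (grad \<eta> x))^2)"
 using assms unfolding DG_def by blast+

lemma sq_integrable_cut_grad:
 fixes u :: "real^'n::finite => real"
 assumes u: "u \<in> LM" and g: "sqv g" and s: "smooth \<eta>" "!!x. 0 <= \<eta> x" "!!x. \<eta> x <= 1"
 shows "sq (%x. \<eta> x * norm (if u x > k then g x else 0))"
proof (rule sq_integrable_bound[OF sqv_norm[OF g]])
 have [measurable]: "\<eta> \<in> LM" "g \<in> LM" "u \<in> LM"
  using smooth_measurable[OF s(1)] sqv_measurable[OF g] u by (auto intro: borel_imp_lebesgue)
 show "(%x. \<eta> x * norm (if u x > k then g x else 0)) \<in> LM" by measurable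
 show "AEL x. \<bar>\<eta> x * norm (if u x > k then g x else 0)\<bar> <= \<bar>norm (g x)\<bar>"
  using s(2,3) by (intro AE_I2) (auto simp: abs_mult intro: mult_left_le_one_le)
qed

lemma DG_energy:
 assumes D: "DG C k0 c R u g" "k0 <= k" and s: "smooth \<eta>" "!!x. 0 <= \<eta> x" "!!x. \<eta> x <= 1" "!!x. norm (grad \<eta> x) <= B" "!!x. x \<notin> ball c R ==> \<eta> x = 0"
 shows "(LEB x. (norm (\<eta> x *\<^sub>R (if u x > k then g x else 0) + max 0 (u x - k) *\<^sub>R grad \<eta> x))^2)
  <= 2 * (C^2 + 1) * (LEB x. (max 0 (u x - k))^2 * (norm (grad \<eta> x))^2)"
proof -
 have u: "sq u" and g: "sqv g" using D(1) by (auto simp: DG_def)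
 note a = sq_integrable_cut_grad[OF sq_integrable_measurable[OF u] g s(1-3), where k=k]
 note b = sq_integrable_trunc_grad(1)[OF u s, where k=k]
 have i: "integrable lebesgue (%x. (\<eta> x)^2 * (norm (if u x > k then g x else 0))^2)"
  "integrable lebesgue (%x. (max 0 (u x - k))^2 * (norm (grad \<eta> x))^2)"
  using a b by (simp_all add: sq_integrable_def power_mult_distrib)
 have "(LEB x. (norm (\<eta> x *\<^sub>R (if u x > k then g x else 0) + max 0 (u x - k) *\<^sub>R grad \<eta> x))^2)
  <= (LEB x. 2 * ((\<eta> x)^2 * (norm (if u x > k then g x else 0))^2) + 2 * ((max 0 (u x - k))^2 * (norm (grad \<eta> x))^2))"
 proof (rule integral_mono)
  show "integrable lebesgue (%x. (norm (\<eta> x *\<^sub>R (if u x > k then g x else 0) + max 0 (u x - k) *\<^sub>R grad \<eta> x))^2)"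
   using sqv_norm[OF W_sqv[OF DG_D(1)[OF D s]]] by (simp add: sq_integrable_def)
  show "integrable lebesgue (%x. 2 * ((\<eta> x)^2 * (norm (if u x > k then g x else 0))^2) + 2 * ((max 0 (u x - k))^2 * (norm (grad \<eta> x))^2))"
   using i by (intro Bochner_Integration.integrable_add integrable_mult_right)
  fix x
  define p q where "p = \<eta> x *\<^sub>R (if u x > k then g x else 0)" and "q = max 0 (u x - k) *\<^sub>R grad \<eta> x"
  have "(norm (p + q))^2 <= (norm p + norm q)^2" by (intro power_mono norm_triangle_ineq) simp
  also have "... <= 2 * (norm p)^2 + 2 * (norm q)^2"
   using sum_squares_ge_zero[of "norm p - norm q" 0] by (simp add: power2_eq_square algebra_simps)
  finally show "(norm (\<eta> x *\<^sub>R (if u x > k then g x else 0) + max 0 (u x - k) *\<^sub>R grad \<eta> x))^2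
   <= 2 * ((\<eta> x)^2 * (norm (if u x > k then g x else 0))^2) + 2 * ((max 0 (u x - k))^2 * (norm (grad \<eta> x))^2)"
   by (simp add: p_def q_def power_mult_distrib)
 qed
 also have "... = 2 * (LEB x. (\<eta> x)^2 * (norm (if u x > k then g x else 0))^2) + 2 * (LEB x. (max 0 (u x - k))^2 * (norm (grad \<eta> x))^2)"
  using i by simp
 also have "... <= 2 * (C^2 * (LEB x. (max 0 (u x - k))^2 * (norm (grad \<eta> x))^2)) + 2 * (LEB x. (max 0 (u x - k))^2 * (norm (grad \<eta> x))^2)"
  using DG_D(2)[OF D s] by simp
 finally show ?thesis by (simp add: algebra_simps)
qed

text \<open>Chebyshev's inequality bounds the part of the ball where \<open>u > k'\<close>. If that
  set is small compared with a cube of side \<open>s\<close>, \<open>faber_krahn\<close> for the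
  cut-off truncation and the energy estimate gain the factor \<open>s^2\<close>.\<close>

lemma DG_step:
 fixes u :: "real^'n::finite => real"
 assumes D: "DG C k0 c R u g" and r: "0 < \<rho>'" "\<rho>' < \<rho>" "\<rho> <= R" and k: "k0 <= k" "k < k'"
  and s: "s > 0" "4 * (LEB x. (indicator (ball c \<rho>) x * max 0 (u x - k))^2) / (k' - k)^2 <= s ^ CARD('n)"
 shows "(LEB x. (indicator (ball c \<rho>') x * max 0 (u x - k'))^2)
  <= 8 * (real CARD('n) * s)^2 * (C^2 + 1) * (cutK TYPE('n) / (\<rho> - \<rho>'))^2 * (LEB x. (indicator (ball c \<rho>) x * max 0 (u x - k))^2)"
proof -
 have u: "sq u" and g: "sqv g" using D by (auto simp: DG_def)
 have [measurable]: "u \<in> LM" by (rule sq_integrable_measurable[OF u])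
 have bm[measurable]: "ball c t \<in> sets lebesgue" for t by simp
 obtain \<eta> where e: "smooth \<eta>" "!!x. 0 <= \<eta> x" "!!x. \<eta> x <= 1" "!!x. x \<in> cball c \<rho>' ==> \<eta> x = 1"
  "!!x. x \<notin> ball c \<rho> ==> \<eta> x = 0" "!!x. norm (grad \<eta> x) <= cutK TYPE('n) / (\<rho> - \<rho>')"
  by (rule cutoffE[OF r(1,2), of c]) blast
 have eR: "\<eta> x = 0" if "x \<notin> ball c R" for x using that r(3) e(5)[of x] by auto
 have k0': "k0 <= k'" using k by simp
 define Y where "Y = (LEB x. (indicator (ball c \<rho>) x * max 0 (u x - k))^2)"
 have Yi: "integrable lebesgue (%x. (indicator (ball c \<rho>) x * max 0 (u x - k))^2)"
  using sq_integrable_trunc_ball[OF u] by (simp add: sq_integrable_def)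
 define A where "A = {x \<in> space lebesgue. x \<in> ball c \<rho> \<and> u x > k'}"
 have Am: "A \<in> sets lebesgue" unfolding A_def by measurable
 have Al: "A \<in> lmeasurable"
  using Am by (intro bounded_set_imp_lmeasurable) (auto simp: A_def intro: bounded_subset[OF bounded_ball[of c \<rho>]])
 have "(k' - k)^2 * measure lebesgue A = (LEB x. (k' - k)^2 * indicator A x)" by simp
 also have "... <= Y"
  unfolding Y_def
 proof (rule integral_mono[OF _ Yi])
  show "integrable lebesgue (%x. (k' - k)^2 * indicator A x)" using Al by (simp add: lmeasurable_iff_integrable)
  fix x
  have "(k' - k)^2 <= (max 0 (u x - k))^2" if "u x > k'" using that k by (intro power_mono) auto
  then show "(k' - k)^2 * indicator A x <= (indicator (ball c \<rho>) x * max 0 (u x - k))^2"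
   by (auto simp: A_def indicator_def)
 qed
 finally have "4 * measure lebesgue A <= 4 * Y / (k' - k)^2" using k by (simp add: field_simps)
 then have As: "4 * measure lebesgue A <= s ^ CARD('n)" using s(2) unfolding Y_def by (rule order_trans)
 have "(LEB x. (indicator (ball c \<rho>') x * max 0 (u x - k'))^2) <= (LEB x. (\<eta> x * max 0 (u x - k'))^2)"
 proof (rule integral_mono)
  show "integrable lebesgue (%x. (indicator (ball c \<rho>') x * max 0 (u x - k'))^2)"
   using sq_integrable_trunc_ball[OF u] by (simp add: sq_integrable_def)
  show "integrable lebesgue (%x. (\<eta> x * max 0 (u x - k'))^2)"
   using W_sq[OF DG_D(1)[OF D k0' e(1-3) e(6) eR]] by (simp add: sq_integrable_def)
  show "(indicator (ball c \<rho>') x * max 0 (u x - k'))^2 <= (\<eta> x * max 0 (u x - k'))^2" for x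
   using e(4)[of x] by (auto simp: indicator_def)
 qed
 also have "... <= 4 * (real CARD('n) * s)^2 * (LEB x. (norm (\<eta> x *\<^sub>R (if u x > k' then g x else 0) + max 0 (u x - k') *\<^sub>R grad \<eta> x))^2)"
  by (rule faber_krahn[OF DG_D(1)[OF D k0' e(1-3) e(6) eR] Al _ s(1) As])
   (use e(5) in \<open>auto simp: A_def intro!: AE_I2\<close>)
 also have "... <= 4 * (real CARD('n) * s)^2 * (2 * (C^2 + 1) * (LEB x. (max 0 (u x - k'))^2 * (norm (grad \<eta> x))^2))"
  by (intro mult_left_mono DG_energy[OF D k0' e(1-3) e(6) eR]) auto
 also have "... <= 4 * (real CARD('n) * s)^2 * (2 * (C^2 + 1) * ((cutK TYPE('n) / (\<rho> - \<rho>'))^2 * (LEB x. (indicator (ball c \<rho>) x * max 0 (u x - k'))^2)))"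
  by (intro mult_left_mono sq_integrable_trunc_grad(2)[OF u e(1-3) e(6) e(5)]) auto
 also have "... <= 4 * (real CARD('n) * s)^2 * (2 * (C^2 + 1) * ((cutK TYPE('n) / (\<rho> - \<rho>'))^2 * Y))"
 proof (intro mult_left_mono)
  show "(LEB x. (indicator (ball c \<rho>) x * max 0 (u x - k'))^2) <= Y"
   unfolding Y_def
  proof (rule integral_mono[OF _ Yi])
   show "integrable lebesgue (%x. (indicator (ball c \<rho>) x * max 0 (u x - k'))^2)"
    using sq_integrable_trunc_ball[OF u] by (simp add: sq_integrable_def)
   show "(indicator (ball c \<rho>) x * max 0 (u x - k'))^2 <= (indicator (ball c \<rho>) x * max 0 (u x - k))^2" for x
    using k by (intro power_mono mult_left_mono) auto
  qed
 qed auto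
 also have "... = 8 * (real CARD('n) * s)^2 * (C^2 + 1) * (cutK TYPE('n) / (\<rho> - \<rho>'))^2 * Y" by simp
 finally show ?thesis by (simp only: Y_def)
qed

text \<open>De Giorgi's first lemma: along levels increasing to \<open>(k + M) / 2\<close> and radii
  decreasing to \<open>r / 2\<close>, the squared norms of the truncations decay geometrically. The
  number \<delta> is chosen before the ball and the levels, by scale invariance.\<close>

lemma DG_small_level:
 "\<exists>\<delta>>0. \<forall>u g (c::real^'n::finite) R k0 k M r. DG C k0 c R u g --> 0 < r --> r <= R --> k0 <= k --> k < M -->
  (AEL x. x \<in> ball c r --> u x <= M) --> measure lebesgue {x \<in> ball c r. u x > k} <= \<delta> * r ^ CARD('n) -->
  (AEL x. x \<in> ball c (r / 2) --> u x <= (k + M) / 2)"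
proof -
 define N where "N = CARD('n)"
 define K where "K = cutK TYPE('n)"
 have K: "K > 0" by (simp add: K_def cutK_pos)
 have N: "N > 0" by (simp add: N_def)
 define K1 where "K1 = 128 * (real N)^2 * (C^2 + 1) * K^2"
 have "C^2 + 1 > 0" by (simp add: add_nonneg_pos)
 then have K1: "K1 > 0" using K N by (simp add: K1_def)
 \<comment> \<open>The decay rate must absorb \<open>4^j\<close> from the squared level increments
   and \<open>((1/4)^j)^N\<close> from the volume of cubes of side proportional to
   \<open>(1/4)^j\<close>.\<close>
 define q where "q = (1/4::real) ^ (N + 1)"
 have q: "q > 0" by (simp add: q_def)
 \<comment> \<open>With this \<open>t\<close>, cubes of side \<open>r * t * (1/4)^j\<close> turn the
   constant \<open>K1\<close> of one iteration step into the rate \<open>q\<close>.\<close>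
 define t where "t = sqrt (q / K1)"
 have t: "t > 0" "K1 * t^2 = q" using q K1 by (auto simp: t_def)
 \<comment> \<open>The equation \<open>16 * \<epsilon> = t^N\<close> makes the smallness condition
   of \<open>DG_step\<close> hold with equality for the assumed bound on \<open>Y j\<close>.\<close>
 define \<epsilon> where "\<epsilon> = t ^ N / 16"
 have ep: "\<epsilon> > 0" using t by (simp add: \<epsilon>_def)
 have "AEL x. x \<in> ball c (r / 2) --> u x <= (k + M) / 2"
  if D: "DG C k0 c R u g" and r: "0 < r" "r <= R" and k: "k0 <= k" "k < M" and uM: "AEL x. x \<in> ball c r --> u x <= M"
   and m: "measure lebesgue {x \<in> ball c r. u x > k} <= \<epsilon> / 4 * r ^ CARD('n)" for u g and c :: "real^'n" and R k0 k M r
 proof -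
  have u: "sq u" using D by (auto simp: DG_def)
  have [measurable]: "u \<in> LM" by (rule sq_integrable_measurable[OF u])
  have bm[measurable]: "ball c t \<in> sets lebesgue" for t by simp
  define d where "d = (M - k) / 2"
  have d: "d > 0" using k by (simp add: d_def)
  define \<kappa> where "\<kappa> j = k + d * (1 - (1/2) ^ j)" for j :: nat
  define \<rho> where "\<rho> j = r / 2 * (1 + (1/2) ^ j)" for j :: nat
  define Y where "Y j = (LEB x. (indicator (ball c (\<rho> j)) x * max 0 (u x - \<kappa> j))^2)" for j
  have Yi: "integrable lebesgue (%x. (indicator (ball c \<sigma>) x * max 0 (u x - l))^2)" for \<sigma> l
   using sq_integrable_trunc_ball[OF u] by (simp add: sq_integrable_def)
  have claim: "Y j <= \<epsilon> * d^2 * r ^ N * q ^ j" for j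
  proof (induction j)
   case 0
   define A where "A = {x \<in> ball c r. u x > k}"
   have Am: "A \<in> lmeasurable"
   proof (rule bounded_set_imp_lmeasurable)
    show "bounded A" by (auto simp: A_def intro: bounded_subset[OF bounded_ball[of c r]])
    have "{x \<in> space lebesgue. x \<in> ball c r \<and> u x > k} \<in> sets lebesgue" by measurable
    then show "A \<in> sets lebesgue" by (simp add: A_def)
   qed
   have "Y 0 <= (LEB x. (4 * d^2) * indicator A x)"
    unfolding Y_def
   proof (rule integral_mono_AE[OF Yi])
    show "integrable lebesgue (%x. (4 * d^2) * indicator A x)" using Am by (simp add: lmeasurable_iff_integrable)
    show "AEL x. (indicator (ball c (\<rho> 0)) x * max 0 (u x - \<kappa> 0))^2 <= (4 * d^2) * indicator A x"
     using uM
    proof eventually_elim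
     case (elim x)
     have "(max 0 (u x - k))^2 <= (2 * d)^2" if "x \<in> ball c r"
      using elim that k by (intro power_mono) (auto simp: d_def max_def)
     then show ?case by (auto simp: A_def indicator_def \<rho>_def \<kappa>_def power_mult_distrib)
    qed
   qed
   also have "... = 4 * d^2 * measure lebesgue A" by simp
   also have "... <= 4 * d^2 * (\<epsilon> / 4 * r ^ N)" using m by (intro mult_left_mono) (auto simp: A_def N_def)
   finally show ?case by (simp add: mult.commute mult.left_commute)
  next
   case (Suc j)
   define s where "s = r * t * (1/4) ^ j"
   have s: "s > 0" using r t by (simp add: s_def)
   have h: "\<kappa> (Suc j) - \<kappa> j = d / 2 * (1/2) ^ j" "\<rho> j - \<rho> (Suc j) = r / 4 * (1/2) ^ j"
    by (simp_all add: \<kappa>_def \<rho>_def field_simps)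
   have p4: "((1/2::real) ^ j)^2 = (1/4) ^ j"
   proof -
    have "((1/2::real) ^ j)^2 = ((1/2)^2) ^ j" by (simp only: power_mult[symmetric] mult.commute)
    also have "(1/2::real)^2 = 1/4" by (simp add: power2_eq_square)
    finally show ?thesis .
   qed
   have Y0: "Y j \<ge> 0" by (simp add: Y_def)
   have c1: "4 * Y j / (\<kappa> (Suc j) - \<kappa> j)^2 <= s ^ N"
   proof -
    have "4 * Y j <= 4 * (\<epsilon> * d^2 * r ^ N * q ^ j)" using Suc.IH by simp
    also have "... = s ^ N * (\<kappa> (Suc j) - \<kappa> j)^2"
    proof -
     have "q ^ j = ((1/4) ^ j) ^ N * (1/4) ^ j"
     proof -
      have "q ^ j = (1/4) ^ ((N + 1) * j)" by (simp only: q_def power_mult)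
      also have "(N + 1) * j = j * N + j" by simp
      finally show ?thesis by (simp only: power_mult power_add)
     qed
     then show ?thesis
      unfolding h(1) power_mult_distrib p4 s_def \<epsilon>_def by (simp add: power_mult_distrib power_divide mult_ac)
    qed
    finally have fin: "4 * Y j <= s ^ N * (\<kappa> (Suc j) - \<kappa> j)^2" .
    have "\<kappa> (Suc j) - \<kappa> j > 0" unfolding h(1) using d by simp
    then have "(\<kappa> (Suc j) - \<kappa> j)^2 > 0" by (rule zero_less_power)
    from pos_divide_le_eq[OF this] fin show ?thesis by blast
   qed
   have "Y (Suc j) <= 8 * (real N * s)^2 * (C^2 + 1) * (K / (\<rho> j - \<rho> (Suc j)))^2 * Y j"
    unfolding Y_def N_def K_def
   proof (rule DG_step[OF D _ _ _ _ _ s])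
    show "0 < \<rho> (Suc j)" unfolding \<rho>_def using r by (intro mult_pos_pos add_pos_pos) auto
    have "r / 2 * (1 + (1/2) ^ j) <= r / 2 * (1 + 1)"
     using r by (intro mult_left_mono add_left_mono power_le_one) auto
    also have "r / 2 * (1 + 1) = r" by simp
    also have "r <= R" by (rule r)
    finally show "\<rho> j <= R" by (simp only: \<rho>_def)
    show "\<rho> (Suc j) < \<rho> j" using h(2) r zero_less_power[of "1/2::real" j] by (smt (verit) divide_pos_pos mult_pos_pos)
    show "k0 <= \<kappa> j" using k d power_le_one[of "1/2::real" j] by (simp add: \<kappa>_def add_increasing2)
    show "\<kappa> j < \<kappa> (Suc j)" using h(1) d zero_less_power[of "1/2::real" j] by (smt (verit) divide_pos_pos mult_pos_pos)
    show "4 * (LEB x. (indicator (ball c (\<rho> j)) x * max 0 (u x - \<kappa> j))^2) / (\<kappa> (Suc j) - \<kappa> j)^2 <= s ^ CARD('n)"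
     using c1 by (simp add: Y_def N_def)
   qed
   also have "8 * (real N * s)^2 * (C^2 + 1) * (K / (\<rho> j - \<rho> (Suc j)))^2 = K1 * t^2 * (1/4) ^ j"
   proof -
    have "((1/4::real) ^ j)^2 = (1/4) ^ j * (1/4) ^ j" by (simp add: power2_eq_square)
    then show ?thesis
     using r unfolding h(2) s_def K1_def power_mult_distrib power_divide[of K] p4 by (simp add: field_simps)
   qed
   also have "K1 * t^2 * (1/4) ^ j * Y j <= q * 1 * Y j"
    unfolding t(2) using q Y0 by (intro mult_right_mono mult_left_mono power_le_one) auto
   also have "... <= q * (\<epsilon> * d^2 * r ^ N * q ^ j)" using Suc.IH q by simp
   finally show ?case by (simp add: mult_ac)
  qed
  define Z where "Z = (LEB x. (indicator (ball c (r / 2)) x * max 0 (u x - (k + M) / 2))^2)"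
  have kd: "(k + M) / 2 = k + d" by (simp add: d_def field_simps)
  have "Z <= Y j" for j
   unfolding Z_def Y_def
  proof (rule integral_mono[OF Yi Yi])
   fix x
   have "ball c (r / 2) \<subseteq> ball c (\<rho> j)" using r by (intro subset_ball) (simp add: \<rho>_def field_simps)
   moreover have "\<kappa> j <= k + d" using d by (simp add: \<kappa>_def)
   ultimately show "(indicator (ball c (r / 2)) x * max 0 (u x - (k + M) / 2))^2 <= (indicator (ball c (\<rho> j)) x * max 0 (u x - \<kappa> j))^2"
    unfolding kd by (intro power_mono mult_mono) (auto simp: indicator_def)
  qed
  then have Zj: "Z <= \<epsilon> * d^2 * r ^ N * q ^ j" for j using claim order_trans by blast
  have "q < 1" unfolding q_def by (rule power_less_one_iff[THEN iffD2]) auto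
  then have "(%j. \<epsilon> * d^2 * r ^ N * q ^ j) ----> \<epsilon> * d^2 * r ^ N * 0"
   using q by (intro tendsto_mult tendsto_const LIMSEQ_realpow_zero) auto
  then have "Z <= 0" using LIMSEQ_le_const[of _ _ Z] Zj by fastforce
  then have "Z = 0" by (simp add: Z_def antisym)
  then have "AEL x. (indicator (ball c (r / 2)) x * max 0 (u x - (k + M) / 2))^2 = 0"
   unfolding Z_def by (subst (asm) integral_nonneg_eq_0_iff_AE[OF Yi]) auto
  then show ?thesis by eventually_elim (auto simp: indicator_def max_def field_simps split: if_splits)
 qed
 then show ?thesis using ep by (intro exI[of _ "\<epsilon> / 4"]) auto
qed

lemma lebesgue_set_ball:
 fixes P :: "real => bool"
 assumes [measurable]: "u \<in> LM" "Measurable.pred borel P"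
 shows "{x \<in> ball (c::real^'n::finite) r. P (u x)} \<in> lmeasurable"
proof (rule bounded_set_imp_lmeasurable)
 have [measurable]: "ball c r \<in> sets lebesgue" by simp
 have "{x \<in> space lebesgue. x \<in> ball c r \<and> P (u x)} \<in> sets lebesgue" by measurable
 then show "{x \<in> ball c r. P (u x)} \<in> sets lebesgue" by simp
qed (auto intro: bounded_subset[OF bounded_ball[of c r]])

text \<open>The isoperimetric inequality is applied to the difference of the cut-off truncations at
  \<open>a\<close> and \<open>b\<close>, whose gradient on the inner ball lives on the strip
  \<open>a < u <= b\<close>. Cauchy-Schwarz over the strip, and the Caccioppoli inequality on the
  doubled ball, bound its gradient integral by the root of the measure of the strip.\<close>

lemma DG_shrink_step:
 fixes u :: "real^'n::finite => real"
 assumes D: "DG C k0 c R u g" and r: "0 < r" "2 * r <= R" and a: "k0 <= a" "a < b"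
  and uM: "AEL x. x \<in> ball c (2 * r) --> u x <= a + 2 * (b - a)"
  and \<mu>: "\<mu> > 0" "\<mu> * r ^ CARD('n) <= measure lebesgue {x \<in> ball c r. u x <= a}"
 defines "L \<equiv> vol1 TYPE('n) * 2 ^ CARD('n)"
 shows "\<mu>^2 * (measure lebesgue {x \<in> ball c r. u x > b})^2
  <= (4 * \<bar>C\<bar> * cutK TYPE('n) * L)^2 * L * r ^ CARD('n) * measure lebesgue {x \<in> ball c r. a < u x \<and> u x <= b}"
proof -
 have u: "sq u" and g: "sqv g" using D by (auto simp: DG_def)
 have um[measurable]: "u \<in> LM" by (rule sq_integrable_measurable[OF u])
 have bm[measurable]: "ball c t \<in> sets lebesgue" for t by simp
 define K where "K = cutK TYPE('n)"
 define m where "m = b - a"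
 have m: "m > 0" using a by (simp add: m_def)
 have K: "K > 0" by (simp add: K_def cutK_pos)
 have L: "L > 0" using vol1_pos[where 'n='n] by (simp add: L_def)
 obtain \<eta> where e: "smooth \<eta>" "!!x. 0 <= \<eta> x" "!!x. \<eta> x <= 1" "!!x. x \<in> cball c r ==> \<eta> x = 1"
  "!!x. x \<notin> ball c (2 * r) ==> \<eta> x = 0" "!!x. norm (grad \<eta> x) <= K / (2 * r - r)"
  unfolding K_def using r by (rule_tac cutoffE[of r "2 * r" c]) auto
 have e6: "norm (grad \<eta> x) <= K / r" for x using e(6)[of x] by simp
 have eR: "\<eta> x = 0" if "x \<notin> ball c R" for x using that r(2) e(5)[of x] by auto
 have kb: "k0 <= b" using a by simp
 note Wa = DG_D(1)[OF D a(1) e(1-3) e6 eR] and Wb = DG_D(1)[OF D kb e(1-3) e6 eR]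
 define w where "w x = \<eta> x * max 0 (u x - a) - \<eta> x * max 0 (u x - b)" for x
 define G where "G x = (\<eta> x *\<^sub>R (if u x > a then g x else 0) + max 0 (u x - a) *\<^sub>R grad \<eta> x)
  - (\<eta> x *\<^sub>R (if u x > b then g x else 0) + max 0 (u x - b) *\<^sub>R grad \<eta> x)" for x
 have WG: "W UNIV w G" unfolding w_def G_def by (rule W_diff[OF Wa Wb])
 define S where "S = {x \<in> ball c r. a < u x \<and> u x <= b}"
 have S: "S \<in> lmeasurable" unfolding S_def by (rule lebesgue_set_ball[OF um]) measurable
 define ga where "ga x = norm (if u x > a then g x else 0)" for x
 have sg: "sq (%x. \<eta> x * ga x)"
  unfolding ga_def by (rule sq_integrable_cut_grad[OF um g e(1-3)])
 have i1: "(LEB x. indicator (ball c r) x * norm (G x)) <= (LEB x. indicator S x * (\<eta> x * ga x))"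
 proof (rule integral_mono)
  show "integrable lebesgue (%x. indicator (ball c r) x * norm (G x))"
   by (rule sq_integrable_mult[OF sq_integrable_indicator sqv_norm[OF W_sqv[OF WG]]]) simp
  show "integrable lebesgue (%x. indicator S x * (\<eta> x * ga x))"
   by (rule sq_integrable_mult[OF sq_integrable_indicator[OF S] sg])
  fix x
  show "indicator (ball c r) x * norm (G x) <= indicator S x * (\<eta> x * ga x)"
  proof (cases "x \<in> ball c r")
   case True
   then have "\<eta> x = 1" using e(4)[of x] by simp
   moreover from this have "grad \<eta> x = 0" using grad_extremum[OF e(1-3), of x] by simp
   ultimately show ?thesis using True a(2) by (auto simp: G_def ga_def S_def indicator_def)
  qed (auto simp: S_def)
 qed
 define s where "s = measure lebesgue S"
 have s0: "s \<ge> 0" by (simp add: s_def)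
 define T where "T = L * r ^ CARD('n)"
 have T: "T > 0" using L r by (simp add: T_def)
 have vol: "measure lebesgue (ball c (2 * r)) = T"
  using ball_measure[of "2 * r" c] r by (simp add: T_def L_def power_mult_distrib)
 have "(LEB x. indicator S x * (\<eta> x * ga x)) <= \<bar>LEB x. indicator S x * (\<eta> x * ga x)\<bar>" by simp
 also have "... <= sqrt (LEB x. (indicator S x)^2) * sqrt (LEB x. (\<eta> x * ga x)^2)"
  by (rule abs_integral_mult_le[OF sq_integrable_indicator[OF S] sg])
 also have "(LEB x. (indicator S x)^2) = s"
 proof -
  have "(%x. (indicator S x :: real)^2) = indicator S" by (auto simp: indicator_def)
  then show ?thesis by (simp add: s_def)
 qed
 also have "sqrt s * sqrt (LEB x. (\<eta> x * ga x)^2) <= sqrt s * sqrt ((\<bar>C\<bar> * (2 * m) * (K / r))^2 * T)"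
 proof (intro mult_left_mono real_sqrt_le_mono)
  have "(LEB x. (\<eta> x * ga x)^2) <= C^2 * (LEB x. (max 0 (u x - a))^2 * (norm (grad \<eta> x))^2)"
   using DG_D(2)[OF D a(1) e(1-3) e6 eR] by (simp add: ga_def power_mult_distrib)
  also have "... <= C^2 * ((K / r)^2 * (LEB x. (indicator (ball c (2 * r)) x * max 0 (u x - a))^2))"
   by (intro mult_left_mono sq_integrable_trunc_grad(2)[OF u e(1-3) e6 e(5)]) auto
  also have "... <= C^2 * ((K / r)^2 * ((2 * m)^2 * T))"
  proof (intro mult_left_mono)
   have "(LEB x. (indicator (ball c (2 * r)) x * max 0 (u x - a))^2) <= (LEB x. (2 * m)^2 * indicator (ball c (2 * r)) x)"
   proof (rule integral_mono_AE)
    show "integrable lebesgue (%x. (indicator (ball c (2 * r)) x * max 0 (u x - a))^2)"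
     using sq_integrable_trunc_ball[OF u] by (simp add: sq_integrable_def)
    show "integrable lebesgue (%x. (2 * m)^2 * indicator (ball c (2 * r)) x)"
     by (intro integrable_mult_right) (simp add: lmeasurable_iff_integrable[symmetric])
    show "AEL x. (indicator (ball c (2 * r)) x * max 0 (u x - a))^2 <= (2 * m)^2 * indicator (ball c (2 * r)) x"
     using uM
    proof eventually_elim
     case (elim x)
     have "(max 0 (u x - a))^2 <= (2 * m)^2" if "x \<in> ball c (2 * r)"
      using elim that m by (intro power_mono) (auto simp: m_def max_def)
     then show ?case by (auto simp: indicator_def)
    qed
   qed
   then show "(LEB x. (indicator (ball c (2 * r)) x * max 0 (u x - a))^2) <= (2 * m)^2 * T" by (simp add: vol)
  qed auto
  also have "... = (\<bar>C\<bar> * (2 * m) * (K / r))^2 * T" by (simp only: power_mult_distrib power2_abs mult_ac)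
  finally show "(LEB x. (\<eta> x * ga x)^2) <= (\<bar>C\<bar> * (2 * m) * (K / r))^2 * T" .
 qed (simp add: s0)
 also have "... = \<bar>C\<bar> * (2 * m) * (K / r) * sqrt (T * s)"
  using m K r by (simp add: real_sqrt_mult)
 finally have i2: "(LEB x. indicator S x * (\<eta> x * ga x)) <= \<bar>C\<bar> * (2 * m) * (K / r) * sqrt (T * s)" .
 define A B where "A = {x \<in> ball c r. u x <= a}" and "B = {x \<in> ball c r. u x > b}"
 have AB: "A \<in> lmeasurable" "B \<in> lmeasurable"
  unfolding A_def B_def by (rule lebesgue_set_ball[OF um]; measurable)+
 have "m * measure lebesgue A * measure lebesgue B
  <= 2 * r * (vol1 TYPE('n) * (2 * r) ^ CARD('n)) * (LEB x. indicator (ball c r) x * norm (G x))"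
 proof (rule de_giorgi_isoperimetric[OF WG r(1)])
  show "AEL x. x \<in> A --> w x <= 0" using a by (intro AE_I2) (auto simp: A_def w_def)
  show "AEL x. x \<in> B --> m <= w x" using a e(4) by (intro AE_I2) (auto simp: B_def w_def m_def)
 qed (use AB m in \<open>auto simp: A_def B_def fmeasurableD\<close>)
 also have "vol1 TYPE('n) * (2 * r) ^ CARD('n) = T" by (simp add: T_def L_def power_mult_distrib)
 also have "2 * r * T * (LEB x. indicator (ball c r) x * norm (G x)) <= 2 * r * T * (\<bar>C\<bar> * (2 * m) * (K / r) * sqrt (T * s))"
  using i1 i2 r T by (intro mult_left_mono) auto
 also have "... = m * (4 * \<bar>C\<bar> * K * T * sqrt (T * s))" using r by (simp add: field_simps)
 finally have "measure lebesgue A * measure lebesgue B <= 4 * \<bar>C\<bar> * K * T * sqrt (T * s)" using m by (simp add: mult.assoc)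
 moreover have "\<mu> * r ^ CARD('n) * measure lebesgue B <= measure lebesgue A * measure lebesgue B"
  using \<mu> by (intro mult_right_mono) (auto simp: A_def)
 ultimately have "r ^ CARD('n) * (\<mu> * measure lebesgue B) <= r ^ CARD('n) * (4 * \<bar>C\<bar> * K * L * sqrt (T * s))"
  by (simp add: T_def mult_ac)
 then have "\<mu> * measure lebesgue B <= 4 * \<bar>C\<bar> * K * L * sqrt (T * s)" using r by simp
 then have "(\<mu> * measure lebesgue B)^2 <= (4 * \<bar>C\<bar> * K * L * sqrt (T * s))^2" using \<mu> by (intro power_mono) auto
 also have "... = (4 * \<bar>C\<bar> * K * L)^2 * (T * s)" using T s0 by (simp add: power_mult_distrib)
 finally show ?thesis by (simp add: power_mult_distrib B_def K_def T_def s_def S_def mult_ac)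
qed

text \<open>The strips between the levels \<open>M - (M - k) * (1/2)^j\<close> are disjoint. If the
  last superlevel set were still large, each strip would have at least a fixed share of the ball,
  which is impossible for \<open>J\<close> strips. Halving the distance to \<open>M\<close> gives
  the bound \<open>a + 2 * (b - a)\<close> required in \<open>DG_shrink_step\<close>.\<close>

lemma DG_shrink:
 assumes "\<mu> > 0" "\<delta> > 0"
 shows "\<exists>J. \<forall>u g (c::real^'n::finite) R k0 k M r. DG C k0 c R u g --> 0 < r --> 2 * r <= R --> k0 <= k --> k < M -->
  (AEL x. x \<in> ball c (2 * r) --> u x <= M) --> \<mu> * r ^ CARD('n) <= measure lebesgue {x \<in> ball c r. u x <= k} -->
  measure lebesgue {x \<in> ball c r. u x > M - (M - k) * (1/2) ^ J} <= \<delta> * r ^ CARD('n)"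
proof -
 define N where "N = CARD('n)"
 define V where "V = vol1 TYPE('n)"
 define L where "L = V * 2 ^ N"
 define K2 where "K2 = (4 * \<bar>C\<bar> * cutK TYPE('n) * L)^2 * L"
 have V: "V > 0" by (simp add: V_def vol1_pos)
 have K2: "K2 \<ge> 0" using V by (simp add: K2_def L_def)
 \<comment> \<open>\<open>J\<close> times the least possible measure of a strip, relative to
   \<open>r^N\<close>, exceeds the relative volume \<open>V\<close> of the ball.\<close>
 obtain J :: nat where J: "K2 * V / (\<mu>^2 * \<delta>^2) < real J" using reals_Archimedean2 by blast
 have "measure lebesgue {x \<in> ball c r. u x > M - (M - k) * (1/2) ^ J} <= \<delta> * r ^ N"
  if D: "DG C k0 c R u g" and r: "0 < r" "2 * r <= R" and k: "k0 <= k" "k < M"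
   and uM: "AEL x. x \<in> ball c (2 * r) --> u x <= M" and m: "\<mu> * r ^ N <= measure lebesgue {x \<in> ball c r. u x <= k}"
  for u g and c :: "real^'n" and R k0 k M r
 proof (rule ccontr)
  assume neg: "\<not> measure lebesgue {x \<in> ball c r. u x > M - (M - k) * (1/2) ^ J} <= \<delta> * r ^ N"
  have um: "u \<in> LM" using D by (auto simp: DG_def sq_integrable_def)
  have lm: "{x \<in> ball c r. u x > t} \<in> lmeasurable" "{x \<in> ball c r. u x <= t} \<in> lmeasurable" for t
   by (rule lebesgue_set_ball[OF um]; measurable)+
  define \<kappa> where "\<kappa> j = M - (M - k) * (1/2) ^ j" for j :: nat
  define b where "b j = measure lebesgue {x \<in> ball c r. u x > \<kappa> j}" for j
  have k1: "\<kappa> (Suc j) - \<kappa> j = (M - k) * (1/2) ^ Suc j" for j by (simp add: \<kappa>_def field_simps)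
  have k2: "\<kappa> j < \<kappa> (Suc j)" for j
  proof -
   have "0 < (M - k) * (1/2) ^ Suc j" using k by (intro mult_pos_pos zero_less_power) auto
   then show ?thesis using k1[of j] by linarith
  qed
  have kinc: "\<kappa> i <= \<kappa> j" if "i <= j" for i j using k2 that by (metis lift_Suc_mono_le less_imp_le)
  have k3: "k <= \<kappa> j" for j using kinc[of 0 j] by (simp add: \<kappa>_def)
  have step: "(\<mu> * \<delta> * r ^ N)^2 <= K2 * r ^ N * (b j - b (Suc j))" if "j < J" for j
  proof -
   have "b J <= b (Suc j)"
    unfolding b_def using lm kinc[of "Suc j" J] that by (intro measure_mono_fmeasurable) (auto simp: fmeasurableD)
   moreover have "\<delta> * r ^ N <= b J" using neg unfolding b_def \<kappa>_def by linarith
   ultimately have "\<delta> * r ^ N <= b (Suc j)" by linarith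
   then have "\<mu> * (\<delta> * r ^ N) <= \<mu> * b (Suc j)" using assms by (intro mult_left_mono) auto
   then have "(\<mu> * \<delta> * r ^ N)^2 <= (\<mu> * b (Suc j))^2" using assms r by (intro power_mono) (auto simp: mult.assoc)
   also have "... = \<mu>^2 * (measure lebesgue {x \<in> ball c r. u x > \<kappa> (Suc j)})^2" by (simp add: b_def power_mult_distrib)
   also have "... <= (4 * \<bar>C\<bar> * cutK TYPE('n) * (vol1 TYPE('n) * 2 ^ CARD('n)))^2 * (vol1 TYPE('n) * 2 ^ CARD('n)) * r ^ CARD('n)
     * measure lebesgue {x \<in> ball c r. \<kappa> j < u x \<and> u x <= \<kappa> (Suc j)}"
   proof (rule DG_shrink_step[OF D r _ k2 _ assms(1)])
    show "k0 <= \<kappa> j" using k k3 order_trans by blast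
    have "\<kappa> j + 2 * (\<kappa> (Suc j) - \<kappa> j) = M" unfolding k1 by (simp add: \<kappa>_def)
    then show "AEL x. x \<in> ball c (2 * r) --> u x <= \<kappa> j + 2 * (\<kappa> (Suc j) - \<kappa> j)" using uM by simp
    have "measure lebesgue {x \<in> ball c r. u x <= k} <= measure lebesgue {x \<in> ball c r. u x <= \<kappa> j}"
     using lm k3[of j] by (intro measure_mono_fmeasurable) (auto simp: fmeasurableD)
    then show "\<mu> * r ^ CARD('n) <= measure lebesgue {x \<in> ball c r. u x <= \<kappa> j}" using m by (simp add: N_def)
   qed
   also have "measure lebesgue {x \<in> ball c r. \<kappa> j < u x \<and> u x <= \<kappa> (Suc j)} = b j - b (Suc j)"
   proof -
    have "{x \<in> ball c r. \<kappa> j < u x \<and> u x <= \<kappa> (Suc j)} = {x \<in> ball c r. u x > \<kappa> j} - {x \<in> ball c r. u x > \<kappa> (Suc j)}" by auto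
    moreover have "measure lebesgue ({x \<in> ball c r. u x > \<kappa> j} - {x \<in> ball c r. u x > \<kappa> (Suc j)}) = b j - b (Suc j)"
     unfolding b_def using lm k2[of j] by (intro measurable_measure_Diff) (auto simp: fmeasurableD)
    ultimately show ?thesis by simp
   qed
   finally show ?thesis by (simp add: K2_def L_def V_def N_def)
  qed
  have "real J * (\<mu> * \<delta> * r ^ N)^2 = (\<Sum>j<J. (\<mu> * \<delta> * r ^ N)^2)" by simp
  also have "... <= (\<Sum>j<J. K2 * r ^ N * (b j - b (Suc j)))" by (rule sum_mono) (use step in auto)
  also have "... = K2 * r ^ N * (b 0 - b J)" unfolding sum_distrib_left[symmetric] sum_lessThan_telescope' ..
  also have "... <= K2 * r ^ N * (V * r ^ N)"
  proof (intro mult_left_mono)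
   have "b 0 <= measure lebesgue (ball c r)" unfolding b_def using lm by (intro measure_mono_fmeasurable) (auto simp: fmeasurableD)
   then show "b 0 - b J <= V * r ^ N" using ball_measure[of r c] r by (simp add: V_def N_def b_def) (smt (verit) measure_nonneg)
  qed (use K2 r in auto)
  finally have "(r ^ N)^2 * (real J * (\<mu>^2 * \<delta>^2)) <= (r ^ N)^2 * (K2 * V)" by (simp add: power2_eq_square mult_ac)
  then have "real J * (\<mu>^2 * \<delta>^2) <= K2 * V" using r by simp
  with J assms show False by (simp add: divide_less_eq)
 qed
 then show ?thesis unfolding N_def by blast
qed

text \<open>\<open>DG_shrink\<close> provides a level \<open>k'\<close> above which \<open>u\<close>
  lies only on a set small enough for \<open>DG_small_level\<close>; that lemma gains half of
  \<open>M - k'\<close>, hence \<theta> is \<open>(1/2)^(J + 1)\<close>. It depends on \<mu>,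
  \<open>C\<close> and the dimension, not on the scale.\<close>

lemma DG_decay:
 assumes "\<mu> > 0"
 shows "\<exists>\<theta>. 0 < \<theta> \<and> \<theta> < 1 \<and> (\<forall>u g (c::real^'n::finite) R k0 k M r. DG C k0 c R u g --> 0 < r --> 2 * r <= R --> k0 <= k --> k < M -->
  (AEL x. x \<in> ball c (2 * r) --> u x <= M) --> \<mu> * r ^ CARD('n) <= measure lebesgue {x \<in> ball c r. u x <= k} -->
  (AEL x. x \<in> ball c (r / 2) --> u x <= M - \<theta> * (M - k)))"
proof -
 obtain \<delta> where \<delta>: "\<delta> > 0" and small0: "\<forall>u g (c::real^'n) R k0 k M r. DG C k0 c R u g --> 0 < r --> r <= R --> k0 <= k --> k < M -->
  (AEL x. x \<in> ball c r --> u x <= M) --> measure lebesgue {x \<in> ball c r. u x > k} <= \<delta> * r ^ CARD('n) -->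
  (AEL x. x \<in> ball c (r / 2) --> u x <= (k + M) / 2)"
  using DG_small_level[of C, where 'n='n] by (elim exE conjE) (rule that)
 note small = small0[rule_format]
 obtain J where shrink0: "\<forall>u g (c::real^'n) R k0 k M r. DG C k0 c R u g --> 0 < r --> 2 * r <= R --> k0 <= k --> k < M -->
  (AEL x. x \<in> ball c (2 * r) --> u x <= M) --> \<mu> * r ^ CARD('n) <= measure lebesgue {x \<in> ball c r. u x <= k} -->
  measure lebesgue {x \<in> ball c r. u x > M - (M - k) * (1/2) ^ J} <= \<delta> * r ^ CARD('n)"
  using DG_shrink[OF assms \<delta>, of C, where 'n='n] by (elim exE conjE) (rule that)
 note shrink = shrink0[rule_format]
 define \<theta> where "\<theta> = (1/2::real) ^ Suc J"
 have th: "0 < \<theta>" "\<theta> < 1" by (simp_all add: \<theta>_def power_Suc_less_one del: power_Suc)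
 have "AEL x. x \<in> ball c (r / 2) --> u x <= M - \<theta> * (M - k)"
  if D: "DG C k0 c R u g" and r: "0 < r" "2 * r <= R" and k: "k0 <= k" "k < M"
   and uM: "AEL x. x \<in> ball c (2 * r) --> u x <= M" and m: "\<mu> * r ^ CARD('n) <= measure lebesgue {x \<in> ball c r. u x <= k}"
  for u g and c :: "real^'n" and R k0 k M r
 proof -
  define k' where "k' = M - (M - k) * (1/2) ^ J"
  have k': "k0 <= k'" "k' < M"
  proof -
   define e where "e = (M - k) * (1/2) ^ J"
   have "e <= (M - k) * 1" unfolding e_def using k by (intro mult_left_mono power_le_one) auto
   then have "e <= M - k" by simp
   moreover have "0 < e" unfolding e_def using k by (intro mult_pos_pos zero_less_power) auto
   moreover have "k' = M - e" by (simp add: k'_def e_def)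
   ultimately show "k0 <= k'" "k' < M" using k by auto
  qed
  have uM': "AEL x. x \<in> ball c r --> u x <= M" using uM by eventually_elim (use r in auto)
  have "AEL x. x \<in> ball c (r / 2) --> u x <= (k' + M) / 2"
   by (rule small[OF D r(1) _ k' uM']) (use r shrink[OF D r k uM m] in \<open>simp_all add: k'_def\<close>)
  moreover have "(k' + M) / 2 = M - \<theta> * (M - k)" by (simp add: k'_def \<theta>_def field_simps)
  ultimately show ?thesis by simp
 qed
 with th show ?thesis by blast
qed

text \<open>The level 0 is available at every scale, since \<open>u <= 0\<close> on a fixed share of
  each small ball. Every passage from radius \<open>r\<close> to \<open>r / 4\<close> therefore
  multiplies the upper bound by \<open>1 - \<theta>\<close>.\<close>

lemma DG_boundary_decay:
 assumes D: "DG C 0 c R u g" and R: "R > 0" and b: "AEL x. u x <= M" and \<mu>: "\<mu> > 0" "r0 > 0"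
  "!!r. 0 < r ==> r < r0 ==> \<mu> * r ^ CARD('n) <= measure lebesgue {x \<in> ball (c::real^'n::finite) r. u x <= 0}"
  and e: "e > 0"
 shows "\<exists>r>0. AEL x. x \<in> ball c r --> u x <= e"
proof -
 obtain \<theta> where th: "0 < \<theta>" "\<theta> < 1" and dec0: "\<forall>u g (c::real^'n) R k0 k M r. DG C k0 c R u g --> 0 < r --> 2 * r <= R --> k0 <= k --> k < M -->
  (AEL x. x \<in> ball c (2 * r) --> u x <= M) --> \<mu> * r ^ CARD('n) <= measure lebesgue {x \<in> ball c r. u x <= k} -->
  (AEL x. x \<in> ball c (r / 2) --> u x <= M - \<theta> * (M - k))"
  using DG_decay[OF \<mu>(1), of C, where 'n='n] by (elim exE conjE) (rule that)
 note dec = dec0[rule_format]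
 \<comment> \<open>A positive bound, because \<open>DG_decay\<close> needs the level 0 to lie
   strictly below it.\<close>
 define M1 where "M1 = max M 1"
 have M1: "M1 > 0" "AEL x. u x <= M1" using b by (auto simp: M1_def elim: eventually_mono)
 have "\<exists>r>0. r <= R \<and> r <= r0 \<and> (AEL x. x \<in> ball c r --> u x <= (1 - \<theta>) ^ n * M1)" for n
 proof (induction n)
  case 0
  then show ?case using R \<mu>(2) M1(2) by (intro exI[of _ "min R r0"]) (auto elim: eventually_mono)
 next
  case (Suc n)
  then obtain r where r: "r > 0" "r <= R" "r <= r0" "AEL x. x \<in> ball c r --> u x <= (1 - \<theta>) ^ n * M1" by blast
  have "AEL x. x \<in> ball c (r / 2 / 2) --> u x <= (1 - \<theta>) ^ n * M1 - \<theta> * ((1 - \<theta>) ^ n * M1 - 0)"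
  proof (rule dec[OF D _ _ order_refl])
   show "0 < (1 - \<theta>) ^ n * M1" using th M1(1) by (intro mult_pos_pos zero_less_power) auto
   show "\<mu> * (r / 2) ^ CARD('n) <= measure lebesgue {x \<in> ball c (r / 2). u x <= 0}"
    using r(1,3) by (intro \<mu>(3)) auto
   show "AEL x. x \<in> ball c (2 * (r / 2)) --> u x <= (1 - \<theta>) ^ n * M1" using r(4) by simp
  qed (use r(1,2) in auto)
  moreover have "(1 - \<theta>) ^ n * M1 - \<theta> * ((1 - \<theta>) ^ n * M1 - 0) = (1 - \<theta>) ^ Suc n * M1" by (simp add: algebra_simps)
  ultimately show ?case using r by (intro exI[of _ "r / 2 / 2"]) auto
 qed
 moreover have "\<exists>n. (1 - \<theta>) ^ n * M1 <= e"
 proof -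
  obtain n where "(1 - \<theta>) ^ n < e / M1" using real_arch_pow_inv[of "e / M1" "1 - \<theta>"] th e M1 by auto
  then show ?thesis using M1 by (intro exI[of _ n]) (simp add: field_simps)
 qed
 ultimately obtain n r where "r > 0" "AEL x. x \<in> ball c r --> u x <= (1 - \<theta>) ^ n * M1" "(1 - \<theta>) ^ n * M1 <= e" by blast
 then show ?thesis by (intro exI[of _ r]) (auto elim: eventually_mono)
qed

text \<open>On at least half of the ball either \<open>u <= m\<close> or \<open>u >= m\<close>.
  Applying the decay to \<open>u\<close> or \<open>- u\<close> improves one of the two bounds by
  \<theta> times the half-width, and moving the centre \<open>m\<close> by half of that gain shrinks
  the half-width by the factor \<open>1 - \<theta> / 2\<close>.\<close>

lemma DG_interior_decay:
 fixes c :: "real^'n::finite"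
 assumes D: "!!k0. DG C k0 c R u g" "!!k0. DG C k0 c R (%x. - u x) g'" and R: "R > 0" and b: "AEL x. \<bar>u x\<bar> <= M"
  and e: "e > 0"
 shows "\<exists>r>0. \<exists>m. AEL x. x \<in> ball c r --> \<bar>u x - m\<bar> <= e"
proof -
 define V where "V = vol1 TYPE('n)"
 have V: "V / 2 > 0" by (simp add: V_def vol1_pos)
 obtain \<theta> where th: "0 < \<theta>" "\<theta> < 1" and dec0: "\<forall>u g (c::real^'n) R k0 k M r. DG C k0 c R u g --> 0 < r --> 2 * r <= R --> k0 <= k --> k < M -->
  (AEL x. x \<in> ball c (2 * r) --> u x <= M) --> V / 2 * r ^ CARD('n) <= measure lebesgue {x \<in> ball c r. u x <= k} -->
  (AEL x. x \<in> ball c (r / 2) --> u x <= M - \<theta> * (M - k))"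
  using DG_decay[OF V, of C, where 'n='n] by (elim exE conjE) (rule that)
 note dec = dec0[rule_format]
 have um: "u \<in> LM" using D(1)[of 0] by (auto simp: DG_def sq_integrable_def)
 define q where "q = 1 - \<theta> / 2"
 have q: "0 < q" "q < 1" using th by (auto simp: q_def)
 define M1 where "M1 = max M 1"
 have M1: "M1 > 0" "AEL x. \<bar>u x\<bar> <= M1" using b by (auto simp: M1_def elim: eventually_mono)
 have "\<exists>r>0. r <= R \<and> (\<exists>m. AEL x. x \<in> ball c r --> \<bar>u x - m\<bar> <= q ^ n * M1)" for n
 proof (induction n)
  case 0
  then show ?case using R M1(2) by (intro exI[of _ R] conjI exI[of _ 0]) (auto elim: eventually_mono)
 next
  case (Suc n)
  then obtain r m where r: "r > 0" "r <= R" "AEL x. x \<in> ball c r --> \<bar>u x - m\<bar> <= q ^ n * M1" by blast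
  define d where "d = q ^ n * M1"
  have d: "d > 0" using q M1 by (simp add: d_def)
  have qd: "q ^ Suc n * M1 = d - \<theta> * d / 2" by (simp add: d_def q_def algebra_simps)
  have r2: "0 < r / 2" "2 * (r / 2) <= R" using r by auto
  define A B where "A = {x \<in> ball c (r / 2). u x <= m}" and "B = {x \<in> ball c (r / 2). - u x <= - m}"
  have "- u x = -1 * u x" for x by simp
  have AB: "A \<in> lmeasurable" "B \<in> lmeasurable"
   unfolding A_def B_def by (rule lebesgue_set_ball[OF um]; measurable)+
  have "A \<union> B = ball c (r / 2)" by (auto simp: A_def B_def)
  then have "V * (r / 2) ^ CARD('n) = measure lebesgue (A \<union> B)"
   using ball_measure[of "r / 2" c] r(1) by (simp add: V_def)
  also have "... <= measure lebesgue A + measure lebesgue B"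
   using AB by (intro measure_Un_le) (auto simp: fmeasurableD)
  finally consider "V / 2 * (r / 2) ^ CARD('n) <= measure lebesgue A" | "V / 2 * (r / 2) ^ CARD('n) <= measure lebesgue B"
   by fastforce
  then have "\<exists>m. AEL x. x \<in> ball c (r / 2 / 2) --> \<bar>u x - m\<bar> <= q ^ Suc n * M1"
  proof cases
   case 1
   have "AEL x. x \<in> ball c (r / 2 / 2) --> u x <= (m + d) - \<theta> * (m + d - m)"
   proof (rule dec[OF D(1)[of m] r2])
    show "AEL x. x \<in> ball c (2 * (r / 2)) --> u x <= m + d" using r(3) by eventually_elim (auto simp: d_def)
   qed (use d 1 in \<open>auto simp: A_def\<close>)
   then have "AEL x. x \<in> ball c (r / 2 / 2) --> \<bar>u x - (m - \<theta> * d / 2)\<bar> <= q ^ Suc n * M1"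
    using r(3)
   proof eventually_elim
    case (elim x)
    show ?case
    proof
     assume x: "x \<in> ball c (r / 2 / 2)"
     then have "x \<in> ball c r" using r(1) by auto
     then show "\<bar>u x - (m - \<theta> * d / 2)\<bar> <= q ^ Suc n * M1"
      unfolding qd using elim x by (simp add: d_def[symmetric] abs_le_iff)
    qed
   qed
   then show ?thesis by blast
  next
   case 2
   have "AEL x. x \<in> ball c (r / 2 / 2) --> - u x <= (- m + d) - \<theta> * (- m + d - (- m))"
   proof (rule dec[OF D(2)[of "- m"] r2])
    show "AEL x. x \<in> ball c (2 * (r / 2)) --> - u x <= - m + d" using r(3) by eventually_elim (auto simp: d_def)
   qed (use d 2 in \<open>auto simp: B_def\<close>)
   then have "AEL x. x \<in> ball c (r / 2 / 2) --> \<bar>u x - (m + \<theta> * d / 2)\<bar> <= q ^ Suc n * M1"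
    using r(3)
   proof eventually_elim
    case (elim x)
    show ?case
    proof
     assume x: "x \<in> ball c (r / 2 / 2)"
     then have "x \<in> ball c r" using r(1) by auto
     then show "\<bar>u x - (m + \<theta> * d / 2)\<bar> <= q ^ Suc n * M1"
      unfolding qd using elim x by (simp add: d_def[symmetric] abs_le_iff)
    qed
   qed
   then show ?thesis by blast
  qed
  then show ?case using r by (intro exI[of _ "r / 2 / 2"]) auto
 qed
 moreover have "\<exists>n. q ^ n * M1 <= e"
 proof -
  obtain n where "q ^ n < e / M1" using real_arch_pow_inv[of "e / M1" q] q e M1 by auto
  then show ?thesis using M1 by (intro exI[of _ n]) (simp add: field_simps)
 qed
 ultimately obtain n r m where "r > 0" "AEL x. x \<in> ball c r --> \<bar>u x - m\<bar> <= q ^ n * M1" "q ^ n * M1 <= e" by blast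
 then show ?thesis by (intro exI[of _ r] conjI exI[of _ m]) (auto elim: eventually_mono)
qed

section \<open>Monotone elliptic equations\<close>

definition mulL :: "(real^'n::finite => real) => 'n L2 => 'n L2" where
 "mulL m u = abs_L2 (%x. m x * rep_L2 u x)"

lemma mulL_sq: "m \<in> LM ==> (!!x. \<bar>m x\<bar> <= C) ==> sq (%x. m x * rep_L2 u x)"
 by (rule sq_integrable_bounded_mult[OF sq_integrable_rep])

lemma norm_abs_L2_le:
 assumes "sq f" "sq g" "AEL x. \<bar>f x\<bar> <= \<bar>g x\<bar>"
 shows "norm (abs_L2 f) <= norm (abs_L2 g)"
proof (rule power2_le_imp_le)
 show "(norm (abs_L2 f))^2 <= (norm (abs_L2 g))^2"
  unfolding norm_abs_L2[OF assms(1)] norm_abs_L2[OF assms(2)]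
 proof (rule integral_mono_AE)
  show "AEL x. (f x)^2 <= (g x)^2" using assms(3) by eventually_elim (simp add: abs_le_square_iff)
 qed (use assms in \<open>auto simp: sq_integrable_def\<close>)
qed simp

lemma norm_mulL:
 assumes "m \<in> LM" "!!x. \<bar>m x\<bar> <= C"
 shows "norm (mulL m u) <= C * norm u"
proof -
 have C: "C \<ge> 0" using assms(2)[of 0] by linarith
 have "norm (mulL m u) <= norm (abs_L2 (%x. C * rep_L2 u x))"
  unfolding mulL_def
 proof (rule norm_abs_L2_le[OF mulL_sq[OF assms] sq_integrable_scale[OF sq_integrable_rep]])
  show "AEL x. \<bar>m x * rep_L2 u x\<bar> <= \<bar>C * rep_L2 u x\<bar>"
   using assms(2) C by (intro AE_I2) (simp add: abs_mult mult_right_mono)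
 qed
 also have "abs_L2 (%x. C * rep_L2 u x) = C *\<^sub>R u" using scaleR_abs_L2[OF sq_integrable_rep, of C u] by simp
 finally show ?thesis using C by simp
qed

lemma mulL_diff:
 assumes "m \<in> LM" "!!x. \<bar>m x\<bar> <= C"
 shows "mulL m u - mulL m v = mulL m (u - v)"
 unfolding mulL_def minus_abs_L2[OF mulL_sq[OF assms] mulL_sq[OF assms]]
proof (rule abs_L2_eqI)
 show "AEL x. m x * rep_L2 u x - m x * rep_L2 v x = m x * rep_L2 (u - v) x"
  using rep_minus_AE[of u v] by eventually_elim (simp add: right_diff_distrib)
qed (intro sq_integrable_diff mulL_sq[OF assms])+

lemma inner_mulL:
 assumes "m \<in> LM" "!!x. \<bar>m x\<bar> <= C" "sq h"
 shows "mulL m u \<bullet> abs_L2 h = (LEB x. m x * rep_L2 u x * h x)"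
 unfolding mulL_def by (rule inner_abs_L2[OF mulL_sq[OF assms(1,2)] assms(3)])

definition rv :: "'n::finite L2 ^ 'n => real^'n => real^'n" where
 "rv G x = (\<chi> i. rep_L2 (G $ i) x)"

lemma sqv_rv: "sqv (rv G)"
 by (simp add: sqv_def rv_def sq_integrable_rep)

lemma emb_rep: "emb (rep_L2 u) (rv G) = (u, G)"
 by (simp add: emb_def rv_def vec_eq_iff)

lemma H0_iff_W: "U \<in> H0 Om \<longleftrightarrow> W Om (rep_L2 (fst U)) (rv (snd U))"
 by (simp add: W_def sq_integrable_rep sqv_rv emb_rep)

lemma emb_add:
 assumes "sq y" "sq y'" "sqv g" "sqv g'"
 shows "emb (%x. y x + y' x) (%x. g x + g' x) = emb y g + emb y' g'"
 using assms by (simp add: emb_def plus_abs_L2 sqv_def vec_eq_iff)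

lemma emb_scale:
 assumes "sq y" "sqv g"
 shows "emb (%x. c * y x) (%x. c *\<^sub>R g x) = c *\<^sub>R emb y g"
 using assms by (simp add: emb_def scaleR_abs_L2 sqv_def vec_eq_iff)

lemma subspace_H0: "subspace (H0 Om)"
proof (rule subspaceI)
 have "emb (%x::real^'a. 0) (%x. 0) = 0"
  by (simp add: emb_def zero_prod_def zero_vec_def vec_eq_iff zero_L2.abs_eq)
 moreover have "emb (%x::real^'a. 0) (%x. 0) \<in> H0 Om" using W_zero[of Om] by (simp add: W_def)
 ultimately show "(0 :: 'a L2 \<times> ('a L2 ^ 'a)) \<in> H0 Om" by simp
next
 fix U V :: "'a L2 \<times> ('a L2 ^ 'a)" assume "U \<in> H0 Om" "V \<in> H0 Om"
 then have "W Om (%x. rep_L2 (fst U) x + rep_L2 (fst V) x) (%x. rv (snd U) x + rv (snd V) x)"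
  by (intro W_add) (simp_all add: H0_iff_W)
 then show "U + V \<in> H0 Om"
  by (simp add: W_def emb_add[OF sq_integrable_rep sq_integrable_rep sqv_rv sqv_rv] emb_rep)
next
 fix U :: "'a L2 \<times> ('a L2 ^ 'a)" and c assume "U \<in> H0 Om"
 then have "W Om (%x. c * rep_L2 (fst U) x) (%x. c *\<^sub>R rv (snd U) x)"
  by (intro W_scale) (simp add: H0_iff_W)
 then show "c *\<^sub>R U \<in> H0 Om"
  by (simp add: W_def emb_scale[OF sq_integrable_rep sqv_rv] emb_rep)
qed

lemma norm_vec_L2_sq: "(norm (G :: 'a::real_inner ^ 'n::finite))^2 = (\<Sum>i\<in>UNIV. (norm (G $ i))^2)"
 by (simp add: power2_norm_eq_inner inner_vec_def)

lemma sqv_norm_sq: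
 assumes "sqv g"
 shows "(LEB x. (norm (g x :: real^'n::finite))^2) = (\<Sum>i\<in>UNIV. LEB x. (g x $ i)^2)"
 using assms by (simp add: norm_vec_sq sqv_def sq_integrable_def)

lemma norm_rv_sq: "(LEB x. (norm (rv G x))^2) = (norm (G :: 'n::finite L2 ^ 'n))^2"
proof -
 have "(LEB x. (rv G x $ i)^2) = (norm (G $ i))^2" for i
  using norm_abs_L2[OF sq_integrable_rep, of "G $ i"] by (simp add: rv_def)
 then show ?thesis by (subst sqv_norm_sq[OF sqv_rv]) (simp add: norm_vec_L2_sq)
qed

lemma poincare:
 assumes "open Om" "bounded (Om :: (real^'n::finite) set)"
 obtains CP where "CP > 0" "!!v g. W Om v g ==> (LEB x. (v x)^2) <= CP * (LEB x. (norm (g x))^2)"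
proof
 \<comment> \<open>Since \<open>s\<close> is at least 1 it is at most \<open>s ^ CARD('n)\<close>,
   so a cube of sufficient volume is found without taking a root.\<close>
 define s where "s = max 1 (4 * measure lebesgue Om)"
 have s: "s \<ge> 1" by (simp add: s_def)
 show "4 * (real CARD('n) * s)^2 > 0" using s by simp
 fix v g assume W: "W Om v g"
 have l: "Om \<in> lmeasurable" using assms by (intro bounded_set_imp_lmeasurable) auto
 have "s <= s ^ CARD('n)" using s by (intro self_le_power) auto
 moreover have "4 * measure lebesgue Om <= s" by (simp add: s_def)
 ultimately have "4 * measure lebesgue Om <= s ^ CARD('n)" by linarith
 then show "(LEB x. (v x)^2) <= 4 * (real CARD('n) * s)^2 * (LEB x. (norm (g x))^2)"
  using s by (intro faber_krahn[OF W l W_outside(1)[OF W]]) auto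
qed

text \<open>Boundedness and ellipticity are demanded at every point of the space, which
  \<open>elliptic_version\<close> arranges; the pointwise estimates then carry no exceptional null
  sets.\<close>

locale elliptic =
 fixes Om :: "(real^'n::finite) set" and b :: "'n => 'n => real^'n => real" and lam Lam :: real
 assumes op: "open Om" and bd: "bounded Om"
  and bm: "!!i j. b i j \<in> LM" and bb: "!!i j x. \<bar>b i j x\<bar> <= Lam"
  and lam: "lam > 0" and ell: "!!x \<xi>. lam * (norm \<xi>)^2 <= (\<Sum>i\<in>UNIV. \<Sum>j\<in>UNIV. b i j x * \<xi> $ i * \<xi> $ j)"
begin

lemma Lam_nonneg: "Lam \<ge> 0" using bb[of undefined undefined 0] by linarith

definition bform :: "(real^'n => real^'n) => (real^'n => real^'n) => real" where
 "bform g h = (\<Sum>i\<in>UNIV. \<Sum>j\<in>UNIV. LEB x. b i j x * g x $ i * h x $ j)"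

lemma b_integrable:
 assumes "sqv g" "sqv h"
 shows "integrable lebesgue (%x. b i j x * g x $ i * h x $ j)"
 using sq_integrable_mult[OF sq_integrable_bounded_mult[OF _ bm bb]] assms by (simp add: sqv_def)

lemma bform_eq:
 assumes "sqv g" "sqv h"
 shows "bform g h = (LEB x. (\<Sum>i\<in>UNIV. \<Sum>j\<in>UNIV. b i j x * g x $ i * h x $ j))"
  and "integrable lebesgue (%x. \<Sum>i\<in>UNIV. \<Sum>j\<in>UNIV. b i j x * g x $ i * h x $ j)"
 using b_integrable[OF assms] by (simp_all add: bform_def)

lemma bform_coercive:
 assumes "sqv g"
 shows "lam * (LEB x. (norm (g x))^2) <= bform g g"
proof -
 have "lam * (LEB x. (norm (g x))^2) = (LEB x. lam * (norm (g x))^2)" by simp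
 also have "... <= bform g g"
  unfolding bform_eq(1)[OF assms assms]
  by (rule integral_mono[OF _ bform_eq(2)[OF assms assms] ell]) (use sqv_norm[OF assms] in \<open>simp add: sq_integrable_def\<close>)
 finally show ?thesis .
qed

lemma bform_add:
 assumes "sqv g" "sqv g'" "sqv h"
 shows "bform (%x. g x + g' x) h = bform g h + bform g' h"
 using b_integrable[OF assms(1,3)] b_integrable[OF assms(2,3)]
 by (simp add: bform_def ring_distribs sum.distrib)

lemma bform_scale:
 shows "bform (%x. c *\<^sub>R g x) h = c * bform g h" and "bform g (%x. c *\<^sub>R h x) = c * bform g h"
 by (simp_all add: bform_def sum_distrib_left mult.left_commute mult.assoc)

lemma sqv_scale: "sqv g ==> sqv (%x. c *\<^sub>R g x)"
 by (simp add: sqv_def sq_integrable_scale)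

lemma bform_diff:
 assumes "sqv g" "sqv g'" "sqv h"
 shows "bform (%x. g x - g' x) h = bform g h - bform g' h"
 using bform_add[OF assms(1) sqv_scale[OF assms(2), of "-1"] assms(3)] bform_scale(1)[of "-1" g' h] by simp

text \<open>The equation is a variational inequality on the closed subspace \<open>H0\<close> of the
  product of \<open>L2\<close> spaces, where gradients are components of the unknown. The term with
  \<open>c\<close> is monotone and Lipschitz from \<open>L2\<close> to \<open>L2\<close>, and the
  principal part is coercive.\<close>

theorem existence:
 fixes c :: "real^'n => real => real"
 assumes cs: "!!y. sq y ==> sq (%x. c x (y x))"
  and cl: "!!x s t. \<bar>c x s - c x t\<bar> <= Lc * \<bar>s - t\<bar>"
  and cm: "!!x s t. s <= t ==> c x s <= c x t"
  and F: "sq F"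
 obtains y g where "W Om y g"
  "!!v h. W Om v h ==> bform g h + (LEB x. c x (y x) * v x) = (LEB x. F x * v x)"
proof -
 obtain CP where CP: "CP > 0" "!!v g. W Om v g ==> (LEB x. (v x)^2) <= CP * (LEB x. (norm (g x))^2)"
  using poincare[OF op bd] by metis
 define Nc where "Nc u = abs_L2 (%x. c x (rep_L2 u x))" for u
 define T1 where "T1 G = (\<chi> j. \<Sum>i\<in>UNIV. mulL (b i j) (G $ i))" for G :: "'n L2 ^ 'n"
 define T where "T U = (Nc (fst U) - abs_L2 F, T1 (snd U))" for U
 have cr: "sq (%x. c x (rep_L2 u x))" for u by (rule cs[OF sq_integrable_rep])
 have Lc: "Lc \<ge> 0" using cl[of 0 1 0] by simp
 have T1d: "T1 G - T1 G' = T1 (G - G')" for G G'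
  by (simp add: T1_def vec_eq_iff mulL_diff[OF bm bb] sum_subtractf[symmetric])
 have T1i: "T1 G \<bullet> (\<chi> j. abs_L2 (%x. h x $ j)) = bform (rv G) h" if "sqv h" for G h
 proof -
  have "T1 G \<bullet> (\<chi> j. abs_L2 (%x. h x $ j)) = (\<Sum>j\<in>UNIV. \<Sum>i\<in>UNIV. mulL (b i j) (G $ i) \<bullet> abs_L2 (%x. h x $ j))"
   by (simp add: T1_def inner_vec_def inner_sum_left)
  also have "... = (\<Sum>j\<in>UNIV. \<Sum>i\<in>UNIV. LEB x. b i j x * rep_L2 (G $ i) x * h x $ j)"
   using that by (simp add: inner_mulL[OF bm bb] sqv_def)
  also have "... = bform (rv G) h" unfolding bform_def rv_def by (subst sum.swap) simp
  finally show ?thesis .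
 qed
 have T1ii: "T1 G \<bullet> H = bform (rv G) (rv H)" for G H
 proof -
  have "(\<chi> j. abs_L2 (%x. rv H x $ j)) = H" by (simp add: rv_def vec_eq_iff)
  then show ?thesis using T1i[OF sqv_rv, of G H] by simp
 qed
 have NcL: "norm (Nc u - Nc v) <= Lc * norm (u - v)" for u v
 proof -
  have "norm (Nc u - Nc v) <= norm (abs_L2 (%x. Lc * rep_L2 (u - v) x))"
   unfolding Nc_def minus_abs_L2[OF cr cr]
  proof (rule norm_abs_L2_le[OF sq_integrable_diff[OF cr cr] sq_integrable_scale[OF sq_integrable_rep]])
   show "AEL x. \<bar>c x (rep_L2 u x) - c x (rep_L2 v x)\<bar> <= \<bar>Lc * rep_L2 (u - v) x\<bar>"
    using rep_minus_AE[of u v] by eventually_elim (use cl Lc in \<open>simp add: abs_mult\<close>)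
  qed
  also have "abs_L2 (%x. Lc * rep_L2 (u - v) x) = Lc *\<^sub>R (u - v)"
   using scaleR_abs_L2[OF sq_integrable_rep, of Lc "u - v"] by simp
  finally show ?thesis using Lc by simp
 qed
 have T1L: "norm (T1 G) <= (real CARD('n))^2 * Lam * norm G" for G
 proof -
  have "norm (T1 G) <= (\<Sum>j\<in>UNIV. norm (T1 G $ j))" unfolding norm_vec_def by (rule L2_set_le_sum) simp
  also have "... <= (\<Sum>j\<in>(UNIV::'n set). \<Sum>i\<in>(UNIV::'n set). Lam * norm G)"
  proof (rule sum_mono)
   fix j
   have "norm (T1 G $ j) <= (\<Sum>i\<in>UNIV. norm (mulL (b i j) (G $ i)))" by (simp add: T1_def norm_sum)
   also have "... <= (\<Sum>i\<in>(UNIV::'n set). Lam * norm G)"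
   proof (rule sum_mono)
    fix i
    have "norm (mulL (b i j) (G $ i)) <= Lam * norm (G $ i)" by (rule norm_mulL[OF bm bb])
    also have "... <= Lam * norm G" using Lam_nonneg by (intro mult_left_mono Finite_Cartesian_Product.norm_nth_le)
    finally show "norm (mulL (b i j) (G $ i)) <= Lam * norm G" .
   qed
   finally show "norm (T1 G $ j) <= (\<Sum>i\<in>(UNIV::'n set). Lam * norm G)" .
  qed
  also have "... = (real CARD('n))^2 * Lam * norm G" by (simp add: power2_eq_square)
  finally show ?thesis .
 qed
 have Td: "T U - T V = (Nc (fst U) - Nc (fst V), T1 (snd U - snd V))" for U V
  by (simp add: T_def T1d)
 define D where "D = Lc + (real CARD('n))^2 * Lam"
 have "\<exists>U\<in>H0 Om. \<forall>Z\<in>H0 Om. 0 <= T U \<bullet> (Z - U)"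
 proof (rule variational_inequality_strongly_monotone)
  show "closed (H0 Om)" by (simp add: H0_def)
  show "convex (H0 Om)" by (rule subspace_imp_convex[OF subspace_H0])
  show "H0 Om \<noteq> {}" using subspace_0[OF subspace_H0, of Om] by blast
  \<comment> \<open>Ellipticity controls the gradient components alone; the Poincare inequality
    extends this to the product norm at the cost of the factor \<open>1 + CP\<close>.\<close>
  show "lam / (1 + CP) > 0" using lam CP by simp
  fix U V assume UV: "U \<in> H0 Om" "V \<in> H0 Om"
  have "norm (T U - T V) <= norm (Nc (fst U) - Nc (fst V)) + norm (T1 (snd U - snd V))"
   unfolding Td by (rule norm_Pair_le)
  also have "... <= Lc * norm (fst U - fst V) + (real CARD('n))^2 * Lam * norm (snd U - snd V)"
   by (intro add_mono NcL T1L)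
  also have "... <= Lc * norm (U - V) + (real CARD('n))^2 * Lam * norm (U - V)"
  proof -
   have "norm (fst (U - V)) <= norm (U - V)" by (metis norm_fst_le prod.collapse)
   moreover have "norm (snd (U - V)) <= norm (U - V)" by (metis norm_snd_le prod.collapse)
   ultimately show ?thesis using Lc Lam_nonneg by (intro add_mono mult_left_mono) auto
  qed
  finally show "norm (T U - T V) <= D * norm (U - V)" by (simp add: D_def algebra_simps)
  define E where "E = snd U - snd V"
  have d: "U - V \<in> H0 Om" using UV subspace_diff[OF subspace_H0] by blast
  have n1: "(norm (fst U - fst V))^2 <= CP * (norm E)^2"
   using CP(2)[OF d[unfolded H0_iff_W]] norm_abs_L2[OF sq_integrable_rep, of "fst U - fst V"]
   by (simp add: norm_rv_sq E_def)
  have "(norm (U - V))^2 = (norm (fst U - fst V))^2 + (norm E)^2"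
   by (simp add: norm_prod_def E_def)
  then have "(norm (U - V))^2 <= (1 + CP) * (norm E)^2" using n1 by (simp add: algebra_simps)
  then have "lam / (1 + CP) * (norm (U - V))^2 <= lam / (1 + CP) * ((1 + CP) * (norm E)^2)"
   using lam CP by (intro mult_left_mono) auto
  also have "... = lam * (norm E)^2" using CP by simp
  also have "... <= T1 E \<bullet> E" using bform_coercive[OF sqv_rv, of E] by (simp add: T1ii norm_rv_sq)
  also have "... <= (Nc (fst U) - Nc (fst V)) \<bullet> (fst U - fst V) + T1 E \<bullet> E"
  proof -
   have "(Nc (fst U) - Nc (fst V)) \<bullet> (fst U - fst V) = (LEB x. (c x (rep_L2 (fst U) x) - c x (rep_L2 (fst V) x)) * (rep_L2 (fst U) x - rep_L2 (fst V) x))"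
    using minus_abs_L2[OF sq_integrable_rep sq_integrable_rep, of "fst U" "fst V"]
     inner_abs_L2[OF sq_integrable_diff[OF cr cr] sq_integrable_diff[OF sq_integrable_rep sq_integrable_rep]]
    by (simp add: Nc_def minus_abs_L2[OF cr cr])
   moreover have "0 <= (c x s - c x t) * (s - t)" for x s t
    using cm[of s t x] cm[of t s x] by (cases "s <= t") (auto simp: mult_nonpos_nonpos)
   ultimately show ?thesis by simp
  qed
  also have "... = (T U - T V) \<bullet> (U - V)" by (simp add: Td inner_prod_def E_def)
  finally show "lam / (1 + CP) * (norm (U - V))^2 <= (T U - T V) \<bullet> (U - V)" .
 qed
 then obtain U where U: "U \<in> H0 Om" "!!Z. Z \<in> H0 Om ==> 0 <= T U \<bullet> (Z - U)" by blast
 \<comment> \<open>On a subspace the inequality may be tested with \<open>U + V\<close> and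
   \<open>U - V\<close>, which turns it into an equation.\<close>
 have eq: "T U \<bullet> V = 0" if V: "V \<in> H0 Om" for V
 proof -
  have "U + V \<in> H0 Om" "U - V \<in> H0 Om" using U(1) V subspace_add[OF subspace_H0] subspace_diff[OF subspace_H0] by blast+
  from U(2)[OF this(1)] U(2)[OF this(2)] show ?thesis by simp
 qed
 show thesis
 proof
  show "W Om (rep_L2 (fst U)) (rv (snd U))" using U(1) by (simp add: H0_iff_W)
  fix v h assume W: "W Om v h"
  have "T U \<bullet> emb v h = 0" using W by (intro eq) (simp add: W_def)
  then have "(Nc (fst U) - abs_L2 F) \<bullet> abs_L2 v + bform (rv (snd U)) h = 0"
   by (simp add: T_def emb_def T1i[OF W_sqv[OF W]])
  then show "bform (rv (snd U)) h + (LEB x. c x (rep_L2 (fst U) x) * v x) = (LEB x. F x * v x)"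
   by (simp add: Nc_def inner_diff_left inner_abs_L2[OF cr W_sq[OF W]] inner_abs_L2[OF F W_sq[OF W]])
 qed
qed

end

section \<open>Boundedness and continuity of solutions\<close>

text \<open>With levels \<open>k\<^sub>j = d (1 - 2\<^sup>-\<^sup>j)\<close> the norms \<open>n\<^sub>j\<close> of \<open>(y - k\<^sub>j)\<^sup>+\<close> satisfy \<open>n\<^sub>j <= \<epsilon> / 16\<^sup>j\<close>: the
 set \<open>y > k\<^sub>j\<^sub>+\<^sub>1\<close> is so small that \<open>faber_krahn\<close> applies with the side length \<open>4\<^sup>-\<^sup>j\<close>. This is the
 only place where \<open>CARD('n) <= 3\<close> matters.\<close>

lemma stampacchia:
 fixes Om :: "(real^'n::finite) set"
 assumes dom: "open Om" "bounded Om" and dim: "CARD('n) <= 3" and lam: "lam > 0"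
 shows "\<exists>K>0. \<forall>y g F E. W Om y g --> sq F --> E > 0 --> sqrt (LEB x. (F x)^2) <= E -->
  (\<forall>k\<ge>0. lam * (LEB x. (norm (if y x > k then g x else 0))^2) <= (LEB x. F x * max 0 (y x - k))) -->
  (AEL x. y x <= K * E)"
proof -
 obtain CP where CP: "CP > 0" "!!v g. W Om v g ==> (LEB x. (v x)^2) <= CP * (LEB x. (norm (g x))^2)"
  using poincare[OF dom] by metis
 define N where "N = real CARD('n)"
 define C where "C = 4 * N^2 / lam"
 have C: "C > 0" using lam by (simp add: C_def N_def)
 \<comment> \<open>\<open>CP / lam\<close> starts the induction by the Poincare inequality, and
   \<open>16 * C\<close> pays for the factor 1/16 in each step.\<close>
 define K0 where "K0 = max (16 * C) (CP / lam)"
 have K0: "K0 > 0" "16 * C <= K0" "CP / lam <= K0" using C by (auto simp: K0_def)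
 have "AEL x. y x <= 4 * K0 * E"
  if W: "W Om y g" and F: "sq F" and E: "E > 0" "sqrt (LEB x. (F x)^2) <= E"
   and en: "!!k. k \<ge> 0 ==> lam * (LEB x. (norm (if y x > k then g x else 0))^2) <= (LEB x. F x * max 0 (y x - k))"
  for y g F E
 proof -
  define n where "n k = sqrt (LEB x. (max 0 (y x - k))^2)" for k
  have n0: "n k \<ge> 0" for k by (simp add: n_def)
  have n2: "(n k)^2 = (LEB x. (max 0 (y x - k))^2)" for k by (simp add: n_def)
  have sp: "sq (%x. max 0 (y x - k))" if "k \<ge> 0" for k by (rule W_sq[OF W_pos[OF W that]])
  have ym[measurable]: "y \<in> LM" by (rule sq_integrable_measurable[OF W_sq[OF W]])
  have Om[measurable]: "Om \<in> sets lebesgue" using dom by simp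
  have gE: "(LEB x. (norm (if y x > k then g x else 0))^2) <= E * n k / lam" if k: "k \<ge> 0" for k
  proof -
   have "(LEB x. F x * max 0 (y x - k)) <= \<bar>LEB x. F x * max 0 (y x - k)\<bar>" by simp
   also have "... <= sqrt (LEB x. (F x)^2) * n k" unfolding n_def by (rule abs_integral_mult_le[OF F sp[OF k]])
   also have "... <= E * n k" using E n0 by (intro mult_right_mono)
   finally show ?thesis using en[OF k] lam by (simp add: le_divide_eq mult.commute)
  qed
  have sq_le: "x <= z" if "x^2 <= z * x" "0 <= x" "0 <= z" for x z :: real
   using that by (cases "x = 0") (auto simp: power2_eq_square)
  define A where "A k = {x \<in> Om. y x > k}" for k
  have Al: "A k \<in> lmeasurable" for k
  proof (rule bounded_set_imp_lmeasurable)
   have "{x \<in> space lebesgue. x \<in> Om \<and> y x > k} \<in> sets lebesgue" by measurable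
   then show "A k \<in> sets lebesgue" by (simp add: A_def)
  qed (use dom in \<open>auto simp: A_def intro: bounded_subset\<close>)
  have nA: "n k <= C * s^2 * E" if k: "k \<ge> 0" and s: "s > 0" "4 * measure lebesgue (A k) <= s ^ CARD('n)" for k s
  proof (rule sq_le)
   have "(n k)^2 <= 4 * (real CARD('n) * s)^2 * (LEB x. (norm (if y x > k then g x else 0))^2)"
    unfolding n2
   proof (rule faber_krahn[OF W_pos[OF W k] Al _ s])
    show "AEL x. x \<notin> A k --> max 0 (y x - k) = 0"
     using W_outside(1)[OF W] by eventually_elim (use k in \<open>auto simp: A_def\<close>)
   qed
   also have "... <= 4 * (real CARD('n) * s)^2 * (E * n k / lam)" by (intro mult_left_mono gE[OF k]) simp
   also have "... = C * s^2 * E * n k" by (simp add: C_def N_def power_mult_distrib)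
   finally show "(n k)^2 <= C * s^2 * E * n k" .
  qed (use n0 C E in auto)
  have mA: "(k - l)^2 * measure lebesgue (A k) <= (n l)^2" if "0 <= l" "l < k" for k l
  proof -
   have "(k - l)^2 * measure lebesgue (A k) = (LEB x. (k - l)^2 * indicator (A k) x)" by simp
   also have "... <= (LEB x. (max 0 (y x - l))^2)"
   proof (rule integral_mono)
    show "integrable lebesgue (%x. (k - l)^2 * indicator (A k) x)" using Al[of k] by (simp add: lmeasurable_iff_integrable)
    show "integrable lebesgue (%x. (max 0 (y x - l))^2)" using sp[OF that(1)] by (simp add: sq_integrable_def)
    fix x
    have "(k - l)^2 <= (max 0 (y x - l))^2" if "y x > k" using that \<open>l < k\<close> by (intro power_mono) auto
    then show "(k - l)^2 * indicator (A k) x <= (max 0 (y x - l))^2" by (auto simp: A_def indicator_def)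
   qed
   finally show ?thesis by (simp add: n2)
  qed
  define \<epsilon> where "\<epsilon> = K0 * E"
  \<comment> \<open>The factor 4 makes the level increments \<open>2 * \<epsilon> * (1/2)^j\<close>,
    so that Chebyshev's inequality bounds four times the measure of the next set by
    \<open>(1/64)^j\<close>, the cube of \<open>(1/4)^j\<close>.\<close>
  define d where "d = 4 * \<epsilon>"
  have ep: "\<epsilon> > 0" using K0 E by (simp add: \<epsilon>_def)
  define \<kappa> where "\<kappa> j = d * (1 - (1/2) ^ j)" for j :: nat
  have kap: "0 <= \<kappa> j" "\<kappa> j <= d" for j
  proof -
   have "(1/2::real) ^ j <= 1" by (rule power_le_one) auto
   then show "0 <= \<kappa> j" using ep by (simp add: \<kappa>_def d_def)
   show "\<kappa> j <= d" using ep by (simp add: \<kappa>_def d_def)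
  qed
  have claim: "n (\<kappa> j) <= \<epsilon> * (1/16) ^ j" for j
  proof (induction j)
   case 0
   have "(n 0)^2 <= CP * (LEB x. (norm (if y x > 0 then g x else 0))^2)"
    unfolding n2 by (rule CP(2)[OF W_pos[OF W order_refl]])
   also have "... <= CP * (E * n 0 / lam)" using CP(1) by (intro mult_left_mono gE) auto
   finally have "(n 0)^2 <= CP / lam * E * n 0" by simp
   then have "n 0 <= CP / lam * E" by (rule sq_le) (use n0 CP(1) lam E in simp_all)
   also have "... <= \<epsilon>" unfolding \<epsilon>_def using K0 E by (intro mult_right_mono) auto
   finally show ?case by (simp add: \<kappa>_def)
  next
   case (Suc j)
   have kd: "\<kappa> (Suc j) - \<kappa> j = 2 * \<epsilon> * (1/2) ^ j" by (simp add: \<kappa>_def d_def field_simps)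
   have kl: "\<kappa> j < \<kappa> (Suc j)"
   proof -
    have "0 < 2 * \<epsilon> * (1/2) ^ j" using ep by simp
    then show ?thesis using kd by linarith
   qed
   have "(2 * \<epsilon> * (1/2) ^ j)^2 * measure lebesgue (A (\<kappa> (Suc j))) <= (n (\<kappa> j))^2"
    using mA[OF kap(1)[of j] kl] by (simp only: kd)
   also have "... <= (\<epsilon> * (1/16) ^ j)^2" using Suc.IH n0 by (intro power_mono)
   finally have "4 * \<epsilon>^2 * (1/4) ^ j * measure lebesgue (A (\<kappa> (Suc j))) <= \<epsilon>^2 * (1/256) ^ j"
   proof -
    have p: "((1/2::real) ^ j)^2 = (1/4) ^ j" "((1/16::real) ^ j)^2 = (1/256) ^ j"
    proof -
     have "((1/2::real) ^ j)^2 = ((1/2)^2) ^ j" "((1/16::real) ^ j)^2 = ((1/16)^2) ^ j" by (simp_all only: power_mult[symmetric] mult.commute)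
     moreover have "(1/2::real)^2 = 1/4" "(1/16::real)^2 = 1/256" by (simp_all add: power2_eq_square)
     ultimately show "((1/2::real) ^ j)^2 = (1/4) ^ j" "((1/16::real) ^ j)^2 = (1/256) ^ j" by simp_all
    qed
    assume "(2 * \<epsilon> * (1/2) ^ j)^2 * measure lebesgue (A (\<kappa> (Suc j))) <= (\<epsilon> * (1/16) ^ j)^2"
    then show ?thesis unfolding power_mult_distrib p by simp
   qed
   then have "\<epsilon>^2 * ((1/4) ^ j * (4 * measure lebesgue (A (\<kappa> (Suc j))))) <= \<epsilon>^2 * (1/256) ^ j" by (simp add: mult_ac)
   then have "(1/4) ^ j * (4 * measure lebesgue (A (\<kappa> (Suc j)))) <= (1/256) ^ j" using ep by simp
   also have "(1/256::real) ^ j = (1/4) ^ j * (1/64) ^ j"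
   proof -
    have "(1/4::real) ^ j * (1/64) ^ j = ((1/4) * (1/64)) ^ j" by (rule power_mult_distrib[symmetric])
    then show ?thesis by simp
   qed
   finally have "4 * measure lebesgue (A (\<kappa> (Suc j))) <= (1/64) ^ j" by simp
   also have "(1/64::real) ^ j = ((1/4) ^ j) ^ 3"
   proof -
    have "((1/4::real) ^ j) ^ 3 = ((1/4) ^ 3) ^ j" by (simp only: power_mult[symmetric] mult.commute)
    also have "(1/4::real) ^ 3 = 1/64" by (simp add: power3_eq_cube)
    finally show ?thesis by simp
   qed
   \<comment> \<open>The base is at most 1, so lowering the exponent from 3 to the dimension can
     only increase the power.\<close>
   also have "... <= ((1/4) ^ j) ^ CARD('n)" using dim by (intro power_decreasing power_le_one) auto
   finally have "n (\<kappa> (Suc j)) <= C * ((1/4) ^ j)^2 * E" by (intro nA kap) auto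
   also have "((1/4::real) ^ j)^2 = (1/16) ^ j"
   proof -
    have "((1/4::real) ^ j)^2 = ((1/4)^2) ^ j" by (simp only: power_mult[symmetric] mult.commute)
    also have "(1/4::real)^2 = 1/16" by (simp add: power2_eq_square)
    finally show ?thesis .
   qed
   also have "C * (1/16) ^ j * E <= K0 / 16 * (1/16) ^ j * E" using K0 E by (intro mult_right_mono) auto
   also have "... = \<epsilon> * (1/16) ^ Suc j" by (simp add: \<epsilon>_def)
   finally show ?case .
  qed
  have nd: "n d <= \<epsilon> * (1/16) ^ j" for j
  proof -
   have "(LEB x. (max 0 (y x - d))^2) <= (LEB x. (max 0 (y x - \<kappa> j))^2)"
   proof (rule integral_mono)
    show "(max 0 (y x - d))^2 <= (max 0 (y x - \<kappa> j))^2" for x using kap(2)[of j] by (intro power_mono) auto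
   qed (use sp[of d] sp[OF kap(1)] ep in \<open>auto simp: sq_integrable_def d_def\<close>)
   then have "n d <= n (\<kappa> j)" by (simp add: n_def)
   with claim[of j] show ?thesis by linarith
  qed
  have "(%j. \<epsilon> * (1/16) ^ j) ----> \<epsilon> * 0"
   by (intro tendsto_mult tendsto_const LIMSEQ_realpow_zero) auto
  from LIMSEQ_le_const[OF this, of "n d"] nd have "n d <= 0" by auto
  then have "(n d)^2 = 0" using n0[of d] by simp
  then have "(LEB x. (max 0 (y x - d))^2) = 0" by (simp only: n2)
  moreover have "integrable lebesgue (%x. (max 0 (y x - d))^2)"
   using sp[of d] ep by (simp add: sq_integrable_def d_def)
  ultimately have "AEL x. (max 0 (y x - d))^2 = 0"
   by (subst (asm) integral_nonneg_eq_0_iff_AE) auto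
  then show ?thesis by eventually_elim (simp add: max_def d_def \<epsilon>_def split: if_splits)
 qed
 then show ?thesis using K0 by (intro exI[of _ "4 * K0"] conjI allI impI) auto
qed

section \<open>Sup bounds and Caccioppoli inequalities for the elliptic operator\<close>

context elliptic
begin

definition bl :: "real^'n => real^'n => real^'n => real" where
 "bl x \<xi> \<zeta> = (\<Sum>i\<in>UNIV. \<Sum>j\<in>UNIV. b i j x * \<xi> $ i * \<zeta> $ j)"

lemma bl_add: "bl x \<xi> (\<zeta> + \<zeta>') = bl x \<xi> \<zeta> + bl x \<xi> \<zeta>'"
 by (simp add: bl_def ring_distribs sum.distrib)

lemma bl_scale: "bl x \<xi> (c *\<^sub>R \<zeta>) = c * bl x \<xi> \<zeta>" "bl x (c *\<^sub>R \<xi>) \<zeta> = c * bl x \<xi> \<zeta>"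
 by (simp_all add: bl_def sum_distrib_left mult.left_commute mult.assoc)

lemma bl_bound: "\<bar>bl x \<xi> \<zeta>\<bar> <= (real CARD('n))^2 * Lam * (norm \<xi> * norm \<zeta>)"
proof -
 have "\<bar>bl x \<xi> \<zeta>\<bar> <= (\<Sum>i\<in>UNIV. \<Sum>j\<in>UNIV. \<bar>b i j x * \<xi> $ i * \<zeta> $ j\<bar>)"
  unfolding bl_def by (rule order_trans[OF sum_abs sum_mono[OF sum_abs]])
 also have "... <= (\<Sum>i\<in>(UNIV::'n set). \<Sum>j\<in>(UNIV::'n set). Lam * (norm \<xi> * norm \<zeta>))"
 proof (intro sum_mono)
  fix i j
  have "\<bar>b i j x\<bar> * (\<bar>\<xi> $ i\<bar> * \<bar>\<zeta> $ j\<bar>) <= Lam * (norm \<xi> * norm \<zeta>)"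
   using Lam_nonneg by (intro mult_mono bb component_le_norm_cart) auto
  then show "\<bar>b i j x * \<xi> $ i * \<zeta> $ j\<bar> <= Lam * (norm \<xi> * norm \<zeta>)" by (simp add: abs_mult mult.assoc)
 qed
 also have "... = (real CARD('n))^2 * Lam * (norm \<xi> * norm \<zeta>)" by (simp add: power2_eq_square)
 finally show ?thesis .
qed

lemma bform_bl: "sqv g ==> sqv h ==> bform g h = (LEB x. bl x (g x) (h x))"
 by (simp add: bl_def bform_eq)

lemma bl_integrable: "sqv g ==> sqv h ==> integrable lebesgue (%x. bl x (g x) (h x))"
 using bform_eq(2) by (simp add: bl_def)

lemma bform_trunc:
 assumes "sqv g" "sqv (%x. if y x > k then g x else 0)"
 shows "lam * (LEB x. (norm (if y x > (k::real) then g x else 0))^2) <= bform g (%x. if y x > k then g x else 0)"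
proof -
 have "bform g (%x. if y x > k then g x else 0) = bform (%x. if y x > k then g x else 0) (%x. if y x > k then g x else 0)"
  unfolding bform_bl[OF assms] bform_bl[OF assms(2,2)] by (intro Bochner_Integration.integral_cong) (auto simp: bl_def)
 then show ?thesis using bform_coercive[OF assms(2)] by simp
qed

text \<open>The truncations used in \<open>stampacchia\<close> are nonnegative and positive only
  where \<open>y\<close> is. Restricting the hypothesis to such test functions lets a lower-order
  term be dropped on account of its sign.\<close>

lemma linf_bound:
 assumes "CARD('n) <= 3"
 shows "\<exists>K>0. \<forall>y g F E. W Om y g --> sq F --> E > 0 --> sqrt (LEB x. (F x)^2) <= E -->
  (\<forall>v h. W Om v h --> (\<forall>x. 0 <= v x) --> (\<forall>x. 0 < v x --> 0 < y x) --> bform g h <= (LEB x. F x * v x)) -->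
  (AEL x. y x <= K * E)"
proof -
 obtain K where K: "K > 0" and K2: "\<forall>y g F E. W Om y g --> sq F --> E > 0 --> sqrt (LEB x. (F x)^2) <= E -->
  (\<forall>k\<ge>0. lam * (LEB x. (norm (if y x > k then g x else 0))^2) <= (LEB x. F x * max 0 (y x - k))) -->
  (AEL x. y x <= K * E)"
  using stampacchia[OF op bd assms lam] by (elim exE conjE) (rule that)
 show ?thesis
 proof (intro exI[of _ K] conjI K allI impI)
  fix y g F E
  assume a: "W Om y g" "sq F" "E > 0" "sqrt (LEB x. (F x)^2) <= E"
   and en: "\<forall>v h. W Om v h --> (\<forall>x. 0 <= v x) --> (\<forall>x. 0 < v x --> 0 < y x) --> bform g h <= (LEB x. F x * v x)"
  show "AEL x. y x <= K * E"
  proof (rule K2[rule_format, OF a])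
   fix k :: real assume k: "k \<ge> 0"
   note W = W_pos[OF a(1) k]
   have "bform g (%x. if y x > k then g x else 0) <= (LEB x. F x * max 0 (y x - k))"
    by (rule en[rule_format, OF W]) (use k in \<open>auto simp: max_def split: if_splits\<close>)
   with bform_trunc[OF W_sqv[OF a(1)] W_sqv[OF W]]
   show "lam * (LEB x. (norm (if y x > k then g x else 0))^2) <= (LEB x. F x * max 0 (y x - k))" by linarith
  qed
 qed
qed

text \<open>The equation is tested with \<open>\<eta>^2\<close> times the truncation. Its zero
  boundary values come either from \<open>k >= 0\<close> or from a ball inside \<open>Om\<close>, as
  in \<open>W_cut_trunc\<close>; this decides which levels belong to the class.\<close>

lemma DG_of_harmonic:
 assumes Wu: "W Om u g" and eq: "!!v h. W Om v h ==> (!!x. x \<notin> ball c R ==> v x = 0) ==> bform g h = 0"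
  and k0: "k0 \<ge> 0 \<or> cball c R \<subseteq> Om"
 shows "DG (2 * ((real CARD('n))^2 * Lam) / lam) k0 c R u g"
 unfolding DG_def
proof (intro conjI allI impI)
 show su: "sq u" by (rule W_sq[OF Wu])
 show sg: "sqv g" by (rule W_sqv[OF Wu])
 fix k \<eta> B
 assume k: "k0 <= k" and s: "smooth \<eta>" and "\<forall>x. 0 <= \<eta> x \<and> \<eta> x <= 1" "\<forall>x. norm (grad \<eta> x) <= B" "\<forall>x. x \<notin> ball c R --> \<eta> x = 0"
 then have e: "!!x. 0 <= \<eta> x" "!!x. \<eta> x <= 1" "!!x. norm (grad \<eta> x) <= B" "!!x. x \<notin> ball c R ==> \<eta> x = 0" by blast+
 define G where "G x = (if u x > k then g x else 0)" for x
 have tst: "k \<ge> 0 \<or> \<zeta> \<in> test_functions Om" if "smooth \<zeta>" "!!x. x \<notin> ball c R ==> \<zeta> x = 0" for \<zeta>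
 proof (cases "k0 \<ge> 0")
  case False
  then have "cball c R \<subseteq> Om" using k0 by blast
  then have "\<zeta> \<in> test_functions Om"
   by (intro test_functionsI[OF that(1) compact_cball[of c R]]) (use that(2) in force)+
  then show ?thesis by blast
 qed (use k in auto)
 have e1: "\<bar>\<eta> x\<bar> <= max 1 B" "norm (grad \<eta> x) <= max 1 B" for x using e(1-3)[of x] by auto
 have "W Om (%x. \<eta> x * max 0 (u x - k)) (%x. \<eta> x *\<^sub>R (if u x > k then g x else 0) + max 0 (u x - k) *\<^sub>R grad \<eta> x)"
  by (rule W_cut_trunc[OF Wu s e1 tst[OF s e(4)]])
 then show "W UNIV (%x. \<eta> x * max 0 (u x - k)) (%x. \<eta> x *\<^sub>R (if u x > k then g x else 0) + max 0 (u x - k) *\<^sub>R grad \<eta> x)"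
  by (rule W_mono) simp
 define \<zeta> where "\<zeta> x = \<eta> x * \<eta> x" for x
 have sz: "smooth \<zeta>" unfolding \<zeta>_def by (intro smooth_mult s)
 have gz: "grad \<zeta> x = (2 * \<eta> x) *\<^sub>R grad \<eta> x" for x
  unfolding \<zeta>_def grad_mult[OF s s] by (simp add: scaleR_add_left[symmetric])
 have z0: "\<zeta> x = 0" if "x \<notin> ball c R" for x using e(4)[OF that] by (simp add: \<zeta>_def)
 have z1: "\<bar>\<zeta> x\<bar> <= max 1 (2 * B)" for x
  using mult_mono[OF e(2)[of x] e(2)[of x] _ e(1)[of x]] e(1)[of x] by (simp add: \<zeta>_def)
 have z2: "norm (grad \<zeta> x) <= max 1 (2 * B)" for x
 proof -
  have "norm (grad \<zeta> x) <= (2 * 1) * B"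
   unfolding gz norm_scaleR using e(1-3)[of x] by (intro mult_mono) auto
  then show ?thesis by simp
 qed
 define h where "h x = \<zeta> x *\<^sub>R G x + max 0 (u x - k) *\<^sub>R grad \<zeta> x" for x
 have Wv: "W Om (%x. \<zeta> x * max 0 (u x - k)) h"
  unfolding h_def G_def by (rule W_cut_trunc[OF Wu sz z1 z2 tst[OF sz z0]])
 have zero: "bform g h = 0" by (rule eq[OF Wv]) (use z0 in simp)
 define X where "X x = \<eta> x * norm (G x)" for x
 define Y where "Y x = max 0 (u x - k) * norm (grad \<eta> x)" for x
 have iX: "integrable lebesgue (%x. (X x)^2)"
  using sq_integrable_cut_grad[OF sq_integrable_measurable[OF su] sg s e(1,2), of k] by (simp add: sq_integrable_def X_def G_def)
 have iY: "integrable lebesgue (%x. (Y x)^2)"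
  using sq_integrable_trunc_grad(1)[OF su s e, where k=k] by (simp add: sq_integrable_def Y_def)
 define \<Lambda> where "\<Lambda> = (real CARD('n))^2 * Lam"
 have \<Lambda>: "\<Lambda> \<ge> 0" using Lam_nonneg by (simp add: \<Lambda>_def)
 \<comment> \<open>The pointwise form of the Caccioppoli inequality: the mixed term is absorbed into
   half of the coercive term, and \<Lambda> bounds the bilinear form.\<close>
 have pt: "lam / 2 * (X x)^2 - 2 * \<Lambda>^2 / lam * (Y x)^2 <= bl x (g x) (h x)" for x
 proof -
  have "bl x (g x) (h x) = \<zeta> x * bl x (g x) (G x) + max 0 (u x - k) * bl x (g x) (grad \<zeta> x)"
   by (simp add: h_def bl_add bl_scale)
  also have "bl x (g x) (G x) = bl x (G x) (G x)" by (auto simp: G_def bl_def)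
  also have "max 0 (u x - k) * bl x (g x) (grad \<zeta> x) = max 0 (u x - k) * bl x (G x) (grad \<zeta> x)" by (auto simp: G_def)
  also have "\<zeta> x * bl x (G x) (G x) + max 0 (u x - k) * bl x (G x) (grad \<zeta> x)
   = \<eta> x * \<eta> x * bl x (G x) (G x) + 2 * (\<eta> x * max 0 (u x - k) * bl x (G x) (grad \<eta> x))"
   unfolding gz bl_scale by (simp add: \<zeta>_def)
  finally have e: "bl x (g x) (h x) = \<eta> x * \<eta> x * bl x (G x) (G x) + 2 * (\<eta> x * max 0 (u x - k) * bl x (G x) (grad \<eta> x))" .
  have "\<eta> x * \<eta> x * (lam * (norm (G x))^2) <= \<eta> x * \<eta> x * bl x (G x) (G x)"
   unfolding bl_def by (intro mult_left_mono ell) simp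
  then have 1: "lam * (X x)^2 <= \<eta> x * \<eta> x * bl x (G x) (G x)" by (simp add: X_def power2_eq_square mult_ac)
  have "\<bar>\<eta> x * max 0 (u x - k) * bl x (G x) (grad \<eta> x)\<bar> <= \<eta> x * max 0 (u x - k) * (\<Lambda> * (norm (G x) * norm (grad \<eta> x)))"
   unfolding abs_mult \<Lambda>_def using \<open>!!x. 0 <= \<eta> x\<close> by (intro mult_mono bl_bound) auto
  also have "... = \<Lambda> * X x * Y x" by (simp add: X_def Y_def mult_ac)
  finally have 2: "\<bar>\<eta> x * max 0 (u x - k) * bl x (G x) (grad \<eta> x)\<bar> <= \<Lambda> * X x * Y x" .
  \<comment> \<open>Young's inequality in the weighting that leaves exactly \<open>lam / 2\<close>
    in front of \<open>(X x)^2\<close>.\<close>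
  have "0 <= (lam * X x - 2 * \<Lambda> * Y x)^2" by simp
  then have "2 * lam * (2 * (\<Lambda> * X x * Y x)) <= lam^2 * (X x)^2 + 4 * \<Lambda>^2 * (Y x)^2"
   by (simp add: power2_diff power_mult_distrib mult_ac)
  then have "2 * (\<Lambda> * X x * Y x) <= (lam^2 * (X x)^2 + 4 * \<Lambda>^2 * (Y x)^2) / (2 * lam)"
   using lam by (simp add: le_divide_eq mult_ac)
  also have "... = lam / 2 * (X x)^2 + 2 * \<Lambda>^2 / lam * (Y x)^2"
   using lam by (simp add: add_divide_distrib power2_eq_square)
  finally show ?thesis using 1 2 e by linarith
 qed
 have "lam / 2 * (LEB x. (X x)^2) - 2 * \<Lambda>^2 / lam * (LEB x. (Y x)^2)
  = (LEB x. lam / 2 * (X x)^2 - 2 * \<Lambda>^2 / lam * (Y x)^2)"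
  using iX iY by simp
 also have "... <= (LEB x. bl x (g x) (h x))"
  by (rule integral_mono[OF _ bl_integrable[OF sg W_sqv[OF Wv]] pt]) (use iX iY in simp)
 also have "... = 0" using zero by (simp add: bform_bl[OF sg W_sqv[OF Wv]])
 finally have "lam * (LEB x. (X x)^2) <= 4 * \<Lambda>^2 / lam * (LEB x. (Y x)^2)" by (simp add: field_simps)
 then have "(LEB x. (X x)^2) <= (2 * \<Lambda> / lam)^2 * (LEB x. (Y x)^2)"
  using lam by (simp add: field_simps power2_eq_square)
 then show "(LEB x. (\<eta> x)^2 * (norm (if u x > k then g x else 0))^2)
   <= (2 * ((real CARD('n))^2 * Lam) / lam)^2 * (LEB x. (max 0 (u x - k))^2 * (norm (grad \<eta> x))^2)"
  by (simp add: X_def Y_def G_def \<Lambda>_def power_mult_distrib)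
qed

end

section \<open>Continuity of solutions up to the boundary\<close>

lemma AE_ball_not_False:
 assumes "AEL x. x \<in> ball (c::real^'n::finite) r --> P x" "r > 0"
 shows "\<exists>x\<in>ball c r. P x"
proof (rule ccontr)
 assume "\<not> (\<exists>x\<in>ball c r. P x)"
 then have "AEL x. x \<notin> ball c r" using assms(1) by (auto elim: eventually_mono)
 then have "ball c r \<in> null_sets lebesgue" by (simp add: AE_iff_null_sets)
 then have "measure lebesgue (ball c r) = 0" by (simp add: null_sets_def measure_def)
 then show False using assms(2) by simp
qed

text \<open>\<open>y c\<close> is the infimum of the essential upper bounds of \<open>u\<close> near
  \<open>c\<close>. Wherever \<open>u\<close> oscillates around \<open>m\<close> by at most
  \<open>e\<close> on a ball, \<open>y\<close> does so at every point of the ball; countably many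
  such balls give equality almost everywhere.\<close>

lemma continuous_representative:
 fixes u :: "real^'n::finite => real"
 assumes loc: "!!c e. e > 0 ==> \<exists>r>0. \<exists>m. AEL x. x \<in> ball c r --> \<bar>u x - m\<bar> <= e"
 obtains y where "continuous_on UNIV y" "AEL x. u x = y x"
proof -
 define S where "S c = {s. \<exists>r>0. AEL x. x \<in> ball c r --> u x <= s}" for c
 define y where "y c = Inf (S c)" for c
 have key: "\<bar>y z - m\<bar> <= e"
  if r: "r > 0" and ae: "AEL x. x \<in> ball c r --> \<bar>u x - m\<bar> <= e" and z: "z \<in> ball c r" for c r m e z
 proof -
  define t where "t = r - dist c z"
  have t: "t > 0" using z by (simp add: t_def)
  have sub: "ball z t \<subseteq> ball c r"
  proof
   fix x assume "x \<in> ball z t"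
   then show "x \<in> ball c r" using dist_triangle[of c x z] by (simp add: t_def)
  qed
  have "AEL x. x \<in> ball z t --> u x <= m + e" using ae by eventually_elim (use sub in auto)
  then have in1: "m + e \<in> S z" using t by (auto simp: S_def)
  have lb: "m - e <= s" if s: "s \<in> S z" for s
  proof -
   obtain r' where r': "r' > 0" "AEL x. x \<in> ball z r' --> u x <= s" using s by (auto simp: S_def)
   have "AEL x. x \<in> ball z (min t r') --> m - e <= s"
    using ae r'(2) by eventually_elim (use sub in force)
   from AE_ball_not_False[OF this] t r'(1) show ?thesis by auto
  qed
  have "y z <= m + e" unfolding y_def by (rule cInf_lower[OF in1 bdd_belowI[of _ "m - e"]]) (rule lb)
  moreover have "m - e <= y z" unfolding y_def by (rule cInf_greatest) (use in1 lb in auto)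
  ultimately show ?thesis by auto
 qed
 show thesis
 proof
  show "continuous_on UNIV y"
   unfolding continuous_on_iff
  proof (intro ballI allI impI)
   fix c and e :: real assume e: "e > 0"
   obtain r m where r: "r > 0" "AEL x. x \<in> ball c r --> \<bar>u x - m\<bar> <= e / 3" using loc[of "e / 3" c] e by auto
   have "dist (y x) (y c) < e" if "dist x c < r" for x
   proof -
    have "\<bar>y x - m\<bar> <= e / 3" "\<bar>y c - m\<bar> <= e / 3" using key[OF r] that r(1) by (simp_all add: dist_commute)
    then show ?thesis using e unfolding dist_real_def by linarith
   qed
   then show "\<exists>d>0. \<forall>x\<in>UNIV. dist x c < d --> dist (y x) (y c) < e" using r(1) by blast
  qed
  have n: "AEL x. \<bar>u x - y x\<bar> <= 2 / real (Suc n)" for n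
  proof -
   have "\<exists>r>0. AEL x. x \<in> ball c r --> \<bar>u x - y x\<bar> <= 2 / real (Suc n)" for c
   proof -
    obtain r m where r: "r > 0" "AEL x. x \<in> ball c r --> \<bar>u x - m\<bar> <= 1 / real (Suc n)"
     using loc[of "1 / real (Suc n)" c] by auto
    have "AEL x. x \<in> ball c r --> \<bar>u x - y x\<bar> <= 2 / real (Suc n)"
     using r(2)
    proof eventually_elim
     case (elim x)
     show ?case
     proof
      assume x: "x \<in> ball c r"
      have "\<bar>u x - y x\<bar> <= 1 / real (Suc n) + 1 / real (Suc n)" using elim x key[OF r x] by linarith
      then show "\<bar>u x - y x\<bar> <= 2 / real (Suc n)" by simp
     qed
    qed
    then show ?thesis using r(1) by blast
   qed
   from choice[OF allI[OF this]]
   obtain r where r': "\<forall>c. r c > 0 \<and> (AEL x. x \<in> ball c (r c) --> \<bar>u x - y x\<bar> <= 2 / real (Suc n))" ..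
   note r = r'[rule_format, THEN conjunct1] r'[THEN spec, THEN conjunct2]
   obtain F where F: "F \<subseteq> range (%c. ball c (r c))" "countable F" "\<Union>F = \<Union>(range (%c. ball c (r c)))"
    using Lindelof[of "range (%c. ball c (r c))"] by auto
   have "AEL x. \<forall>B\<in>F. x \<in> B --> \<bar>u x - y x\<bar> <= 2 / real (Suc n)"
    using F(1,2) r(2) by (subst AE_ball_countable) auto
   moreover have "\<exists>B\<in>F. x \<in> B" for x
   proof -
    have "x \<in> ball x (r x)" using r(1)[of x] by simp
    then have "x \<in> \<Union>(range (%c. ball c (r c)))" by (rule UnionI[OF rangeI])
    then show ?thesis using F(3) by blast
   qed
   ultimately show ?thesis by (auto elim: eventually_mono)
  qed
  have "AEL x. \<forall>n. \<bar>u x - y x\<bar> <= 2 / real (Suc n)" using n by (simp add: AE_all_countable)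
  then show "AEL x. u x = y x"
  proof eventually_elim
   case (elim x)
   have l: "(%n. 2 * inverse (real (Suc n))) ----> 2 * 0"
    by (intro tendsto_mult tendsto_const LIMSEQ_inverse_real_of_nat)
   have "\<bar>u x - y x\<bar> <= 2 * 0"
    by (rule LIMSEQ_le_const[OF l]) (use elim in \<open>auto simp: divide_inverse\<close>)
   then show ?case by simp
  qed
 qed
qed

text \<open>This is the form in which the Lipschitz boundary enters the regularity theory: it
  provides the share of each small ball on which a function with zero boundary values
  vanishes.\<close>

definition exterior_density :: "(real^'n::finite) set => real^'n => bool" where
 "exterior_density Om c \<longleftrightarrow> (\<exists>\<mu>>0. \<exists>r0>0. \<forall>r. 0 < r --> r < r0 --> \<mu> * r ^ CARD('n) <= measure lebesgue (ball c r - Om))"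

context elliptic
begin

definition solves :: "(real^'n => real) => (real^'n => real) => (real^'n => real^'n) => bool" where
 "solves F u g \<longleftrightarrow> W Om u g \<and> (\<forall>v h. W Om v h --> bform g h = (LEB x. F x * v x))"

lemma bform_uminus: "bform (%x. - g x) h = - bform g h"
 using bform_scale(1)[of "-1" g h] by simp

text \<open>The constant is uniform in \<open>c\<close>, which enters only through its sign. This
  covers linear problems with \<open>c\<close> zero, the truncated nonlinearity at any truncation
  height, and the difference of two solutions.\<close>

definition linf_const :: "real => bool" where
 "linf_const K \<longleftrightarrow> K > 0 \<and> (\<forall>u g c F E. W Om u g --> (\<forall>x. 0 <= c x * u x) -->
  (\<forall>v h. W Om v h --> bform g h + (LEB x. c x * v x) = (LEB x. F x * v x)) -->
  sq F --> E > 0 --> sqrt (LEB x. (F x)^2) <= E --> (AEL x. \<bar>u x\<bar> <= K * E))"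

lemma monotone_linf:
 assumes "CARD('n) <= 3"
 shows "\<exists>K. linf_const K"
proof -
 obtain K where K: "K > 0" and K2: "\<forall>y g F E. W Om y g --> sq F --> E > 0 --> sqrt (LEB x. (F x)^2) <= E -->
  (\<forall>v h. W Om v h --> (\<forall>x. 0 <= v x) --> (\<forall>x. 0 < v x --> 0 < y x) --> bform g h <= (LEB x. F x * v x)) -->
  (AEL x. y x <= K * E)"
  using linf_bound[OF assms] by (elim exE conjE) (rule that)
 have up: "AEL x. u x <= K * E"
  if a: "W Om u g" "sq F" "E > 0" "sqrt (LEB x. (F x)^2) <= E"
   and c: "\<forall>x. 0 <= c x * u x" and eq: "\<forall>v h. W Om v h --> bform g h + (LEB x. c x * v x) = (LEB x. F x * v x)"
  for u g F E c
 proof (rule K2[rule_format, OF a])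
  fix v h assume v: "W Om v h" "!!x. 0 <= v x" "!!x. 0 < v x ==> 0 < u x"
  have "0 <= c x * v x" for x
   using c[rule_format, of x] v(2)[of x] v(3)[of x] by (cases "v x = 0") (auto simp: zero_le_mult_iff)
  then have "0 <= (LEB x. c x * v x)" by simp
  then show "bform g h <= (LEB x. F x * v x)" using eq[rule_format, OF v(1)] by linarith
 qed
 show ?thesis
  unfolding linf_const_def
 proof (intro exI[of _ K] conjI K allI impI)
  fix u :: "real^'n => real" and g c F and E :: real
  assume a: "W Om u g" and c: "\<forall>x. 0 <= c x * u x"
   and eq: "\<forall>v h. W Om v h --> bform g h + (LEB x. c x * v x) = (LEB x. F x * v x)"
   and b: "sq F" "E > 0" "sqrt (LEB x. (F x)^2) <= E"
  have 1: "AEL x. u x <= K * E" by (rule up[OF a b c eq])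
  have 2: "AEL x. - u x <= K * E"
  proof (rule up[OF W_uminus[OF a], where F="%x. - F x" and c="%x. - c x"])
   show "sq (%x. - F x)" using sq_integrable_scale[OF b(1), of "-1"] by simp
   show "\<forall>v h. W Om v h --> bform (%x. - g x) h + (LEB x. - c x * v x) = (LEB x. - F x * v x)"
    using eq by (auto simp: bform_uminus algebra_simps)
  qed (use b c in auto)
  from 1 2 show "AEL x. \<bar>u x\<bar> <= K * E" by eventually_elim auto
 qed
qed

text \<open>In an interior ball all levels are admissible for \<open>u\<close> and
  \<open>- u\<close>, and the oscillation decays. At a boundary point only nonnegative levels are,
  but there the upper bounds of both \<open>u\<close> and \<open>- u\<close> decay to 0, so
  \<open>m = 0\<close>.\<close>

lemma harmonic_local:
 assumes Wu: "W Om u g" and M: "AEL x. \<bar>u x\<bar> <= M" and R: "R > 0"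
  and eq: "!!v h. W Om v h ==> (!!x. x \<notin> ball c R ==> v x = 0) ==> bform g h = 0"
  and c: "cball c R \<subseteq> Om \<or> exterior_density Om c" and e: "e > 0"
 shows "\<exists>r>0. \<exists>m. AEL x. x \<in> ball c r --> \<bar>u x - m\<bar> <= e"
proof -
 have Wn: "W Om (%x. - u x) (%x. - g x)" by (rule W_uminus[OF Wu])
 have eqn: "bform (%x. - g x) h = 0" if "W Om v h" "!!x. x \<notin> ball c R ==> v x = 0" for v h
  using eq[OF that] by (simp add: bform_uminus)
 define C where "C = 2 * ((real CARD('n))^2 * Lam) / lam"
 show ?thesis
  using c
 proof
  assume "cball c R \<subseteq> Om"
  then have c': "k0 \<ge> 0 \<or> cball c R \<subseteq> Om" for k0 :: real by blast
  have D1: "DG C k0 c R u g" for k0 unfolding C_def by (rule DG_of_harmonic[OF Wu _ c'], rule eq, assumption+)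
  have D2: "DG C k0 c R (%x. - u x) (%x. - g x)" for k0
   unfolding C_def by (rule DG_of_harmonic[OF Wn _ c'], rule eqn, assumption+)
  show ?thesis by (rule DG_interior_decay[OF D1 D2 R M e])
 next
  assume "exterior_density Om c"
  then obtain \<mu> r0 where d: "\<mu> > 0" "r0 > 0" "!!r. 0 < r ==> r < r0 ==> \<mu> * r ^ CARD('n) <= measure lebesgue (ball c r - Om)"
   unfolding exterior_density_def by blast
  have Om: "Om \<in> sets lebesgue" using op by simp
  have dens: "\<mu> * r ^ CARD('n) <= measure lebesgue {x \<in> ball c r. w x <= 0}"
   if w: "w \<in> LM" "AEL x. x \<notin> Om --> w x = 0" and r: "0 < r" "r < r0" for w :: "real^'n => real" and r
  proof -
   have l1: "ball c r - Om \<in> lmeasurable" using Om by (intro bounded_set_imp_lmeasurable bounded_diff bounded_ball) auto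
   have l2: "{x \<in> ball c r. w x <= 0} \<in> lmeasurable" by (rule lebesgue_set_ball[OF w(1)]) measurable
   have "emeasure lebesgue (ball c r - Om) <= emeasure lebesgue {x \<in> ball c r. w x <= 0}"
    by (rule emeasure_mono_AE) (use w(2) l2 in \<open>auto simp: fmeasurableD elim: eventually_mono\<close>)
   then have "measure lebesgue (ball c r - Om) <= measure lebesgue {x \<in> ball c r. w x <= 0}"
    using l1 l2 by (simp add: emeasure_eq_measure2)
   with d(3)[OF r] show ?thesis by linarith
  qed
  have D1: "DG C 0 c R u g" unfolding C_def by (rule DG_of_harmonic[OF Wu], rule eq, assumption+) simp
  have D2: "DG C 0 c R (%x. - u x) (%x. - g x)" unfolding C_def by (rule DG_of_harmonic[OF Wn], rule eqn, assumption+) simp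
  have M1: "AEL x. u x <= M" and M2: "AEL x. - u x <= M" using M by (auto elim: eventually_mono)
  obtain r1 where r1: "r1 > 0" "AEL x. x \<in> ball c r1 --> u x <= e"
   using DG_boundary_decay[OF D1 R M1 d(1,2) dens[OF sq_integrable_measurable[OF W_sq[OF Wu]] W_outside(1)[OF Wu]] e] by blast
  obtain r2 where r2: "r2 > 0" "AEL x. x \<in> ball c r2 --> - u x <= e"
   using DG_boundary_decay[OF D2 R M2 d(1,2) dens[OF sq_integrable_measurable[OF W_sq[OF Wn]] W_outside(1)[OF Wn]] e] by blast
  have "AEL x. x \<in> ball c (min r1 r2) --> \<bar>u x - 0\<bar> <= e"
   using r1(2) r2(2) by eventually_elim auto
  moreover have "min r1 r2 > 0" using r1(1) r2(1) by simp
  ultimately show ?thesis by (intro exI conjI)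
 qed
qed

text \<open>Dominated convergence along balls shrinking to the null set consisting of
  \<open>c\<close>.\<close>

lemma small_ball_mass:
 fixes F :: "real^'n => real"
 assumes F: "sq F" and "R0 > 0" "e > 0"
 obtains R where "0 < R" "R <= R0" "(LEB x. (indicator (ball c R) x * F x)^2) <= e"
proof -
 define R where "R n = R0 * inverse (real (Suc n))" for n
 have Rn: "0 < R n" "R n <= R0" for n
  using assms(2) inverse_le_1_iff[of "real (Suc n)"] by (auto simp: R_def mult_le_cancel_left1 field_simps)
 have [measurable]: "F \<in> LM" "ball c t \<in> sets lebesgue" for t
  using sq_integrable_measurable[OF F] by auto
 have "(%n. LEB x. (indicator (ball c (R n)) x * F x)^2) ----> (LINT x|(lebesgue::(real^'n) measure). 0)"
 proof (rule integral_dominated_convergence[where w="%x. (F x)^2"])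
  show "integrable lebesgue (%x. (F x)^2)" using F by (simp add: sq_integrable_def)
  show "AEL x. norm ((indicator (ball c (R n)) x * F x)^2) <= (F x)^2" for n
   by (intro AE_I2) (auto simp: indicator_def)
  have "AEL x. x \<noteq> c" by (rule AE_completion[OF AE_lborel_singleton])
  then show "AEL x. (%n. (indicator (ball c (R n)) x * F x)^2) ----> 0"
  proof eventually_elim
   case (elim x)
   have "R ----> R0 * 0" unfolding R_def by (intro tendsto_mult tendsto_const LIMSEQ_inverse_real_of_nat)
   then have "\<forall>\<^sub>F n in sequentially. R n < dist c x" by (rule order_tendstoD(2)) (use elim in simp)
   then have "\<forall>\<^sub>F n in sequentially. 0 = (indicator (ball c (R n)) x * F x)^2" by eventually_elim (simp add: indicator_def)
   from Lim_transform_eventually[OF tendsto_const this] show ?case .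
  qed
 qed measurable
 then have "(%n. LEB x. (indicator (ball c (R n)) x * F x)^2) ----> 0" by simp
 then have "\<forall>\<^sub>F n in sequentially. (LEB x. (indicator (ball c (R n)) x * F x)^2) < e"
  by (rule order_tendstoD(2)) (rule assms)
 then obtain n where "(LEB x. (indicator (ball c (R n)) x * F x)^2) < e" by (auto simp: eventually_sequentially)
 then show thesis using that Rn by (meson less_imp_le)
qed

text \<open>Near \<open>c\<close> the solution is split into the solution for the right-hand side cut off to a small
 ball, which is uniformly small, and a remainder which is harmonic in that ball.\<close>

lemma solves_local:
 assumes dim: "CARD('n) <= 3" and S: "solves F u g" and F: "sq F"
  and c: "c \<in> Om \<or> exterior_density Om c" and e: "e > 0"
 shows "\<exists>r>0. \<exists>m. AEL x. x \<in> ball c r --> \<bar>u x - m\<bar> <= e"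
proof -
 obtain K where "linf_const K" using monotone_linf[OF dim] by blast
 note K0 = this[unfolded linf_const_def, THEN conjunct1] and K1 = this[unfolded linf_const_def, THEN conjunct2]
 have K2: "AEL x. \<bar>u x\<bar> <= K * E"
  if "solves F u g" "sq F" "E > 0" "sqrt (LEB x. (F x)^2) <= E" for F u g E
  by (rule K1[rule_format, where c="%x. 0"]) (use that in \<open>auto simp: solves_def sq_integrable_zero\<close>)
 note K = K0 K2
 define E1 where "E1 = sqrt (LEB x. (F x)^2) + 1"
 have "sqrt (LEB x. (F x)^2) \<ge> 0" by simp
 then have E1: "E1 > 0" "sqrt (LEB x. (F x)^2) <= E1" unfolding E1_def by linarith+
 have uM: "AEL x. \<bar>u x\<bar> <= K * E1" by (rule K(2)[OF S F E1])
 obtain R0 where R0: "R0 > 0" "cball c R0 \<subseteq> Om \<or> exterior_density Om c"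
  using c op open_contains_cball by (metis zero_less_one)
 \<comment> \<open>Chosen so that the sup bound for the solution with localised right-hand side is
   half of the tolerance.\<close>
 define E where "E = e / (2 * K)"
 have E: "E > 0" "K * E = e / 2" using e K(1) by (auto simp: E_def)
 obtain R where R: "0 < R" "R <= R0" "(LEB x. (indicator (ball c R) x * F x)^2) <= E^2"
  by (rule small_ball_mass[OF F R0(1), of "E^2" c]) (use E in auto)
 define F2 where "F2 x = indicator (ball c R) x * F x" for x
 have F2: "sq F2"
  unfolding F2_def
 proof (rule sq_integrable_bounded_mult[OF F, where C=1])
  have "ball c R \<in> sets lebesgue" by simp
  then show "indicator (ball c R) \<in> LM" by (rule borel_measurable_indicator)
 qed (auto simp: indicator_def)
 obtain u2 g2 where W2: "W Om u2 g2" and eq2: "!!v h. W Om v h ==> bform g2 h + (LEB x. 0 * v x) = (LEB x. F2 x * v x)"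
  by (rule existence[of "%x t. 0" 0 F2]) (auto simp: sq_integrable_zero F2)
 have S2: "solves F2 u2 g2" using W2 eq2 by (simp add: solves_def)
 have "sqrt (LEB x. (F2 x)^2) <= E" using R(3) E by (intro real_le_lsqrt) (auto simp: F2_def)
 from K(2)[OF S2 F2 E(1) this] have u2: "AEL x. \<bar>u2 x\<bar> <= e / 2" by (simp add: E(2))
 have Wu: "W Om u g" using S by (simp add: solves_def)
 have W1: "W Om (%x. u x - u2 x) (%x. g x - g2 x)" by (rule W_diff[OF Wu W2])
 have "\<exists>r>0. \<exists>m. AEL x. x \<in> ball c r --> \<bar>(u x - u2 x) - m\<bar> <= e / 2"
 proof (rule harmonic_local[OF W1 _ R(1)])
  show "AEL x. \<bar>u x - u2 x\<bar> <= K * E1 + e / 2" using uM u2 by eventually_elim linarith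
  show "cball c R \<subseteq> Om \<or> exterior_density Om c" using R0(2) R(2) by (meson subset_cball order_trans)
  show "e / 2 > 0" using e by simp
  fix v h assume v: "W Om v h" "!!x. x \<notin> ball c R ==> v x = 0"
  have "bform (%x. g x - g2 x) h = (LEB x. F x * v x) - (LEB x. F2 x * v x)"
   using S S2 v(1) by (simp add: solves_def bform_diff[OF W_sqv[OF Wu] W_sqv[OF W2] W_sqv[OF v(1)]])
  also have "(LEB x. F2 x * v x) = (LEB x. F x * v x)"
   using v(2) by (intro Bochner_Integration.integral_cong) (auto simp: F2_def indicator_def)
  finally show "bform (%x. g x - g2 x) h = 0" by simp
 qed
 then obtain r m where r: "r > 0" "AEL x. x \<in> ball c r --> \<bar>(u x - u2 x) - m\<bar> <= e / 2" by blast
 have "AEL x. x \<in> ball c r --> \<bar>u x - m\<bar> <= e"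
  using r(2) u2
 proof eventually_elim
  case (elim x)
  show ?case
  proof
   assume "x \<in> ball c r"
   then have "\<bar>u x - u2 x - m\<bar> <= e / 2" using elim(1) by blast
   then show "\<bar>u x - m\<bar> <= e" using elim(2) by linarith
  qed
 qed
 then show ?thesis using r(1) by blast
qed

theorem solves_continuous:
 assumes dim: "CARD('n) <= 3" and S: "solves F u g" and F: "sq F"
  and fr: "!!c. c \<in> frontier Om ==> exterior_density Om c"
 obtains y where "continuous_on UNIV y" "AEL x. u x = y x" "!!x. x \<notin> Om ==> y x = 0"
proof -
 have Wu: "W Om u g" using S by (simp add: solves_def)
 have out: "\<exists>r>0. ball c r \<inter> Om = {}" if c: "c \<notin> closure Om" for c
 proof -
  have "open (- closure Om)" by (simp add: open_Compl)
  then obtain r where "r > 0" "ball c r \<subseteq> - closure Om" using c open_contains_ball[of "- closure Om"] by blast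
  then show ?thesis using closure_subset[of Om] by blast
 qed
 have loc: "\<exists>r>0. \<exists>m. AEL x. x \<in> ball c r --> \<bar>u x - m\<bar> <= e" if e: "e > 0" for c e
 proof (cases "c \<in> closure Om")
  case True
  then have "c \<in> Om \<or> exterior_density Om c" using fr op by (auto simp: frontier_def interior_open)
  then show ?thesis by (rule solves_local[OF dim S F _ e])
 next
  case False
  then obtain r where r: "r > 0" "ball c r \<inter> Om = {}" using out by blast
  have "AEL x. x \<in> ball c r --> \<bar>u x - 0\<bar> <= e"
   using W_outside(1)[OF Wu] by eventually_elim (use r e in auto)
  then show ?thesis using r(1) by blast
 qed
 obtain y where y: "continuous_on UNIV y" "AEL x. u x = y x"
  by (rule continuous_representative[OF loc])
 \<comment> \<open>A nonzero value off \<open>Om\<close> would persist in a ball, almost all of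
   whose points would then lie in \<open>Om\<close>; this contradicts either the openness of the
   exterior or the density of the complement.\<close>
 have "y c = 0" if c: "c \<notin> Om" for c
 proof (rule ccontr)
  assume "y c \<noteq> 0"
  then have "\<exists>d>0. \<forall>x\<in>UNIV. dist x c < d --> dist (y x) (y c) < \<bar>y c\<bar>"
   using y(1) unfolding continuous_on_iff by simp
  then obtain d where d: "d > 0" "!!x. dist x c < d ==> dist (y x) (y c) < \<bar>y c\<bar>" by auto
  have nz: "y x \<noteq> 0" if "x \<in> ball c d" for x using d(2)[of x] that by (auto simp: dist_commute dist_real_def)
  have ae: "AEL x. x \<in> ball c d --> x \<in> Om"
   using y(2) W_outside(1)[OF Wu] by eventually_elim (use nz in auto)
  show False
  proof (cases "c \<in> closure Om")
   case False
   then obtain r where "r > 0" "ball c r \<inter> Om = {}" using out by blast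
   moreover have "\<exists>x\<in>ball c (min r d). x \<in> Om"
    using \<open>r > 0\<close> d(1) by (intro AE_ball_not_False eventually_mono[OF ae]) auto
   ultimately show False by auto
  next
   case True
   then have "exterior_density Om c" using c fr op by (auto simp: frontier_def interior_open)
   then obtain \<mu> r0 where e: "\<mu> > 0" "r0 > 0" "!!r. 0 < r ==> r < r0 ==> \<mu> * r ^ CARD('n) <= measure lebesgue (ball c r - Om)"
    unfolding exterior_density_def by blast
   define r where "r = min d (r0 / 2)"
   have r: "0 < r" "r < r0" "r <= d" using d(1) e(2) by (auto simp: r_def)
   have "AEL x. x \<notin> ball c r - Om" using ae by eventually_elim (use r in auto)
   moreover have "ball c r - Om \<in> sets lebesgue" using op by auto
   ultimately have "ball c r - Om \<in> null_sets lebesgue" by (simp add: AE_iff_null_sets)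
   then have "measure lebesgue (ball c r - Om) = 0" by (simp add: null_sets_def measure_def)
   moreover have "0 < \<mu> * r ^ CARD('n)" using e(1) r(1) by simp
   ultimately show False using e(3)[OF r(1,2)] by linarith
  qed
 qed
 with y that show thesis by blast
qed

end

text \<open>Near \<open>p\<close> the domain lies above a graph that is not below \<open>p\<close>.
  Going down by \<open>r / 2\<close> from \<open>p\<close> leaves room for a ball of radius
  proportional to \<open>r\<close> beneath the graph, since the graph can drop only with slope
  \<open>K\<close>.\<close>

lemma lipschitz_boundary_exterior_density:
 fixes Om :: "(real^'n::finite) set"
 assumes op: "open Om" and lip: "lipschitz_boundary Om" and p: "p \<in> frontier Om"
 shows "exterior_density Om p"
proof -
 obtain U \<nu> K \<phi> where U: "open U" "p \<in> U" "norm \<nu> = 1" "K-lipschitz_on {z. z \<bullet> \<nu> = 0} \<phi>"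
  "Om \<inter> U = {x \<in> U. \<phi> (x - (x \<bullet> \<nu>) *\<^sub>R \<nu>) < x \<bullet> \<nu>}"
  using lip[unfolded lipschitz_boundary_def, rule_format, OF p] by (elim exE conjE) (rule that)
 define \<pi> where "\<pi> x = x - (x \<bullet> \<nu>) *\<^sub>R \<nu>" for x
 have nn: "\<nu> \<bullet> \<nu> = 1" using U(3) by (simp add: norm_eq_1)
 have pi0: "\<pi> x \<in> {z. z \<bullet> \<nu> = 0}" for x by (simp add: \<pi>_def inner_diff_left nn)
 have K: "K \<ge> 0" using U(4) lipschitz_on_nonneg by blast
 have pn: "p \<notin> Om" using p op by (auto simp: frontier_def interior_open)
 then have ph: "p \<bullet> \<nu> <= \<phi> (\<pi> p)" using U(2,5) unfolding \<pi>_def by force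
 obtain r1 where r1: "r1 > 0" "ball p r1 \<subseteq> U" using U(1,2) open_contains_ball by blast
 \<comment> \<open>\<open>\<kappa> * (K + 1) <= 1 / 2\<close> keeps the small ball below the graph,
   and \<open>\<kappa> <= 1 / 2\<close> keeps it inside \<open>ball p r\<close>.\<close>
 define \<kappa> where "\<kappa> = 1 / (2 * (K + 2))"
 have k: "0 < \<kappa>" "\<kappa> * (K + 1) <= 1 / 2" "\<kappa> <= 1 / 2" using K by (auto simp: \<kappa>_def field_simps)
 define V where "V = vol1 TYPE('n)"
 have sub: "ball (p - (r / 2) *\<^sub>R \<nu>) (\<kappa> * r) \<subseteq> ball p r - Om" if r: "0 < r" "r < r1" for r
 proof
  fix x assume x: "x \<in> ball (p - (r / 2) *\<^sub>R \<nu>) (\<kappa> * r)"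
  define z where "z = x - (p - (r / 2) *\<^sub>R \<nu>)"
  have z: "norm z < \<kappa> * r" using x by (simp add: z_def dist_norm norm_minus_commute)
  have xe: "x = p - (r / 2) *\<^sub>R \<nu> + z" by (simp add: z_def)
  have zr: "norm z < r / 2" using z k(3) r mult_right_mono[of \<kappa> "1/2" r] by linarith
  have "dist p x = norm ((r / 2) *\<^sub>R \<nu> - z)" by (simp add: xe dist_norm)
  also have "... <= norm ((r / 2) *\<^sub>R \<nu>) + norm z" by (rule norm_triangle_ineq4)
  also have "... < r" using zr U(3) r by simp
  finally have d: "x \<in> ball p r" by simp
  then have xU: "x \<in> U" using r r1(2) by auto
  have "\<pi> x - \<pi> p = z - (z \<bullet> \<nu>) *\<^sub>R \<nu>"
   unfolding \<pi>_def xe by (simp add: inner_add_left inner_diff_left nn algebra_simps)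
  moreover have "(norm (z - (z \<bullet> \<nu>) *\<^sub>R \<nu>))^2 <= (norm z)^2"
   by (simp add: power2_norm_eq_inner inner_diff_left inner_diff_right nn inner_commute)
  ultimately have "norm (\<pi> x - \<pi> p) <= norm z" by (metis norm_ge_zero power2_le_imp_le)
  moreover have "dist (\<phi> (\<pi> p)) (\<phi> (\<pi> x)) <= K * dist (\<pi> p) (\<pi> x)" by (rule lipschitz_onD[OF U(4) pi0 pi0])
  ultimately have "\<bar>\<phi> (\<pi> p) - \<phi> (\<pi> x)\<bar> <= K * norm z"
   using K mult_left_mono[of "norm (\<pi> x - \<pi> p)" "norm z" K] by (simp add: dist_norm norm_minus_commute)
  then have 1: "\<phi> (\<pi> p) - K * norm z <= \<phi> (\<pi> x)" by linarith
  have "x \<bullet> \<nu> = p \<bullet> \<nu> - r / 2 + z \<bullet> \<nu>" by (simp add: xe inner_add_left inner_diff_left nn)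
  moreover have "z \<bullet> \<nu> <= norm z" using norm_cauchy_schwarz[of z \<nu>] U(3) by simp
  moreover have "norm z * (K + 1) <= r / 2"
  proof -
   have "norm z * (K + 1) <= \<kappa> * r * (K + 1)" using z K by (intro mult_right_mono) auto
   also have "... = r * (\<kappa> * (K + 1))" by simp
   also have "... <= r * (1 / 2)" using k r by (intro mult_left_mono) auto
   finally show ?thesis by simp
  qed
  ultimately have "x \<bullet> \<nu> <= \<phi> (\<pi> x)" using 1 ph by (simp add: algebra_simps)
  then have "x \<notin> Om" using U(5) xU unfolding \<pi>_def by force
  with d show "x \<in> ball p r - Om" by simp
 qed
 have "V * \<kappa> ^ CARD('n) * r ^ CARD('n) <= measure lebesgue (ball p r - Om)" if r: "0 < r" "r < r1" for r
 proof -
  have "measure lebesgue (ball (p - (r / 2) *\<^sub>R \<nu>) (\<kappa> * r)) = V * (\<kappa> * r) ^ CARD('n)"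
   unfolding V_def using k r by (intro ball_measure) auto
  moreover have "measure lebesgue (ball (p - (r / 2) *\<^sub>R \<nu>) (\<kappa> * r)) <= measure lebesgue (ball p r - Om)"
   using op by (intro measure_mono_fmeasurable[OF sub[OF r]] bounded_set_imp_lmeasurable bounded_diff bounded_ball) auto
  ultimately show ?thesis by (simp add: power_mult_distrib mult.assoc)
 qed
 moreover have "V * \<kappa> ^ CARD('n) > 0" using k vol1_pos[where 'n='n] by (simp add: V_def)
 ultimately show ?thesis unfolding exterior_density_def using r1(1) by blast
qed

section \<open>The state equation\<close>

text \<open>\<open>y\<close> is approximated by functions with countably many values, for which
  measurability at fixed second argument suffices; continuity in that argument gives the
  limit.\<close>

lemma caratheodory_measurable:
 fixes \<phi> :: "'a => real => real"
 assumes m: "!!t. (%x. \<phi> x t) \<in> borel_measurable M" and c: "!!x. continuous_on UNIV (\<phi> x)"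
  and y [measurable]: "y \<in> borel_measurable M"
 shows "(%x. \<phi> x (y x)) \<in> borel_measurable M"
proof (rule borel_measurable_LIMSEQ_real)
 define q where "q n x = \<lfloor>real (Suc n) * y x\<rfloor>" for n x
 have [measurable]: "q n \<in> M \<rightarrow>\<^sub>M count_space UNIV" for n unfolding q_def by measurable
 show "(%x. \<phi> x (real_of_int (q n x) / real (Suc n))) \<in> borel_measurable M" for n
  by (rule measurable_compose_countable[where f="%i x. \<phi> x (real_of_int i / real (Suc n))" and g="q n"]) (auto intro: m)
 fix x assume "x \<in> space M"
 have "(%n. real_of_int (q n x) / real (Suc n)) ----> y x"
 proof (rule LIM_zero_cancel, rule tendsto_rabs_zero_cancel, rule tendsto_0_sandwich)
  show "(%n. inverse (real (Suc n))) ----> 0" by (rule LIMSEQ_inverse_real_of_nat)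
  fix n
  define s where "s = real (Suc n)"
  have s: "s > 0" by (simp add: s_def)
  have "\<bar>real_of_int (q n x) - s * y x\<bar> <= 1" unfolding q_def s_def by linarith
  then have "\<bar>real_of_int (q n x) - s * y x\<bar> / s <= 1 / s" using s by (intro divide_right_mono) auto
  also have "\<bar>real_of_int (q n x) - s * y x\<bar> / s = \<bar>real_of_int (q n x) / s - y x\<bar>"
   using s by (simp add: abs_divide[symmetric, of _ s, unfolded abs_of_pos[OF s]] diff_divide_distrib)
  finally show "\<bar>real_of_int (q n x) / real (Suc n) - y x\<bar> <= inverse (real (Suc n))" by (simp add: s_def inverse_eq_divide)
 qed simp
 from continuous_on_tendsto_compose[OF c[of x] this]
 show "(%n. \<phi> x (real_of_int (q n x) / real (Suc n))) ----> \<phi> x (y x)" by simp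
qed

lemma derivative_measurable:
 fixes \<phi> :: "'a => real => real"
 assumes [measurable]: "!!t. (%x. \<phi> x t) \<in> borel_measurable M" and d: "!!x t. (\<phi> x has_real_derivative \<phi>' x t) (at t)"
 shows "(%x. \<phi>' x t) \<in> borel_measurable M"
proof (rule borel_measurable_LIMSEQ_real)
 fix x
 have "filterlim (%n. inverse (real (Suc n))) (at 0) sequentially"
  by (rule filterlim_atI[OF LIMSEQ_inverse_real_of_nat]) simp
 from filterlim_compose[OF d[of x t, unfolded DERIV_def] this]
 show "(%n. (\<phi> x (t + inverse (real (Suc n))) - \<phi> x t) / inverse (real (Suc n))) ----> \<phi>' x t" .
qed measurable

lemma derivative_bound_on:
 fixes F :: "real => real"
 assumes "!!t. (F has_real_derivative F' t) (at t)" "!!r. \<bar>r\<bar> <= M ==> \<bar>F' r\<bar> <= C" "\<bar>s\<bar> <= M" "\<bar>t\<bar> <= M"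
 shows "\<bar>F s - F t\<bar> <= C * \<bar>s - t\<bar>"
proof -
 have "norm (F s - F t) <= C * norm (s - t)"
  by (rule field_differentiable_bound[where S="{-M..M}" and f'=F'])
   (use assms in \<open>auto intro: has_field_derivative_at_within\<close>)
 then show ?thesis by simp
qed

lemma taylor_remainder:
 fixes F :: "real => real"
 assumes d: "!!t. (F has_real_derivative F' t) (at t)" and s: "\<bar>s\<bar> <= M" "\<bar>t\<bar> <= M"
  and l: "!!r r'. \<bar>r\<bar> <= M ==> \<bar>r'\<bar> <= M ==> \<bar>F' r - F' r'\<bar> <= C * \<bar>r - r'\<bar>" and C: "C \<ge> 0"
 shows "\<bar>F s - F t - F' t * (s - t)\<bar> <= C * (s - t)^2"
proof -
 have "norm ((F s - F' t * s) - (F t - F' t * t)) <= (C * \<bar>s - t\<bar>) * norm (s - t)"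
 proof (rule field_differentiable_bound[where S="closed_segment t s" and f'="%r. F' r - F' t"])
  show "((%r. F r - F' t * r) has_field_derivative F' r - F' t) (at r within closed_segment t s)" for r
   by (rule has_field_derivative_at_within) (auto intro!: derivative_eq_intros d)
  show "norm (F' r - F' t) <= C * \<bar>s - t\<bar>" if r: "r \<in> closed_segment t s" for r
  proof -
   have r': "\<bar>r\<bar> <= M" "\<bar>r - t\<bar> <= \<bar>s - t\<bar>" using r s by (auto simp: closed_segment_eq_real_ivl split: if_splits)
   have "\<bar>F' r - F' t\<bar> <= C * \<bar>r - t\<bar>" by (rule l[OF r'(1) s(2)])
   also have "... <= C * \<bar>s - t\<bar>" by (rule mult_left_mono[OF r'(2) C])
   finally show ?thesis by simp
  qed
 qed auto
 then show ?thesis by (simp add: algebra_simps power2_eq_square abs_mult[symmetric])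
qed

lemma continuous_AE_le:
 fixes f :: "real^'n::finite => real"
 assumes "continuous_on UNIV f" "AEL x. f x <= a"
 shows "f c <= a"
proof (rule ccontr)
 assume "\<not> f c <= a"
 then obtain d where d: "d > 0" "!!x. dist x c < d ==> dist (f x) (f c) < f c - a"
  using assms(1) unfolding continuous_on_iff by (metis UNIV_I diff_gt_0_iff_gt not_le)
 have "AEL x. x \<in> ball c d --> False"
  using assms(2)
 proof eventually_elim
  case (elim x)
  have "dist x c < d ==> f x > a" using d(2)[of x] by (auto simp: dist_real_def abs_if split: if_splits)
  then show ?case using elim by (force simp: dist_commute)
 qed
 from AE_ball_not_False[OF this d(1)] show False by simp
qed

lemma continuous_compact_support_bounded:
 fixes y :: "real^'n::finite => real"
 assumes "bounded Om" "continuous_on UNIV y" "!!x. x \<notin> Om ==> y x = 0"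
 shows "\<exists>M>0. \<forall>x. \<bar>y x\<bar> <= M"
proof -
 have "compact (y ` closure Om)"
  using assms by (intro compact_continuous_image) (auto simp: compact_closure intro: continuous_on_subset)
 then obtain M where M: "!!x. x \<in> closure Om ==> \<bar>y x\<bar> <= M"
  using compact_imp_bounded bounded_iff by (metis image_eqI real_norm_def)
 have "\<bar>y x\<bar> <= max M 1" for x using M[of x] assms(3)[of x] closure_subset[of Om] by (cases "x \<in> Om") auto
 then show ?thesis by (intro exI[of _ "max M 1"]) auto
qed

text \<open>The data are again required to satisfy their bounds at every point. The second-order
  bounds on the nonlinearity enter as a local Lipschitz bound for \<open>\<phi>'\<close>.\<close>

locale semilinear = elliptic Om b lam Lam for Om :: "(real^'n::finite) set" and b lam Lam +
 fixes \<phi> \<phi>' :: "real^'n => real => real"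
 assumes dim: "CARD('n) <= 3"
  and density: "!!c. c \<in> frontier Om ==> exterior_density Om c"
  and pm: "!!t. (%x. \<phi> x t) \<in> LM"
  and p0: "sq (%x. \<phi> x 0)"
  and pd: "!!x t. (\<phi> x has_real_derivative \<phi>' x t) (at t)"
  and pos: "!!x t. 0 <= \<phi>' x t"
  and loc: "!!M. M > 0 ==> \<exists>C>0. \<forall>x s t. \<bar>s\<bar> <= M --> \<bar>t\<bar> <= M --> \<bar>\<phi>' x t\<bar> <= C \<and> \<bar>\<phi>' x s - \<phi>' x t\<bar> <= C * \<bar>s - t\<bar>"
begin

lemma phi_continuous: "continuous_on UNIV (\<phi> x)"
 by (intro continuous_at_imp_continuous_on ballI DERIV_isCont[OF pd])

lemma phi_mono: "s <= t ==> \<phi> x s <= \<phi> x t"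
 by (erule DERIV_nonneg_imp_nondecreasing) (rule exI, rule conjI, rule pd, rule pos)

lemma phi_lipschitz:
 assumes "M > 0"
 shows "\<exists>C>0. \<forall>x s t. \<bar>s\<bar> <= M --> \<bar>t\<bar> <= M --> \<bar>\<phi> x s - \<phi> x t\<bar> <= C * \<bar>s - t\<bar>"
proof -
 obtain C where C: "C > 0" "!!x s t. \<bar>s\<bar> <= M ==> \<bar>t\<bar> <= M ==> \<bar>\<phi>' x t\<bar> <= C" using loc[OF assms] by blast
 have "\<bar>\<phi> x s - \<phi> x t\<bar> <= C * \<bar>s - t\<bar>" if "\<bar>s\<bar> <= M" "\<bar>t\<bar> <= M" for x s t
  by (rule derivative_bound_on[OF pd C(2)]) (use that assms in auto)
 then show ?thesis using C(1) by blast
qed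

lemma phi_sq:
 assumes y: "sq y" and M: "!!x. \<bar>y x\<bar> <= M"
 shows "sq (%x. \<phi> x (y x))"
proof -
 have M': "max M 1 > 0" by simp
 obtain C where C: "C > 0" "!!x s t. \<bar>s\<bar> <= max M 1 ==> \<bar>t\<bar> <= max M 1 ==> \<bar>\<phi> x s - \<phi> x t\<bar> <= C * \<bar>s - t\<bar>"
  using phi_lipschitz[OF M'] by blast
 have m: "(%x. \<phi> x (y x)) \<in> LM"
  by (rule caratheodory_measurable[OF pm phi_continuous sq_integrable_measurable[OF y]])
 have "sq (%x. \<phi> x (y x) - \<phi> x 0)"
 proof (rule sq_integrable_bound[OF sq_integrable_scale[OF y, of C]])
  have "\<bar>\<phi> x (y x) - \<phi> x 0\<bar> <= C * \<bar>y x - 0\<bar>" for x using M[of x] by (intro C) auto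
  then show "AEL x. \<bar>\<phi> x (y x) - \<phi> x 0\<bar> <= \<bar>C * y x\<bar>" using C(1) by (simp add: abs_mult)
  show "(%x. \<phi> x (y x) - \<phi> x 0) \<in> LM" using m pm by measurable
 qed
 from sq_integrable_add[OF this p0] show ?thesis by simp
qed

text \<open>Continuity and vanishing off \<open>Om\<close> select a single function instead of a
  class. \<open>weak_solution_iff\<close> identifies this notion with the one that defines the
  state.\<close>

definition sol :: "(real^'n => real) => (real^'n => real) => bool" where
 "sol w y \<longleftrightarrow> continuous_on UNIV y \<and> (\<forall>x. x \<notin> Om --> y x = 0) \<and>
  (\<exists>g. W Om y g \<and> (\<forall>v h. W Om v h --> bform g h + (LEB x. \<phi> x (y x) * v x) = (LEB x. w x * v x)))"

lemma sol_bounded: "sol w y ==> \<exists>M>0. \<forall>x. \<bar>y x\<bar> <= M"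
 unfolding sol_def by (elim conjE, rule continuous_compact_support_bounded[OF bd]) auto

lemma sol_sq: "sol w y ==> sq y" "sol w y ==> sq (%x. \<phi> x (y x))"
proof -
 assume y: "sol w y"
 then show s: "sq y" by (auto simp: sol_def intro: W_sq)
 obtain M where "!!x. \<bar>y x\<bar> <= M" using sol_bounded[OF y] by blast
 then show "sq (%x. \<phi> x (y x))" by (rule phi_sq[OF s])
qed

text \<open>The nonlinearity is frozen outside a bounded range of the state, which makes it globally
  Lipschitz; the sup bound then shows that the solution never leaves that range.\<close>

lemma sol_exists:
 assumes w: "sq w"
 shows "\<exists>y. sol w y"
proof -
 obtain K where "linf_const K" using monotone_linf[OF dim] by blast
 note K = this[unfolded linf_const_def, THEN conjunct1] and K1 = this[unfolded linf_const_def, THEN conjunct2]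
 define F where "F x = w x - \<phi> x 0" for x
 have F: "sq F" unfolding F_def by (rule sq_integrable_diff[OF w p0])
 define E where "E = sqrt (LEB x. (F x)^2) + 1"
 have "sqrt (LEB x. (F x)^2) \<ge> 0" by simp
 then have E: "E > 0" "sqrt (LEB x. (F x)^2) <= E" unfolding E_def by linarith+
 \<comment> \<open>This bound is known before truncating, because \<open>linf_const\<close> does not
   depend on the zero-order term; truncation at height \<open>M\<close> is therefore invisible to
   the solution.\<close>
 define M where "M = K * E"
 have M: "M > 0" using K E by (simp add: M_def)
 obtain C where C: "C > 0" "!!x s t. \<bar>s\<bar> <= M ==> \<bar>t\<bar> <= M ==> \<bar>\<phi> x s - \<phi> x t\<bar> <= C * \<bar>s - t\<bar>"
  using phi_lipschitz[OF M] by blast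
 define cl where "cl t = max (- M) (min M t)" for t
 have cl: "\<bar>cl t\<bar> <= M" "\<bar>cl s - cl t\<bar> <= \<bar>s - t\<bar>" "s <= t ==> cl s <= cl t" "cl 0 = 0" "\<bar>t\<bar> <= M ==> cl t = t" for s t
  using M by (auto simp: cl_def)
 have clc: "continuous_on UNIV cl" unfolding cl_def by (intro continuous_intros)
 \<comment> \<open>Subtracting the value at 0, which is moved into \<open>F\<close>, yields
   \<open>c x 0 = 0\<close>; by monotonicity \<open>c x t\<close> then has the sign of
   \<open>t\<close>.\<close>
 define c where "c x t = \<phi> x (cl t) - \<phi> x 0" for x t
 have cl_lip: "\<bar>c x s - c x t\<bar> <= C * \<bar>s - t\<bar>" for x s t
 proof -
  have "\<bar>c x s - c x t\<bar> <= C * \<bar>cl s - cl t\<bar>" using C(2)[OF cl(1) cl(1), of x s t] by (simp add: c_def)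
  also have "... <= C * \<bar>s - t\<bar>" using C(1) cl(2) by (intro mult_left_mono) auto
  finally show ?thesis .
 qed
 have c_mono: "c x s <= c x t" if "s <= t" for x s t using phi_mono[OF cl(3)[OF that]] by (simp add: c_def)
 have c0: "c x 0 = 0" for x by (simp add: c_def cl(4))
 have c_sq: "sq (%x. c x (y x))" if y: "sq y" for y
 proof (rule sq_integrable_bound[OF sq_integrable_scale[OF y, of C]])
  show "AEL x. \<bar>c x (y x)\<bar> <= \<bar>C * y x\<bar>" using cl_lip[of _ "y _" 0] C(1) by (simp add: c0 abs_mult)
  show "(%x. c x (y x)) \<in> LM"
   by (rule caratheodory_measurable[OF _ _ sq_integrable_measurable[OF y]])
    (auto simp: c_def intro!: borel_measurable_diff pm continuous_intros continuous_on_compose2[OF phi_continuous clc])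
 qed
 obtain y0 g where W0: "W Om y0 g"
  and eq0: "!!v h. W Om v h ==> bform g h + (LEB x. c x (y0 x) * v x) = (LEB x. F x * v x)"
  by (rule existence[OF c_sq cl_lip c_mono F]) (assumption | rule that | blast)+
 have sc: "sq (%x. c x (y0 x))" by (rule c_sq[OF W_sq[OF W0]])
 have b0: "AEL x. \<bar>y0 x\<bar> <= M"
  unfolding M_def
 proof (rule K1[rule_format, OF W0 _ eq0 F E])
  show "0 <= c x (y0 x) * y0 x" for x
   using c_mono[of 0 "y0 x" x] c_mono[of "y0 x" 0 x] by (cases "0 <= y0 x") (auto simp: c0 zero_le_mult_iff)
 qed
 have sF: "sq (%x. F x - c x (y0 x))" by (rule sq_integrable_diff[OF F sc])
 have "solves (%x. F x - c x (y0 x)) y0 g"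
  unfolding solves_def
 proof (intro conjI allI impI W0)
  fix v h assume v: "W Om v h"
  show "bform g h = (LEB x. (F x - c x (y0 x)) * v x)"
   using eq0[OF v] sq_integrable_mult[OF F W_sq[OF v]] sq_integrable_mult[OF sc W_sq[OF v]] by (simp add: left_diff_distrib)
 qed
 then obtain y where y: "continuous_on UNIV y" "AEL x. y0 x = y x" "!!x. x \<notin> Om ==> y x = 0"
  by (rule solves_continuous[OF dim _ sF density]) (assumption | rule that | blast)+
 have ym: "y \<in> LM" by (rule borel_imp_lebesgue[OF borel_measurable_continuous_onI[OF y(1)]])
 have sy: "sq y"
  by (rule sq_integrable_bound[OF W_sq[OF W0] ym]) (use y(2) in \<open>auto elim: eventually_mono\<close>)
 have Wy: "W Om y g" by (rule W_AE_cong[OF W0 sy W_sqv[OF W0] y(2)]) simp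
 have "AEL x. \<bar>y x\<bar> <= M" using b0 y(2) by eventually_elim simp
 then have yM: "\<bar>y x\<bar> <= M" for x
  by (intro continuous_AE_le[where f="%x. \<bar>y x\<bar>"]) (use y(1) in \<open>auto intro: continuous_intros\<close>)
 have "sol w y"
  unfolding sol_def
 proof (intro conjI exI[of _ g] allI impI y Wy)
  fix v h assume v: "W Om v h"
  have py: "sq (%x. \<phi> x (y x))" by (rule phi_sq[OF sy yM])
  have "(LEB x. c x (y0 x) * v x) = (LEB x. \<phi> x (y x) * v x - \<phi> x 0 * v x)"
  proof (rule integral_cong_AE)
   show "AEL x. c x (y0 x) * v x = \<phi> x (y x) * v x - \<phi> x 0 * v x"
    using y(2) by eventually_elim (simp add: c_def cl(5)[OF yM] algebra_simps)
  qed (use sq_integrable_mult[OF sc W_sq[OF v]] sq_integrable_mult[OF py W_sq[OF v]] sq_integrable_mult[OF p0 W_sq[OF v]] in measurable)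
  then show "bform g h + (LEB x. \<phi> x (y x) * v x) = (LEB x. w x * v x)"
   using eq0[OF v] sq_integrable_mult[OF py W_sq[OF v]] sq_integrable_mult[OF p0 W_sq[OF v]] sq_integrable_mult[OF w W_sq[OF v]]
   by (simp add: F_def left_diff_distrib)
 qed
 then show ?thesis by blast
qed

text \<open>The difference of two solutions satisfies an equation whose zero-order term has, by
  monotonicity, the sign of that difference, so \<open>linf_const\<close> applies with the
  difference of the right-hand sides.\<close>

lemma sol_lipschitz:
 "\<exists>K>0. \<forall>w w' y y' x. sq w --> sq w' --> sol w y --> sol w' y' -->
  \<bar>y x - y' x\<bar> <= K * sqrt (LEB x. (w x - w' x)^2)"
proof -
 obtain K where "linf_const K" using monotone_linf[OF dim] by blast
 note K = this[unfolded linf_const_def, THEN conjunct1] and K1 = this[unfolded linf_const_def, THEN conjunct2]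
 show ?thesis
 proof (intro exI[of _ K] conjI K allI impI)
  fix w w' y y' and x0 :: "real^'n"
  assume w: "sq w" "sq w'" and y: "sol w y" and y': "sol w' y'"
  obtain g where g: "W Om y g" "!!v h. W Om v h ==> bform g h + (LEB x. \<phi> x (y x) * v x) = (LEB x. w x * v x)"
   using y by (auto simp: sol_def)
  obtain g' where g': "W Om y' g'" "!!v h. W Om v h ==> bform g' h + (LEB x. \<phi> x (y' x) * v x) = (LEB x. w' x * v x)"
   using y' by (auto simp: sol_def)
  have c: "continuous_on UNIV y" "continuous_on UNIV y'" using y y' by (auto simp: sol_def)
  note s = sol_sq(2)[OF y] sol_sq(2)[OF y'] w
  have *: "\<bar>y x0 - y' x0\<bar> <= K * E" if E: "E > 0" "sqrt (LEB x. (w x - w' x)^2) <= E" for E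
  proof -
   have "AEL x. \<bar>y x - y' x\<bar> <= K * E"
   proof (rule K1[rule_format, where c="%x. \<phi> x (y x) - \<phi> x (y' x)", OF W_diff[OF g(1) g'(1)] _ _ sq_integrable_diff[OF w] E])
    show "0 <= (\<phi> x (y x) - \<phi> x (y' x)) * (y x - y' x)" for x
     using phi_mono[of "y x" "y' x" x] phi_mono[of "y' x" "y x" x] by (cases "y x <= y' x") (auto simp: zero_le_mult_iff)
    fix v h assume v: "W Om v h"
    note i = s[THEN sq_integrable_mult, OF W_sq[OF v]]
    show "bform (%x. g x - g' x) h + (LEB x. (\<phi> x (y x) - \<phi> x (y' x)) * v x) = (LEB x. (w x - w' x) * v x)"
     using g(2)[OF v] g'(2)[OF v] i
     by (simp add: bform_diff[OF W_sqv[OF g(1)] W_sqv[OF g'(1)] W_sqv[OF v]] left_diff_distrib)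
   qed
   then show ?thesis
    by (intro continuous_AE_le[where f="%x. \<bar>y x - y' x\<bar>"]) (use c in \<open>auto intro: continuous_intros\<close>)
  qed
  define r where "r = sqrt (LEB x. (w x - w' x)^2)"
  have r: "r \<ge> 0" by (simp add: r_def)
  \<comment> \<open>\<open>linf_const\<close> requires a positive bound, so the norm
    \<open>r\<close>, which may be 0, is approached from above.\<close>
  have "\<bar>y x0 - y' x0\<bar> <= K * r + e" if "e > 0" for e
  proof -
   have "e / K > 0" using that K by simp
   then have "\<bar>y x0 - y' x0\<bar> <= K * (r + e / K)" using * r by (simp add: r_def[symmetric] add_nonneg_pos)
   also have "... = K * r + e" using K by (simp add: distrib_left)
   finally show ?thesis .
  qed
  then show "\<bar>y x0 - y' x0\<bar> <= K * sqrt (LEB x. (w x - w' x)^2)"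
   unfolding r_def[symmetric] by (rule field_le_epsilon)
 qed
qed

lemma sol_unique:
 assumes "sq w" "sol w y" "sol w y'"
 shows "y = y'"
proof
 fix x
 obtain K where "\<forall>w w' y y' x. sq w --> sq w' --> sol w y --> sol w' y' -->
  \<bar>y x - y' x\<bar> <= K * sqrt (LEB x. (w x - w' x)^2)" using sol_lipschitz by blast
 from this[rule_format, OF assms(1) assms(1) assms(2,3), of x] show "y x = y' x" by simp
qed

lemma sol_AE_cong:
 assumes "AEL x. w x = w' x" "w \<in> LM" "w' \<in> LM"
 shows "sol w y \<longleftrightarrow> sol w' y"
proof -
 have "(LEB x. w x * v x) = (LEB x. w' x * v x)" if "W Om v h" for v h
  by (rule integral_cong_AE) (use assms sq_integrable_measurable[OF W_sq[OF that]] in \<open>auto elim: eventually_mono\<close>)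
 then show ?thesis by (auto simp: sol_def)
qed

text \<open>The control-to-state map on all of \<open>L2\<close>: values of \<open>w\<close> off
  \<open>Om\<close> have no effect, since the functions tested with vanish there.\<close>

definition st :: "'n L2 => real^'n => real" where
 "st w = (THE y. sol (rep_L2 w) y)"

lemma sol_st: "sol (rep_L2 w) (st w)"
 unfolding st_def by (rule theI'[OF ex_ex1I[OF sol_exists[OF sq_integrable_rep] sol_unique[OF sq_integrable_rep]]])

lemma st_lipschitz: "\<exists>K>0. \<forall>w w' x. \<bar>st w x - st w' x\<bar> <= K * norm (w - w')"
proof -
 obtain K where K: "K > 0" "\<forall>w w' y y' x. sq w --> sq w' --> sol w y --> sol w' y' -->
  \<bar>y x - y' x\<bar> <= K * sqrt (LEB x. (w x - w' x)^2)" using sol_lipschitz by blast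
 have "norm (w - w') = sqrt (LEB x. (rep_L2 w x - rep_L2 w' x)^2)" for w w' :: "'n L2"
  using norm_diff_abs_L2[OF sq_integrable_rep sq_integrable_rep, of w w'] by (simp add: real_sqrt_unique)
 then have "\<bar>st w x - st w' x\<bar> <= K * norm (w - w')" for w w' x
  using K(2)[rule_format, OF sq_integrable_rep sq_integrable_rep sol_st sol_st, of w x w'] by simp
 then show ?thesis using K(1) by blast
qed

lemma st_bounded: "\<exists>M>0. \<forall>w x. norm w <= R --> \<bar>st w x\<bar> <= M"
proof -
 obtain K where K: "K > 0" "!!w w' x. \<bar>st w x - st w' x\<bar> <= K * norm (w - w')" using st_lipschitz by blast
 obtain M where M: "M > 0" "!!x. \<bar>st 0 x\<bar> <= M" using sol_bounded[OF sol_st] by blast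
 have "\<bar>st w x\<bar> <= K * \<bar>R\<bar> + M" if "norm w <= R" for w x
 proof -
  have "K * norm w <= K * \<bar>R\<bar>" using K(1) that by (intro mult_left_mono) auto
  then show ?thesis using K(2)[of w x 0] M(2)[of x] by simp
 qed
 moreover have "K * \<bar>R\<bar> + M > 0" using K(1) M(1) by (simp add: add_nonneg_pos)
 ultimately show ?thesis by blast
qed

end

section \<open>The adjoint state and the gradient of the cost\<close>

lemma locally_lipschitz_continuous:
 fixes F :: "real => real"
 assumes "!!M. M > 0 ==> \<exists>C>0. \<forall>s t. \<bar>s\<bar> <= M --> \<bar>t\<bar> <= M --> \<bar>F s - F t\<bar> <= C * \<bar>s - t\<bar>"
 shows "continuous_on UNIV F"
proof (rule continuous_at_imp_continuous_on, intro ballI)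
 fix t :: real
 define M where "M = \<bar>t\<bar> + 1"
 have "M > 0" by (simp add: M_def add_nonneg_pos)
 from assms[OF this] obtain C where C: "C > 0" "!!s t. \<bar>s\<bar> <= M ==> \<bar>t\<bar> <= M ==> \<bar>F s - F t\<bar> <= C * \<bar>s - t\<bar>" by blast
 have "C-lipschitz_on {-M<..<M} F" using C by (intro lipschitz_onI) (auto simp: dist_real_def)
 then have "continuous_on {-M<..<M} F" by (rule lipschitz_on_continuous_on)
 then show "continuous (at t) F"
  by (rule continuous_on_interior) (auto simp: M_def interior_open abs_if)
qed

lemma has_derivative_quadratic:
 fixes f :: "'a::real_normed_vector => 'b::real_normed_vector"
 assumes "bounded_linear f'" "!!y. norm (y - x) <= 1 ==> norm (f y - f x - f' (y - x)) <= C * (norm (y - x))^2"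
 shows "(f has_derivative f') (at x within S)"
proof (rule has_derivativeI_sandwich[of 1 _ _ _ _ "%y. C * norm (y - x)"])
 show "((%y. C * norm (y - x)) \<longlongrightarrow> 0) (at x within S)"
  by (rule tendsto_eq_intros refl | simp)+
 fix y assume y: "y \<noteq> x" "dist y x < 1"
 have "norm (f y - f x - f' (y - x)) <= (C * norm (y - x)) * norm (y - x)"
  using assms(2)[of y] y by (simp add: dist_norm power2_eq_square mult.assoc)
 then show "norm (f y - f x - f' (y - x)) / norm (y - x) <= C * norm (y - x)" using y(1) by (simp add: divide_le_eq)
qed (use assms in auto)

lemma energy_estimate:
 assumes p: "sq p" and F: "sq F" and CP: "CP > 0" and lam: "lam > 0"
  and P: "(LEB x. (p x)^2) <= CP * G^2" and G: "G \<ge> 0"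
  and e: "lam * G^2 <= (LEB x. F x * p x)"
 shows "G <= sqrt CP / lam * norm (abs_L2 F)" "norm (abs_L2 p) <= CP / lam * norm (abs_L2 F)"
proof -
 have p1: "norm (abs_L2 p) <= sqrt CP * G"
 proof (rule power2_le_imp_le)
  show "(norm (abs_L2 p))^2 <= (sqrt CP * G)^2" using P CP by (simp add: norm_abs_L2[OF p] power_mult_distrib)
 qed (use CP G in simp)
 have "(LEB x. F x * p x) <= norm (abs_L2 F) * norm (abs_L2 p)"
  unfolding inner_abs_L2[OF F p, symmetric] by (rule norm_cauchy_schwarz)
 also have "... <= norm (abs_L2 F) * (sqrt CP * G)" by (rule mult_left_mono[OF p1]) simp
 finally have "(lam * G) * G <= (norm (abs_L2 F) * sqrt CP) * G" using e by (simp add: power2_eq_square mult.assoc)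
 then have "lam * G <= norm (abs_L2 F) * sqrt CP"
  using G CP lam by (cases "G = 0") (auto simp: mult_le_cancel_right)
 then show g: "G <= sqrt CP / lam * norm (abs_L2 F)" using lam by (simp add: field_simps)
 have "norm (abs_L2 p) <= sqrt CP * (sqrt CP / lam * norm (abs_L2 F))"
  by (rule order_trans[OF p1 mult_left_mono[OF g]]) (use CP in simp)
 then show "norm (abs_L2 p) <= CP / lam * norm (abs_L2 F)" using CP by (simp add: mult.assoc[symmetric])
qed

text \<open>The everywhere form of the hypotheses on an integrand. The product of the state with a
  fixed \<open>L2\<close> function is another instance, so one gradient theorem serves both integral
  terms of the perturbed cost that involve the state.\<close>

definition cost_density :: "(real^'n::finite => real => real) => (real^'n => real => real) => bool" where
 "cost_density l l' \<longleftrightarrow> (\<forall>t. (%x. l x t) \<in> LM) \<and> integrable lebesgue (%x. l x 0) \<and>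
  (\<forall>x t. (l x has_real_derivative l' x t) (at t)) \<and>
  (\<forall>M>0. \<exists>C>0. \<exists>\<psi>. sq \<psi> \<and> (\<forall>x s t. \<bar>s\<bar> <= M --> \<bar>t\<bar> <= M -->
   \<bar>l' x t\<bar> <= \<psi> x \<and> \<bar>l' x s - l' x t\<bar> <= C * \<bar>s - t\<bar>))"

lemma cost_densityD:
 assumes "cost_density l l'"
 shows "y \<in> LM ==> (%x. l x (y x)) \<in> LM"
  and "y \<in> LM ==> (%x. l' x (y x)) \<in> LM"
  and "(l x has_real_derivative l' x t) (at t)"
proof -
 have m: "!!t. (%x. l x t) \<in> LM" and d: "!!x t. (l x has_real_derivative l' x t) (at t)"
  and loc: "!!M. M > 0 ==> \<exists>C>0. \<forall>x s t. \<bar>s\<bar> <= M --> \<bar>t\<bar> <= M --> \<bar>l' x s - l' x t\<bar> <= C * \<bar>s - t\<bar>"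
  using assms unfolding cost_density_def by (blast, blast, meson)
 show "(l x has_real_derivative l' x t) (at t)" by (rule d)
 have c: "continuous_on UNIV (l x)" for x by (intro continuous_at_imp_continuous_on ballI DERIV_isCont[OF d])
 have c': "continuous_on UNIV (l' x)" for x by (rule locally_lipschitz_continuous) (use loc in meson)
 assume y: "y \<in> LM"
 show "(%x. l x (y x)) \<in> LM" by (rule caratheodory_measurable[OF m c y])
 show "(%x. l' x (y x)) \<in> LM"
  by (rule caratheodory_measurable[OF derivative_measurable[OF m d] c' y])
qed

text \<open>The adjoint equation has the transposed coefficients, which satisfy the same hypotheses;
  under the prefix \<open>tr\<close> the theorem \<open>existence\<close> becomes available for
  it.\<close>

sublocale semilinear \<subseteq> tr: elliptic Om "%i j. b j i" lam Lam
proof unfold_locales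
 show "lam * (norm \<xi>)^2 <= (\<Sum>i\<in>UNIV. \<Sum>j\<in>UNIV. b j i x * \<xi> $ i * \<xi> $ j)" for x \<xi>
  using ell[where \<xi>=\<xi> and x=x] by (subst sum.swap) (simp add: mult_ac)
qed (use op bd bm bb lam in auto)

context semilinear
begin

lemma bform_transpose: "tr.bform g h = bform h g"
 unfolding tr.bform_def bform_def by (subst sum.swap) (simp add: mult_ac)

lemma phi'_measurable: "y \<in> LM ==> (%x. \<phi>' x (y x)) \<in> LM"
proof (rule caratheodory_measurable[OF derivative_measurable[OF pm pd]])
 show "continuous_on UNIV (\<phi>' x)" for x by (rule locally_lipschitz_continuous) (use loc in meson)
qed

definition adjoint :: "(real^'n => real) => (real^'n => real) => (real^'n => real) => (real^'n => real^'n) => bool" where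
 "adjoint y F p gp \<longleftrightarrow> W Om p gp \<and>
  (\<forall>v h. W Om v h --> bform h gp + (LEB x. \<phi>' x (y x) * p x * v x) = (LEB x. F x * v x))"

lemma adjoint_exists:
 assumes y: "y \<in> LM" and M: "M > 0" "!!x. \<bar>y x\<bar> <= M" and F: "sq F"
 shows "\<exists>p gp. adjoint y F p gp"
proof -
 obtain C where C: "C > 0" "!!x t. \<bar>t\<bar> <= M ==> \<bar>\<phi>' x t\<bar> <= C" using loc[OF M(1)] by blast
 have Cy: "\<bar>\<phi>' x (y x)\<bar> <= C" for x by (rule C(2)[OF M(2)])
 obtain p gp where p: "W Om p gp"
  "!!v h. W Om v h ==> tr.bform gp h + (LEB x. \<phi>' x (y x) * p x * v x) = (LEB x. F x * v x)"
 proof (rule tr.existence[where c="%x t. \<phi>' x (y x) * t" and Lc=C])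
  show "sq (%x. \<phi>' x (y x) * u x)" if "sq u" for u
   by (rule sq_integrable_bounded_mult[OF that phi'_measurable[OF y] Cy])
  show "\<bar>\<phi>' x (y x) * s - \<phi>' x (y x) * t\<bar> <= C * \<bar>s - t\<bar>" for x s t
   using mult_right_mono[OF Cy[of x], of "\<bar>s - t\<bar>"] by (simp add: right_diff_distrib[symmetric] abs_mult)
  show "\<phi>' x (y x) * s <= \<phi>' x (y x) * t" if "s <= t" for x s t by (rule mult_left_mono[OF that pos])
 qed (use F that in blast)+
 then show ?thesis unfolding adjoint_def bform_transpose by blast
qed

lemma phi'_mult_sq:
 assumes "y \<in> LM" "M > 0" "!!x. \<bar>y x\<bar> <= M" "sq u"
 shows "sq (%x. \<phi>' x (y x) * u x)"
proof -
 obtain C where C: "C > 0" "!!x t. \<bar>t\<bar> <= M ==> \<bar>\<phi>' x t\<bar> <= C" using loc[OF assms(2)] by blast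
 show ?thesis by (rule sq_integrable_bounded_mult[OF assms(4) phi'_measurable[OF assms(1)] C(2)[OF assms(3)]])
qed

lemma st_measurable [measurable]: "st w \<in> LM"
 by (rule sq_integrable_measurable[OF sol_sq(1)[OF sol_st]])

lemma cost_derivative_sq:
 assumes c: "cost_density l l'"
 shows "sq (%x. l' x (st w x))"
proof -
 obtain M where M: "M > 0" "!!x. \<bar>st w x\<bar> <= M" using sol_bounded[OF sol_st] by blast
 then obtain \<psi> where psi: "sq \<psi>" "!!x t. \<bar>t\<bar> <= M ==> \<bar>l' x t\<bar> <= \<psi> x"
  using c unfolding cost_density_def by meson
 show ?thesis
 proof (rule sq_integrable_bound[OF psi(1) cost_densityD(2)[OF c st_measurable]])
  show "AEL x. \<bar>l' x (st w x)\<bar> <= \<bar>\<psi> x\<bar>" using psi(2)[OF M(2)] by (intro AE_I2) (meson abs_ge_self order_trans)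
 qed
qed

lemma cost_integrable:
 assumes c: "cost_density l l'"
 shows "integrable lebesgue (%x. l x (st w x))"
proof -
 obtain M where M: "M > 0" "!!x. \<bar>st w x\<bar> <= M" using sol_bounded[OF sol_st] by blast
 then obtain \<psi> where psi: "sq \<psi>" "!!x t. \<bar>t\<bar> <= M ==> \<bar>l' x t\<bar> <= \<psi> x"
  using c unfolding cost_density_def by meson
 have "integrable lebesgue (%x. l x (st w x) - l x 0)"
 proof (rule Bochner_Integration.integrable_bound[OF sq_integrable_mult[OF psi(1) sol_sq(1)[OF sol_st]]])
  show "(%x. l x (st w x) - l x 0) \<in> LM"
   using cost_densityD(1)[OF c st_measurable] cost_densityD(1)[OF c, of "%x. 0"] by measurable
  have "norm (l x (st w x) - l x 0) <= norm (\<psi> x * st w x)" for x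
  proof -
   have "\<bar>l x (st w x) - l x 0\<bar> <= \<psi> x * \<bar>st w x - 0\<bar>"
    by (rule derivative_bound_on[OF cost_densityD(3)[OF c] psi(2)]) (use M in auto)
   also have "... <= \<bar>\<psi> x * st w x\<bar>" by (simp add: abs_mult mult_right_mono)
   finally show ?thesis by simp
  qed
  then show "AEL x. norm (l x (st w x) - l x 0) <= norm (\<psi> x * st w x)" by (rule AE_I2)
 qed
 moreover have "integrable lebesgue (%x. l x 0)" using c by (simp add: cost_density_def)
 ultimately have "integrable lebesgue (%x. (l x (st w x) - l x 0) + l x 0)" by (rule Bochner_Integration.integrable_add)
 then show ?thesis by simp
qed

definition adj :: "(real^'n => real => real) => 'n L2 => 'n L2" where
 "adj l' w = abs_L2 (SOME p. \<exists>gp. adjoint (st w) (%x. l' x (st w x)) p gp)"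

lemma adjE:
 assumes c: "cost_density l l'"
 obtains p gp where "adj l' w = abs_L2 p" "adjoint (st w) (%x. l' x (st w x)) p gp"
proof -
 obtain M where M: "M > 0" "!!x. \<bar>st w x\<bar> <= M" using sol_bounded[OF sol_st] by blast
 from someI_ex[OF adjoint_exists[OF st_measurable M cost_derivative_sq[OF c]]]
 show thesis using that unfolding adj_def by blast
qed

lemma st_diff_bound:
 "norm (abs_L2 (%x. st w' x - st w x)) <= D * norm (abs_L2 (indicator Om :: real^'n => real))" if D: "D \<ge> 0" "!!x. \<bar>st w' x - st w x\<bar> <= D"
proof -
 have lm: "Om \<in> lmeasurable" using op bd by (intro bounded_set_imp_lmeasurable) auto
 have s: "sq (indicator Om :: real^'n => real)" by (rule sq_integrable_indicator[OF lm])
 have "norm (abs_L2 (%x. st w' x - st w x)) <= norm (abs_L2 (%x. D * indicator Om x))"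
 proof (rule norm_abs_L2_le[OF sq_integrable_diff[OF sol_sq(1)[OF sol_st] sol_sq(1)[OF sol_st]] sq_integrable_scale[OF s]], intro AE_I2)
  fix x
  show "\<bar>st w' x - st w x\<bar> <= \<bar>D * indicator Om x\<bar>"
   using D(2)[of x] sol_st[of w] sol_st[of w'] by (auto simp: sol_def indicator_def)
 qed
 also have "... = D * norm (abs_L2 (indicator Om :: real^'n => real))"
  using D(1) by (simp add: scaleR_abs_L2[OF s, symmetric])
 finally show ?thesis .
qed

text \<open>The adjoint equation is tested with the difference of two states, and the difference of
  their equations with the adjoint state. The bilinear terms cancel, and only Taylor remainders of
  the nonlinearity and of the integrand are left, both quadratic in the control by the uniform
  Lipschitz bound for the state.\<close>

theorem cost_gradient:
 assumes c: "cost_density l l'"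
 shows "((%w. LEB x. l x (st w x)) has_derivative (%h. adj l' w \<bullet> h)) (at w within S)"
proof -
 obtain K where K: "K > 0" "!!w w' x. \<bar>st w x - st w' x\<bar> <= K * norm (w - w')" using st_lipschitz by blast
 \<comment> \<open>One bound for the states of all controls within distance 1 of \<open>w\<close>,
   the range considered in \<open>has_derivative_quadratic\<close>.\<close>
 obtain M where M: "M > 0" "!!w' x. norm w' <= norm w + 1 ==> \<bar>st w' x\<bar> <= M" using st_bounded by blast
 obtain C1 where C1: "C1 > 0" "!!x s t. \<bar>s\<bar> <= M ==> \<bar>t\<bar> <= M ==> \<bar>\<phi>' x s - \<phi>' x t\<bar> <= C1 * \<bar>s - t\<bar>"
  using loc[OF M(1)] by blast
 obtain C2 where C2: "C2 > 0" "!!x s t. \<bar>s\<bar> <= M ==> \<bar>t\<bar> <= M ==> \<bar>l' x s - l' x t\<bar> <= C2 * \<bar>s - t\<bar>"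
  using c M(1) unfolding cost_density_def by meson
 define V where "V = norm (abs_L2 (indicator Om :: real^'n => real))"
 define y where "y = st w"
 define F where "F x = l' x (y x)" for x
 obtain p gp where p: "adj l' w = abs_L2 p" "adjoint y F p gp" using adjE[OF c, of w] unfolding y_def F_def by blast
 have Wp: "W Om p gp" using p(2) by (simp add: adjoint_def)
 note sp = W_sq[OF Wp]
 have sy: "sq y" and sF: "sq F"
  unfolding y_def F_def by (rule sol_sq(1)[OF sol_st], rule cost_derivative_sq[OF c])
 obtain g where g: "W Om y g" "!!v h. W Om v h ==> bform g h + (LEB x. \<phi> x (y x) * v x) = (LEB x. rep_L2 w x * v x)"
  using sol_st[of w] by (auto simp: sol_def y_def)
 have yM: "\<bar>y x\<bar> <= M" for x unfolding y_def by (rule M(2)) simp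
 show ?thesis
 proof (rule has_derivative_quadratic)
  show "bounded_linear (%h. adj l' w \<bullet> h)" by (rule bounded_linear_inner_right)
  fix w' assume n: "norm (w' - w) <= 1"
  define y' where "y' = st w'"
  have "norm w' <= norm w + 1" using norm_triangle_sub[of w' w] n by linarith
  then have y'M: "\<bar>y' x\<bar> <= M" for x unfolding y'_def by (rule M(2))
  define \<delta> where "\<delta> x = y' x - y x" for x
  define D where "D = K * norm (w' - w)"
  have D: "D \<ge> 0" "\<bar>\<delta> x\<bar> <= D" for x using K by (auto simp: D_def \<delta>_def y_def y'_def)
  have sy': "sq y'" unfolding y'_def by (rule sol_sq(1)[OF sol_st])
  have sd: "sq \<delta>" unfolding \<delta>_def by (rule sq_integrable_diff[OF sy' sy])
  have nd: "norm (abs_L2 \<delta>) <= D * V"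
   unfolding V_def \<delta>_def y_def y'_def by (rule st_diff_bound[OF D[unfolded \<delta>_def y_def y'_def]])
  obtain g' where g': "W Om y' g'" "!!v h. W Om v h ==> bform g' h + (LEB x. \<phi> x (y' x) * v x) = (LEB x. rep_L2 w' x * v x)"
   using sol_st[of w'] by (auto simp: sol_def y'_def)
  have W\<delta>: "W Om \<delta> (%x. g' x - g x)" unfolding \<delta>_def by (rule W_diff[OF g'(1) g(1)])
  have e2: "bform (%x. g' x - g x) gp + (LEB x. \<phi>' x (y x) * p x * \<delta> x) = (LEB x. F x * \<delta> x)"
   using p(2) W\<delta> by (simp add: adjoint_def)
  define \<rho> where "\<rho> x = \<phi> x (y' x) - \<phi> x (y x) - \<phi>' x (y x) * \<delta> x" for x
  have s1: "sq (%x. \<phi> x (y' x))" "sq (%x. \<phi> x (y x))"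
   unfolding y_def y'_def by (rule sol_sq(2)[OF sol_st])+
  note ym = sq_integrable_measurable[OF sy]
  have s2: "sq (%x. \<phi>' x (y x) * \<delta> x)" by (rule phi'_mult_sq[OF ym M(1) yM sd])
  have s3: "sq \<rho>" unfolding \<rho>_def by (intro sq_integrable_diff s1 s2)
  have i: "(LEB x. \<rho> x * p x) = (LEB x. \<phi> x (y' x) * p x) - (LEB x. \<phi> x (y x) * p x) - (LEB x. \<phi>' x (y x) * p x * \<delta> x)"
  proof -
   have "(%x. \<phi>' x (y x) * \<delta> x * p x) = (%x. \<phi>' x (y x) * p x * \<delta> x)" by (simp add: mult_ac)
   then show ?thesis using s1[THEN sq_integrable_mult, OF sp] sq_integrable_mult[OF s2 sp]
    by (simp add: \<rho>_def left_diff_distrib)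
  qed
  have e1: "bform (%x. g' x - g x) gp + (LEB x. \<phi> x (y' x) * p x) - (LEB x. \<phi> x (y x) * p x) = (w' - w) \<bullet> abs_L2 p"
  proof -
   have ip: "u \<bullet> abs_L2 p = (LEB x. rep_L2 u x * p x)" for u
    using inner_abs_L2[OF sq_integrable_rep sp, of u] by simp
   show ?thesis
    unfolding inner_diff_left ip[of w] ip[of w'] using g(2)[OF Wp] g'(2)[OF Wp]
    by (simp add: bform_diff[OF W_sqv[OF g'(1)] W_sqv[OF g(1)] W_sqv[OF Wp]])
  qed
  \<comment> \<open>One of the two factors \<open>\<delta> x\<close> is replaced by its sup bound:
    the remainder is to be paired with \<open>p\<close>, which is only square integrable.\<close>
  have rb: "\<bar>\<rho> x\<bar> <= C1 * D * \<bar>\<delta> x\<bar>" for x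
  proof -
   have "\<bar>\<rho> x\<bar> <= C1 * (y' x - y x)^2" unfolding \<rho>_def \<delta>_def
    by (rule taylor_remainder[OF pd y'M yM C1(2)]) (use C1(1) in auto)
   also have "... = C1 * \<bar>\<delta> x\<bar> * \<bar>\<delta> x\<bar>" by (simp add: \<delta>_def power2_eq_square mult.assoc)
   also have "... <= C1 * D * \<bar>\<delta> x\<bar>" using C1(1) D(2) by (intro mult_right_mono mult_left_mono) auto
   finally show ?thesis .
  qed
  have nr: "norm (abs_L2 \<rho>) <= C1 * D * (D * V)"
  proof -
   have "norm (abs_L2 \<rho>) <= norm (abs_L2 (%x. C1 * D * \<delta> x))"
    by (rule norm_abs_L2_le[OF s3 sq_integrable_scale[OF sd]]) (use rb C1(1) D(1) in \<open>simp add: abs_mult\<close>)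
   also have "... = C1 * D * norm (abs_L2 \<delta>)" using C1(1) D(1) by (simp add: scaleR_abs_L2[OF sd, symmetric])
   also have "... <= C1 * D * (D * V)" using nd C1(1) D(1) by (intro mult_left_mono) auto
   finally show ?thesis .
  qed
  have "\<bar>LEB x. \<rho> x * p x\<bar> <= norm (abs_L2 \<rho>) * norm (abs_L2 p)"
   unfolding inner_abs_L2[OF s3 sp, symmetric] by (rule Cauchy_Schwarz_ineq2)
  also have "... <= C1 * D * (D * V) * norm (abs_L2 p)" by (rule mult_right_mono[OF nr]) simp
  finally have B1: "\<bar>LEB x. \<rho> x * p x\<bar> <= C1 * V * norm (abs_L2 p) * D^2" by (simp add: power2_eq_square mult_ac)
  define \<sigma> where "\<sigma> x = l x (y' x) - l x (y x) - F x * \<delta> x" for x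
  have il: "integrable lebesgue (%x. l x (y' x))" "integrable lebesgue (%x. l x (y x))"
   unfolding y_def y'_def by (rule cost_integrable[OF c])+
  have isg: "(LEB x. \<sigma> x) = (LEB x. l x (y' x)) - (LEB x. l x (y x)) - (LEB x. F x * \<delta> x)"
   using il sq_integrable_mult[OF sF sd] by (simp add: \<sigma>_def)
  have "\<bar>LEB x. \<sigma> x\<bar> <= (LEB x. C2 * (\<delta> x)^2)"
  proof (rule integral_abs_bound_integral)
   show "integrable lebesgue \<sigma>" unfolding \<sigma>_def using il sq_integrable_mult[OF sF sd] by auto
   show "integrable lebesgue (%x. C2 * (\<delta> x)^2)" using sd by (simp add: sq_integrable_def)
   show "\<bar>\<sigma> x\<bar> <= C2 * (\<delta> x)^2" for x
    unfolding \<sigma>_def \<delta>_def F_def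
    by (rule taylor_remainder[OF cost_densityD(3)[OF c] y'M yM C2(2)]) (use C2(1) in auto)
  qed
  also have "... = C2 * (norm (abs_L2 \<delta>))^2" by (simp add: norm_abs_L2[OF sd])
  also have "... <= C2 * (D * V)^2" using nd C2(1) by (intro mult_left_mono power_mono) auto
  finally have B2: "\<bar>LEB x. \<sigma> x\<bar> <= C2 * V^2 * D^2" by (simp add: power_mult_distrib mult_ac)
  \<comment> \<open>The two tested equations combine to an exact formula for the error of the linear
    approximation.\<close>
  have "(LEB x. l x (y' x)) - (LEB x. l x (y x)) - adj l' w \<bullet> (w' - w) = (LEB x. \<sigma> x) - (LEB x. \<rho> x * p x)"
   using e1 e2 i isg by (simp add: p(1) inner_commute)
  then have "\<bar>(LEB x. l x (y' x)) - (LEB x. l x (y x)) - adj l' w \<bullet> (w' - w)\<bar> <= C2 * V^2 * D^2 + C1 * V * norm (abs_L2 p) * D^2"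
   using B1 B2 by linarith
  also have "... = (C2 * V^2 + C1 * V * norm (abs_L2 p)) * K^2 * (norm (w' - w))^2"
   by (simp add: D_def power_mult_distrib algebra_simps)
  finally show "norm ((LEB x. l x (st w' x)) - (LEB x. l x (st w x)) - adj l' w \<bullet> (w' - w)) <= ..."
   by (simp add: y_def y'_def)
 qed
qed

section \<open>Bounds and Lipschitz dependence of the adjoint state\<close>

lemma adjoint_energy:
 assumes CP: "CP > 0" "!!v g. W Om v g ==> (LEB x. (v x)^2) <= CP * (LEB x. (norm (g x))^2)"
  and q: "W Om q gq" and F: "sq F"
  and e: "bform gq gq <= (LEB x. F x * q x)"
 shows "sqrt (LEB x. (norm (gq x))^2) <= sqrt CP / lam * norm (abs_L2 F)"
  "norm (abs_L2 q) <= CP / lam * norm (abs_L2 F)"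
proof -
 define G where "G = sqrt (LEB x. (norm (gq x))^2)"
 have G: "G^2 = (LEB x. (norm (gq x))^2)" "G \<ge> 0" by (simp_all add: G_def)
 have "lam * G^2 <= (LEB x. F x * q x)" using bform_coercive[OF W_sqv[OF q]] e by (simp add: G)
 note en = energy_estimate[OF W_sq[OF q] F CP(1) lam CP(2)[OF q, folded G(1)] G(2) this]
 show "sqrt (LEB x. (norm (gq x))^2) <= sqrt CP / lam * norm (abs_L2 F)" using en(1) by (simp add: G_def)
 show "norm (abs_L2 q) <= CP / lam * norm (abs_L2 F)" by (rule en(2))
qed

lemma cost_derivative_bound:
 assumes "cost_density l l'"
 shows "\<exists>N. \<forall>w. norm w <= R --> norm (abs_L2 (%x. l' x (st w x))) <= N"
proof -
 obtain M where M: "M > 0" "!!w x. norm w <= R ==> \<bar>st w x\<bar> <= M" using st_bounded by blast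
 obtain \<psi> where psi: "sq \<psi>" "!!x t. \<bar>t\<bar> <= M ==> \<bar>l' x t\<bar> <= \<psi> x"
  using assms M(1) unfolding cost_density_def by meson
 have "norm (abs_L2 (%x. l' x (st w x))) <= norm (abs_L2 \<psi>)" if "norm w <= R" for w
  by (rule norm_abs_L2_le[OF cost_derivative_sq[OF assms] psi(1)])
   (use psi(2)[OF M(2)[OF that]] in \<open>auto intro!: AE_I2 intro: order_trans[OF _ abs_ge_self]\<close>)
 then show ?thesis by blast
qed

lemma adjoint_self:
 assumes "adjoint y F p gp"
 shows "bform gp gp <= (LEB x. F x * p x)"
proof -
 have "0 <= (LEB x. \<phi>' x (y x) * p x * p x)" using pos by (simp add: mult.assoc)
 moreover have "bform gp gp + (LEB x. \<phi>' x (y x) * p x * p x) = (LEB x. F x * p x)"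
  using assms by (simp add: adjoint_def)
 ultimately show ?thesis by linarith
qed

text \<open>The bound on the gradient of a representative is recorded together with the norm, as
  input for \<open>rellich\<close>.\<close>

lemma adj_bounded:
 assumes c: "cost_density l l'"
 shows "\<exists>N. \<forall>w. norm w <= R --> norm (adj l' w) <= N \<and>
  (\<exists>p gp. adj l' w = abs_L2 p \<and> W Om p gp \<and> sqrt (LEB x. (norm (gp x))^2) <= N)"
proof -
 obtain CP where CP: "CP > 0" "!!v g. W Om v g ==> (LEB x. (v x)^2) <= CP * (LEB x. (norm (g x))^2)"
  by (rule poincare[OF op bd]) (assumption | rule that | blast)+
 obtain N where N: "!!w. norm w <= R ==> norm (abs_L2 (%x. l' x (st w x))) <= N" using cost_derivative_bound[OF c] by blast
 define N' where "N' = max (sqrt CP / lam * N) (CP / lam * N)"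
 have "norm (adj l' w) <= N' \<and> (\<exists>p gp. adj l' w = abs_L2 p \<and> W Om p gp \<and> sqrt (LEB x. (norm (gp x))^2) <= N')"
  if w: "norm w <= R" for w
 proof -
  obtain p gp where p: "adj l' w = abs_L2 p" "adjoint (st w) (%x. l' x (st w x)) p gp" by (rule adjE[OF c])
  have Wp: "W Om p gp" using p(2) by (simp add: adjoint_def)
  note e = adjoint_energy[OF CP Wp cost_derivative_sq[OF c] adjoint_self[OF p(2)]]
  have "sqrt CP / lam * norm (abs_L2 (%x. l' x (st w x))) <= sqrt CP / lam * N"
   "CP / lam * norm (abs_L2 (%x. l' x (st w x))) <= CP / lam * N"
   using N[OF w] CP(1) lam by (intro mult_left_mono; simp)+
  then have "sqrt (LEB x. (norm (gp x))^2) <= N'" "norm (adj l' w) <= N'" using e p(1) by (auto simp: N'_def)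
  then show ?thesis using p(1) Wp by blast
 qed
 then show ?thesis by blast
qed

text \<open>The difference \<open>q\<close> of two adjoint states obeys an energy inequality with
  right-hand side \<open>H\<close>, made of the change of \<open>l'\<close> along the states and the
  change of \<open>\<phi>'\<close> times the first adjoint state. Both are controlled by the sup
  norm of the difference of the states.\<close>

lemma adj_lipschitz:
 assumes c: "cost_density l l'"
 shows "\<exists>C. \<forall>w w'. norm w <= R --> norm w' <= R --> norm (adj l' w' - adj l' w) <= C * norm (w' - w)"
proof -
 obtain CP where CP: "CP > 0" "!!v g. W Om v g ==> (LEB x. (v x)^2) <= CP * (LEB x. (norm (g x))^2)"
  by (rule poincare[OF op bd]) (assumption | rule that | blast)+
 obtain N where N: "!!w. norm w <= R ==> norm (adj l' w) <= N" using adj_bounded[OF c] by blast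
 obtain K where K: "K > 0" "!!w w' x. \<bar>st w x - st w' x\<bar> <= K * norm (w - w')" using st_lipschitz by blast
 obtain M where M: "M > 0" "!!w x. norm w <= R ==> \<bar>st w x\<bar> <= M" using st_bounded by blast
 obtain C1 where C1: "C1 > 0" "!!x s t. \<bar>s\<bar> <= M ==> \<bar>t\<bar> <= M ==> \<bar>\<phi>' x s - \<phi>' x t\<bar> <= C1 * \<bar>s - t\<bar>"
  using loc[OF M(1)] by blast
 obtain C2 where C2: "C2 > 0" "!!x s t. \<bar>s\<bar> <= M ==> \<bar>t\<bar> <= M ==> \<bar>l' x s - l' x t\<bar> <= C2 * \<bar>s - t\<bar>"
  using c M(1) unfolding cost_density_def by meson
 define V where "V = norm (abs_L2 (indicator Om :: real^'n => real))"
 have "norm (adj l' w' - adj l' w) <= CP / lam * (C2 * K * V + C1 * K * N) * norm (w' - w)"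
  if w: "norm w <= R" "norm w' <= R" for w w'
 proof -
  define y y' where "y = st w" and "y' = st w'"
  define F F' where "F = (%x. l' x (y x))" and "F' = (%x. l' x (y' x))"
  obtain p gp where p: "adj l' w = abs_L2 p" "adjoint y F p gp" using adjE[OF c, of w] unfolding y_def F_def by blast
  obtain p' gp' where p': "adj l' w' = abs_L2 p'" "adjoint y' F' p' gp'" using adjE[OF c, of w'] unfolding y'_def F'_def by blast
  have W: "W Om p gp" "W Om p' gp'" using p(2) p'(2) by (auto simp: adjoint_def)
  note sp = W[THEN W_sq]
  define D where "D = K * norm (w' - w)"
  have D: "D \<ge> 0" "\<bar>y' x - y x\<bar> <= D" for x using K by (auto simp: D_def y_def y'_def)
  have sy: "sq y" "sq y'" unfolding y_def y'_def by (rule sol_sq(1)[OF sol_st])+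
  have sF: "sq F" "sq F'"
   unfolding F_def F'_def y_def y'_def by (rule cost_derivative_sq[OF c])+
  have yM: "\<bar>y x\<bar> <= M" "\<bar>y' x\<bar> <= M" for x unfolding y_def y'_def using w by (auto intro: M(2))
  define q where "q x = p' x - p x" for x
  define gq where "gq x = gp' x - gp x" for x
  have Wq: "W Om q gq" unfolding q_def gq_def by (rule W_diff[OF W(2,1)])
  note ph = phi'_mult_sq[OF sq_integrable_measurable[OF sy(1)] M(1) yM(1)] phi'_mult_sq[OF sq_integrable_measurable[OF sy(2)] M(1) yM(2)]
  define r where "r x = \<phi>' x (y' x) * p x - \<phi>' x (y x) * p x" for x
  have sr: "sq r" unfolding r_def by (intro sq_integrable_diff ph sp)
  define H where "H x = (F' x - F x) - r x" for x
  have sH: "sq H" unfolding H_def by (intro sq_integrable_diff sF sr)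
  have "bform gq gq <= (LEB x. H x * q x)"
  proof -
   have b: "bform gq gq = bform gq gp' - bform gq gp"
    using tr.bform_diff[OF W_sqv[OF W(2)] W_sqv[OF W(1)] W_sqv[OF Wq]] unfolding bform_transpose gq_def[symmetric] .
   have e1: "bform gq gp' + (LEB x. \<phi>' x (y' x) * p' x * q x) = (LEB x. F' x * q x)"
    and e2: "bform gq gp + (LEB x. \<phi>' x (y x) * p x * q x) = (LEB x. F x * q x)"
    using p(2) p'(2) Wq by (auto simp: adjoint_def)
   note sq = W_sq[OF Wq]
   have i: "(LEB x. H x * q x) = (LEB x. F' x * q x) - (LEB x. F x * q x) -
    ((LEB x. \<phi>' x (y' x) * p x * q x) - (LEB x. \<phi>' x (y x) * p x * q x))"
    using sF[THEN sq_integrable_mult, OF sq] sq_integrable_mult[OF ph(1)[OF sp(1)] sq] sq_integrable_mult[OF ph(2)[OF sp(1)] sq]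
    by (simp add: H_def r_def left_diff_distrib)
   have "(LEB x. \<phi>' x (y' x) * p' x * q x) - (LEB x. \<phi>' x (y' x) * p x * q x) = (LEB x. \<phi>' x (y' x) * (q x)^2)"
    using sq_integrable_mult[OF ph(2)[OF sp(1)] sq] sq_integrable_mult[OF ph(2)[OF sp(2)] sq]
    by (subst Bochner_Integration.integral_diff[symmetric]) (auto simp: q_def power2_eq_square algebra_simps)
   moreover have "0 <= (LEB x. \<phi>' x (y' x) * (q x)^2)" using pos by simp
   ultimately show ?thesis using b e1 e2 i by linarith
  qed
  from adjoint_energy(2)[OF CP Wq sH this]
  have 1: "norm (abs_L2 q) <= CP / lam * norm (abs_L2 H)" .
  have nd: "norm (abs_L2 (%x. y' x - y x)) <= D * V"
   unfolding V_def y_def y'_def by (rule st_diff_bound[OF D[unfolded y_def y'_def]])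
  have sd: "sq (%x. y' x - y x)" by (rule sq_integrable_diff[OF sy(2,1)])
  have a: "norm (abs_L2 (%x. F' x - F x)) <= C2 * (D * V)"
  proof -
   have "norm (abs_L2 (%x. F' x - F x)) <= norm (abs_L2 (%x. C2 * (y' x - y x)))"
    by (rule norm_abs_L2_le[OF sq_integrable_diff[OF sF(2,1)] sq_integrable_scale[OF sd]])
     (use C2 yM in \<open>auto simp: F_def F'_def abs_mult\<close>)
   also have "... = C2 * norm (abs_L2 (%x. y' x - y x))" using C2(1) by (simp add: scaleR_abs_L2[OF sd, symmetric])
   also have "... <= C2 * (D * V)" using nd C2(1) by (intro mult_left_mono) auto
   finally show ?thesis .
  qed
  have b: "norm (abs_L2 r) <= C1 * D * N"
  proof -
   have "\<bar>r x\<bar> <= \<bar>C1 * D * p x\<bar>" for x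
   proof -
    have "\<bar>\<phi>' x (y' x) - \<phi>' x (y x)\<bar> <= C1 * \<bar>y' x - y x\<bar>" by (rule C1(2)[OF yM(2) yM(1)])
    also have "... <= C1 * D" using C1(1) D(2) by (intro mult_left_mono) auto
    finally have "\<bar>\<phi>' x (y' x) - \<phi>' x (y x)\<bar> * \<bar>p x\<bar> <= C1 * D * \<bar>p x\<bar>" by (rule mult_right_mono) simp
    then show ?thesis using C1(1) D(1) by (simp add: r_def left_diff_distrib[symmetric] abs_mult)
   qed
   then have "norm (abs_L2 r) <= norm (abs_L2 (%x. C1 * D * p x))" by (intro norm_abs_L2_le sr sq_integrable_scale sp AE_I2)
   also have "... = C1 * D * norm (abs_L2 p)" using C1(1) D(1) by (simp add: scaleR_abs_L2[OF sp(1), symmetric])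
   also have "... <= C1 * D * N" using N[OF w(1)] p(1) C1(1) D(1) by (intro mult_left_mono) auto
   finally show ?thesis .
  qed
  have "abs_L2 H = abs_L2 (%x. F' x - F x) - abs_L2 r"
   unfolding H_def by (rule minus_abs_L2[OF sq_integrable_diff[OF sF(2,1)] sr, symmetric])
  then have "norm (abs_L2 H) <= C2 * (D * V) + C1 * D * N" using a b norm_triangle_ineq4 by (smt (verit))
  then have "norm (abs_L2 q) <= CP / lam * (C2 * (D * V) + C1 * D * N)"
   using 1 CP(1) lam by (meson mult_left_mono order_trans divide_nonneg_pos less_imp_le)
  moreover have "adj l' w' - adj l' w = abs_L2 q" unfolding p(1) p'(1) q_def by (rule minus_abs_L2[OF sp(2,1)])
  ultimately show ?thesis by (simp add: D_def algebra_simps)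
 qed
 then show ?thesis by blast
qed

end

section \<open>Fixed points of compact maps\<close>

text \<open>The set is a Minkowski sum of \<open>n\<close> compact segments, which gives the
  induction.\<close>

lemma compact_combinations:
 fixes c :: "nat => 'a::real_normed_vector"
 shows "compact {\<Sum>i<n. x i *\<^sub>R c i |x. \<forall>i<n. x i \<in> {a..b::real}}"
proof (induction n)
 case (Suc n)
 let ?C = "%n. {\<Sum>i<n. x i *\<^sub>R c i |x. \<forall>i<n. x i \<in> {a..b::real}}"
 have "?C (Suc n) = {u + v |u v. u \<in> ?C n \<and> v \<in> (%t. t *\<^sub>R c n) ` {a..b}}" (is "_ = ?R")
 proof
  show "?R \<subseteq> ?C (Suc n)"
  proof
   fix w assume "w \<in> ?R"
   then obtain x t where x: "w = (\<Sum>i<n. x i *\<^sub>R c i) + t *\<^sub>R c n" "\<forall>i<n. x i \<in> {a..b}" "t \<in> {a..b}" by blast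
   have "w = (\<Sum>i<Suc n. (x(n := t)) i *\<^sub>R c i)" using x(1) by simp
   moreover have "\<forall>i<Suc n. (x(n := t)) i \<in> {a..b}" using x(2,3) by (auto simp: less_Suc_eq)
   ultimately show "w \<in> ?C (Suc n)" by blast
  qed
 qed force
 moreover have "compact ?R" by (intro compact_sums Suc compact_continuous_image continuous_intros compact_Icc)
 ultimately show ?case by simp
qed simp

text \<open>Brouwer's theorem is replaced by the combinatorial lemma behind it, since the dimension is the
 size of a finite net and hence not the cardinality of a type.\<close>

lemma approximate_fixed_point:
 fixes S :: "'a::real_normed_vector => 'a"
 assumes cont: "continuous_on UNIV S" and K: "compact K" "range S \<subseteq> K" and e: "e > 0"
 shows "\<exists>z. norm (S z - z) <= e"
proof -
 obtain D where D: "finite D" "K \<subseteq> (\<Union>c\<in>D. ball c e)" using K(1) e unfolding compact_eq_totally_bounded by blast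
 obtain n :: nat and c where c: "D = c ` {i. i < n}" using finite_imp_nat_seg_image_inj_on[OF D(1)] by blast
 \<comment> \<open>Normalised by \<open>B\<close>, these are the weights of the Schauder projection
   onto the span of the net: \<open>c i\<close> counts only if it lies within \<open>e\<close> of
   \<open>S u\<close>.\<close>
 define \<beta> where "\<beta> i y = max 0 (e - norm (y - c i))" for i y
 define B where "B y = (\<Sum>i<n. \<beta> i y)" for y
 have b0: "\<beta> i y \<ge> 0" for i y by (simp add: \<beta>_def)
 have B: "B (S u) > 0" for u
 proof -
  have "S u \<in> (\<Union>c\<in>D. ball c e)" using K(2) D(2) by blast
  then obtain i where i: "i < n" "dist (c i) (S u) < e" by (auto simp: c)
  show ?thesis unfolding B_def
   by (rule sum_pos2[of _ i]) (use i b0 in \<open>auto simp: \<beta>_def dist_norm norm_minus_commute\<close>)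
 qed
 define \<tau> where "\<tau> i u = \<beta> i (S u) / B (S u)" for i u
 have t0: "0 <= \<tau> i u" for i u using B[of u] b0 by (simp add: \<tau>_def)
 have t1: "(\<Sum>i<n. \<tau> i u) = 1" for u using B[of u] by (simp add: \<tau>_def sum_divide_distrib[symmetric] B_def[symmetric])
 have tle: "\<tau> i u <= 1" if "i < n" for i u
  using member_le_sum[of i "{..<n}" "%i. \<tau> i u"] that t0 t1[of u] by auto
 have tc: "continuous_on UNIV (\<tau> i)" for i
  unfolding \<tau>_def B_def \<beta>_def using B
  by (intro continuous_intros cont) (auto simp: B_def \<beta>_def less_le)
 \<comment> \<open>Coordinates run through the whole unit cube instead of the simplex; that they sum
   to 1 is recovered in the limit, where they equal the weights \<open>\<tau>\<close>.\<close>
 define comb where "comb x = (\<Sum>i<n. x i *\<^sub>R c i)" for x :: "nat => real"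
 define s where "s k r j = real (r j) / real (Suc k)" for k and r :: "nat => nat" and j :: nat
 have sle: "s k r j \<in> {0..1}" if "r j <= Suc k" for k r j using that by (simp add: s_def)
 have "\<exists>q. (\<forall>i<n. q i < Suc k) \<and> (\<forall>i<n. \<exists>r r'. (\<forall>j<n. q j <= r j \<and> r j <= q j + 1) \<and> (\<forall>j<n. q j <= r' j \<and> r' j <= q j + 1) \<and>
  s k r i <= \<tau> i (comb (s k r)) \<and> \<tau> i (comb (s k r')) <= s k r' i)" for k
 proof -
  \<comment> \<open>Label 0 says that the i-th coordinate may still grow. On the upper face the
    label is forced to be 1, and on the lower face it is 0 because the weights are nonnegative;
    these are the boundary conditions of \<open>kuhn_lemma\<close>.\<close>
  define lab :: "(nat => nat) => nat => nat" where "lab r i = (if s k r i <= \<tau> i (comb (s k r)) \<and> r i \<noteq> Suc k then 0 else 1)" for r i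
  obtain q where q: "\<forall>i<n. q i < Suc k" "\<forall>i<n. \<exists>r r'. (\<forall>j<n. q j <= r j \<and> r j <= q j + 1) \<and> (\<forall>j<n. q j <= r' j \<and> r' j <= q j + 1) \<and> lab r i \<noteq> lab r' i"
   by (rule kuhn_lemma[of "Suc k" n lab]) (auto simp: lab_def s_def t0)
  have lab0: "s k r i <= \<tau> i (comb (s k r))" if "lab r i = 0" for r i using that by (auto simp: lab_def split: if_splits)
  have lab1: "\<tau> i (comb (s k r)) <= s k r i" if "lab r i \<noteq> 0" "i < n" for r i
  proof (cases "r i = Suc k")
   case True
   then show ?thesis using tle[OF that(2)] by (simp add: s_def)
  qed (use that(1) in \<open>auto simp: lab_def split: if_splits\<close>)
  show ?thesis
  proof (rule exI[of _ q], rule conjI, rule q(1), intro allI impI)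
   fix i assume i: "i < n"
   obtain r r' where r: "\<forall>j<n. q j <= r j \<and> r j <= q j + 1" "\<forall>j<n. q j <= r' j \<and> r' j <= q j + 1" "lab r i \<noteq> lab r' i" using q(2) i by blast
   show "\<exists>r r'. (\<forall>j<n. q j <= r j \<and> r j <= q j + 1) \<and> (\<forall>j<n. q j <= r' j \<and> r' j <= q j + 1) \<and>
    s k r i <= \<tau> i (comb (s k r)) \<and> \<tau> i (comb (s k r')) <= s k r' i"
   proof (cases "lab r i = 0")
    case True
    then have "lab r' i \<noteq> 0" using r(3) by simp
    then show ?thesis using True r(1,2) lab0 lab1 i by blast
   next
    case False
    then have "lab r' i = 0" using r(3) by (auto simp: lab_def split: if_splits)
    then show ?thesis using False r(1,2) lab0 lab1 i by blast
   qed
  qed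
 qed
 then obtain q where q: "!!k i. i < n ==> q k i < Suc k"
  "!!k i. i < n ==> \<exists>r r'. (\<forall>j<n. q k j <= r j \<and> r j <= q k j + 1) \<and> (\<forall>j<n. q k j <= r' j \<and> r' j <= q k j + 1) \<and>
   s k r i <= \<tau> i (comb (s k r)) \<and> \<tau> i (comb (s k r')) <= s k r' i" by metis
 define X where "X k = comb (s k (q k))" for k
 have "\<forall>k. X k \<in> {\<Sum>i<n. x i *\<^sub>R c i |x. \<forall>i<n. x i \<in> {0..1::real}}"
  unfolding X_def comb_def using sle q(1) less_imp_le by blast
 from compact_combinations[where n=n and c=c and a=0 and b=1, unfolded compact_def, THEN spec, THEN mp, OF this]
 obtain z \<rho> where z: "strict_mono (\<rho> :: nat => nat)" "(X \<circ> \<rho>) ----> z" by blast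
 have inv: "(%k. 1 / real (Suc (\<rho> k))) ----> 0"
  using LIMSEQ_subseq_LIMSEQ[OF LIMSEQ_inverse_real_of_nat z(1)] by (simp add: o_def inverse_eq_divide)
 \<comment> \<open>Corners of the chosen cell differ from its base point by at most one mesh width
   in each coordinate, so every choice of corners has the same limit.\<close>
 have near: "(%k. comb (s (\<rho> k) (r k))) ----> z" if r: "!!k j. j < n ==> q (\<rho> k) j <= r k j \<and> r k j <= q (\<rho> k) j + 1" for r
 proof -
  have "(%k. comb (s (\<rho> k) (r k)) - X (\<rho> k)) ----> 0"
  proof (rule Lim_null_comparison)
   show "(%k. 1 / real (Suc (\<rho> k)) * (\<Sum>j<n. norm (c j))) ----> 0" using tendsto_mult_right[OF inv, of "\<Sum>j<n. norm (c j)"] by simp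
   show "\<forall>\<^sub>F k in sequentially. norm (comb (s (\<rho> k) (r k)) - X (\<rho> k)) <= 1 / real (Suc (\<rho> k)) * (\<Sum>j<n. norm (c j))"
   proof (intro always_eventually allI)
    fix k
    have "comb (s (\<rho> k) (r k)) - X (\<rho> k) = (\<Sum>j<n. (s (\<rho> k) (r k) j - s (\<rho> k) (q (\<rho> k)) j) *\<^sub>R c j)"
     by (simp add: comb_def X_def sum_subtractf scaleR_diff_left)
    also have "norm ... <= (\<Sum>j<n. 1 / real (Suc (\<rho> k)) * norm (c j))"
    proof (rule sum_norm_le)
     fix j assume "j \<in> {..<n}"
     then have j: "j < n" by simp
     have "\<bar>real (r k j) - real (q (\<rho> k) j)\<bar> <= 1" using r[OF j, of k] by auto
     then have "\<bar>s (\<rho> k) (r k) j - s (\<rho> k) (q (\<rho> k)) j\<bar> <= 1 / real (Suc (\<rho> k))"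
      unfolding s_def diff_divide_distrib[symmetric] abs_divide by (simp add: divide_right_mono)
     then show "norm ((s (\<rho> k) (r k) j - s (\<rho> k) (q (\<rho> k)) j) *\<^sub>R c j) <= 1 / real (Suc (\<rho> k)) * norm (c j)"
      by (simp only: norm_scaleR mult_right_mono norm_ge_zero)
    qed
    finally show "norm (comb (s (\<rho> k) (r k)) - X (\<rho> k)) <= 1 / real (Suc (\<rho> k)) * (\<Sum>j<n. norm (c j))"
     by (simp add: sum_distrib_left)
   qed
  qed
  from tendsto_add[OF this z(2)] show ?thesis by (simp add: o_def)
 qed
 \<comment> \<open>The two corners with opposite labels enclose the i-th coordinate between weights
   that both converge to \<open>\<tau> i z\<close>.\<close>
 have lim: "(%k. s (\<rho> k) (q (\<rho> k)) i) ----> \<tau> i z" if i: "i < n" for i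
 proof -
  define P where "P k r r' \<longleftrightarrow> (\<forall>j<n. q (\<rho> k) j <= r j \<and> r j <= q (\<rho> k) j + 1) \<and> (\<forall>j<n. q (\<rho> k) j <= r' j \<and> r' j <= q (\<rho> k) j + 1) \<and>
   s (\<rho> k) r i <= \<tau> i (comb (s (\<rho> k) r)) \<and> \<tau> i (comb (s (\<rho> k) r')) <= s (\<rho> k) r' i" for k r r'
  have "\<forall>k. \<exists>r r'. P k r r'" unfolding P_def by (intro allI q(2)[OF i])
  then obtain r r' where P: "!!k. P k (r k) (r' k)" by metis
  have r: "!!k j. j < n ==> q (\<rho> k) j <= r k j \<and> r k j <= q (\<rho> k) j + 1"
   "!!k j. j < n ==> q (\<rho> k) j <= r' k j \<and> r' k j <= q (\<rho> k) j + 1"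
   "!!k. s (\<rho> k) (r k) i <= \<tau> i (comb (s (\<rho> k) (r k)))" "!!k. \<tau> i (comb (s (\<rho> k) (r' k))) <= s (\<rho> k) (r' k) i"
   using P unfolding P_def by blast+
  have l: "(%k. \<tau> i (comb (s (\<rho> k) (r k)))) ----> \<tau> i z" "(%k. \<tau> i (comb (s (\<rho> k) (r' k)))) ----> \<tau> i z"
   using continuous_on_tendsto_compose[OF tc near[OF r(1)]] continuous_on_tendsto_compose[OF tc near[OF r(2)]] by auto
  show ?thesis
  proof (rule real_tendsto_sandwich)
   show "(%k. \<tau> i (comb (s (\<rho> k) (r' k))) - 1 / real (Suc (\<rho> k))) ----> \<tau> i z" using tendsto_diff[OF l(2) inv] by simp
   show "(%k. \<tau> i (comb (s (\<rho> k) (r k)))) ----> \<tau> i z" by (rule l)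
   show "\<forall>\<^sub>F k in sequentially. s (\<rho> k) (q (\<rho> k)) i <= \<tau> i (comb (s (\<rho> k) (r k)))"
   proof (intro always_eventually allI)
    fix k
    have "s (\<rho> k) (q (\<rho> k)) i <= s (\<rho> k) (r k) i" using r(1)[OF i, of k] by (simp add: s_def divide_right_mono)
    then show "s (\<rho> k) (q (\<rho> k)) i <= \<tau> i (comb (s (\<rho> k) (r k)))" using r(3)[of k] by linarith
   qed
   show "\<forall>\<^sub>F k in sequentially. \<tau> i (comb (s (\<rho> k) (r' k))) - 1 / real (Suc (\<rho> k)) <= s (\<rho> k) (q (\<rho> k)) i"
   proof (intro always_eventually allI)
    fix k
    have "real (r' k i) <= real (q (\<rho> k) i) + 1" using r(2)[OF i, of k] by linarith
    then have "s (\<rho> k) (r' k) i <= s (\<rho> k) (q (\<rho> k)) i + 1 / real (Suc (\<rho> k))"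
     unfolding s_def add_divide_distrib[symmetric] by (rule divide_right_mono) simp
    then show "\<tau> i (comb (s (\<rho> k) (r' k))) - 1 / real (Suc (\<rho> k)) <= s (\<rho> k) (q (\<rho> k)) i" using r(4)[of k] by linarith
   qed
  qed
 qed
 have "(%k. comb (s (\<rho> k) (q (\<rho> k)))) ----> (\<Sum>i<n. \<tau> i z *\<^sub>R c i)"
  unfolding comb_def by (intro tendsto_sum tendsto_scaleR tendsto_const) (use lim in auto)
 \<comment> \<open>\<open>z\<close> is fixed by the projection of \<open>S\<close>, and the
   projection moves each \<open>S u\<close> by at most \<open>e\<close>.\<close>
 then have zz: "z = (\<Sum>i<n. \<tau> i z *\<^sub>R c i)" using z(2) LIMSEQ_unique unfolding X_def o_def by blast
 have "S z - z = (\<Sum>i<n. \<tau> i z *\<^sub>R (S z - c i))"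
  by (subst zz) (simp add: scaleR_diff_right sum_subtractf scaleR_sum_left[symmetric] t1)
 also have "norm ... <= (\<Sum>i<n. \<tau> i z * e)"
 proof (rule sum_norm_le)
  fix i
  show "norm (\<tau> i z *\<^sub>R (S z - c i)) <= \<tau> i z * e"
  proof (cases "norm (S z - c i) <= e")
   case True
   then show ?thesis using t0[of i z] by (simp add: mult_left_mono)
  next
   case False
   then have "\<tau> i z = 0" by (simp add: \<tau>_def \<beta>_def)
   then show ?thesis by simp
  qed
 qed
 also have "... = e" by (simp add: sum_distrib_right[symmetric] t1)
 finally show ?thesis by blast
qed

theorem schauder_fixed_point:
 fixes S :: "'a::real_normed_vector => 'a"
 assumes cont: "continuous_on UNIV S" and K: "compact K" "range S \<subseteq> K"
 shows "\<exists>z. S z = z"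
proof -
 have "\<forall>k. \<exists>z. norm (S z - z) <= inverse (real (Suc k))" using approximate_fixed_point[OF assms] by simp
 then obtain z where z: "!!k. norm (S (z k) - z k) <= inverse (real (Suc k))" by metis
 have "\<forall>k. S (z k) \<in> K" using K(2) by blast
 then obtain w \<rho> where w: "strict_mono (\<rho> :: nat => nat)" "(%k. S (z (\<rho> k))) ----> w"
  using K(1)[unfolded compact_def, rule_format, of "%k. S (z k)"] by (auto simp: o_def)
 have "(%k. S (z (\<rho> k)) - z (\<rho> k)) ----> 0"
  by (rule Lim_null_comparison[OF always_eventually LIMSEQ_subseq_LIMSEQ[OF LIMSEQ_inverse_real_of_nat w(1)]]) (simp add: z del: of_nat_Suc)
 from tendsto_diff[OF w(2) this] have "(%k. z (\<rho> k)) ----> w" by simp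
 from continuous_on_tendsto_compose[OF cont this] have "(%k. S (z (\<rho> k))) ----> S w" by simp
 with w(2) have "S w = w" by (rule LIMSEQ_unique[rotated])
 then show ?thesis ..
qed

section \<open>Compactness of the adjoint states\<close>

text \<open>The number \<open>a\<close> is the mean of \<open>v\<close> over \<open>D\<close>. The
  double integral of the squared increments is twice the measure of \<open>D\<close> times the
  integral of \<open>(v - a)^2\<close>, and \<open>poincare_double\<close> bounds it. The lower
  bound \<open>m0\<close> makes the constants uniform over all cells.\<close>

lemma cell_average:
 fixes v :: "real^'n::finite => real"
 assumes D: "convex D" "D \<in> sets borel" "bounded D" and W: "W Om v g"
  and b: "v \<in> borel_measurable borel" "g \<in> borel_measurable borel"
  and d: "!!x z. x \<in> D ==> z \<in> D ==> norm (z - x) <= d" "d \<ge> 0" and m0: "m0 > 0" "m0 <= measure lebesgue D"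
 shows "\<exists>a. (LEB x. indicator D x * (v x - a)^2) <= vol1 TYPE('n) * d ^ CARD('n) / m0 * d^2 * (LEB x. indicator D x * (norm (g x))^2) \<and>
  a^2 * m0 <= (LEB x. (v x)^2)"
proof -
 define m where "m = measure lebesgue D"
 have m: "m > 0" using m0 by (simp add: m_def)
 have Dl: "D \<in> lmeasurable" using D by (intro bounded_set_imp_lmeasurable) auto
 have Ds[measurable]: "D \<in> sets lebesgue" using D by simp
 note s1 = sq_integrable_indicator[OF Dl]
 note sv = W_sq[OF W]
 have mi: "indicator D \<in> LM" by simp
 have sDv: "sq (%x. indicator D x * v x)" by (rule sq_integrable_bounded_mult[OF sv mi, where C=1]) (auto simp: indicator_def)
 have sDg: "sq (%x. indicator D x * norm (g x))"
  by (rule sq_integrable_bounded_mult[OF sqv_norm[OF W_sqv[OF W]] mi, where C=1]) (auto simp: indicator_def)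
 have i0: "integrable lebesgue (indicator D :: _ => real)" "(LEB x. indicator D x) = m"
  using Dl by (auto simp: lmeasurable_iff_integrable m_def)
 have i1: "integrable lebesgue (%x. indicator D x * v x)" by (rule sq_integrable_mult[OF s1 sv])
 have sqD: "(indicator D x * t)^2 = indicator D x * t^2" for x and t :: real by (simp add: indicator_def)
 have i2: "integrable lebesgue (%x. indicator D x * (v x)^2)" and ig: "integrable lebesgue (%x. indicator D x * (norm (g x))^2)"
  using sDv sDg by (auto simp: sq_integrable_def sqD)
 define A where "A = (LEB x. indicator D x * (v x)^2)"
 define B where "B = (LEB x. indicator D x * v x)"
 define J where "J = (LEB x. indicator D x * (norm (g x))^2)"
 have J0: "J \<ge> 0" by (simp add: J_def)
 have q: "integrable lebesgue (%z. indicator D z * (v z - c)^2)" "(LEB z. indicator D z * (v z - c)^2) = A - 2 * c * B + m * c^2" for c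
 proof -
  have e: "(%z. indicator D z * (v z - c)^2) = (%z. indicator D z * (v z)^2 - 2 * c * (indicator D z * v z) + c^2 * indicator D z)"
   by (auto simp: power2_diff algebra_simps)
  show "integrable lebesgue (%z. indicator D z * (v z - c)^2)" unfolding e using i0(1) i1 i2 by auto
  show "(LEB z. indicator D z * (v z - c)^2) = A - 2 * c * B + m * c^2" unfolding e using i0 i1 i2 by (simp add: A_def B_def)
 qed
 define h where "h x = A - 2 * v x * B + m * (v x)^2" for x
 have h0: "h x \<ge> 0" for x unfolding h_def q(2)[symmetric] by simp
 have hi: "integrable lebesgue (%x. indicator D x * h x)" "(LEB x. indicator D x * h x) = 2 * (m * A - B^2)"
 proof -
  have e: "(%x. indicator D x * h x) = (%x. A * indicator D x - 2 * B * (indicator D x * v x) + m * (indicator D x * (v x)^2))"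
   by (auto simp: h_def algebra_simps)
  show "integrable lebesgue (%x. indicator D x * h x)" unfolding e using i0(1) i1 i2 by auto
  have "(LEB x. indicator D x * h x) = A * m - 2 * B * B + m * A" unfolding e using i0 i1 i2
   by (simp add: A_def[symmetric] B_def[symmetric])
  then show "(LEB x. indicator D x * h x) = 2 * (m * A - B^2)" by (simp add: power2_eq_square algebra_simps)
 qed
 have inner: "(\<integral>\<^sup>+z. indicator D x * indicator D z * ennreal (\<bar>v z - v x\<bar> ^ 2) \<partial>lborel) = ennreal (indicator D x * h x)" for x
 proof -
  have "(\<integral>\<^sup>+z. indicator D x * indicator D z * ennreal (\<bar>v z - v x\<bar> ^ 2) \<partial>lborel) = (\<integral>\<^sup>+z. ennreal (indicator D x * (indicator D z * (v z - v x)^2)) \<partial>lebesgue)"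
   unfolding nn_integral_lebesgue by (intro nn_integral_cong) (auto simp: indicator_def)
  also have "... = ennreal (LEB z. indicator D x * (indicator D z * (v z - v x)^2))"
   by (rule nn_integral_eq_integral) (use q(1) in auto)
  finally show ?thesis by (simp add: q(2) h_def)
 qed
 have cb: "emeasure lborel (cball (0::real^'n) d) = ennreal (vol1 TYPE('n) * d ^ CARD('n))"
 proof -
  have "emeasure lborel (cball (0::real^'n) d) = ennreal (measure lborel (cball (0::real^'n) d))"
   using emeasure_lborel_cball_finite by (intro emeasure_eq_ennreal_measure) (auto simp: less_top)
  also have "measure lborel (cball (0::real^'n) d) = vol1 TYPE('n) * d ^ CARD('n)"
   using content_cball_conv_ball[of "0::real^'n" d] ball_measure[of d "0::real^'n"] d(2) by simp
  finally show ?thesis .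
 qed
 have Jn: "(\<integral>\<^sup>+x. indicator D x * ennreal (norm (g x) ^ 2) \<partial>lborel) = ennreal J"
 proof -
  have "(\<integral>\<^sup>+x. indicator D x * ennreal (norm (g x) ^ 2) \<partial>lborel) = (\<integral>\<^sup>+x. ennreal (indicator D x * (norm (g x))^2) \<partial>lebesgue)"
   unfolding nn_integral_lebesgue by (intro nn_integral_cong) (auto simp: indicator_def)
  also have "... = ennreal J" unfolding J_def by (rule nn_integral_eq_integral[OF ig]) auto
  finally show ?thesis .
 qed
 have "ennreal (2 * (m * A - B^2)) = (\<integral>\<^sup>+x. ennreal (indicator D x * h x) \<partial>lebesgue)"
  unfolding hi(2)[symmetric] by (rule nn_integral_eq_integral[symmetric, OF hi(1)]) (simp add: h0)
 also have "... <= ennreal (vol1 TYPE('n) * d ^ CARD('n)) * (ennreal (d ^ 2) * ennreal J)"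
  unfolding nn_integral_lebesgue inner[symmetric] cb[symmetric] Jn[symmetric]
  by (rule poincare_double[OF D(1,2) W b]) (use d in auto)
 also have "... = ennreal (vol1 TYPE('n) * d ^ CARD('n) * d^2 * J)"
  using d(2) J0 vol1_pos[where 'n='n] by (simp add: ennreal_mult[symmetric] mult_ac)
 finally have le: "2 * (m * A - B^2) <= vol1 TYPE('n) * d ^ CARD('n) * d^2 * J"
  using d(2) J0 vol1_pos[where 'n='n] by (subst (asm) ennreal_le_iff) auto
 define a where "a = B / m"
 have e1: "(LEB x. indicator D x * (v x - a)^2) = (m * A - B^2) / m"
  unfolding q(2) a_def using m by (simp add: field_simps power2_eq_square)
 have r0: "m * A - B^2 \<ge> 0"
 proof -
  have "0 <= (LEB x. indicator D x * (v x - a)^2)" by simp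
  then show ?thesis unfolding e1 using m by (simp add: zero_le_divide_iff)
 qed
 have "(m * A - B^2) / m <= (vol1 TYPE('n) * d ^ CARD('n) * d^2 * J) / m0"
  using r0 le m0 by (intro frac_le) (auto simp: m_def)
 then have 1: "(LEB x. indicator D x * (v x - a)^2) <= vol1 TYPE('n) * d ^ CARD('n) / m0 * d^2 * J" unfolding e1 by (simp add: mult_ac)
 have "a^2 * m0 <= a^2 * m" using m0 by (intro mult_left_mono) (auto simp: m_def)
 also have "... <= A" using r0 m by (simp add: a_def field_simps power2_eq_square)
 also have "A <= (LEB x. (v x)^2)"
  unfolding A_def by (rule integral_mono[OF i2]) (use sv in \<open>auto simp: sq_integrable_def indicator_def\<close>)
 finally show ?thesis using 1 unfolding J_def by blast
qed

lemma abs_L2_sum: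
 fixes N :: nat
 assumes "!!i. sq (h i)"
 shows "abs_L2 (%x. \<Sum>i<N. a i * h i x) = (\<Sum>i<N. a i *\<^sub>R abs_L2 (h i))"
proof (induction N)
 case (Suc N)
 have s: "sq (%x. \<Sum>i<N. a i * h i x)" by (intro sq_integrable_sum sq_integrable_scale assms)
 show ?case using plus_abs_L2[OF s sq_integrable_scale[OF assms], of "a N" N]
  by (simp add: Suc scaleR_abs_L2[OF assms])
qed (simp add: zero_L2_def)

text \<open>Functions bounded in \<open>H\<^sup>1\<^sub>0\<close> are approximated by their averages over the cells of a fine grid,
 and these averages range over a compact subset of a finite-dimensional space.\<close>

theorem rellich:
 fixes Om :: "(real^'n::finite) set"
 assumes dom: "open Om" "bounded Om"
 shows "compact (closure {abs_L2 v |v g. W Om v g \<and> (LEB x. (norm (g x))^2) <= G})"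
proof -
 let ?R = "{abs_L2 v |v g. W Om v g \<and> (LEB x. (norm (g x))^2) <= G}"
 obtain CP where CP: "CP > 0" "!!v g. W Om v g ==> (LEB x. (v x)^2) <= CP * (LEB x. (norm (g x))^2)"
  by (rule poincare[OF dom]) (assumption | rule that | blast)+
 obtain r where r: "!!x. x \<in> Om ==> norm x <= r" using dom(2) bounded_iff by blast
 have key: "\<exists>k. finite k \<and> ?R \<subseteq> (\<Union>c\<in>k. ball c e)" if e: "e > 0" for e
 proof -
  define n where "n = real CARD('n)"
  have n1: "n \<ge> 1" by (simp add: n_def)
  \<comment> \<open>The constant that multiplies \<open>s^2\<close> in the final error, enlarged by
    1 to be positive; \<open>s\<close> is then chosen to make the error
    \<open>e / 2\<close>.\<close>
  define \<kappa> where "\<kappa> = (2 * n) ^ CARD('n) * n^2 * \<bar>G\<bar> + 1"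
  have k: "\<kappa> > 0" using n1 by (simp add: \<kappa>_def add_nonneg_pos)
  define s where "s = e / (2 * sqrt \<kappa>)"
  have s: "s > 0" using e k by (simp add: s_def)
  \<comment> \<open>The grid cell of side \<open>s\<close> that contains \<open>x\<close>, described
    by its integer corner; bounded \<open>Om\<close> meets finitely many cells.\<close>
  define cell where "cell x = (%i. \<lfloor>x $ i / s\<rfloor>)" for x :: "real^'n"
  have celli: "cell x = z \<longleftrightarrow> (\<forall>i. of_int (z i) * s <= x $ i \<and> x $ i < (of_int (z i) + 1) * s)" for x z
   using s by (auto simp: cell_def fun_eq_iff floor_eq_iff pos_le_divide_eq pos_divide_less_eq)
  have "cell ` Om \<subseteq> PiE UNIV (%_. {\<lfloor>-(r / s)\<rfloor>..\<lfloor>r / s\<rfloor>})"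
  proof (clarsimp simp: cell_def PiE_UNIV_domain)
   fix x i assume "x \<in> Om"
   then have "\<bar>x $ i\<bar> <= r" using r component_le_norm_cart[of x i] by (meson order_trans)
   then have "-(r / s) <= x $ i / s \<and> x $ i / s <= r / s"
    using s divide_right_mono[of "- r" "x $ i" s] divide_right_mono[of "x $ i" r s] by (auto simp: abs_le_iff)
   then show "\<lfloor>-(r / s)\<rfloor> <= \<lfloor>x $ i / s\<rfloor> \<and> \<lfloor>x $ i / s\<rfloor> <= \<lfloor>r / s\<rfloor>" by (auto intro: floor_mono)
  qed
  then have "finite (cell ` Om)" by (rule finite_subset) (intro finite_PiE, auto)
  from finite_imp_nat_seg_image_inj_on[OF this]
  obtain N :: nat and f where f: "cell ` Om = f ` {i. i < N}" "inj_on f {i. i < N}" by (elim exE conjE) (rule that)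
  define D where "D i = {x. cell x = f i}" for i
  have Dc: "convex (D i)" for i
  proof -
   have "D i = (\<Inter>j. (%x. x $ j) -` {of_int (f i j) * s..<(of_int (f i j) + 1) * s})" by (auto simp: D_def celli)
   then show ?thesis by (simp only:) (intro convex_INT convex_linear_vimage bounded_linear.linear[OF bounded_linear_vec_nth] convex_real_interval)
  qed
  have Db: "D i \<in> sets borel" for i
  proof -
   have "D i = {x \<in> space borel. \<forall>j. of_int (f i j) * s <= x $ j \<and> x $ j < (of_int (f i j) + 1) * s}" by (auto simp: D_def celli)
   then show ?thesis by (simp only:) measurable
  qed
  have Dd: "norm (z - x) <= n * s" if "x \<in> D i" "z \<in> D i" for x z i
  proof -
   have "norm (z - x) <= (\<Sum>j\<in>UNIV. \<bar>(z - x) $ j\<bar>)" by (rule norm_le_l1_cart)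
   also have "... <= (\<Sum>j\<in>(UNIV::'n set). s)"
    using that by (intro sum_mono) (auto simp: D_def celli abs_le_iff distrib_right; smt (verit))
   finally show ?thesis by (simp add: n_def)
  qed
  have Dbd: "bounded (D i)" for i
   unfolding bounded_def dist_norm using Dd norm_minus_commute by metis
  \<comment> \<open>The volume of a ball inscribed in a cell. Comparing it with the ball of radius
    \<open>n * s\<close>, which contains all differences of points of a cell, produces the factor
    \<open>(2 * n) ^ CARD('n)\<close>.\<close>
  define m0 where "m0 = vol1 TYPE('n) * (s / 2) ^ CARD('n)"
  have m0: "m0 > 0" using s vol1_pos[where 'n='n] by (simp add: m0_def)
  have mD: "m0 <= measure lebesgue (D i)" for i
  proof -
   define c :: "real^'n" where "c = (\<chi> j. (of_int (f i j) + 1 / 2) * s)"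
   have "ball c (s / 2) \<subseteq> D i"
   proof
    fix x assume "x \<in> ball c (s / 2)"
    then have "\<bar>c $ j - x $ j\<bar> < s / 2" for j using component_le_norm_cart[of "c - x" j] by (simp add: dist_norm)
    then show "x \<in> D i" unfolding D_def celli by (simp add: c_def abs_less_iff distrib_right) (smt (verit) field_sum_of_halves)
   qed
   then have "measure lebesgue (ball c (s / 2)) <= measure lebesgue (D i)"
    using Db Dbd by (intro measure_mono_fmeasurable bounded_set_imp_lmeasurable) auto
   then show ?thesis using ball_measure[of "s / 2" c] s by (simp only: m0_def)
  qed
  have Dl: "D i \<in> lmeasurable" for i using Db Dbd by (intro bounded_set_imp_lmeasurable) auto
  define c where "c i = abs_L2 (indicator (D i) :: _ => real)" for i
  \<comment> \<open>By \<open>cell_average\<close> and the Poincare inequality all averages have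
    absolute value at most \<open>T\<close>, so that the approximating step functions form a compact
    set.\<close>
  define T where "T = sqrt (CP * \<bar>G\<bar> / m0)"
  define C where "C = {\<Sum>i<N. x i *\<^sub>R c i |x. \<forall>i<N. x i \<in> {- T..T}}"
  obtain k where kk: "finite k" "C \<subseteq> (\<Union>c\<in>k. ball c (e / 2))"
   using compact_combinations[where n=N and c=c and a="- T" and b=T] half_gt_zero[OF e]
   unfolding compact_eq_totally_bounded C_def[symmetric] by blast
  have "\<exists>u\<in>C. norm (abs_L2 v - u) <= e / 2" if Wv: "W Om v g" and gG: "(LEB x. (norm (g x))^2) <= G" for v g
  proof -
   obtain v' g' where b: "v' \<in> borel_measurable borel" "g' \<in> borel_measurable borel"
    and eq: "AEL x. v x = v' x" "AEL x. g x = g' x" and W': "W Om v' g'" by (rule W_borel[OF Wv])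
   have ns: "n * s \<ge> 0" using n1 s by simp
   define Q where "Q i a \<longleftrightarrow> (LEB x. indicator (D i) x * (v' x - a)^2) <= vol1 TYPE('n) * (n * s) ^ CARD('n) / m0 * (n * s)^2 * (LEB x. indicator (D i) x * (norm (g' x))^2) \<and>
    a^2 * m0 <= (LEB x. (v' x)^2)" for i a
   have "\<forall>i. \<exists>a. Q i a" unfolding Q_def by (rule allI, rule cell_average[OF Dc Db Dbd W' b _ ns m0 mD], rule Dd)
   then obtain a where Q: "!!i. Q i (a i)" by metis
   note a = Q[unfolded Q_def, THEN conjunct1] Q[unfolded Q_def, THEN conjunct2]
   have gg: "(LEB x. (norm (g' x))^2) <= G"
   proof -
    have "(LEB x. (norm (g' x))^2) = (LEB x. (norm (g x))^2)"
     using sqv_measurable[OF W_sqv[OF W']] sqv_measurable[OF W_sqv[OF Wv]]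
     by (intro integral_cong_AE) (use eq(2) in \<open>auto elim: eventually_mono\<close>)
    then show ?thesis using gG by simp
   qed
   have G0: "\<bar>G\<bar> = G" using gg order_trans[OF integral_nonneg_AE gg] by simp
   have aT: "a i \<in> {- T..T}" for i
   proof -
    have "(a i)^2 * m0 <= CP * G" using a(2)[of i] CP(2)[OF W'] mult_left_mono[OF gg, of CP] CP(1) by linarith
    then have "(a i)^2 <= CP * \<bar>G\<bar> / m0" using m0 by (simp add: pos_le_divide_eq G0)
    then have "\<bar>a i\<bar> <= T" unfolding T_def by (metis real_sqrt_abs real_sqrt_le_mono)
    then show ?thesis by auto
   qed
   have si: "sq (indicator (D i) :: _ => real)" for i by (rule sq_integrable_indicator[OF Dl])
   define u where "u x = (\<Sum>i<N. a i * indicator (D i) x)" for x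
   have su: "sq u" unfolding u_def by (intro sq_integrable_sum sq_integrable_scale si)
   have uC: "abs_L2 u \<in> C" unfolding u_def abs_L2_sum[OF si] C_def c_def using aT by blast
   have mi: "integrable lebesgue (%x. indicator (D i) x * (v' x - a i)^2)" "integrable lebesgue (%x. indicator (D i) x * (norm (g' x))^2)" for i
   proof -
    have [measurable]: "D i \<in> sets lebesgue" using Db by simp
    have "(%x. indicator (D i) x * (v' x - a i)^2) = (%x. indicator (D i) x * (v' x)^2 - 2 * a i * (indicator (D i) x * v' x) + (a i)^2 * indicator (D i) x)"
     by (auto simp: power2_diff algebra_simps)
    moreover have j: "integrable lebesgue (%x. indicator (D i) x * h x)" if "integrable lebesgue h" for h :: "_ => real"
     using integrable_mult_indicator[OF \<open>D i \<in> sets lebesgue\<close> that] by simp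
    ultimately show "integrable lebesgue (%x. indicator (D i) x * (v' x - a i)^2)"
     using W_sq[OF W'] sq_integrable_mult[OF si W_sq[OF W']] Dl[of i] by (simp add: sq_integrable_def lmeasurable_iff_integrable)
    show "integrable lebesgue (%x. indicator (D i) x * (norm (g' x))^2)" using j sqv_norm[OF W_sqv[OF W']] by (simp add: sq_integrable_def)
   qed
   \<comment> \<open>The cells are pairwise disjoint, so at a point of a cell meeting
     \<open>Om\<close> exactly one summand survives; elsewhere \<open>v'\<close> is 0 almost
     everywhere.\<close>
   have ind: "\<exists>j<N. \<forall>i<N. indicator (D i) x = (if i = j then 1 else (0::real))" if x: "cell x \<in> cell ` Om" for x
   proof -
    obtain j where j: "j < N" "cell x = f j" using x f(1) by auto
    then have "indicator (D i) x = (if i = j then 1 else (0::real))" if "i < N" for i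
     using f(2) that by (auto simp: D_def indicator_def inj_on_def)
    with j(1) show ?thesis by blast
   qed
   have "(norm (abs_L2 v' - abs_L2 u))^2 = (LEB x. (v' x - u x)^2)" by (rule norm_diff_abs_L2[OF W_sq[OF W'] su])
   also have "... = (LEB x. (\<Sum>i<N. indicator (D i) x * (v' x - a i)^2))"
   proof (rule integral_cong_AE)
    show "AEL x. (v' x - u x)^2 = (\<Sum>i<N. indicator (D i) x * (v' x - a i)^2)"
     using W_outside(1)[OF W']
    proof eventually_elim
     case (elim x)
     show ?case
     proof (cases "cell x \<in> cell ` Om")
      case True
      then obtain j where j: "j < N" "!!i. i < N ==> indicator (D i) x = (if i = j then 1 else (0::real))" using ind by blast
      have "u x = (\<Sum>i<N. if i = j then a i else 0)" unfolding u_def by (intro sum.cong) (auto simp: j(2))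
      moreover have "(\<Sum>i<N. indicator (D i) x * (v' x - a i)^2) = (\<Sum>i<N. if i = j then (v' x - a i)^2 else 0)"
       by (intro sum.cong) (auto simp: j(2))
      ultimately show ?thesis using j(1) by simp
     next
      case False
      then have "indicator (D i) x = (0::real)" if "i < N" for i using f(1) that by (auto simp: D_def indicator_def)
      moreover have "v' x = 0" using elim False by blast
      ultimately show ?thesis by (simp add: u_def)
     qed
    qed
    show "(%x. (v' x - u x)^2) \<in> LM" using sq_integrable_diff[OF W_sq[OF W'] su] unfolding sq_integrable_def by (blast intro: borel_measurable_integrable)
   qed (intro borel_measurable_sum borel_measurable_integrable mi(1))
   also have "... = (\<Sum>i<N. LEB x. indicator (D i) x * (v' x - a i)^2)" by (rule Bochner_Integration.integral_sum) (rule mi)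
   also have "... <= (\<Sum>i<N. (2 * n) ^ CARD('n) * (n * s)^2 * (LEB x. indicator (D i) x * (norm (g' x))^2))"
   proof (rule sum_mono)
    fix i
    have "vol1 TYPE('n) * (n * s) ^ CARD('n) / m0 = (2 * n) ^ CARD('n)"
     using s vol1_pos[where 'n='n] by (simp add: m0_def power_mult_distrib power_divide)
    then show "(LEB x. indicator (D i) x * (v' x - a i)^2) <= (2 * n) ^ CARD('n) * (n * s)^2 * (LEB x. indicator (D i) x * (norm (g' x))^2)"
     using a(1)[of i] by simp
   qed
   also have "... = (2 * n) ^ CARD('n) * (n * s)^2 * (LEB x. (\<Sum>i<N. indicator (D i) x * (norm (g' x))^2))"
    by (simp only: Bochner_Integration.integral_sum[OF mi(2)] sum_distrib_left)
   also have "... <= (2 * n) ^ CARD('n) * (n * s)^2 * G"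
   proof (rule mult_left_mono)
    have "(LEB x. (\<Sum>i<N. indicator (D i) x * (norm (g' x))^2)) <= (LEB x. (norm (g' x))^2)"
    proof (rule integral_mono)
     fix x
     show "(\<Sum>i<N. indicator (D i) x * (norm (g' x))^2) <= (norm (g' x))^2"
     proof (cases "cell x \<in> cell ` Om")
      case True
      then obtain j where j: "j < N" "!!i. i < N ==> indicator (D i) x = (if i = j then 1 else (0::real))" using ind by blast
      have "(\<Sum>i<N. indicator (D i) x * (norm (g' x))^2) = (\<Sum>i<N. if i = j then (norm (g' x))^2 else 0)"
       by (intro sum.cong) (auto simp: j(2))
      also have "... = (norm (g' x))^2" using j(1) by simp
      finally show ?thesis by (rule eq_refl)
     next
      case False
      then have "indicator (D i) x = (0::real)" if "i < N" for i using f(1) that by (auto simp: D_def indicator_def)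
      then show ?thesis by simp
     qed
     show "integrable lebesgue (%x. (norm (g' x))^2)" using sqv_norm[OF W_sqv[OF W']] by (simp add: sq_integrable_def)
    qed (intro Bochner_Integration.integrable_sum mi(2))
    then show "(LEB x. (\<Sum>i<N. indicator (D i) x * (norm (g' x))^2)) <= G" using gg by linarith
   qed (use n1 in simp)
   also have "... <= (e / 2)^2"
   proof -
    have "(2 * n) ^ CARD('n) * (n * s)^2 * G = ((2 * n) ^ CARD('n) * n^2 * \<bar>G\<bar>) * s^2" by (simp add: power_mult_distrib G0)
    also have "... <= \<kappa> * s^2" by (intro mult_right_mono) (auto simp: \<kappa>_def)
    also have "... = (e / 2)^2" using k by (simp add: s_def power_divide power_mult_distrib)
    finally show ?thesis .
   qed
   finally have "norm (abs_L2 v' - abs_L2 u) <= e / 2" by (rule power2_le_imp_le) (use e in simp)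
   moreover have "abs_L2 v = abs_L2 v'" by (rule abs_L2_eqI[OF W_sq[OF Wv] W_sq[OF W'] eq(1)])
   ultimately show ?thesis using uC by auto
  qed
  note approx = this
  have cover: "\<exists>c\<in>k. abs_L2 v \<in> ball c e" if t: "W Om v g" "(LEB x. (norm (g x))^2) <= G" for v g
  proof -
   obtain u where u: "u \<in> C" "norm (abs_L2 v - u) <= e / 2" using approx[OF t] by blast
   obtain c where c: "c \<in> k" "dist c u < e / 2" using kk(2) u(1) by auto
   have "dist c (abs_L2 v) < e" using dist_triangle[of c "abs_L2 v" u] u(2) c(2) by (simp add: dist_norm norm_minus_commute)
   then show ?thesis using c(1) by auto
  qed
  have "?R \<subseteq> (\<Union>c\<in>k. ball c e)"
  proof
   fix w assume "w \<in> ?R"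
   then obtain v g where "w = abs_L2 v" "W Om v g" "(LEB x. (norm (g x))^2) <= G" by (elim CollectE exE conjE) (rule that)
   then show "w \<in> (\<Union>c\<in>k. ball c e)" using cover[of v g] by (simp only: UN_iff)
  qed
  then show ?thesis using kk(1) by (intro exI conjI)
 qed
 show ?thesis
  unfolding compact_eq_totally_bounded
 proof (intro conjI allI impI)
  show "complete (closure ?R)" by (simp add: complete_eq_closed)
  fix e :: real assume e: "e > 0"
  obtain k where k: "finite k" "?R \<subseteq> (\<Union>c\<in>k. ball c (e / 2))" using key[of "e / 2"] e by auto
  have "?R \<subseteq> (\<Union>c\<in>k. cball c (e / 2))" using k(2) ball_subset_cball by blast
  then have "closure ?R \<subseteq> (\<Union>c\<in>k. cball c (e / 2))" by (rule closure_minimal) (intro closed_UN k(1) ballI closed_cball)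
  also have "... \<subseteq> (\<Union>c\<in>k. ball c e)" using e by (intro UN_mono) auto
  finally show "\<exists>k. finite k \<and> closure ?R \<subseteq> (\<Union>x\<in>k. ball x e)" using k(1) by blast
 qed
qed

section \<open>Equilibria\<close>

text \<open>Products of nets for the factors form a net; the radius \<open>e'\<close> allows for
  adding up the distances over all coordinates.\<close>

lemma compact_vec_box:
 fixes K :: "'m::finite => 'a::{real_normed_vector,complete_space} set"
 assumes "!!k. compact (K k)"
 shows "compact {q. \<forall>k. q $ k \<in> K k}"
 unfolding compact_eq_totally_bounded
proof (intro conjI allI impI)
 have "{q. \<forall>k. q $ k \<in> K k} = (\<Inter>k. (%q. q $ k) -` K k)" by auto
 then show "complete {q. \<forall>k. q $ k \<in> K k}"
  by (simp only: complete_eq_closed)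
   (intro closed_INT ballI closed_vimage compact_imp_closed assms continuous_on_component continuous_on_id)
 fix e :: real assume e: "e > 0"
 define e' where "e' = e / (real CARD('m) + 1)"
 have e': "e' > 0" using e by (simp add: e'_def add_nonneg_pos)
 have "\<forall>k. \<exists>N. finite N \<and> K k \<subseteq> (\<Union>x\<in>N. ball x e')" using assms e' unfolding compact_eq_totally_bounded by blast
 then obtain N where N: "!!k. finite (N k)" "!!k. K k \<subseteq> (\<Union>x\<in>N k. ball x e')" by metis
 let ?F = "(%n. \<chi> k. n k) ` PiE UNIV N"
 have "finite ?F" using N(1) by (intro finite_imageI finite_PiE) auto
 moreover have "{q. \<forall>k. q $ k \<in> K k} \<subseteq> (\<Union>x\<in>?F. ball x e)"
 proof
  fix q assume q: "q \<in> {q. \<forall>k. q $ k \<in> K k}"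
  then have "\<forall>k. \<exists>x\<in>N k. dist x (q $ k) < e'" using N(2) by fastforce
  then obtain n where n: "!!k. n k \<in> N k" "!!k. dist (n k) (q $ k) < e'" by metis
  have "dist (\<chi> k. n k) q <= (\<Sum>k\<in>UNIV. dist (n k) (q $ k))"
   unfolding dist_norm norm_vec_def by (rule order_trans[OF L2_set_le_sum]) auto
  also have "... <= (\<Sum>k\<in>(UNIV::'m set). e')" using n(2) by (intro sum_mono less_imp_le)
  also have "... < e" using e by (simp add: e'_def field_simps)
  finally show "q \<in> (\<Union>x\<in>?F. ball x e)" using n(1) by (auto simp: PiE_UNIV_domain)
 qed
 ultimately show "\<exists>F. finite F \<and> {q. \<forall>k. q $ k \<in> K k} \<subseteq> (\<Union>x\<in>F. ball x e)" by blast
qed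

text \<open>The fixed point is that of the map sending \<open>q\<close> to \<open>P (u q)\<close>, where the components of \<open>u q\<close> solve
 the variational inequalities for the operators \<open>T k\<close> shifted by \<open>q $ k\<close>.\<close>

theorem compact_perturbation_equilibrium:
 fixes K :: "'m::finite => 'a::{real_inner,complete_space} set" and P :: "'m => 'a ^ 'm => 'a"
 assumes K: "!!k. closed (K k)" "!!k. convex (K k)" "!!k. K k \<noteq> {}"
  and T: "!!k. bounded_linear (T k)" "!!k. \<mu> k > 0"
   "!!k u v. u \<in> K k ==> v \<in> K k ==> \<mu> k * (norm (u - v))^2 <= T k (u - v) \<bullet> (u - v)"
  and P: "!!k. continuous_on UNIV (P k)" and C: "!!k. compact (C k)" "!!k u. (!!i. u $ i \<in> K i) ==> P k u \<in> C k"
 shows "\<exists>u. \<forall>k. u $ k \<in> K k \<and> (\<forall>z\<in>K k. 0 <= (T k (u $ k) + P k u) \<bullet> (z - u $ k))"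
proof -
 note Td = linear_diff[OF bounded_linear.linear[OF T(1)]]
 have "\<exists>u\<in>K k. \<forall>z\<in>K k. 0 <= (T k u + q) \<bullet> (z - u)" for k q
 proof -
  obtain B where B: "!!x. norm (T k x) <= norm x * B" using bounded_linear.bounded[OF T(1)] by blast
  show ?thesis
   by (rule variational_inequality_strongly_monotone[OF K T(2)[of k], where C=B])
    (use T(3) B in \<open>auto simp: Td[symmetric] mult.commute\<close>)
 qed
 then obtain s where s: "!!k q. s k q \<in> K k" "!!k q z. z \<in> K k ==> 0 <= (T k (s k q) + q) \<bullet> (z - s k q)" by metis
 \<comment> \<open>Each inequality is tested with the solution of the other one; strong monotonicity
   applied to the sum gives the Lipschitz constant.\<close>
 have lip: "norm (s k q - s k q') <= 1 / \<mu> k * norm (q - q')" for k q q'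
 proof -
  let ?d = "s k q - s k q'"
  have "0 <= (T k (s k q) + q) \<bullet> (s k q' - s k q)" "0 <= (T k (s k q') + q') \<bullet> (s k q - s k q')" by (intro s)+
  then have "T k ?d \<bullet> ?d <= (q' - q) \<bullet> ?d" by (simp add: Td inner_diff_left inner_diff_right inner_add_left)
  also have "... <= norm (q - q') * norm ?d" using norm_cauchy_schwarz[of "q' - q" ?d] by (simp add: norm_minus_commute)
  finally have "(\<mu> k * norm ?d) * norm ?d <= norm (q - q') * norm ?d"
   using T(3)[OF s(1) s(1), of k q q'] by (simp add: power2_eq_square mult.assoc)
  then have "\<mu> k * norm ?d <= norm (q - q')" by (cases "norm ?d = 0") (auto simp: mult_le_cancel_right)
  then show ?thesis using T(2)[of k] by (simp add: field_simps)
 qed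
 have sc: "continuous_on UNIV (s k)" for k
  by (rule lipschitz_on_continuous_on[of "1 / \<mu> k"]) (use lip T(2)[of k] in \<open>auto intro!: lipschitz_onI simp: dist_norm\<close>)
 define S where "S q = (\<chi> k. P k (\<chi> i. s i (q $ i)))" for q
 have "continuous_on UNIV S"
  unfolding S_def
  by (intro continuous_on_vec_lambda continuous_on_compose2[OF P] continuous_on_compose2[OF sc] continuous_on_component continuous_on_id subset_UNIV)
 moreover have "range S \<subseteq> {q. \<forall>k. q $ k \<in> C k}" by (auto simp: S_def intro!: C(2) s(1))
 ultimately have "\<exists>q. S q = q" by (rule schauder_fixed_point[OF _ compact_vec_box[OF C(1)]])
 then obtain q where q: "S q = q" ..
 define u where "u = (\<chi> i. s i (q $ i))"
 have "P k u = q $ k" for k using arg_cong[OF q, of "%v. v $ k"] by (simp add: S_def u_def)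
 then have "u $ k \<in> K k \<and> (\<forall>z\<in>K k. 0 <= (T k (u $ k) + P k u) \<bullet> (z - u $ k))" for k
  using s[where k=k] by (simp add: u_def)
 then show ?thesis by blast
qed

section \<open>Versions of the data that satisfy their hypotheses everywhere\<close>

lemma AE_measurable_cong:
 fixes f g :: "real^'n::finite => real"
 assumes "AEL x. f x = g x" "g \<in> LM"
 shows "f \<in> LM"
proof (rule measurableI)
 fix A :: "real set" assume A: "A \<in> sets borel"
 have "AEL x. x \<in> g -` A \<inter> space lebesgue \<longleftrightarrow> x \<in> f -` A \<inter> space lebesgue"
  using assms(1) by eventually_elim auto
 then show "f -` A \<inter> space lebesgue \<in> sets lebesgue"
  by (rule completion.in_sets_AE[OF _ measurable_sets[OF assms(2) A]]) simp
qed simp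

lemma integral_on_eq:
 fixes f g :: "real^'n::finite => real"
 assumes "Om \<in> sets lebesgue" "g \<in> LM"
  and "AEL x. x \<in> Om --> f x = g x" "AEL x. x \<notin> Om --> g x = 0"
 shows "(LINT x|lebesgue_on Om. f x) = (LEB x. g x)"
proof -
 have "AEL x. ext Om f x = g x" using assms(3,4) by eventually_elim (auto simp: ext_def)
 from integral_cong_AE[OF AE_measurable_cong[OF this assms(2)] assms(2) this]
 show ?thesis by (simp only: ext_integral[OF assms(1)])
qed

lemma Linf_version:
 fixes g :: "real^'n::finite => real"
 assumes "Om \<in> sets lebesgue" "Linf_on Om g"
 obtains g' C where "g' \<in> LM" "C \<ge> 0" "!!x. \<bar>g' x\<bar> <= C" "!!x. x \<notin> Om ==> g' x = 0"
  "AEL x. x \<in> Om --> g' x = g x"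
proof -
 obtain C where C: "AEL x. x \<in> Om --> \<bar>g x\<bar> <= C" using assms by (auto simp: Linf_on_def AE_on)
 define g' where "g' x = max (- \<bar>C\<bar>) (min \<bar>C\<bar> (ext Om g x))" for x
 have "ext Om g \<in> LM" using assms by (simp add: ext_measurable Linf_on_def)
 then have "g' \<in> LM" unfolding g'_def by measurable
 moreover have "AEL x. x \<in> Om --> g' x = g x" using C by eventually_elim (auto simp: g'_def ext_def)
 moreover have "\<bar>g' x\<bar> <= \<bar>C\<bar>" "x \<notin> Om ==> g' x = 0" for x by (auto simp: g'_def ext_def)
 ultimately show thesis using that[of g' "\<bar>C\<bar>"] by simp
qed

lemma elliptic_version:
 fixes Om :: "(real^'n::finite) set"
 assumes dom: "open Om" "bounded Om" and a: "uniformly_elliptic Om a"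
 shows "\<exists>b lam Lam. elliptic Om b lam Lam \<and> (AEL x. x \<in> Om --> (\<forall>i j. b i j x = a i j x))"
proof -
 have Om: "Om \<in> sets lebesgue" using dom by simp
 obtain \<mu> where mu: "\<mu> > 0" "AEL x. x \<in> Om --> (\<forall>\<xi>. \<mu> * (norm \<xi>)^2 <= (\<Sum>i\<in>UNIV. \<Sum>j\<in>UNIV. a i j x * \<xi> $ i * \<xi> $ j))"
  using a Om by (auto simp: uniformly_elliptic_def AE_on)
 have "\<forall>i j. \<exists>C. AEL x. x \<in> Om --> \<bar>a i j x\<bar> <= C" using a Om by (auto simp: uniformly_elliptic_def Linf_on_def AE_on)
 then obtain C where C: "!!i j. AEL x. x \<in> Om --> \<bar>a i j x\<bar> <= C i j" by metis
 have C': "AEL x. \<forall>i j. x \<in> Om --> \<bar>a i j x\<bar> <= C i j" unfolding AE_all_countable using C by blast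
 define G where "G = {x \<in> Om. (\<forall>i j. \<bar>a i j x\<bar> <= C i j) \<and> (\<forall>\<xi>. \<mu> * (norm \<xi>)^2 <= (\<Sum>i\<in>UNIV. \<Sum>j\<in>UNIV. a i j x * \<xi> $ i * \<xi> $ j))}"
 have G: "AEL x. x \<in> Om --> x \<in> G" using mu(2) C' by eventually_elim (auto simp: G_def)
 \<comment> \<open>Off the good set \<open>G\<close> the coefficients become \<mu> times the
   identity matrix, which preserves ellipticity; this is why \<open>Lam\<close> contains the summand
   \<mu>.\<close>
 define b where "b i j x = (if x \<in> G then a i j x else if i = j then \<mu> else 0)" for i j x
 define Lam where "Lam = \<mu> + (\<Sum>i\<in>UNIV. \<Sum>j\<in>UNIV. \<bar>C i j\<bar>)"
 have CL: "\<bar>C i j\<bar> <= Lam" for i j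
 proof -
  have "\<bar>C i j\<bar> <= (\<Sum>j\<in>UNIV. \<bar>C i j\<bar>)" by (rule member_le_sum) auto
  also have "... <= (\<Sum>i\<in>UNIV. \<Sum>j\<in>UNIV. \<bar>C i j\<bar>)" by (rule member_le_sum[where f="%i. \<Sum>j\<in>UNIV. \<bar>C i j\<bar>"]) (auto intro: sum_nonneg)
  finally show ?thesis using mu(1) by (simp add: Lam_def)
 qed
 have "elliptic Om b \<mu> Lam"
 proof
  fix i j x and \<xi> :: "real^'n"
  have "AEL x. b i j x = (if x \<in> Om then a i j x else if i = j then \<mu> else 0)"
   using G by eventually_elim (auto simp: b_def G_def)
  moreover have "(%x. ext Om (a i j) x + (if i = j then \<mu> else 0) * indicator (- Om) x) \<in> LM"
  proof -
   have [measurable]: "ext Om (a i j) \<in> LM" "- Om \<in> sets lebesgue"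
    using a Om dom by (auto simp: uniformly_elliptic_def Linf_on_def ext_measurable)
   show ?thesis by measurable
  qed
  then have "(%x. if x \<in> Om then a i j x else if i = j then \<mu> else 0) \<in> LM"
   by (rule back_subst[where P="%f. f \<in> LM"]) (auto simp: ext_def fun_eq_iff)
  ultimately show "b i j \<in> LM" by (rule AE_measurable_cong)
  have "Lam \<ge> \<mu>" unfolding Lam_def by (simp add: sum_nonneg)
  moreover have "\<bar>a i j x\<bar> <= Lam" if "x \<in> G"
  proof -
   have "\<bar>a i j x\<bar> <= C i j" using that by (simp add: G_def)
   then show ?thesis using CL[of i j] by linarith
  qed
  ultimately show "\<bar>b i j x\<bar> <= Lam" using mu(1) by (auto simp: b_def)
  show "\<mu> * (norm \<xi>)^2 <= (\<Sum>i\<in>UNIV. \<Sum>j\<in>UNIV. b i j x * \<xi> $ i * \<xi> $ j)"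
  proof (cases "x \<in> G")
   case False
   then have "b i j x * \<xi> $ i * \<xi> $ j = (if j = i then \<mu> * (\<xi> $ i)^2 else 0)" for i j by (simp add: b_def power2_eq_square)
   then show ?thesis by (simp add: norm_vec_sq sum_distrib_left)
  qed (auto simp: b_def G_def)
 qed (use dom mu in auto)
 moreover have "AEL x. x \<in> Om --> (\<forall>i j. b i j x = a i j x)" using G by eventually_elim (auto simp: b_def)
 ultimately show ?thesis by blast
qed

lemma C2_realD:
 assumes "C2_real g"
 shows "(g has_real_derivative deriv g t) (at t)" "(deriv g has_real_derivative deriv (deriv g) t) (at t)"
 using assms by (auto simp: C2_real_def DERIV_deriv_iff_real_differentiable)

text \<open>The function is set to 0 off the good set \<open>G\<close>. As \<open>G\<close> fills
  \<open>Om\<close> up to a null set, completeness of Lebesgue measure preserves measurability, and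
  smoothness in the second variable then holds at every point.\<close>

lemma caratheodory_version:
 fixes F :: "real^'n::finite => real => real"
 assumes Om: "Om \<in> sets lebesgue" and c: "caratheodory_C2 Om F" and P: "AE x in lebesgue_on Om. P x"
  and G: "G = {x \<in> Om. C2_real (F x) \<and> P x}"
 shows "AEL x. x \<in> Om --> x \<in> G" "(%x. if x \<in> G then F x t else 0) \<in> LM"
  "((%t. if x \<in> G then F x t else 0) has_real_derivative (if x \<in> G then deriv (F x) t else 0)) (at t)"
proof -
 have "AEL x. x \<in> Om --> C2_real (F x)" using c Om by (simp add: caratheodory_C2_def AE_on)
 then show ae: "AEL x. x \<in> Om --> x \<in> G" using P unfolding AE_on[OF Om] by eventually_elim (auto simp: G)
 have "AEL x. (if x \<in> G then F x t else 0) = ext Om (%x. F x t) x" using ae by eventually_elim (auto simp: ext_def G)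
 then show "(%x. if x \<in> G then F x t else 0) \<in> LM"
  by (rule AE_measurable_cong) (use c in \<open>simp add: caratheodory_C2_def ext_measurable[OF Om]\<close>)
 show "((%t. if x \<in> G then F x t else 0) has_real_derivative (if x \<in> G then deriv (F x) t else 0)) (at t)"
  by (cases "x \<in> G") (auto simp: G intro: C2_realD)
qed

text \<open>The bounds are collected for the countably many radii \<open>real (Suc n)\<close>, so
  that their exceptional sets form one null set; an arbitrary \<open>M\<close> is rounded up. The
  bound on the second derivative gives the Lipschitz bound for the first.\<close>

lemma nonlinearity_version:
 fixes f :: "real^'n::finite => real => real"
 assumes Om: "Om \<in> sets lebesgue" and f: "state_nonlinearity Om f"
 shows "\<exists>\<phi> \<phi>'. (\<forall>t. (%x. \<phi> x t) \<in> LM) \<and> sq (%x. \<phi> x 0) \<and>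
  (\<forall>x t. (\<phi> x has_real_derivative \<phi>' x t) (at t)) \<and> (\<forall>x t. 0 <= \<phi>' x t) \<and>
  (\<forall>M>0. \<exists>C>0. \<forall>x s t. \<bar>s\<bar> <= M --> \<bar>t\<bar> <= M --> \<bar>\<phi>' x t\<bar> <= C \<and> \<bar>\<phi>' x s - \<phi>' x t\<bar> <= C * \<bar>s - t\<bar>) \<and>
  (AEL x. x \<in> Om --> \<phi> x = f x)"
proof -
 have c: "caratheodory_C2 Om f" and f0: "sq (ext Om (%x. f x 0))" and p: "AE x in lebesgue_on Om. \<forall>t. 0 <= deriv (f x) t"
  using f by (auto simp: state_nonlinearity_def ext_sq_integrable[OF Om])
 define Q where "Q M C x \<longleftrightarrow> (\<forall>t. \<bar>t\<bar> <= M --> \<bar>deriv (f x) t\<bar> + \<bar>deriv (deriv (f x)) t\<bar> <= C)" for M C x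
 have "\<forall>n. \<exists>C>0. AE x in lebesgue_on Om. Q (real (Suc n)) C x"
 proof
  fix n :: nat
  have "real (Suc n) > 0" by simp
  then obtain C where "C > 0" "AE x in lebesgue_on Om. (\<forall>t. \<bar>t\<bar> <= real (Suc n) --> \<bar>deriv (f x) t\<bar> + \<bar>deriv (deriv (f x)) t\<bar> <= C) \<and>
    (\<forall>t1 t2. \<bar>t1\<bar> <= real (Suc n) \<and> \<bar>t2\<bar> <= real (Suc n) --> \<bar>deriv (deriv (f x)) t2 - deriv (deriv (f x)) t1\<bar> <= C * \<bar>t2 - t1\<bar>)"
   using f unfolding state_nonlinearity_def by blast
  then show "\<exists>C>0. AE x in lebesgue_on Om. Q (real (Suc n)) C x" unfolding Q_def by (intro exI[of _ C] conjI) (auto elim: eventually_mono)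
 qed
 from choice[OF this] obtain C where C: "\<forall>n. C n > 0 \<and> (AE x in lebesgue_on Om. Q (real (Suc n)) (C n) x)" ..
 define G where "G = {x \<in> Om. C2_real (f x) \<and> ((\<forall>t. 0 <= deriv (f x) t) \<and> (\<forall>n. Q (real (Suc n)) (C n) x))}"
 have P: "AE x in lebesgue_on Om. (\<forall>t. 0 <= deriv (f x) t) \<and> (\<forall>n. Q (real (Suc n)) (C n) x)"
  using p C by (simp add: AE_all_countable)
 note v = caratheodory_version[OF Om c P G_def]
 show ?thesis
 proof (rule exI[of _ "%x t. if x \<in> G then f x t else 0"], rule exI[of _ "%x t. if x \<in> G then deriv (f x) t else 0"],
   intro conjI allI impI)
  show "sq (%x. if x \<in> G then f x 0 else 0)"
  proof (rule sq_integrable_bound[OF f0 v(2)])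
   show "AEL x. \<bar>if x \<in> G then f x 0 else 0\<bar> <= \<bar>ext Om (%x. f x 0) x\<bar>" by (rule AE_I2) (auto simp: ext_def G_def)
  qed
  show "AEL x. x \<in> Om --> (%t. if x \<in> G then f x t else 0) = f x" using v(1) by eventually_elim auto
  fix M :: real assume "M > 0"
  obtain n where "M <= real n" using real_arch_simple by blast
  then have n: "M <= real (Suc n)" by simp
  have "\<bar>if x \<in> G then deriv (f x) t else 0\<bar> <= C n \<and> \<bar>(if x \<in> G then deriv (f x) s else 0) - (if x \<in> G then deriv (f x) t else 0)\<bar> <= C n * \<bar>s - t\<bar>"
   if "\<bar>s\<bar> <= M" "\<bar>t\<bar> <= M" for x s t
  proof (cases "x \<in> G")
   case True
   then have q: "!!r. \<bar>r\<bar> <= real (Suc n) ==> \<bar>deriv (f x) r\<bar> + \<bar>deriv (deriv (f x)) r\<bar> <= C n" and g: "C2_real (f x)"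
    by (auto simp: G_def Q_def)
   have "\<bar>deriv (f x) s - deriv (f x) t\<bar> <= C n * \<bar>s - t\<bar>"
   proof (rule derivative_bound_on[where M=M, OF C2_realD(2)[OF g] _ that])
    show "\<bar>deriv (deriv (f x)) r\<bar> <= C n" if "\<bar>r\<bar> <= M" for r
     using q[of r] that n abs_ge_zero[of "deriv (f x) r"] by linarith
   qed
   moreover have "\<bar>deriv (f x) t\<bar> <= C n" using q[of t] that n by simp
   ultimately show ?thesis using True by simp
  qed (use C[THEN spec, of n] in simp)
  then show "\<exists>C>0. \<forall>x s t. \<bar>s\<bar> <= M --> \<bar>t\<bar> <= M --> \<bar>if x \<in> G then deriv (f x) t else 0\<bar> <= C \<and>
   \<bar>(if x \<in> G then deriv (f x) s else 0) - (if x \<in> G then deriv (f x) t else 0)\<bar> <= C * \<bar>s - t\<bar>"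
   using C by blast
 qed (use v in \<open>auto simp: G_def\<close>)
qed

text \<open>As for the nonlinearity, countably many radii suffice; constants and square integrable
  bounds are chosen together as pairs.\<close>

lemma cost_version:
 fixes L :: "real^'n::finite => real => real"
 assumes Om: "Om \<in> sets lebesgue" and L: "cost_integrand Om L"
 shows "\<exists>l l'. cost_density l l' \<and> (\<forall>x t. x \<notin> Om --> l x t = 0) \<and> (AEL x. x \<in> Om --> l x = L x)"
proof -
 have c: "caratheodory_C2 Om L" and L0: "integrable lebesgue (ext Om (%x. L x 0))"
  using L by (auto simp: cost_integrand_def ext_integrable[OF Om])
 define Q where "Q M C \<psi> x \<longleftrightarrow> (\<forall>t. \<bar>t\<bar> <= M --> \<bar>deriv (L x) t\<bar> <= \<psi> x \<and> \<bar>deriv (deriv (L x)) t\<bar> <= C)" for M C x and \<psi> :: "real^'n => real"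
 have "\<forall>n. \<exists>p. fst p > 0 \<and> sq_integrable (lebesgue_on Om) (snd p) \<and> (AE x in lebesgue_on Om. Q (real (Suc n)) (fst p) (snd p) x)"
 proof
  fix n :: nat
  have "real (Suc n) > 0" by simp
  then obtain C \<psi> where "C > 0" "sq_integrable (lebesgue_on Om) \<psi>" "AE x in lebesgue_on Om.
    (\<forall>t. \<bar>t\<bar> <= real (Suc n) --> \<bar>deriv (L x) t\<bar> <= \<psi> x \<and> \<bar>deriv (deriv (L x)) t\<bar> <= C) \<and>
    (\<forall>t1 t2. \<bar>t1\<bar> <= real (Suc n) \<and> \<bar>t2\<bar> <= real (Suc n) --> \<bar>deriv (deriv (L x)) t2 - deriv (deriv (L x)) t1\<bar> <= C * \<bar>t2 - t1\<bar>)"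
   using L unfolding cost_integrand_def by blast
  then show "\<exists>p. fst p > 0 \<and> sq_integrable (lebesgue_on Om) (snd p) \<and> (AE x in lebesgue_on Om. Q (real (Suc n)) (fst p) (snd p) x)"
   unfolding Q_def by (intro exI[of _ "(C, \<psi>)"] conjI) (auto elim: eventually_mono)
 qed
 from choice[OF this] obtain p where p: "\<forall>n. fst (p n) > 0 \<and> sq_integrable (lebesgue_on Om) (snd (p n)) \<and>
  (AE x in lebesgue_on Om. Q (real (Suc n)) (fst (p n)) (snd (p n)) x)" ..
 define G where "G = {x \<in> Om. C2_real (L x) \<and> (\<forall>n. Q (real (Suc n)) (fst (p n)) (snd (p n)) x)}"
 have P: "AE x in lebesgue_on Om. \<forall>n. Q (real (Suc n)) (fst (p n)) (snd (p n)) x" using p by (simp add: AE_all_countable)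
 note v = caratheodory_version[OF Om c P G_def]
 let ?l = "%x t. if x \<in> G then L x t else 0" and ?l' = "%x t. if x \<in> G then deriv (L x) t else 0"
 have "cost_density ?l ?l'"
  unfolding cost_density_def
 proof (intro conjI allI impI)
  show "integrable lebesgue (%x. ?l x 0)"
   by (rule Bochner_Integration.integrable_bound[OF L0 v(2)]) (auto intro!: AE_I2 simp: ext_def G_def)
  fix M :: real assume "M > 0"
  obtain n where "M <= real n" using real_arch_simple by blast
  then have n: "M <= real (Suc n)" by simp
  \<comment> \<open>The absolute value and the extension by zero make this a valid bound also off
    \<open>G\<close>, where the derivative is set to 0.\<close>
  let ?\<psi> = "%x. \<bar>ext Om (snd (p n)) x\<bar>"
  have "sq (ext Om (snd (p n)))" using p by (simp add: ext_sq_integrable[OF Om])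
  then have psi: "sq ?\<psi>" by (auto simp: sq_integrable_def)
  have "\<bar>?l' x t\<bar> <= ?\<psi> x \<and> \<bar>?l' x s - ?l' x t\<bar> <= fst (p n) * \<bar>s - t\<bar>"
   if "\<bar>s\<bar> <= M" "\<bar>t\<bar> <= M" for x s t
  proof (cases "x \<in> G")
   case True
   then have q: "!!r. \<bar>r\<bar> <= real (Suc n) ==> \<bar>deriv (L x) r\<bar> <= snd (p n) x \<and> \<bar>deriv (deriv (L x)) r\<bar> <= fst (p n)"
    and g: "C2_real (L x)" "x \<in> Om" by (auto simp: G_def Q_def)
   have "\<bar>deriv (L x) s - deriv (L x) t\<bar> <= fst (p n) * \<bar>s - t\<bar>"
   proof (rule derivative_bound_on[where M=M, OF C2_realD(2)[OF g(1)] _ that])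
    show "\<bar>deriv (deriv (L x)) r\<bar> <= fst (p n)" if "\<bar>r\<bar> <= M" for r using q[of r] that n by linarith
   qed
   moreover have "\<bar>deriv (L x) t\<bar> <= snd (p n) x" using q[of t] that n by simp
   ultimately show ?thesis using True g(2) by (simp add: ext_def)
  qed (use p[THEN spec, of n] in simp)
  then show "\<exists>C>0. \<exists>\<psi>. sq \<psi> \<and> (\<forall>x s t. \<bar>s\<bar> <= M --> \<bar>t\<bar> <= M --> \<bar>?l' x t\<bar> <= \<psi> x \<and> \<bar>?l' x s - ?l' x t\<bar> <= C * \<bar>s - t\<bar>)"
   using p psi by blast
 qed (use v in auto)
 moreover have "AEL x. x \<in> Om --> ?l x = L x" using v(1) by eventually_elim auto
 ultimately show ?thesis by (intro exI[of _ ?l] exI[of _ ?l'] conjI) (auto simp: G_def)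
qed

section \<open>Identification of the state of the problem with \<open>st\<close>\<close>

context semilinear
begin

text \<open>Integrals over \<open>Om\<close> become integrals over the space because gradients and
  test functions vanish off \<open>Om\<close>, and \<open>weak_partial\<close> agrees there with the
  gradients recorded by \<open>W\<close>. Both sides determine the same function, since each
  prescribes its values off \<open>Om\<close>.\<close>

lemma weak_solution_iff:
 assumes ba: "AEL x. x \<in> Om --> (\<forall>i j. b i j x = a i j x)" and pf: "AEL x. x \<in> Om --> \<phi> x = f x"
  and w: "sq (ext Om w)"
 shows "is_weak_solution Om a f w y \<and> (\<forall>x. x \<notin> closure Om --> y x = 0) \<longleftrightarrow> sol (ext Om w) y"
proof -
 have Om: "Om \<in> sets lebesgue" using op by simp
 have eqs: "(\<Sum>i\<in>UNIV. \<Sum>j\<in>UNIV. LINT x|lebesgue_on Om. a i j x * weak_partial Om i y x * weak_partial Om j v x) = bform g h"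
  "(LINT x|lebesgue_on Om. f x (y x) * v x) = (LEB x. \<phi> x (y x) * ext Om v x)"
  "(LINT x|lebesgue_on Om. w x * v x) = (LEB x. ext Om w x * ext Om v x)"
  if y: "W Om y g" "ext Om y = y" and v: "W Om (ext Om v) h" for g v h
 proof -
  have y': "W Om (ext Om y) g" using y by simp
  show "(\<Sum>i\<in>UNIV. \<Sum>j\<in>UNIV. LINT x|lebesgue_on Om. a i j x * weak_partial Om i y x * weak_partial Om j v x) = bform g h"
   unfolding bform_def
  proof (intro sum.cong refl integral_on_eq[OF Om])
   fix i j
   show "(%x. b i j x * g x $ i * h x $ j) \<in> LM"
    by (rule borel_measurable_integrable[OF b_integrable[OF W_sqv[OF y(1)] W_sqv[OF v]]])
   show "AEL x. x \<in> Om --> a i j x * weak_partial Om i y x * weak_partial Om j v x = b i j x * g x $ i * h x $ j"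
    using ba W_weak_partial_AE[OF op bd y', of i] W_weak_partial_AE[OF op bd v, of j] by eventually_elim simp
   show "AEL x. x \<notin> Om --> b i j x * g x $ i * h x $ j = 0" using W_outside(2)[OF y(1)] by eventually_elim simp
  qed
  show "(LINT x|lebesgue_on Om. f x (y x) * v x) = (LEB x. \<phi> x (y x) * ext Om v x)"
  proof (rule integral_on_eq[OF Om])
   show "(%x. \<phi> x (y x) * ext Om v x) \<in> LM"
    by (intro borel_measurable_times caratheodory_measurable[OF pm phi_continuous] sq_integrable_measurable[OF W_sq[OF y(1)]] sq_integrable_measurable[OF W_sq[OF v]])
  qed (use pf in \<open>auto simp: ext_def elim: eventually_mono\<close>)
  show "(LINT x|lebesgue_on Om. w x * v x) = (LEB x. ext Om w x * ext Om v x)"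
   by (rule integral_on_eq[OF Om borel_measurable_times[OF sq_integrable_measurable[OF w] sq_integrable_measurable[OF W_sq[OF v]]]]) (auto simp: ext_def)
 qed
 have We: "W Om (ext Om v) h" and ce: "AEL x. ext Om v x = v x" if v: "W Om v h" for v h
 proof -
  show ce: "AEL x. ext Om v x = v x" using W_outside(1)[OF v] by eventually_elim (simp add: ext_def)
  have "sq (ext Om v)"
   by (rule sq_integrable_bound[OF W_sq[OF v] AE_measurable_cong[OF ce sq_integrable_measurable[OF W_sq[OF v]]]]) (auto simp: ext_def)
  then show "W Om (ext Om v) h" by (rule W_AE_cong[OF v _ W_sqv[OF v]]) (use ce in \<open>auto elim: eventually_mono\<close>)
 qed
 show ?thesis
 proof
  assume a: "is_weak_solution Om a f w y \<and> (\<forall>x. x \<notin> closure Om --> y x = 0)"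
  then have a1: "y \<in> H10 Om" "continuous_on (closure Om) y" "!!x. x \<in> frontier Om ==> y x = 0" "!!x. x \<notin> closure Om ==> y x = 0"
   and a2: "!!v. v \<in> H10 Om ==> (\<Sum>i\<in>UNIV. \<Sum>j\<in>UNIV. LINT x|lebesgue_on Om. a i j x * weak_partial Om i y x * weak_partial Om j v x)
    + (LINT x|lebesgue_on Om. f x (y x) * v x) = (LINT x|lebesgue_on Om. w x * v x)" by (auto simp: is_weak_solution_def)
  have z: "y x = 0" if "x \<notin> Om" for x using a1(3,4)[of x] that op by (auto simp: frontier_def interior_open)
  then have ye: "ext Om y = y" by (auto simp: ext_def fun_eq_iff)
  \<comment> \<open>Continuity on the closure is glued to the zero function on the closed complement
    of \<open>Om\<close>; the boundary values agree.\<close>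
  have "continuous_on (- Om) y" by (rule continuous_on_eq[OF continuous_on_const[of _ 0]]) (simp add: z)
  then have "continuous_on (closure Om \<union> - Om) y" using a1(2) op by (intro continuous_on_closed_Un) auto
  moreover have "closure Om \<union> - Om = UNIV" using closure_subset[of Om] by auto
  ultimately have cy: "continuous_on UNIV y" by simp
  obtain g where g: "W Om y g" using a1(1) H10_iff_W[OF op bd] ye by auto
  show "sol (ext Om w) y"
   unfolding sol_def
  proof (intro conjI allI impI exI[of _ g] cy z g)
   fix v h assume v: "W Om v h"
   have "v \<in> H10 Om" using H10_iff_W[OF op bd] We[OF v] by blast
   from a2[OF this] have 1: "bform g h + (LEB x. \<phi> x (y x) * ext Om v x) = (LEB x. ext Om w x * ext Om v x)"
    by (simp only: eqs[OF g ye We[OF v]])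
   have m: "(%x. \<phi> x (y x)) \<in> LM"
    by (intro caratheodory_measurable[OF pm phi_continuous] sq_integrable_measurable[OF W_sq[OF g]])
   have 2: "(LEB x. F x * ext Om v x) = (LEB x. F x * v x)" if "F \<in> LM" for F
    using ce[OF v] sq_integrable_measurable[OF W_sq[OF v]] sq_integrable_measurable[OF W_sq[OF We[OF v]]] that
    by (intro integral_cong_AE) (auto elim: eventually_mono)
   show "bform g h + (LEB x. \<phi> x (y x) * v x) = (LEB x. ext Om w x * v x)"
    using 1 unfolding 2[OF m] 2[OF sq_integrable_measurable[OF w]] .
  qed
 next
  assume s: "sol (ext Om w) y"
  then obtain g where g: "W Om y g" and cy: "continuous_on UNIV y" and z: "!!x. x \<notin> Om ==> y x = 0"
   and eq: "!!v h. W Om v h ==> bform g h + (LEB x. \<phi> x (y x) * v x) = (LEB x. ext Om w x * v x)"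
   by (auto simp: sol_def)
  have ye: "ext Om y = y" using z by (auto simp: ext_def fun_eq_iff)
  show "is_weak_solution Om a f w y \<and> (\<forall>x. x \<notin> closure Om --> y x = 0)"
   unfolding is_weak_solution_def
  proof (intro conjI ballI allI impI)
   show "y \<in> H10 Om" using H10_iff_W[OF op bd] ye g by metis
   show "continuous_on (closure Om) y" using cy continuous_on_subset by blast
   show "y x = 0" if "x \<in> frontier Om" for x using that op by (intro z) (auto simp: frontier_def interior_open)
   show "y x = 0" if "x \<notin> closure Om" for x using that closure_subset[of Om] by (intro z) auto
   fix v assume "v \<in> H10 Om"
   then obtain h where h: "W Om (ext Om v) h" using H10_iff_W[OF op bd] by blast
   show "(\<Sum>i\<in>UNIV. \<Sum>j\<in>UNIV. LINT x|lebesgue_on Om. a i j x * weak_partial Om i y x * weak_partial Om j v x)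
    + (LINT x|lebesgue_on Om. f x (y x) * v x) = (LINT x|lebesgue_on Om. w x * v x)"
    unfolding eqs[OF g ye h] by (rule eq[OF h])
  qed
 qed
qed

lemma state_eq_st:
 assumes "AEL x. x \<in> Om --> (\<forall>i j. b i j x = a i j x)" "AEL x. x \<in> Om --> \<phi> x = f x"
  and w: "sq (ext Om w)"
 shows "state Om a f w = st (abs_L2 (ext Om w))"
proof -
 have "sol (rep_L2 (abs_L2 (ext Om w))) y \<longleftrightarrow> sol (ext Om w) y" for y
  by (rule sol_AE_cong[OF rep_abs_AE[OF w] measurable_rep_L2 sq_integrable_measurable[OF w]])
 then have "sol (rep_L2 (abs_L2 (ext Om w))) = sol (ext Om w)" by (simp add: fun_eq_iff)
 then show ?thesis unfolding state_def st_def weak_solution_iff[OF assms] by simp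
qed

end

section \<open>Multiplication operators, classes vanishing off a set, and compactness of
  \<open>adj\<close>\<close>

lemma bounded_linear_mulL:
 fixes m :: "real^'n::finite => real"
 assumes m: "m \<in> LM" "!!x. \<bar>m x\<bar> <= C"
 shows "bounded_linear (mulL m)"
proof (rule bounded_linear_intro)
 show "mulL m (c *\<^sub>R u) = c *\<^sub>R mulL m u" for c u
 proof (rule L2_eqI)
  show "AEL x. rep_L2 (mulL m (c *\<^sub>R u)) x = rep_L2 (c *\<^sub>R mulL m u) x"
   using rep_abs_AE[OF mulL_sq[OF m], of u] rep_abs_AE[OF mulL_sq[OF m], of "c *\<^sub>R u"] rep_scaleR_AE[of c u] rep_scaleR_AE[of c "mulL m u"]
   unfolding mulL_def by eventually_elim simp
 qed
 from this[of "-1"] have n: "mulL m (- v) = - mulL m v" for v by simp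
 show "mulL m (u + v) = mulL m u + mulL m v" for u v using mulL_diff[OF m, of u "- v"] by (simp add: n)
 show "norm (mulL m u) <= norm u * C" for u using norm_mulL[OF m, of u] by (simp add: mult.commute)
qed

lemma mulL_inner_rep:
 assumes "m \<in> LM" "!!x. \<bar>m x\<bar> <= C"
 shows "mulL m u \<bullet> v = (LEB x. m x * rep_L2 u x * rep_L2 v x)"
 using inner_mulL[OF assms sq_integrable_rep, of u v] by simp

lemma mulL_adjoint:
 assumes "m \<in> LM" "!!x. \<bar>m x\<bar> <= C"
 shows "mulL m u \<bullet> v = u \<bullet> mulL m v"
 using mulL_inner_rep[OF assms, of u v] mulL_inner_rep[OF assms, of v u] by (simp add: inner_commute mult_ac)

lemma mulL_L2_on:
 assumes "m \<in> LM" "!!x. \<bar>m x\<bar> <= C" "!!x. x \<notin> Om ==> m x = 0"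
 shows "mulL m u \<in> L2_on Om"
 using rep_abs_AE[OF mulL_sq[OF assms(1,2)], of u] unfolding L2_on_def mulL_def mem_Collect_eq
 by eventually_elim (auto simp: assms(3))

lemma L2_on_add_diff:
 assumes "u \<in> L2_on Om" "v \<in> L2_on Om"
 shows L2_on_add: "u + v \<in> L2_on Om" and L2_on_diff: "u - v \<in> L2_on Om"
proof -
 note a = assms[unfolded L2_on_def mem_Collect_eq]
 show "u + v \<in> L2_on Om"
  unfolding L2_on_def mem_Collect_eq using a rep_plus_AE[of u v] by eventually_elim simp
 show "u - v \<in> L2_on Om"
  unfolding L2_on_def mem_Collect_eq using a rep_minus_AE[of u v] by eventually_elim simp
qed

lemma rep_sum_AE:
 fixes v :: "'i::finite => 'n::finite L2"
 shows "finite I ==> AEL x. rep_L2 (\<Sum>i\<in>I. v i) x = (\<Sum>i\<in>I. rep_L2 (v i) x)"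
proof (induction rule: finite_induct)
 case empty
 show ?case using rep_abs_AE[OF sq_integrable_zero] by (simp add: zero_L2_def)
next
 case (insert i I)
 have "AEL x. rep_L2 (v i + (\<Sum>i\<in>I. v i)) x = rep_L2 (v i) x + rep_L2 (\<Sum>i\<in>I. v i) x" by (rule rep_plus_AE)
 then show ?case using insert.IH by eventually_elim (simp add: insert.hyps)
qed

lemma abs_L2_of_AE:
 assumes "AEL x. f x = rep_L2 v x"
 shows "sq f" "abs_L2 f = v"
proof -
 show s: "sq f"
  by (rule sq_integrable_bound[OF sq_integrable_rep AE_measurable_cong[OF assms measurable_rep_L2]])
   (use assms in \<open>auto elim: eventually_mono\<close>)
 show "abs_L2 f = v" using abs_L2_eqI[OF s sq_integrable_rep assms] by simp
qed

lemma cost_density_linear: "cost_density (%x t. rep_L2 v x * t) (%x t. rep_L2 v x)"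
 unfolding cost_density_def
proof (intro conjI allI impI)
 show "((%t. rep_L2 v x * t) has_real_derivative rep_L2 v x) (at t)" for x t by (auto intro!: derivative_eq_intros)
 have "sq (%x. \<bar>rep_L2 v x\<bar>)" using sq_integrable_rep[of v] by (auto simp: sq_integrable_def)
 then show "\<exists>C>0. \<exists>\<psi>. sq \<psi> \<and> (\<forall>x s t. \<bar>s\<bar> <= M --> \<bar>t\<bar> <= M --> \<bar>rep_L2 v x\<bar> <= \<psi> x \<and> \<bar>rep_L2 v x - rep_L2 v x\<bar> <= C * \<bar>s - t\<bar>)" for M :: real
  by (intro exI[of _ 1] exI[of _ "%x. \<bar>rep_L2 v x\<bar>"] conjI) auto
qed auto

context semilinear
begin

lemma adj_continuous:
 assumes "cost_density l l'"
 shows "continuous_on UNIV (adj l')"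
proof (rule continuous_at_imp_continuous_on, intro ballI)
 fix w :: "'n L2"
 obtain C where C: "!!u v. norm u <= norm w + 1 ==> norm v <= norm w + 1 ==> norm (adj l' v - adj l' u) <= C * norm (v - u)"
  using adj_lipschitz[OF assms, of "norm w + 1"] by blast
 have "\<bar>C\<bar>-lipschitz_on (ball 0 (norm w + 1)) (adj l')"
 proof (rule lipschitz_onI)
  fix u v :: "'n L2" assume "u \<in> ball 0 (norm w + 1)" "v \<in> ball 0 (norm w + 1)"
  then have "norm (adj l' u - adj l' v) <= C * norm (u - v)" by (intro C) auto
  also have "... <= \<bar>C\<bar> * norm (u - v)" by (intro mult_right_mono) auto
  finally show "dist (adj l' u) (adj l' v) <= \<bar>C\<bar> * dist u v" by (simp add: dist_norm)
 qed simp
 then have "continuous_on (ball 0 (norm w + 1)) (adj l')" by (rule lipschitz_on_continuous_on)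
 then show "continuous (at w) (adj l')" by (rule continuous_on_interior) simp
qed

lemma adj_compact:
 assumes "cost_density l l'"
 shows "\<exists>C. compact C \<and> (\<forall>w. norm w <= R --> adj l' w \<in> C)"
proof -
 obtain N where N: "!!w. norm w <= R ==> \<exists>p gp. adj l' w = abs_L2 p \<and> W Om p gp \<and> sqrt (LEB x. (norm (gp x))^2) <= N"
  using adj_bounded[OF assms, of R] by blast
 let ?R = "{abs_L2 v |v g. W Om v g \<and> (LEB x. (norm (g x))^2) <= N^2}"
 have "adj l' w \<in> closure ?R" if w: "norm w <= R" for w
 proof -
  obtain p gp where p: "adj l' w = abs_L2 p" "W Om p gp" "sqrt (LEB x. (norm (gp x))^2) <= N" using N[OF w] by blast
  have "adj l' w \<in> ?R" using p(1,2) sqrt_le_D[OF p(3)] by blast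
  then show ?thesis by (rule subsetD[OF closure_subset])
 qed
 then show ?thesis by (intro exI[of _ "closure ?R"] conjI rellich[OF op bd] allI impI)
qed

end

theorem theorem3p3:
  fixes \<Omega> :: "(real^'n::finite) set"
    and a :: "'n \<Rightarrow> 'n \<Rightarrow> real^'n \<Rightarrow> real"
    and f :: "real^'n \<Rightarrow> real \<Rightarrow> real"
    and B \<zeta> :: "'m::finite \<Rightarrow> real^'n \<Rightarrow> real"
    and \<zeta>0 :: "'m \<Rightarrow> real"
    and L :: "'m \<Rightarrow> real^'n \<Rightarrow> real \<Rightarrow> real"
    and EY :: "'n L2 set" and dY :: "'n L2 \<Rightarrow> 'n L2 \<Rightarrow> real"
    and EJ :: "'m \<Rightarrow> 'n L2 set" and dJ :: "'m \<Rightarrow> 'n L2 \<Rightarrow> 'n L2 \<Rightarrow> real"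
    and E' :: "'m \<Rightarrow> 'e set" and d' :: "'m \<Rightarrow> 'e \<Rightarrow> 'e \<Rightarrow> real"
    and Uad :: "'m \<Rightarrow> 'n L2 \<times> 'e \<Rightarrow> 'n L2 set"
    and ustar :: "'m \<Rightarrow> 'n L2"
    and eY :: "'n L2" and e :: "'m \<Rightarrow> 'n L2 \<times> 'e"
  assumes dim: "CARD('n) \<in> {1, 2, 3}"
    and domain: "open \<Omega>" "connected \<Omega>" "\<Omega> \<noteq> {}" "bounded \<Omega>" "lipschitz_boundary \<Omega>"
    and elliptic: "uniformly_elliptic \<Omega> a"
    and weights: "\<And>k. Linf_on \<Omega> (\<zeta> k)" "\<And>k. Linf_on \<Omega> (B k)"
      "\<And>k. 0 < \<zeta>0 k" "\<And>k. AE x in lebesgue_on \<Omega>. \<zeta>0 k \<le> \<zeta> k x"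
    and nonlinearity: "state_nonlinearity \<Omega> f"
    and integrands: "\<And>k. cost_integrand \<Omega> (L k)"
    and params_Y: "EY \<subseteq> L2_on \<Omega>" "Metric_space EY dY"
    and params_J: "\<And>k. EJ k \<subseteq> L2_on \<Omega>" "\<And>k. Metric_space (EJ k) (dJ k)"
    and params_E': "\<And>k. Metric_space (E' k) (d' k)"
    and admissible: "\<And>k ek. ek \<in> EJ k \<times> E' k \<Longrightarrow>
      Uad k ek \<subseteq> L2_on \<Omega> \<and> convex (Uad k ek) \<and> closed (Uad k ek) \<and> bounded (Uad k ek)"
    and ustar: "\<And>k. ustar k \<in> L2_on \<Omega>"
    and e: "eY \<in> EY" "\<And>k. e k \<in> EJ k \<times> E' k"
    and nonempty: "(\<Pi> k\<in>UNIV. Uad k (e k)) \<noteq> {}"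
  shows "\<exists>u \<in> (\<Pi> k\<in>UNIV. Uad k (e k)). \<forall>k. \<exists>g.
    has_gradient_on (\<lambda>v. perturbed_cost \<Omega> a f B \<zeta> L k (u(k := v)) eY (e k)) g (L2_on \<Omega>) (u k) \<and>
    ustar k \<in> g +o normal_cone (L2_on \<Omega>) (u k) (Uad k (e k))"
proof -
 have Om: "\<Omega> \<in> sets lebesgue" using domain(1) by simp
 obtain b lam Lam where el: "elliptic \<Omega> b lam Lam" and ba: "AEL x. x \<in> \<Omega> --> (\<forall>i j. b i j x = a i j x)"
  using elliptic_version[OF domain(1,4) elliptic] by (elim exE conjE) (rule that)
 obtain \<phi> \<phi>' where ph: "\<forall>t. (%x. \<phi> x t) \<in> LM" "sq (%x. \<phi> x 0)"
  "\<forall>x t. (\<phi> x has_real_derivative \<phi>' x t) (at t)" "\<forall>x t. 0 <= \<phi>' x t"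
  "\<forall>M>0. \<exists>C>0. \<forall>x s t. \<bar>s\<bar> <= M --> \<bar>t\<bar> <= M --> \<bar>\<phi>' x t\<bar> <= C \<and> \<bar>\<phi>' x s - \<phi>' x t\<bar> <= C * \<bar>s - t\<bar>"
  and pf: "AEL x. x \<in> \<Omega> --> \<phi> x = f x"
  using nonlinearity_version[OF Om nonlinearity] by (elim exE conjE) (rule that)
 interpret semilinear \<Omega> b lam Lam \<phi> \<phi>'
 proof (intro semilinear.intro el semilinear_axioms.intro)
  show "CARD('n) <= 3" using dim by auto
  show "exterior_density \<Omega> c" if "c \<in> frontier \<Omega>" for c
   by (rule lipschitz_boundary_exterior_density[OF domain(1,5) that])
 qed (use ph in blast)+
 \<comment> \<open>The weights are replaced by versions that are bounded everywhere and vanish off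
   the domain, so that multiplication by them maps \<open>L2\<close> into
   \<open>L2_on \<Omega>\<close>.\<close>
 have "\<exists>g. g \<in> LM \<and> (\<exists>C. \<forall>x. \<bar>g x\<bar> <= C) \<and> (\<forall>x. x \<notin> \<Omega> --> g x = 0) \<and> (AEL x. x \<in> \<Omega> --> g x = h x)"
  if "Linf_on \<Omega> h" for h :: "real^'n => real"
  by (rule Linf_version[OF Om that]) blast
 note lv = this
 from choice[OF allI[OF lv[OF weights(2)]]] obtain Bt where Bt: "\<forall>k. Bt k \<in> LM \<and> (\<exists>C. \<forall>x. \<bar>Bt k x\<bar> <= C) \<and>
  (\<forall>x. x \<notin> \<Omega> --> Bt k x = 0) \<and> (AEL x. x \<in> \<Omega> --> Bt k x = B k x)" ..
 from choice[OF allI[OF lv[OF weights(1)]]] obtain Zt where Zt: "\<forall>k. Zt k \<in> LM \<and> (\<exists>C. \<forall>x. \<bar>Zt k x\<bar> <= C) \<and>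
  (\<forall>x. x \<notin> \<Omega> --> Zt k x = 0) \<and> (AEL x. x \<in> \<Omega> --> Zt k x = \<zeta> k x)" ..
 obtain CB CZ where CB: "!!k x. \<bar>Bt k x\<bar> <= CB k" and CZ: "!!k x. \<bar>Zt k x\<bar> <= CZ k" using Bt Zt by metis
 have Bm: "Bt k \<in> LM" "x \<notin> \<Omega> ==> Bt k x = 0" and Bae: "AEL x. x \<in> \<Omega> --> Bt k x = B k x" for k x
  using Bt[THEN spec, of k] by auto
 have Zm: "Zt k \<in> LM" "x \<notin> \<Omega> ==> Zt k x = 0" and Zae: "AEL x. x \<in> \<Omega> --> Zt k x = \<zeta> k x" for k x
  using Zt[THEN spec, of k] by auto
 have "\<forall>k. \<exists>p. cost_density (fst p) (snd p) \<and> (\<forall>x t. x \<notin> \<Omega> --> fst p x t = 0) \<and> (AEL x. x \<in> \<Omega> --> fst p x = L k x)"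
  using cost_version[OF Om integrands] by simp
 from choice[OF this] obtain l where l: "\<forall>k. cost_density (fst (l k)) (snd (l k)) \<and> (\<forall>x t. x \<notin> \<Omega> --> fst (l k) x t = 0) \<and>
  (AEL x. x \<in> \<Omega> --> fst (l k) x = L k x)" ..
 have ld: "cost_density (fst (l k)) (snd (l k))" for k using l by blast
 \<comment> \<open>The tracking term of the perturbation is treated as a second integrand, linear in
   the state.\<close>
 define lJ where "lJ k x t = rep_L2 (fst (e k)) x * t" for k x t
 define lJ' where "lJ' k x t = rep_L2 (fst (e k)) x" for k x and t :: real
 have lJd: "cost_density (lJ k) (lJ' k)" for k unfolding lJ_def lJ'_def by (rule cost_density_linear)
 define MB where "MB k = mulL (Bt k)" for k
 define MZ where "MZ k = mulL (Zt k)" for k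
 have blB: "bounded_linear (MB k)" and blZ: "bounded_linear (MZ k)" for k
  unfolding MB_def MZ_def by (rule bounded_linear_mulL[OF Bm(1) CB], rule bounded_linear_mulL[OF Zm(1) CZ])
 note addB = linear_add[OF bounded_linear.linear[OF blB]] and addZ = linear_add[OF bounded_linear.linear[OF blZ]]
 define tot where "tot u = (\<Sum>i\<in>UNIV. MB i (u i))" for u :: "'m => 'n L2"
 have eYon: "eY \<in> L2_on \<Omega>" using e(1) params_Y(1) by blast
 have tot: "AEL x. ext \<Omega> (total_control B u) x = rep_L2 (tot u) x" for u
 proof -
  have "AEL x. \<forall>i. rep_L2 (MB i (u i)) x = Bt i x * rep_L2 (u i) x"
   unfolding AE_all_countable MB_def mulL_def by (intro allI rep_abs_AE mulL_sq[OF Bm(1) CB])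
  moreover have "AEL x. \<forall>i. x \<in> \<Omega> --> Bt i x = B i x" unfolding AE_all_countable by (intro allI Bae)
  moreover have "AEL x. rep_L2 (tot u) x = (\<Sum>i\<in>UNIV. rep_L2 (MB i (u i)) x)" unfolding tot_def by (rule rep_sum_AE) simp
  ultimately show ?thesis by eventually_elim (auto simp: ext_def total_control_def Bm(2))
 qed
 have st1: "state \<Omega> a f (total_control B u) = st (tot u)" for u
  using state_eq_st[OF ba pf] abs_L2_of_AE[OF tot] by metis
 have st2: "state \<Omega> a f (%z. total_control B u z + rep_L2 eY z) = st (tot u + eY)" for u
 proof -
  have eY0: "AEL x. x \<notin> \<Omega> --> rep_L2 eY x = 0" using eYon by (simp add: L2_on_def)
  have "AEL x. ext \<Omega> (%z. total_control B u z + rep_L2 eY z) x = rep_L2 (tot u + eY) x"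
   using tot[of u] rep_plus_AE[of "tot u" eY] eY0 by eventually_elim (auto simp: ext_def)
  note s = abs_L2_of_AE[OF this]
  show ?thesis using state_eq_st[OF ba pf s(1)] s(2) by simp
 qed
 have pc: "perturbed_cost \<Omega> a f B \<zeta> L k (u(k := v)) eY (e k) = (LEB x. fst (l k) x (st (tot (u(k := v + eY))) x))
   + 1 / 2 * (MZ k (v + eY) \<bullet> (v + eY)) + (LEB x. lJ k x (st (tot (u(k := v)) + eY) x))" for k u v
 proof -
  have 1: "(LINT x|lebesgue_on \<Omega>. L k x (st w x)) = (LEB x. fst (l k) x (st w x))" for w
   by (rule integral_on_eq[OF Om cost_densityD(1)[OF ld st_measurable]]) (use l[THEN spec, of k] in \<open>auto elim: eventually_mono\<close>)
  have 2: "(LINT x|lebesgue_on \<Omega>. \<zeta> k x * (rep_L2 w x)^2) = MZ k w \<bullet> w" for w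
   unfolding MZ_def mulL_inner_rep[OF Zm(1) CZ]
  proof (rule integral_on_eq[OF Om])
   show "(%x. Zt k x * rep_L2 w x * rep_L2 w x) \<in> LM" using Zm(1) by (intro borel_measurable_times) auto
   show "AEL x. x \<in> \<Omega> --> \<zeta> k x * (rep_L2 w x)^2 = Zt k x * rep_L2 w x * rep_L2 w x"
    using Zae[of k] by eventually_elim (simp add: power2_eq_square)
  qed (simp add: Zm(2))
  have 3: "(LINT x|lebesgue_on \<Omega>. rep_L2 (fst (e k)) x * st w x) = (LEB x. lJ k x (st w x))" for w
   by (rule integral_on_eq[OF Om cost_densityD(1)[OF lJd st_measurable]]) (use sol_st[of w] in \<open>auto simp: lJ_def sol_def\<close>)
  show ?thesis unfolding perturbed_cost_def cost_def st1 st2 1 3 by (simp add: 2)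
 qed
 have totk: "tot (u(k := v)) = MB k v + (\<Sum>i\<in>UNIV - {k}. MB i (u i))" for u k v
  unfolding tot_def by (subst sum.remove[of _ k]) (auto intro!: sum.cong)
 \<comment> \<open>From here on the controls form a vector in \<open>'n L2 ^ 'm\<close>, a normed
   space, as the fixed point theorem requires.\<close>
 define totv where "totv q = (\<Sum>i\<in>UNIV. MB i (q $ i))" for q :: "'n L2 ^ 'm"
 \<comment> \<open>All gradient terms except \<open>MZ k (q $ k)\<close>, minus the target
   \<open>ustar k\<close>. The parameter \<open>eY\<close> enters the first adjoint state through
   the k-th control, hence as \<open>MB k eY\<close>, but the second one as a direct summand of the
   right-hand side.\<close>
 define P where "P k q = MB k (adj (snd (l k)) (totv q + MB k eY)) + MZ k eY + MB k (adj (lJ' k) (totv q + eY)) - ustar k" for k q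
 have grad: "has_gradient_on (%v. perturbed_cost \<Omega> a f B \<zeta> L k ((($) q)(k := v)) eY (e k)) (MZ k (q $ k) + P k q + ustar k) (L2_on \<Omega>) (q $ k)" for k q
 proof -
  define r where "r = (\<Sum>i\<in>UNIV - {k}. MB i (q $ i))"
  have tv: "totv q = MB k (q $ k) + r" unfolding totv_def r_def by (rule sum.remove) auto
  let ?A = "adj (snd (l k)) (totv q + MB k eY)" and ?A' = "adj (lJ' k) (totv q + eY)"
  have dB: "((%v. MB k v + c) has_derivative MB k) (at v within S)" for v c S
   by (auto intro!: derivative_eq_intros bounded_linear.has_derivative[OF blB])
  \<comment> \<open>Multiplication is self-adjoint, which moves it from the direction to the adjoint
    state when the chain rule is applied.\<close>
  have i: "MB k u \<bullet> v = u \<bullet> MB k v" for u v unfolding MB_def by (rule mulL_adjoint[OF Bm(1) CB])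
  have iZ: "MZ k u \<bullet> v = u \<bullet> MZ k v" for u v unfolding MZ_def by (rule mulL_adjoint[OF Zm(1) CZ])
  have d1: "((%v. LEB x. fst (l k) x (st (MB k v + (MB k eY + r)) x)) has_derivative (%h. ?A \<bullet> MB k h)) (at (q $ k) within L2_on \<Omega>)"
   by (rule has_derivative_compose[OF dB]) (use cost_gradient[OF ld, of k] in \<open>simp add: tv add_ac\<close>)
  have d3: "((%v. LEB x. lJ k x (st (MB k v + (r + eY)) x)) has_derivative (%h. ?A' \<bullet> MB k h)) (at (q $ k) within L2_on \<Omega>)"
   by (rule has_derivative_compose[OF dB]) (use cost_gradient[OF lJd, of k] in \<open>simp add: tv add_ac\<close>)
  have d2: "((%v. 1 / 2 * (MZ k (v + eY) \<bullet> (v + eY))) has_derivative (%h. MZ k (q $ k + eY) \<bullet> h)) (at (q $ k) within L2_on \<Omega>)"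
   by (rule derivative_eq_intros bounded_linear.has_derivative[OF blZ] refl)+
    (auto simp: fun_eq_iff iZ inner_commute)
  have "((%v. perturbed_cost \<Omega> a f B \<zeta> L k ((($) q)(k := v)) eY (e k)) has_derivative
   (%h. (?A \<bullet> MB k h + MZ k (q $ k + eY) \<bullet> h) + ?A' \<bullet> MB k h)) (at (q $ k) within L2_on \<Omega>)"
   unfolding pc totk r_def[symmetric] addB add.assoc using has_derivative_add[OF has_derivative_add[OF d1 d2] d3] by (simp only: add.assoc)
  moreover have "(%h. (?A \<bullet> MB k h + MZ k (q $ k + eY) \<bullet> h) + ?A' \<bullet> MB k h) = (%h. (MZ k (q $ k) + P k q + ustar k) \<bullet> h)"
   by (simp add: fun_eq_iff P_def i[symmetric] inner_add_left addZ)
  moreover have "MZ k (q $ k) + P k q + ustar k \<in> L2_on \<Omega>"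
  proof -
   have "MB k u \<in> L2_on \<Omega>" "MZ k u \<in> L2_on \<Omega>" for u
    unfolding MB_def MZ_def by (rule mulL_L2_on[OF Bm(1) CB Bm(2)], assumption, rule mulL_L2_on[OF Zm(1) CZ Zm(2)])
   then show ?thesis unfolding P_def diff_add_cancel by (intro L2_on_add) (auto intro!: L2_on_add L2_on_diff ustar)
  qed
  ultimately show ?thesis by (simp add: has_gradient_on_def)
 qed
 have adm: "Uad k (e k) \<subseteq> L2_on \<Omega>" "convex (Uad k (e k))" "closed (Uad k (e k))" "bounded (Uad k (e k))" for k
  using admissible[OF e(2)] by auto
 have ne: "Uad k (e k) \<noteq> {}" for k using nonempty by auto
 \<comment> \<open>The lower bound for \<open>\<zeta>\<close> holds on the domain only; it is enough
   because differences of admissible controls vanish outside.\<close>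
 have coercive: "\<zeta>0 k * (norm (u - v))^2 <= MZ k (u - v) \<bullet> (u - v)" if "u \<in> Uad k (e k)" "v \<in> Uad k (e k)" for k u v
 proof -
  have "u - v \<in> L2_on \<Omega>" using adm(1) that by (blast intro: L2_on_diff)
  then have z: "AEL x. x \<notin> \<Omega> --> rep_L2 (u - v) x = 0" by (simp add: L2_on_def)
  have z0: "AEL x. x \<in> \<Omega> --> \<zeta>0 k <= \<zeta> k x" using weights(4)[of k] by (simp add: AE_on[OF Om])
  have "(LEB x. \<zeta>0 k * (rep_L2 (u - v) x)^2) <= (LEB x. Zt k x * rep_L2 (u - v) x * rep_L2 (u - v) x)"
  proof (rule integral_mono_AE)
   show "integrable lebesgue (%x. \<zeta>0 k * (rep_L2 (u - v) x)^2)" using sq_integrable_rep[of "u - v"] by (simp add: sq_integrable_def)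
   show "integrable lebesgue (%x. Zt k x * rep_L2 (u - v) x * rep_L2 (u - v) x)"
    by (rule sq_integrable_mult[OF mulL_sq[OF Zm(1) CZ] sq_integrable_rep])
   show "AEL x. \<zeta>0 k * (rep_L2 (u - v) x)^2 <= Zt k x * rep_L2 (u - v) x * rep_L2 (u - v) x"
    using z z0 Zae[of k]
   proof eventually_elim
    case (elim x)
    then show ?case by (cases "x \<in> \<Omega>") (auto simp: power2_eq_square mult.assoc intro: mult_right_mono)
   qed
  qed
  then show ?thesis
   using norm_abs_L2[OF sq_integrable_rep, of "u - v"] by (simp add: MZ_def mulL_inner_rep[OF Zm(1) CZ])
 qed
 have Pc: "continuous_on UNIV (P k)" for k
  unfolding P_def totv_def
  by (intro continuous_intros bounded_linear.continuous_on[OF blB] continuous_on_compose2[OF adj_continuous[OF ld]]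
   continuous_on_compose2[OF adj_continuous[OF lJd]] continuous_on_component subset_UNIV)
 \<comment> \<open>Bounded admissible sets give bounded total controls, whose adjoint states stay in
   compact sets; \<open>P k\<close> is a continuous image of the pair of adjoint states.\<close>
 have "\<exists>C. compact C \<and> (\<forall>q. (\<forall>i. q $ i \<in> Uad i (e i)) --> P k q \<in> C)" for k
 proof -
  have "\<forall>i. \<exists>r. \<forall>u\<in>Uad i (e i). norm (MB i u) <= r" using bounded_linear_image[OF adm(4) blB] by (auto simp: bounded_iff)
  then obtain r where r: "!!i u. u \<in> Uad i (e i) ==> norm (MB i u) <= r i" by metis
  have tb: "norm (totv q) <= (\<Sum>i\<in>UNIV. r i)" if "\<forall>i. q $ i \<in> Uad i (e i)" for q
   unfolding totv_def using that r by (intro sum_norm_le) auto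
  obtain C1 where C1: "compact C1" "!!w. norm w <= (\<Sum>i\<in>UNIV. r i) + norm (MB k eY) ==> adj (snd (l k)) w \<in> C1" using adj_compact[OF ld] by blast
  obtain C2 where C2: "compact C2" "!!w. norm w <= (\<Sum>i\<in>UNIV. r i) + norm eY ==> adj (lJ' k) w \<in> C2" using adj_compact[OF lJd] by blast
  let ?F = "%z. MB k (fst z) + MZ k eY + MB k (snd z) - ustar k"
  have "compact (?F ` (C1 \<times> C2))"
   by (intro compact_continuous_image compact_Times C1 C2 continuous_intros bounded_linear.continuous_on[OF blB])
  moreover have "P k q \<in> ?F ` (C1 \<times> C2)" if q: "\<forall>i. q $ i \<in> Uad i (e i)" for q
  proof (rule image_eqI)
   show "(adj (snd (l k)) (totv q + MB k eY), adj (lJ' k) (totv q + eY)) \<in> C1 \<times> C2"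
    using tb[OF q] by (intro SigmaI C1(2) C2(2) norm_triangle_le) auto
  qed (simp add: P_def)
  ultimately show ?thesis by blast
 qed
 then obtain C where C: "!!k. compact (C k)" "!!k q. (!!i. q $ i \<in> Uad i (e i)) ==> P k q \<in> C k" by metis
 have "\<exists>q. \<forall>k. q $ k \<in> Uad k (e k) \<and> (\<forall>z\<in>Uad k (e k). 0 <= (MZ k (q $ k) + P k q) \<bullet> (z - q $ k))"
  by (rule compact_perturbation_equilibrium[where K="%k. Uad k (e k)" and T=MZ and \<mu>=\<zeta>0 and P=P and C=C,
   OF adm(3,2) ne blZ weights(3) coercive Pc C])
 then obtain q where q: "\<forall>k. q $ k \<in> Uad k (e k) \<and> (\<forall>z\<in>Uad k (e k). 0 <= (MZ k (q $ k) + P k q) \<bullet> (z - q $ k))" ..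
 show ?thesis
 proof (intro bexI[of _ "($) q"] allI exI conjI)
  show "($) q \<in> (\<Pi> k\<in>UNIV. Uad k (e k))" using q by blast
  fix k
  let ?g = "MZ k (q $ k) + P k q + ustar k"
  show "has_gradient_on (%v. perturbed_cost \<Omega> a f B \<zeta> L k ((($) q)(k := v)) eY (e k)) ?g (L2_on \<Omega>) (q $ k)" by (rule grad)
  have "?g \<in> L2_on \<Omega>" using grad[of k q] by (simp add: has_gradient_on_def)
  then have "ustar k - ?g \<in> L2_on \<Omega>" by (rule L2_on_diff[OF ustar])
  moreover have "(ustar k - ?g) \<bullet> (z - q $ k) <= 0" if "z \<in> Uad k (e k)" for z
  proof -
   have "0 <= (MZ k (q $ k) + P k q) \<bullet> (z - q $ k)" using q that by blast
   moreover have "ustar k - ?g = - (MZ k (q $ k) + P k q)" by simp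
   ultimately show ?thesis by (simp only: inner_minus_left neg_le_0_iff_le)
  qed
  ultimately have "ustar k - ?g \<in> normal_cone (L2_on \<Omega>) (q $ k) (Uad k (e k))" using q by (simp add: normal_cone_def)
  \<comment> \<open>The coset is met by writing \<open>ustar k\<close> as the gradient plus
    \<open>ustar k - ?g\<close>, which is \<open>- (MZ k (q $ k) + P k q)\<close>, the negative of
    the element in the variational inequality.\<close>
  then show "ustar k \<in> ?g +o normal_cone (L2_on \<Omega>) (q $ k) (Uad k (e k))"
   unfolding elt_set_plus_def by (intro CollectI bexI[of _ "ustar k - ?g"]) auto
 qed
qed

end
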